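(* Let $\mathcal{B}$ be a rigid braided category, $H$ a Hopf algebra in $\mathcal{B}$ and $\mathcal{M}$ a stable braided $\mathcal{B}$-module. The categories $\mathcal{C}_n=(H^{\otimes^\tau(n+1)})_{\mathcal{M}}\text{-mod}$, $n\ge0$, together with the functors $d_i$, $s_i$, $\tau_n$ and the natural isomorphisms $\varsigma:Id\simeq\tau_n^{n+1}$ form a cyclic object in categories. If $\mathcal{M}$ is only assumed to be braided (stability is not assumed) then the $\mathcal{C}_n$ with the functors $d_i,s_i$ form a simplicial object in categories.
   Context: All categories are $k$-linear, $k$ an algebraically closed field of characteristic $0$. $\tau$ is the braiding of $\mathcal{B}$, $\tau^{-1}_{X,Y}:=(\tau_{Y,X})^{-1}:X\otimes Y\to Y\otimes X$; identity factors are suppressed. **(Stable) braided modules.** A $\mathcal{B}$-module category $\mathcal{M}$ is braided if equipped with a natural automorphism $E_{X,M}:X\cdot M\to X\cdot M$ of the action functor with $E_{Y,X\cdot M}=\tau^{-1}_{X,Y}E_{Y,M}\tau^{-1}_{Y,X}$ and $E_{Y\otimes X,M}=E_{Y,X\cdot M}E_{X,M}$; it is stable if equipped with an automorphism $\varsigma$ of $Id_{\mathcal{M}}$ with $E_{X,M}=\varsigma_{X\cdot M}(Id_X\cdot\varsigma_M)^{-1}$. **Algebras.** For algebras $A,B$ in $\mathcal{B}$, $A\otimes^\tau B$ is $A\otimes B$ with product $(m_A\otimes m_B)(Id\otimes\tau_{B,A}\otimes Id)$. An $A\otimes^\tau B$-module $N$ in $\mathcal{M}$ is the same as an object with an $A$-action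 $\rho_A$ and a $B$-action $\rho_B$ satisfying $\rho_A(Id_A\otimes\rho_B)=\rho_B(Id_B\otimes\rho_A)(\tau^{-1}_{A,B}\otimes Id_N)$. The functor $\sigma^{\mathcal{M}}_{A,B}:(A\otimes^\tau B)_{\mathcal{M}}\text{-mod}\to(B\otimes^\tau A)_{\mathcal{M}}\text{-mod}$ keeps the underlying object and the $A$-action and replaces $\rho_B$ by $\rho_B\circ E_{B,N}$. For an algebra map $f$, $f^*$ is restriction of modules. $H^n$ denotes $H^{\otimes^\tau n}$. **Functors.** $\tau_n=\sigma^{\mathcal{M}}_{H^n,H}:\mathcal{C}_n\to\mathcal{C}_n$; $d_i=(Id_H^{i}\otimes\Delta\otimes Id_H^{n-1-i})^*:\mathcal{C}_n\to\mathcal{C}_{n-1}$ for $0\le i\le n-1$; $d_n=d_0\tau_n$; $s_i=(Id_H^{i+1}\otimes\epsilon\otimes Id_H^{n-i})^*:\mathcal{C}_n\to\mathcal{C}_{n+1}$ for $-1\le i\le n$. The natural isomorphism $\varsigma:Id\to\tau_n^{n+1}$ on $\mathcal{C}_n$ has component at $N$ the morphism $\varsigma_N$ of $\mathcal{M}$. **Simplicial/cyclic object.** Simplicial: $d_id_j=d_{j-1}d_i$ ($i<j$); $s_is_j=s_js_{i-1}$ ($i>j$); $d_is_j=s_{j-1}d_i$ ($i<j$), $=Id$ ($i=j,j+1$), $=s_jd_{i-1}$ ($i>j+1$), for $i,j\ge0$. Cyclic: additionally $d_i\tau_n=\tau_{n-1}d_{i-1}$ ($1\le i\le n$), $d_0\tau_n=d_n$,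 $s_i\tau_n=\tau_{n+1}s_{i-1}$ ($1\le i\le n$), $s_0\tau_n=\tau_{n+1}^2s_n$, with the remaining relation $\tau_n^{n+1}=Id$ replaced by the specified isomorphism $\varsigma:Id\simeq\tau_n^{n+1}$ (so that one obtains a diagram of categories, i.e. a pseudofunctor, over $\Lambda^{op}$, $\Lambda$ being Connes' cyclic category). *)

theory Defs
  imports "HOL-Computational_Algebra.Polynomial"
begin

section \<open>Linear categories, functors, natural isomorphisms\<close>

text \<open>
  Hom-sets are indexed by source and target and need not be disjoint; source and target of an
  arrow are therefore always given explicitly.  All axioms are relativised to the carriers.
\<close>

record ('o, 'm) cat =
  Ob :: "'o set"
  Hom :: "'o \<Rightarrow> 'o \<Rightarrow> 'm set"
  Ident :: "'o \<Rightarrow> 'm"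
  Compose :: "'m \<Rightarrow> 'm \<Rightarrow> 'm"  (infixr "\<cdot>\<index>" 70)

record ('o, 'm, 'k) lin_cat = "('o, 'm) cat" +
  Zero :: "'o \<Rightarrow> 'o \<Rightarrow> 'm"
  Add :: "'m \<Rightarrow> 'm \<Rightarrow> 'm"
  Scale :: "'k \<Rightarrow> 'm \<Rightarrow> 'm"

locale category =
  fixes C :: "('o, 'm, 'z) cat_scheme" (structure)
  assumes ident_hom: "X \<in> Ob C \<Longrightarrow> Ident C X \<in> Hom C X X"
    and comp_hom: "\<lbrakk>X \<in> Ob C; Y \<in> Ob C; Z \<in> Ob C; f \<in> Hom C X Y; g \<in> Hom C Y Z\<rbrakk>
      \<Longrightarrow> g \<cdot> f \<in> Hom C X Z"
    and ident_left: "\<lbrakk>X \<in> Ob C; Y \<in> Ob C; f \<in> Hom C X Y\<rbrakk> \<Longrightarrow> Ident C Y \<cdot> f = f"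
    and ident_right: "\<lbrakk>X \<in> Ob C; Y \<in> Ob C; f \<in> Hom C X Y\<rbrakk> \<Longrightarrow> f \<cdot> Ident C X = f"
    and comp_assoc: "\<lbrakk>W \<in> Ob C; X \<in> Ob C; Y \<in> Ob C; Z \<in> Ob C;
        f \<in> Hom C W X; g \<in> Hom C X Y; h \<in> Hom C Y Z\<rbrakk>
      \<Longrightarrow> (h \<cdot> g) \<cdot> f = h \<cdot> (g \<cdot> f)"

definition inverse_pair :: "('o, 'm, 'z) cat_scheme \<Rightarrow> 'o \<Rightarrow> 'o \<Rightarrow> 'm \<Rightarrow> 'm \<Rightarrow> bool" where
  "inverse_pair C X Y f g \<longleftrightarrow> f \<in> Hom C X Y \<and> g \<in> Hom C Y X \<and>
     g \<cdot>\<^bsub>C\<^esub> f = Ident C X \<and> f \<cdot>\<^bsub>C\<^esub> g = Ident C Y"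

definition is_iso :: "('o, 'm, 'z) cat_scheme \<Rightarrow> 'o \<Rightarrow> 'o \<Rightarrow> 'm \<Rightarrow> bool" where
  "is_iso C X Y f \<longleftrightarrow> (\<exists>g. inverse_pair C X Y f g)"

text \<open>The inverse \<open>Y \<rightarrow> X\<close> of an isomorphism \<open>f : X \<rightarrow> Y\<close>.\<close>
definition Inv :: "('o, 'm, 'z) cat_scheme \<Rightarrow> 'o \<Rightarrow> 'o \<Rightarrow> 'm \<Rightarrow> 'm" where
  "Inv C X Y f = (THE g. inverse_pair C X Y f g)"

locale linear_category = category C
  for C :: "('o, 'm, 'k::{alg_closed_field, field_char_0}, 'z) lin_cat_scheme" (structure) +
  assumes zero_hom: "\<lbrakk>X \<in> Ob C; Y \<in> Ob C\<rbrakk> \<Longrightarrow> Zero C X Y \<in> Hom C X Y"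
    and add_hom: "\<lbrakk>X \<in> Ob C; Y \<in> Ob C; f \<in> Hom C X Y; g \<in> Hom C X Y\<rbrakk>
      \<Longrightarrow> Add C f g \<in> Hom C X Y"
    and scale_hom: "\<lbrakk>X \<in> Ob C; Y \<in> Ob C; f \<in> Hom C X Y\<rbrakk> \<Longrightarrow> Scale C a f \<in> Hom C X Y"
    and add_assoc: "\<lbrakk>X \<in> Ob C; Y \<in> Ob C; f \<in> Hom C X Y; g \<in> Hom C X Y; h \<in> Hom C X Y\<rbrakk>
      \<Longrightarrow> Add C (Add C f g) h = Add C f (Add C g h)"
    and add_comm: "\<lbrakk>X \<in> Ob C; Y \<in> Ob C; f \<in> Hom C X Y; g \<in> Hom C X Y\<rbrakk>
      \<Longrightarrow> Add C f g = Add C g f"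
    and add_zero: "\<lbrakk>X \<in> Ob C; Y \<in> Ob C; f \<in> Hom C X Y\<rbrakk> \<Longrightarrow> Add C (Zero C X Y) f = f"
    and add_minus: "\<lbrakk>X \<in> Ob C; Y \<in> Ob C; f \<in> Hom C X Y\<rbrakk>
      \<Longrightarrow> Add C f (Scale C (- 1) f) = Zero C X Y"
    and scale_one: "\<lbrakk>X \<in> Ob C; Y \<in> Ob C; f \<in> Hom C X Y\<rbrakk> \<Longrightarrow> Scale C 1 f = f"
    and scale_mult: "\<lbrakk>X \<in> Ob C; Y \<in> Ob C; f \<in> Hom C X Y\<rbrakk>
      \<Longrightarrow> Scale C (a * b) f = Scale C a (Scale C b f)"
    and scale_add_left: "\<lbrakk>X \<in> Ob C; Y \<in> Ob C; f \<in> Hom C X Y\<rbrakk>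
      \<Longrightarrow> Scale C (a + b) f = Add C (Scale C a f) (Scale C b f)"
    and scale_add_right: "\<lbrakk>X \<in> Ob C; Y \<in> Ob C; f \<in> Hom C X Y; g \<in> Hom C X Y\<rbrakk>
      \<Longrightarrow> Scale C a (Add C f g) = Add C (Scale C a f) (Scale C a g)"
    and comp_add_left: "\<lbrakk>X \<in> Ob C; Y \<in> Ob C; Z \<in> Ob C; f \<in> Hom C X Y;
        g \<in> Hom C Y Z; g' \<in> Hom C Y Z\<rbrakk> \<Longrightarrow> Add C g g' \<cdot> f = Add C (g \<cdot> f) (g' \<cdot> f)"
    and comp_add_right: "\<lbrakk>X \<in> Ob C; Y \<in> Ob C; Z \<in> Ob C; f \<in> Hom C X Y; f' \<in> Hom C X Y;
        g \<in> Hom C Y Z\<rbrakk> \<Longrightarrow> g \<cdot> Add C f f' = Add C (g \<cdot> f) (g \<cdot> f')"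
    and comp_scale_left: "\<lbrakk>X \<in> Ob C; Y \<in> Ob C; Z \<in> Ob C; f \<in> Hom C X Y; g \<in> Hom C Y Z\<rbrakk>
      \<Longrightarrow> Scale C a g \<cdot> f = Scale C a (g \<cdot> f)"
    and comp_scale_right: "\<lbrakk>X \<in> Ob C; Y \<in> Ob C; Z \<in> Ob C; f \<in> Hom C X Y; g \<in> Hom C Y Z\<rbrakk>
      \<Longrightarrow> g \<cdot> Scale C a f = Scale C a (g \<cdot> f)"

record ('o, 'm, 'p, 'q) functr =
  on_ob :: "'o \<Rightarrow> 'p"
  on_hom :: "'m \<Rightarrow> 'q"

locale linear_functor = C: linear_category C + D: linear_category D
  for C :: "('o, 'm, 'k::{alg_closed_field, field_char_0}, 'y) lin_cat_scheme"
    and D :: "('p, 'q, 'k, 'z) lin_cat_scheme"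
    and F :: "('o, 'm, 'p, 'q) functr" +
  assumes on_ob: "X \<in> Ob C \<Longrightarrow> on_ob F X \<in> Ob D"
    and on_hom: "\<lbrakk>X \<in> Ob C; Y \<in> Ob C; f \<in> Hom C X Y\<rbrakk>
      \<Longrightarrow> on_hom F f \<in> Hom D (on_ob F X) (on_ob F Y)"
    and map_ident: "X \<in> Ob C \<Longrightarrow> on_hom F (Ident C X) = Ident D (on_ob F X)"
    and map_comp: "\<lbrakk>X \<in> Ob C; Y \<in> Ob C; Z \<in> Ob C; f \<in> Hom C X Y; g \<in> Hom C Y Z\<rbrakk>
      \<Longrightarrow> on_hom F (g \<cdot>\<^bsub>C\<^esub> f) = on_hom F g \<cdot>\<^bsub>D\<^esub> on_hom F f"
    and map_add: "\<lbrakk>X \<in> Ob C; Y \<in> Ob C; f \<in> Hom C X Y; g \<in> Hom C X Y\<rbrakk>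
      \<Longrightarrow> on_hom F (Add C f g) = Add D (on_hom F f) (on_hom F g)"
    and map_scale: "\<lbrakk>X \<in> Ob C; Y \<in> Ob C; f \<in> Hom C X Y\<rbrakk>
      \<Longrightarrow> on_hom F (Scale C a f) = Scale D a (on_hom F f)"

definition id_functor :: "('o, 'm, 'o, 'm) functr" where
  "id_functor = \<lparr>on_ob = (\<lambda>X. X), on_hom = (\<lambda>f. f)\<rparr>"

definition comp_functor ::
    "('p, 'q, 'r, 's) functr \<Rightarrow> ('o, 'm, 'p, 'q) functr \<Rightarrow> ('o, 'm, 'r, 's) functr"
    (infixr "\<circ>\<^sub>F" 75) where
  "G \<circ>\<^sub>F F = \<lparr>on_ob = on_ob G \<circ> on_ob F, on_hom = on_hom G \<circ> on_hom F\<rparr>"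

fun functor_power :: "('o, 'm, 'o, 'm) functr \<Rightarrow> nat \<Rightarrow> ('o, 'm, 'o, 'm) functr" where
  "functor_power F 0 = id_functor"
| "functor_power F (Suc n) = F \<circ>\<^sub>F functor_power F n"

text \<open>Strict equality of functors with source \<open>C\<close>.\<close>
definition functor_eq ::
    "('o, 'm, 'z) cat_scheme \<Rightarrow> ('o, 'm, 'p, 'q) functr \<Rightarrow> ('o, 'm, 'p, 'q) functr \<Rightarrow> bool" where
  "functor_eq C F G \<longleftrightarrow> (\<forall>X \<in> Ob C. on_ob F X = on_ob G X) \<and>
     (\<forall>X \<in> Ob C. \<forall>Y \<in> Ob C. \<forall>f \<in> Hom C X Y. on_hom F f = on_hom G f)"

definition natural_iso ::
    "('o, 'm, 'y) cat_scheme \<Rightarrow> ('p, 'q, 'z) cat_scheme \<Rightarrow>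
     ('o, 'm, 'p, 'q) functr \<Rightarrow> ('o, 'm, 'p, 'q) functr \<Rightarrow> ('o \<Rightarrow> 'q) \<Rightarrow> bool" where
  "natural_iso C D F G \<eta> \<longleftrightarrow>
     (\<forall>X \<in> Ob C. is_iso D (on_ob F X) (on_ob G X) (\<eta> X)) \<and>
     (\<forall>X \<in> Ob C. \<forall>Y \<in> Ob C. \<forall>f \<in> Hom C X Y. \<eta> Y \<cdot>\<^bsub>D\<^esub> on_hom F f = on_hom G f \<cdot>\<^bsub>D\<^esub> \<eta> X)"


section \<open>Rigid braided categories\<close>

record ('o, 'm, 'k) br_cat = "('o, 'm, 'k) lin_cat" +
  Tensor :: "'o \<Rightarrow> 'o \<Rightarrow> 'o"  (infixr "\<otimes>\<index>" 80)
  TensorHom :: "'m \<Rightarrow> 'm \<Rightarrow> 'm"  (infixr "\<odot>\<index>" 80)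
  Unit :: 'o
  Assoc :: "'o \<Rightarrow> 'o \<Rightarrow> 'o \<Rightarrow> 'm"  \<comment> \<open>\<open>(X \<otimes> Y) \<otimes> Z \<rightarrow> X \<otimes> (Y \<otimes> Z)\<close>\<close>
  LUnit :: "'o \<Rightarrow> 'm"  \<comment> \<open>\<open>I \<otimes> X \<rightarrow> X\<close>\<close>
  RUnit :: "'o \<Rightarrow> 'm"  \<comment> \<open>\<open>X \<otimes> I \<rightarrow> X\<close>\<close>
  Braid :: "'o \<Rightarrow> 'o \<Rightarrow> 'm"  \<comment> \<open>\<open>X \<otimes> Y \<rightarrow> Y \<otimes> X\<close>\<close>

abbreviation InvAssoc :: "('o, 'm, 'k, 'z) br_cat_scheme \<Rightarrow> 'o \<Rightarrow> 'o \<Rightarrow> 'o \<Rightarrow> 'm" where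
  "InvAssoc B X Y Z \<equiv> Inv B ((X \<otimes>\<^bsub>B\<^esub> Y) \<otimes>\<^bsub>B\<^esub> Z) (X \<otimes>\<^bsub>B\<^esub> (Y \<otimes>\<^bsub>B\<^esub> Z)) (Assoc B X Y Z)"

abbreviation InvLUnit :: "('o, 'm, 'k, 'z) br_cat_scheme \<Rightarrow> 'o \<Rightarrow> 'm" where
  "InvLUnit B X \<equiv> Inv B (Unit B \<otimes>\<^bsub>B\<^esub> X) X (LUnit B X)"

abbreviation InvRUnit :: "('o, 'm, 'k, 'z) br_cat_scheme \<Rightarrow> 'o \<Rightarrow> 'm" where
  "InvRUnit B X \<equiv> Inv B (X \<otimes>\<^bsub>B\<^esub> Unit B) X (RUnit B X)"

text \<open>\<open>InvBraid B X Y : X \<otimes> Y \<rightarrow> Y \<otimes> X\<close> is the inverse of the braiding \<open>Y \<otimes> X \<rightarrow> X \<otimes> Y\<close>.\<close>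
abbreviation InvBraid :: "('o, 'm, 'k, 'z) br_cat_scheme \<Rightarrow> 'o \<Rightarrow> 'o \<Rightarrow> 'm" where
  "InvBraid B X Y \<equiv> Inv B (Y \<otimes>\<^bsub>B\<^esub> X) (X \<otimes>\<^bsub>B\<^esub> Y) (Braid B Y X)"

locale monoidal_category = linear_category B
  for B :: "('o, 'm, 'k::{alg_closed_field, field_char_0}) br_cat" (structure) +
  assumes unit_ob: "Unit B \<in> Ob B"
    and tensor_ob: "\<lbrakk>X \<in> Ob B; Y \<in> Ob B\<rbrakk> \<Longrightarrow> X \<otimes> Y \<in> Ob B"
    and tensor_hom: "\<lbrakk>X \<in> Ob B; Y \<in> Ob B; X' \<in> Ob B; Y' \<in> Ob B; f \<in> Hom B X X'; g \<in> Hom B Y Y'\<rbrakk>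
      \<Longrightarrow> f \<odot> g \<in> Hom B (X \<otimes> Y) (X' \<otimes> Y')"
    and tensor_ident: "\<lbrakk>X \<in> Ob B; Y \<in> Ob B\<rbrakk> \<Longrightarrow> Ident B X \<odot> Ident B Y = Ident B (X \<otimes> Y)"
    and tensor_comp: "\<lbrakk>X \<in> Ob B; Y \<in> Ob B; X' \<in> Ob B; Y' \<in> Ob B; X'' \<in> Ob B; Y'' \<in> Ob B;
        f \<in> Hom B X X'; f' \<in> Hom B X' X''; g \<in> Hom B Y Y'; g' \<in> Hom B Y' Y''\<rbrakk>
      \<Longrightarrow> (f' \<cdot> f) \<odot> (g' \<cdot> g) = (f' \<odot> g') \<cdot> (f \<odot> g)"
    and tensor_add_left: "\<lbrakk>X \<in> Ob B; Y \<in> Ob B; X' \<in> Ob B; Y' \<in> Ob B;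
        f \<in> Hom B X X'; f' \<in> Hom B X X'; g \<in> Hom B Y Y'\<rbrakk>
      \<Longrightarrow> Add B f f' \<odot> g = Add B (f \<odot> g) (f' \<odot> g)"
    and tensor_add_right: "\<lbrakk>X \<in> Ob B; Y \<in> Ob B; X' \<in> Ob B; Y' \<in> Ob B;
        f \<in> Hom B X X'; g \<in> Hom B Y Y'; g' \<in> Hom B Y Y'\<rbrakk>
      \<Longrightarrow> f \<odot> Add B g g' = Add B (f \<odot> g) (f \<odot> g')"
    and tensor_scale_left: "\<lbrakk>X \<in> Ob B; Y \<in> Ob B; X' \<in> Ob B; Y' \<in> Ob B;
        f \<in> Hom B X X'; g \<in> Hom B Y Y'\<rbrakk> \<Longrightarrow> Scale B a f \<odot> g = Scale B a (f \<odot> g)"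
    and tensor_scale_right: "\<lbrakk>X \<in> Ob B; Y \<in> Ob B; X' \<in> Ob B; Y' \<in> Ob B;
        f \<in> Hom B X X'; g \<in> Hom B Y Y'\<rbrakk> \<Longrightarrow> f \<odot> Scale B a g = Scale B a (f \<odot> g)"
    and assoc_iso: "\<lbrakk>X \<in> Ob B; Y \<in> Ob B; Z \<in> Ob B\<rbrakk>
      \<Longrightarrow> is_iso B ((X \<otimes> Y) \<otimes> Z) (X \<otimes> (Y \<otimes> Z)) (Assoc B X Y Z)"
    and assoc_nat: "\<lbrakk>X \<in> Ob B; Y \<in> Ob B; Z \<in> Ob B; X' \<in> Ob B; Y' \<in> Ob B; Z' \<in> Ob B;
        f \<in> Hom B X X'; g \<in> Hom B Y Y'; h \<in> Hom B Z Z'\<rbrakk>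
      \<Longrightarrow> Assoc B X' Y' Z' \<cdot> ((f \<odot> g) \<odot> h) = (f \<odot> (g \<odot> h)) \<cdot> Assoc B X Y Z"
    and lunit_iso: "X \<in> Ob B \<Longrightarrow> is_iso B (Unit B \<otimes> X) X (LUnit B X)"
    and lunit_nat: "\<lbrakk>X \<in> Ob B; Y \<in> Ob B; f \<in> Hom B X Y\<rbrakk>
      \<Longrightarrow> LUnit B Y \<cdot> (Ident B (Unit B) \<odot> f) = f \<cdot> LUnit B X"
    and runit_iso: "X \<in> Ob B \<Longrightarrow> is_iso B (X \<otimes> Unit B) X (RUnit B X)"
    and runit_nat: "\<lbrakk>X \<in> Ob B; Y \<in> Ob B; f \<in> Hom B X Y\<rbrakk>
      \<Longrightarrow> RUnit B Y \<cdot> (f \<odot> Ident B (Unit B)) = f \<cdot> RUnit B X"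
    and pentagon: "\<lbrakk>W \<in> Ob B; X \<in> Ob B; Y \<in> Ob B; Z \<in> Ob B\<rbrakk>
      \<Longrightarrow> Assoc B W X (Y \<otimes> Z) \<cdot> Assoc B (W \<otimes> X) Y Z =
          (Ident B W \<odot> Assoc B X Y Z) \<cdot> Assoc B W (X \<otimes> Y) Z \<cdot> (Assoc B W X Y \<odot> Ident B Z)"
    and triangle: "\<lbrakk>X \<in> Ob B; Y \<in> Ob B\<rbrakk>
      \<Longrightarrow> (Ident B X \<odot> LUnit B Y) \<cdot> Assoc B X (Unit B) Y = RUnit B X \<odot> Ident B Y"

locale braided_category = monoidal_category B
  for B :: "('o, 'm, 'k::{alg_closed_field, field_char_0}) br_cat" (structure) +
  assumes braid_iso: "\<lbrakk>X \<in> Ob B; Y \<in> Ob B\<rbrakk> \<Longrightarrow> is_iso B (X \<otimes> Y) (Y \<otimes> X) (Braid B X Y)"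
    and braid_nat: "\<lbrakk>X \<in> Ob B; Y \<in> Ob B; X' \<in> Ob B; Y' \<in> Ob B; f \<in> Hom B X X'; g \<in> Hom B Y Y'\<rbrakk>
      \<Longrightarrow> Braid B X' Y' \<cdot> (f \<odot> g) = (g \<odot> f) \<cdot> Braid B X Y"
    and hexagon_right: "\<lbrakk>X \<in> Ob B; Y \<in> Ob B; Z \<in> Ob B\<rbrakk>
      \<Longrightarrow> Assoc B Y Z X \<cdot> Braid B X (Y \<otimes> Z) \<cdot> Assoc B X Y Z =
          (Ident B Y \<odot> Braid B X Z) \<cdot> Assoc B Y X Z \<cdot> (Braid B X Y \<odot> Ident B Z)"
    and hexagon_left: "\<lbrakk>X \<in> Ob B; Y \<in> Ob B; Z \<in> Ob B\<rbrakk>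
      \<Longrightarrow> InvAssoc B Z X Y \<cdot> Braid B (X \<otimes> Y) Z \<cdot> InvAssoc B X Y Z =
          (Braid B X Z \<odot> Ident B Y) \<cdot> InvAssoc B X Z Y \<cdot> (Ident B X \<odot> Braid B Y Z)"

definition dual_pair :: "('o, 'm, 'k) br_cat \<Rightarrow> 'o \<Rightarrow> 'o \<Rightarrow> bool" where
  "dual_pair B Y X \<longleftrightarrow>
     (\<exists>ev \<in> Hom B (Y \<otimes>\<^bsub>B\<^esub> X) (Unit B). \<exists>coev \<in> Hom B (Unit B) (X \<otimes>\<^bsub>B\<^esub> Y).
        RUnit B X \<cdot>\<^bsub>B\<^esub> (Ident B X \<odot>\<^bsub>B\<^esub> ev) \<cdot>\<^bsub>B\<^esub> Assoc B X Y X \<cdot>\<^bsub>B\<^esub>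
          (coev \<odot>\<^bsub>B\<^esub> Ident B X) \<cdot>\<^bsub>B\<^esub> InvLUnit B X = Ident B X \<and>
        LUnit B Y \<cdot>\<^bsub>B\<^esub> (ev \<odot>\<^bsub>B\<^esub> Ident B Y) \<cdot>\<^bsub>B\<^esub> InvAssoc B Y X Y \<cdot>\<^bsub>B\<^esub>
          (Ident B Y \<odot>\<^bsub>B\<^esub> coev) \<cdot>\<^bsub>B\<^esub> InvRUnit B Y = Ident B Y)"

locale rigid_braided_category = braided_category B
  for B :: "('o, 'm, 'k::{alg_closed_field, field_char_0}) br_cat" (structure) +
  assumes left_dual: "X \<in> Ob B \<Longrightarrow> \<exists>Y \<in> Ob B. dual_pair B Y X"
    and right_dual: "X \<in> Ob B \<Longrightarrow> \<exists>Y \<in> Ob B. dual_pair B X Y"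


section \<open>Algebras and Hopf algebras\<close>

record ('o, 'm) algebra =
  Carrier :: 'o
  Mult :: 'm
  One :: 'm

locale algebra_in =
  fixes B :: "('o, 'm, 'k) br_cat" and A :: "('o, 'm, 'z) algebra_scheme"
  assumes carrier_ob: "Carrier A \<in> Ob B"
    and mult_hom: "Mult A \<in> Hom B (Carrier A \<otimes>\<^bsub>B\<^esub> Carrier A) (Carrier A)"
    and one_hom: "One A \<in> Hom B (Unit B) (Carrier A)"
    and mult_assoc: "Mult A \<cdot>\<^bsub>B\<^esub> (Mult A \<odot>\<^bsub>B\<^esub> Ident B (Carrier A)) =
      Mult A \<cdot>\<^bsub>B\<^esub> (Ident B (Carrier A) \<odot>\<^bsub>B\<^esub> Mult A) \<cdot>\<^bsub>B\<^esub>
        Assoc B (Carrier A) (Carrier A) (Carrier A)"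
    and one_left: "Mult A \<cdot>\<^bsub>B\<^esub> (One A \<odot>\<^bsub>B\<^esub> Ident B (Carrier A)) = LUnit B (Carrier A)"
    and one_right: "Mult A \<cdot>\<^bsub>B\<^esub> (Ident B (Carrier A) \<odot>\<^bsub>B\<^esub> One A) = RUnit B (Carrier A)"

definition algebra_map ::
    "('o, 'm, 'k) br_cat \<Rightarrow> ('o, 'm, 'y) algebra_scheme \<Rightarrow> ('o, 'm, 'z) algebra_scheme \<Rightarrow> 'm \<Rightarrow> bool"
  where
  "algebra_map B A A' f \<longleftrightarrow> f \<in> Hom B (Carrier A) (Carrier A') \<and>
     f \<cdot>\<^bsub>B\<^esub> Mult A = Mult A' \<cdot>\<^bsub>B\<^esub> (f \<odot>\<^bsub>B\<^esub> f) \<and> f \<cdot>\<^bsub>B\<^esub> One A = One A'"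

definition unit_algebra :: "('o, 'm, 'k) br_cat \<Rightarrow> ('o, 'm) algebra" where
  "unit_algebra B =
     \<lparr>Carrier = Unit B, Mult = LUnit B (Unit B), One = Ident B (Unit B)\<rparr>"

text \<open>\<open>(X \<otimes> Y) \<otimes> (X \<otimes> Y) \<rightarrow> (X \<otimes> X) \<otimes> (Y \<otimes> Y)\<close>, braiding the inner factors \<open>Y \<otimes> X\<close>.\<close>
definition middle_braid :: "('o, 'm, 'k) br_cat \<Rightarrow> 'o \<Rightarrow> 'o \<Rightarrow> 'm" where
  "middle_braid B X Y =
     InvAssoc B X X (Y \<otimes>\<^bsub>B\<^esub> Y) \<cdot>\<^bsub>B\<^esub>
     (Ident B X \<odot>\<^bsub>B\<^esub> Assoc B X Y Y) \<cdot>\<^bsub>B\<^esub>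
     (Ident B X \<odot>\<^bsub>B\<^esub> (Braid B Y X \<odot>\<^bsub>B\<^esub> Ident B Y)) \<cdot>\<^bsub>B\<^esub>
     (Ident B X \<odot>\<^bsub>B\<^esub> InvAssoc B Y X Y) \<cdot>\<^bsub>B\<^esub>
     Assoc B X Y (X \<otimes>\<^bsub>B\<^esub> Y)"

definition tensor_algebra ::
    "('o, 'm, 'k) br_cat \<Rightarrow> ('o, 'm, 'y) algebra_scheme \<Rightarrow> ('o, 'm, 'z) algebra_scheme \<Rightarrow>
     ('o, 'm) algebra" where
  "tensor_algebra B A A' =
     \<lparr>Carrier = Carrier A \<otimes>\<^bsub>B\<^esub> Carrier A',
      Mult = (Mult A \<odot>\<^bsub>B\<^esub> Mult A') \<cdot>\<^bsub>B\<^esub> middle_braid B (Carrier A) (Carrier A'),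
      One = (One A \<odot>\<^bsub>B\<^esub> One A') \<cdot>\<^bsub>B\<^esub> InvLUnit B (Unit B)\<rparr>"

record ('o, 'm) hopf = "('o, 'm) algebra" +
  Comult :: 'm
  Counit :: 'm
  Antipode :: 'm

locale hopf_algebra = algebra_in B H
  for B :: "('o, 'm, 'k) br_cat" and H :: "('o, 'm) hopf" +
  assumes comult_map: "algebra_map B H (tensor_algebra B H H) (Comult H)"
    and counit_map: "algebra_map B H (unit_algebra B) (Counit H)"
    and coassoc: "Assoc B (Carrier H) (Carrier H) (Carrier H) \<cdot>\<^bsub>B\<^esub>
        (Comult H \<odot>\<^bsub>B\<^esub> Ident B (Carrier H)) \<cdot>\<^bsub>B\<^esub> Comult H =
      (Ident B (Carrier H) \<odot>\<^bsub>B\<^esub> Comult H) \<cdot>\<^bsub>B\<^esub> Comult H"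
    and counit_left: "LUnit B (Carrier H) \<cdot>\<^bsub>B\<^esub> (Counit H \<odot>\<^bsub>B\<^esub> Ident B (Carrier H)) \<cdot>\<^bsub>B\<^esub>
        Comult H = Ident B (Carrier H)"
    and counit_right: "RUnit B (Carrier H) \<cdot>\<^bsub>B\<^esub> (Ident B (Carrier H) \<odot>\<^bsub>B\<^esub> Counit H) \<cdot>\<^bsub>B\<^esub>
        Comult H = Ident B (Carrier H)"
    and antipode_hom: "Antipode H \<in> Hom B (Carrier H) (Carrier H)"
    and antipode_left: "Mult H \<cdot>\<^bsub>B\<^esub> (Antipode H \<odot>\<^bsub>B\<^esub> Ident B (Carrier H)) \<cdot>\<^bsub>B\<^esub> Comult H =
      One H \<cdot>\<^bsub>B\<^esub> Counit H"
    and antipode_right: "Mult H \<cdot>\<^bsub>B\<^esub> (Ident B (Carrier H) \<odot>\<^bsub>B\<^esub> Antipode H) \<cdot>\<^bsub>B\<^esub> Comult H =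
      One H \<cdot>\<^bsub>B\<^esub> Counit H"


section \<open>Stable braided module categories\<close>

record ('p, 'q, 'k, 'o, 'm) mod_cat = "('p, 'q, 'k) lin_cat" +
  Act :: "'o \<Rightarrow> 'p \<Rightarrow> 'p"  (infixr "\<rhd>\<index>" 80)
  ActHom :: "'m \<Rightarrow> 'q \<Rightarrow> 'q"  (infixr "\<bullet>\<index>" 80)
  MAssoc :: "'o \<Rightarrow> 'o \<Rightarrow> 'p \<Rightarrow> 'q"  \<comment> \<open>\<open>(X \<otimes> Y) \<rhd> M \<rightarrow> X \<rhd> (Y \<rhd> M)\<close>\<close>
  MUnit :: "'p \<Rightarrow> 'q"  \<comment> \<open>\<open>I \<rhd> M \<rightarrow> M\<close>\<close>

abbreviation InvMAssoc ::
    "('o, 'm, 'k) br_cat \<Rightarrow> ('p, 'q, 'k, 'o, 'm) mod_cat \<Rightarrow> 'o \<Rightarrow> 'o \<Rightarrow> 'p \<Rightarrow> 'q" where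
  "InvMAssoc B \<M> X Y N \<equiv>
     Inv \<M> ((X \<otimes>\<^bsub>B\<^esub> Y) \<rhd>\<^bsub>\<M>\<^esub> N) (X \<rhd>\<^bsub>\<M>\<^esub> (Y \<rhd>\<^bsub>\<M>\<^esub> N)) (MAssoc \<M> X Y N)"

locale module_category = B: monoidal_category B + linear_category \<M>
  for B :: "('o, 'm, 'k::{alg_closed_field, field_char_0}) br_cat"
    and \<M> :: "('p, 'q, 'k, 'o, 'm) mod_cat" (structure) +
  assumes act_ob: "\<lbrakk>X \<in> Ob B; N \<in> Ob \<M>\<rbrakk> \<Longrightarrow> X \<rhd> N \<in> Ob \<M>"
    and act_hom: "\<lbrakk>X \<in> Ob B; X' \<in> Ob B; N \<in> Ob \<M>; N' \<in> Ob \<M>; f \<in> Hom B X X'; u \<in> Hom \<M> N N'\<rbrakk>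
      \<Longrightarrow> f \<bullet> u \<in> Hom \<M> (X \<rhd> N) (X' \<rhd> N')"
    and act_ident: "\<lbrakk>X \<in> Ob B; N \<in> Ob \<M>\<rbrakk> \<Longrightarrow> Ident B X \<bullet> Ident \<M> N = Ident \<M> (X \<rhd> N)"
    and act_comp: "\<lbrakk>X \<in> Ob B; X' \<in> Ob B; X'' \<in> Ob B; N \<in> Ob \<M>; N' \<in> Ob \<M>; N'' \<in> Ob \<M>;
        f \<in> Hom B X X'; f' \<in> Hom B X' X''; u \<in> Hom \<M> N N'; u' \<in> Hom \<M> N' N''\<rbrakk>
      \<Longrightarrow> (f' \<cdot>\<^bsub>B\<^esub> f) \<bullet> (u' \<cdot> u) = (f' \<bullet> u') \<cdot> (f \<bullet> u)"
    and act_add_left: "\<lbrakk>X \<in> Ob B; X' \<in> Ob B; N \<in> Ob \<M>; N' \<in> Ob \<M>;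
        f \<in> Hom B X X'; f' \<in> Hom B X X'; u \<in> Hom \<M> N N'\<rbrakk>
      \<Longrightarrow> Add B f f' \<bullet> u = Add \<M> (f \<bullet> u) (f' \<bullet> u)"
    and act_add_right: "\<lbrakk>X \<in> Ob B; X' \<in> Ob B; N \<in> Ob \<M>; N' \<in> Ob \<M>;
        f \<in> Hom B X X'; u \<in> Hom \<M> N N'; u' \<in> Hom \<M> N N'\<rbrakk>
      \<Longrightarrow> f \<bullet> Add \<M> u u' = Add \<M> (f \<bullet> u) (f \<bullet> u')"
    and act_scale_left: "\<lbrakk>X \<in> Ob B; X' \<in> Ob B; N \<in> Ob \<M>; N' \<in> Ob \<M>;
        f \<in> Hom B X X'; u \<in> Hom \<M> N N'\<rbrakk> \<Longrightarrow> Scale B a f \<bullet> u = Scale \<M> a (f \<bullet> u)"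
    and act_scale_right: "\<lbrakk>X \<in> Ob B; X' \<in> Ob B; N \<in> Ob \<M>; N' \<in> Ob \<M>;
        f \<in> Hom B X X'; u \<in> Hom \<M> N N'\<rbrakk> \<Longrightarrow> f \<bullet> Scale \<M> a u = Scale \<M> a (f \<bullet> u)"
    and massoc_iso: "\<lbrakk>X \<in> Ob B; Y \<in> Ob B; N \<in> Ob \<M>\<rbrakk>
      \<Longrightarrow> is_iso \<M> ((X \<otimes>\<^bsub>B\<^esub> Y) \<rhd> N) (X \<rhd> (Y \<rhd> N)) (MAssoc \<M> X Y N)"
    and massoc_nat: "\<lbrakk>X \<in> Ob B; X' \<in> Ob B; Y \<in> Ob B; Y' \<in> Ob B; N \<in> Ob \<M>; N' \<in> Ob \<M>;
        f \<in> Hom B X X'; g \<in> Hom B Y Y'; u \<in> Hom \<M> N N'\<rbrakk>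
      \<Longrightarrow> MAssoc \<M> X' Y' N' \<cdot> ((f \<odot>\<^bsub>B\<^esub> g) \<bullet> u) = (f \<bullet> (g \<bullet> u)) \<cdot> MAssoc \<M> X Y N"
    and munit_iso: "N \<in> Ob \<M> \<Longrightarrow> is_iso \<M> (Unit B \<rhd> N) N (MUnit \<M> N)"
    and munit_nat: "\<lbrakk>N \<in> Ob \<M>; N' \<in> Ob \<M>; u \<in> Hom \<M> N N'\<rbrakk>
      \<Longrightarrow> MUnit \<M> N' \<cdot> (Ident B (Unit B) \<bullet> u) = u \<cdot> MUnit \<M> N"
    and mpentagon: "\<lbrakk>X \<in> Ob B; Y \<in> Ob B; Z \<in> Ob B; N \<in> Ob \<M>\<rbrakk>
      \<Longrightarrow> MAssoc \<M> X Y (Z \<rhd> N) \<cdot> MAssoc \<M> (X \<otimes>\<^bsub>B\<^esub> Y) Z N =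
          (Ident B X \<bullet> MAssoc \<M> Y Z N) \<cdot> MAssoc \<M> X (Y \<otimes>\<^bsub>B\<^esub> Z) N \<cdot>
            (Assoc B X Y Z \<bullet> Ident \<M> N)"
    and mtriangle: "\<lbrakk>X \<in> Ob B; N \<in> Ob \<M>\<rbrakk>
      \<Longrightarrow> (Ident B X \<bullet> MUnit \<M> N) \<cdot> MAssoc \<M> X (Unit B) N = RUnit B X \<bullet> Ident \<M> N"

text \<open>
  In the first axiom on \<open>E\<close>, \<open>InvBraid\<close> acts on iterated actions through \<open>MAssoc\<close>:
  the composite runs \<open>Y \<rhd> X \<rhd> N \<rightarrow> X \<rhd> Y \<rhd> N \<rightarrow> X \<rhd> Y \<rhd> N \<rightarrow> Y \<rhd> X \<rhd> N\<close>.
\<close>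
locale braided_module = module_category B \<M>
  for B :: "('o, 'm, 'k::{alg_closed_field, field_char_0}) br_cat"
    and \<M> :: "('p, 'q, 'k, 'o, 'm) mod_cat" (structure) +
  fixes E :: "'o \<Rightarrow> 'p \<Rightarrow> 'q"
  assumes E_iso: "\<lbrakk>X \<in> Ob B; N \<in> Ob \<M>\<rbrakk> \<Longrightarrow> is_iso \<M> (X \<rhd> N) (X \<rhd> N) (E X N)"
    and E_nat: "\<lbrakk>X \<in> Ob B; X' \<in> Ob B; N \<in> Ob \<M>; N' \<in> Ob \<M>; f \<in> Hom B X X'; u \<in> Hom \<M> N N'\<rbrakk>
      \<Longrightarrow> E X' N' \<cdot> (f \<bullet> u) = (f \<bullet> u) \<cdot> E X N"
    and E_act: "\<lbrakk>X \<in> Ob B; Y \<in> Ob B; N \<in> Ob \<M>\<rbrakk>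
      \<Longrightarrow> E Y (X \<rhd> N) =
        MAssoc \<M> Y X N \<cdot> (InvBraid B X Y \<bullet> Ident \<M> N) \<cdot> InvMAssoc B \<M> X Y N \<cdot>
        (Ident B X \<bullet> E Y N) \<cdot>
        MAssoc \<M> X Y N \<cdot> (InvBraid B Y X \<bullet> Ident \<M> N) \<cdot> InvMAssoc B \<M> Y X N"
    and E_tensor: "\<lbrakk>X \<in> Ob B; Y \<in> Ob B; N \<in> Ob \<M>\<rbrakk>
      \<Longrightarrow> E (Y \<otimes>\<^bsub>B\<^esub> X) N =
        InvMAssoc B \<M> Y X N \<cdot> E Y (X \<rhd> N) \<cdot> (Ident B Y \<bullet> E X N) \<cdot> MAssoc \<M> Y X N"

locale stable_braided_module = braided_module B \<M> E
  for B :: "('o, 'm, 'k::{alg_closed_field, field_char_0}) br_cat"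
    and \<M> :: "('p, 'q, 'k, 'o, 'm) mod_cat" (structure)
    and E :: "'o \<Rightarrow> 'p \<Rightarrow> 'q" +
  fixes \<sigma> :: "'p \<Rightarrow> 'q"
  assumes twist_natural: "natural_iso \<M> \<M> id_functor id_functor \<sigma>"
    and E_twist: "\<lbrakk>X \<in> Ob B; N \<in> Ob \<M>\<rbrakk>
      \<Longrightarrow> E X N = \<sigma> (X \<rhd> N) \<cdot> Inv \<M> (X \<rhd> N) (X \<rhd> N) (Ident B X \<bullet> \<sigma> N)"


section \<open>Modules over an algebra, restriction, and the functor \<open>\<sigma>\<^bsub>A,A'\<^esub>\<close>\<close>

definition is_module ::
    "('o, 'm, 'k) br_cat \<Rightarrow> ('p, 'q, 'k, 'o, 'm) mod_cat \<Rightarrow> ('o, 'm, 'z) algebra_scheme \<Rightarrow>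
     'p \<times> 'q \<Rightarrow> bool" where
  "is_module B \<M> A = (\<lambda>(N, \<rho>).
     N \<in> Ob \<M> \<and> \<rho> \<in> Hom \<M> (Carrier A \<rhd>\<^bsub>\<M>\<^esub> N) N \<and>
     \<rho> \<cdot>\<^bsub>\<M>\<^esub> (Mult A \<bullet>\<^bsub>\<M>\<^esub> Ident \<M> N) =
       \<rho> \<cdot>\<^bsub>\<M>\<^esub> (Ident B (Carrier A) \<bullet>\<^bsub>\<M>\<^esub> \<rho>) \<cdot>\<^bsub>\<M>\<^esub> MAssoc \<M> (Carrier A) (Carrier A) N \<and>
     \<rho> \<cdot>\<^bsub>\<M>\<^esub> (One A \<bullet>\<^bsub>\<M>\<^esub> Ident \<M> N) = MUnit \<M> N)"

definition Mod ::
    "('o, 'm, 'k) br_cat \<Rightarrow> ('p, 'q, 'k, 'o, 'm) mod_cat \<Rightarrow> ('o, 'm, 'z) algebra_scheme \<Rightarrow>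
     ('p \<times> 'q, 'q, 'k) lin_cat" where
  "Mod B \<M> A =
     \<lparr>Ob = {P. is_module B \<M> A P},
      Hom = (\<lambda>(N, \<rho>) (N', \<rho>'). {u \<in> Hom \<M> N N'.
               u \<cdot>\<^bsub>\<M>\<^esub> \<rho> = \<rho>' \<cdot>\<^bsub>\<M>\<^esub> (Ident B (Carrier A) \<bullet>\<^bsub>\<M>\<^esub> u)}),
      Ident = (\<lambda>(N, \<rho>). Ident \<M> N),
      Compose = Compose \<M>,
      Zero = (\<lambda>(N, \<rho>) (N', \<rho>'). Zero \<M> N N'),
      Add = Add \<M>,
      Scale = Scale \<M>\<rparr>"

definition restrict_functor ::
    "('p, 'q, 'k, 'o, 'm) mod_cat \<Rightarrow> 'm \<Rightarrow> ('p \<times> 'q, 'q, 'p \<times> 'q, 'q) functr" where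
  "restrict_functor \<M> f =
     \<lparr>on_ob = (\<lambda>(N, \<rho>). (N, \<rho> \<cdot>\<^bsub>\<M>\<^esub> (f \<bullet>\<^bsub>\<M>\<^esub> Ident \<M> N))), on_hom = (\<lambda>u. u)\<rparr>"

text \<open>The two actions \<open>\<rho>\<^sub>A\<close>, \<open>\<rho>\<^sub>A\<^sub>'\<close> underlying an action \<open>\<rho>\<close> of \<open>A \<otimes> A'\<close> on \<open>N\<close>.\<close>
definition left_action ::
    "('o, 'm, 'k) br_cat \<Rightarrow> ('p, 'q, 'k, 'o, 'm) mod_cat \<Rightarrow> ('o, 'm, 'y) algebra_scheme \<Rightarrow>
     ('o, 'm, 'z) algebra_scheme \<Rightarrow> 'p \<Rightarrow> 'q \<Rightarrow> 'q" where
  "left_action B \<M> A A' N \<rho> = \<rho> \<cdot>\<^bsub>\<M>\<^esub>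
     (((Ident B (Carrier A) \<odot>\<^bsub>B\<^esub> One A') \<cdot>\<^bsub>B\<^esub> InvRUnit B (Carrier A)) \<bullet>\<^bsub>\<M>\<^esub> Ident \<M> N)"

definition right_action ::
    "('o, 'm, 'k) br_cat \<Rightarrow> ('p, 'q, 'k, 'o, 'm) mod_cat \<Rightarrow> ('o, 'm, 'y) algebra_scheme \<Rightarrow>
     ('o, 'm, 'z) algebra_scheme \<Rightarrow> 'p \<Rightarrow> 'q \<Rightarrow> 'q" where
  "right_action B \<M> A A' N \<rho> = \<rho> \<cdot>\<^bsub>\<M>\<^esub>
     (((One A \<odot>\<^bsub>B\<^esub> Ident B (Carrier A')) \<cdot>\<^bsub>B\<^esub> InvLUnit B (Carrier A')) \<bullet>\<^bsub>\<M>\<^esub> Ident \<M> N)"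

text \<open>
  Conversely, an \<open>A\<close>-action \<open>\<rho>\<close> and an \<open>A'\<close>-action \<open>\<rho>'\<close> give
  \<open>\<rho> (Id \<rhd> \<rho>') : (A \<otimes> A') \<rhd> N \<rightarrow> N\<close>.
\<close>
definition joint_action ::
    "('o, 'm, 'k) br_cat \<Rightarrow> ('p, 'q, 'k, 'o, 'm) mod_cat \<Rightarrow> ('o, 'm, 'y) algebra_scheme \<Rightarrow>
     ('o, 'm, 'z) algebra_scheme \<Rightarrow> 'p \<Rightarrow> 'q \<Rightarrow> 'q \<Rightarrow> 'q" where
  "joint_action B \<M> A A' N \<rho> \<rho>' =
     \<rho> \<cdot>\<^bsub>\<M>\<^esub> (Ident B (Carrier A) \<bullet>\<^bsub>\<M>\<^esub> \<rho>') \<cdot>\<^bsub>\<M>\<^esub> MAssoc \<M> (Carrier A) (Carrier A') N"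

text \<open>
  \<open>\<sigma>\<^bsub>A,A'\<^esub> : Mod (A \<otimes> A') \<rightarrow> Mod (A' \<otimes> A)\<close> keeps the object and the \<open>A\<close>-action and
  precomposes the \<open>A'\<close>-action with \<open>E\<close>.
\<close>
definition swap_functor ::
    "('o, 'm, 'k) br_cat \<Rightarrow> ('p, 'q, 'k, 'o, 'm) mod_cat \<Rightarrow> ('o \<Rightarrow> 'p \<Rightarrow> 'q) \<Rightarrow>
     ('o, 'm, 'y) algebra_scheme \<Rightarrow> ('o, 'm, 'z) algebra_scheme \<Rightarrow>
     ('p \<times> 'q, 'q, 'p \<times> 'q, 'q) functr" where
  "swap_functor B \<M> E A A' =
     \<lparr>on_ob = (\<lambda>(N, \<rho>). (N, joint_action B \<M> A' A N
         (right_action B \<M> A A' N \<rho> \<cdot>\<^bsub>\<M>\<^esub> E (Carrier A') N)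
         (left_action B \<M> A A' N \<rho>))),
      on_hom = (\<lambda>u. u)\<rparr>"


section \<open>Tensor powers of \<open>H\<close> and the functors \<open>d\<^sub>i\<close>, \<open>s\<^sub>i\<close>, \<open>\<tau>\<^sub>n\<close>\<close>

text \<open>The powers are bracketed to the left: \<open>H\<^sup>n\<^sup>+\<^sup>1 = H\<^sup>n \<otimes> H\<close> for \<open>n \<ge> 1\<close>.\<close>
fun algebra_power ::
    "('o, 'm, 'k) br_cat \<Rightarrow> ('o, 'm) hopf \<Rightarrow> nat \<Rightarrow> ('o, 'm) algebra" where
  "algebra_power B H 0 = unit_algebra B"
| "algebra_power B H (Suc 0) = algebra.truncate H"
| "algebra_power B H (Suc (Suc n)) = tensor_algebra B (algebra_power B H (Suc n)) H"

abbreviation power_ob :: "('o, 'm, 'k) br_cat \<Rightarrow> ('o, 'm) hopf \<Rightarrow> nat \<Rightarrow> 'o" where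
  "power_ob B H n \<equiv> Carrier (algebra_power B H n)"

text \<open>
  The canonical isomorphism \<open>H\<^sup>a \<otimes> H\<^sup>b \<rightarrow> H\<^sup>a\<^sup>+\<^sup>b\<close>, composed of associativity and unit constraints.
\<close>
fun power_join :: "('o, 'm, 'k) br_cat \<Rightarrow> ('o, 'm) hopf \<Rightarrow> nat \<Rightarrow> nat \<Rightarrow> 'm" where
  "power_join B H 0 b = LUnit B (power_ob B H b)"
| "power_join B H (Suc a) 0 = RUnit B (power_ob B H (Suc a))"
| "power_join B H (Suc a) (Suc 0) = Ident B (power_ob B H (Suc (Suc a)))"
| "power_join B H (Suc a) (Suc (Suc b)) =
     (power_join B H (Suc a) (Suc b) \<odot>\<^bsub>B\<^esub> Ident B (Carrier H)) \<cdot>\<^bsub>B\<^esub>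
     InvAssoc B (power_ob B H (Suc a)) (power_ob B H (Suc b)) (Carrier H)"

definition power_split :: "('o, 'm, 'k) br_cat \<Rightarrow> ('o, 'm) hopf \<Rightarrow> nat \<Rightarrow> nat \<Rightarrow> 'm" where
  "power_split B H a b =
     Inv B (power_ob B H a \<otimes>\<^bsub>B\<^esub> power_ob B H b) (power_ob B H (a + b)) (power_join B H a b)"

text \<open>
  For \<open>f : H\<^sup>p \<rightarrow> H\<^sup>q\<close>, the map \<open>Id \<otimes> f \<otimes> Id : H\<^sup>a\<^sup>+\<^sup>p\<^sup>+\<^sup>b \<rightarrow> H\<^sup>a\<^sup>+\<^sup>q\<^sup>+\<^sup>b\<close> with \<open>a\<close> identity factors
  on the left and \<open>b\<close> on the right.
\<close>
definition pad ::
    "('o, 'm, 'k) br_cat \<Rightarrow> ('o, 'm) hopf \<Rightarrow> nat \<Rightarrow> nat \<Rightarrow> nat \<Rightarrow> 'm \<Rightarrow> nat \<Rightarrow> 'm" where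
  "pad B H a p q f b =
     power_join B H (a + q) b \<cdot>\<^bsub>B\<^esub>
     (power_join B H a q \<odot>\<^bsub>B\<^esub> Ident B (power_ob B H b)) \<cdot>\<^bsub>B\<^esub>
     ((Ident B (power_ob B H a) \<odot>\<^bsub>B\<^esub> f) \<odot>\<^bsub>B\<^esub> Ident B (power_ob B H b)) \<cdot>\<^bsub>B\<^esub>
     (power_split B H a p \<odot>\<^bsub>B\<^esub> Ident B (power_ob B H b)) \<cdot>\<^bsub>B\<^esub>
     power_split B H (a + p) b"

definition cyc_cat ::
    "('o, 'm, 'k) br_cat \<Rightarrow> ('p, 'q, 'k, 'o, 'm) mod_cat \<Rightarrow> ('o, 'm) hopf \<Rightarrow> nat \<Rightarrow>
     ('p \<times> 'q, 'q, 'k) lin_cat" where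
  "cyc_cat B \<M> H n = Mod B \<M> (algebra_power B H (Suc n))"

text \<open>
  \<open>\<tau>\<^sub>n = \<sigma>\<^bsub>A,H\<^esub>\<close> with \<open>A = H\<^sup>n\<close>, after identifying \<open>H\<^sup>n\<^sup>+\<^sup>1\<close> with \<open>H\<^sup>n \<otimes> H\<close> in the source
  and with \<open>H \<otimes> H\<^sup>n\<close> in the target.
\<close>
definition cyc_functor ::
    "('o, 'm, 'k) br_cat \<Rightarrow> ('p, 'q, 'k, 'o, 'm) mod_cat \<Rightarrow> ('o \<Rightarrow> 'p \<Rightarrow> 'q) \<Rightarrow> ('o, 'm) hopf \<Rightarrow>
     nat \<Rightarrow> ('p \<times> 'q, 'q, 'p \<times> 'q, 'q) functr" where
  "cyc_functor B \<M> E H n =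
     restrict_functor \<M> (power_split B H 1 n) \<circ>\<^sub>F
     swap_functor B \<M> E (algebra_power B H n) H \<circ>\<^sub>F
     restrict_functor \<M> (power_join B H n 1)"

definition inner_face ::
    "('o, 'm, 'k) br_cat \<Rightarrow> ('p, 'q, 'k, 'o, 'm) mod_cat \<Rightarrow> ('o, 'm) hopf \<Rightarrow>
     nat \<Rightarrow> nat \<Rightarrow> ('p \<times> 'q, 'q, 'p \<times> 'q, 'q) functr" where
  "inner_face B \<M> H n i = restrict_functor \<M> (pad B H i 1 2 (Comult H) (n - 1 - i))"

definition face_functor ::
    "('o, 'm, 'k) br_cat \<Rightarrow> ('p, 'q, 'k, 'o, 'm) mod_cat \<Rightarrow> ('o \<Rightarrow> 'p \<Rightarrow> 'q) \<Rightarrow> ('o, 'm) hopf \<Rightarrow>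
     nat \<Rightarrow> nat \<Rightarrow> ('p \<times> 'q, 'q, 'p \<times> 'q, 'q) functr" where
  "face_functor B \<M> E H n i =
     (if i < n then inner_face B \<M> H n i else inner_face B \<M> H n 0 \<circ>\<^sub>F cyc_functor B \<M> E H n)"

text \<open>\<open>s\<^sub>i\<close> on \<open>C\<^sub>n\<close> for \<open>-1 \<le> i \<le> n\<close>.\<close>
definition degeneracy_functor ::
    "('o, 'm, 'k) br_cat \<Rightarrow> ('p, 'q, 'k, 'o, 'm) mod_cat \<Rightarrow> ('o, 'm) hopf \<Rightarrow>
     nat \<Rightarrow> int \<Rightarrow> ('p \<times> 'q, 'q, 'p \<times> 'q, 'q) functr" where
  "degeneracy_functor B \<M> H n i =
     restrict_functor \<M> (pad B H (nat (i + 1)) 1 0 (Counit H) (nat (int n - i)))"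


section \<open>Simplicial and cyclic objects in categories\<close>

locale simplicial_object_in_categories =
  fixes C :: "nat \<Rightarrow> ('o, 'm, 'k::{alg_closed_field, field_char_0}) lin_cat"
    and d :: "nat \<Rightarrow> nat \<Rightarrow> ('o, 'm, 'o, 'm) functr"
    and s :: "nat \<Rightarrow> nat \<Rightarrow> ('o, 'm, 'o, 'm) functr"
  assumes linear: "linear_category (C n)"
    and d_functor: "\<lbrakk>1 \<le> n; i \<le> n\<rbrakk> \<Longrightarrow> linear_functor (C n) (C (n - 1)) (d n i)"
    and s_functor: "i \<le> n \<Longrightarrow> linear_functor (C n) (C (n + 1)) (s n i)"
    and d_d: "\<lbrakk>2 \<le> n; i < j; j \<le> n\<rbrakk>
      \<Longrightarrow> functor_eq (C n) (d (n - 1) i \<circ>\<^sub>F d n j) (d (n - 1) (j - 1) \<circ>\<^sub>F d n i)"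
    and s_s: "\<lbrakk>j < i; i \<le> n + 1\<rbrakk>
      \<Longrightarrow> functor_eq (C n) (s (n + 1) i \<circ>\<^sub>F s n j) (s (n + 1) j \<circ>\<^sub>F s n (i - 1))"
    and d_s_less: "\<lbrakk>i < j; j \<le> n\<rbrakk>
      \<Longrightarrow> functor_eq (C n) (d (n + 1) i \<circ>\<^sub>F s n j) (s (n - 1) (j - 1) \<circ>\<^sub>F d n i)"
    and d_s_eq: "\<lbrakk>j \<le> n; i = j \<or> i = j + 1\<rbrakk>
      \<Longrightarrow> functor_eq (C n) (d (n + 1) i \<circ>\<^sub>F s n j) id_functor"
    and d_s_greater: "\<lbrakk>j + 1 < i; i \<le> n + 1\<rbrakk>
      \<Longrightarrow> functor_eq (C n) (d (n + 1) i \<circ>\<^sub>F s n j) (s (n - 1) j \<circ>\<^sub>F d n (i - 1))"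

text \<open>
  The opposite of Connes' cyclic category, by generators and relations.  A word
  \<open>[g\<^sub>1, \<dots>, g\<^sub>k]\<close> stands for the composite \<open>g\<^sub>1 \<circ> \<dots> \<circ> g\<^sub>k\<close>.
\<close>
datatype cyc_gen = Face nat nat | Degen nat nat | Cyc nat

fun gen_src :: "cyc_gen \<Rightarrow> nat" where
  "gen_src (Face n i) = n"
| "gen_src (Degen n i) = n"
| "gen_src (Cyc n) = n"

fun gen_tgt :: "cyc_gen \<Rightarrow> nat" where
  "gen_tgt (Face n i) = n - 1"
| "gen_tgt (Degen n i) = n + 1"
| "gen_tgt (Cyc n) = n"

fun gen_valid :: "cyc_gen \<Rightarrow> bool" where
  "gen_valid (Face n i) \<longleftrightarrow> 1 \<le> n \<and> i \<le> n"
| "gen_valid (Degen n i) \<longleftrightarrow> i \<le> n"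
| "gen_valid (Cyc n) \<longleftrightarrow> True"

fun word_path :: "nat \<Rightarrow> cyc_gen list \<Rightarrow> nat \<Rightarrow> bool" where
  "word_path n [] m \<longleftrightarrow> n = m"
| "word_path n (g # w) m \<longleftrightarrow> gen_valid g \<and> word_path n w (gen_src g) \<and> gen_tgt g = m"

text \<open>The relations of words with source \<open>n\<close>, except for \<open>\<tau>\<^sub>n\<^bsup>n+1\<^esup> = Id\<close>.\<close>
inductive cyc_rel :: "nat \<Rightarrow> cyc_gen list \<Rightarrow> cyc_gen list \<Rightarrow> bool" where
  "\<lbrakk>2 \<le> n; i < j; j \<le> n\<rbrakk>
    \<Longrightarrow> cyc_rel n [Face (n - 1) i, Face n j] [Face (n - 1) (j - 1), Face n i]"
| "\<lbrakk>j < i; i \<le> n + 1\<rbrakk>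
    \<Longrightarrow> cyc_rel n [Degen (n + 1) i, Degen n j] [Degen (n + 1) j, Degen n (i - 1)]"
| "\<lbrakk>i < j; j \<le> n\<rbrakk>
    \<Longrightarrow> cyc_rel n [Face (n + 1) i, Degen n j] [Degen (n - 1) (j - 1), Face n i]"
| "\<lbrakk>j \<le> n; i = j \<or> i = j + 1\<rbrakk> \<Longrightarrow> cyc_rel n [Face (n + 1) i, Degen n j] []"
| "\<lbrakk>j + 1 < i; i \<le> n + 1\<rbrakk>
    \<Longrightarrow> cyc_rel n [Face (n + 1) i, Degen n j] [Degen (n - 1) j, Face n (i - 1)]"
| "\<lbrakk>1 \<le> i; i \<le> n\<rbrakk> \<Longrightarrow> cyc_rel n [Face n i, Cyc n] [Cyc (n - 1), Face n (i - 1)]"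
| "1 \<le> n \<Longrightarrow> cyc_rel n [Face n 0, Cyc n] [Face n n]"
| "\<lbrakk>1 \<le> i; i \<le> n\<rbrakk> \<Longrightarrow> cyc_rel n [Degen n i, Cyc n] [Cyc (n + 1), Degen n (i - 1)]"
| "cyc_rel n [Degen n 0, Cyc n] [Cyc (n + 1), Cyc (n + 1), Degen n n]"

inductive word_eq :: "nat \<Rightarrow> cyc_gen list \<Rightarrow> cyc_gen list \<Rightarrow> bool" where
  word_eq_rel: "cyc_rel n u v \<Longrightarrow> word_eq n u v"
| word_eq_cyc: "word_eq n (replicate (n + 1) (Cyc n)) []"
| word_eq_refl: "word_path n u m \<Longrightarrow> word_eq n u u"
| word_eq_sym: "word_eq n u v \<Longrightarrow> word_eq n v u"
| word_eq_trans: "\<lbrakk>word_eq n u v; word_eq n v w\<rbrakk> \<Longrightarrow> word_eq n u w"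
| word_eq_cong: "\<lbrakk>word_eq n u v; word_path k x n; word_path n u m; word_path m w l\<rbrakk>
    \<Longrightarrow> word_eq k (w @ u @ x) (w @ v @ x)"

text \<open>Classes record the source, since the empty word does not.\<close>
definition word_class :: "nat \<Rightarrow> cyc_gen list \<Rightarrow> (nat \<times> cyc_gen list) set" where
  "word_class n u = {(n, v) | v. word_eq n u v}"

definition Lambda_op :: "(nat, (nat \<times> cyc_gen list) set) cat" where
  "Lambda_op =
     \<lparr>Ob = UNIV,
      Hom = (\<lambda>n m. {word_class n u | u. word_path n u m}),
      Ident = (\<lambda>n. word_class n []),
      Compose = (\<lambda>c c'. \<Union>{word_class n (u @ v) | m u n v. (m, u) \<in> c \<and> (n, v) \<in> c'})\<rparr>"

text \<open>
  Pseudofunctors from a category to linear categories, with compositor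
  \<open>\<mu> g f : P g \<circ> P f \<cong> P (g \<cdot> f)\<close> and unitor \<open>\<iota> x : Id \<cong> P (Ident x)\<close>.
\<close>
locale pseudofunctor = J: category J
  for J :: "('j, 'w) cat" +
  fixes C :: "'j \<Rightarrow> ('o, 'm, 'k::{alg_closed_field, field_char_0}) lin_cat"
    and P :: "'w \<Rightarrow> ('o, 'm, 'o, 'm) functr"
    and \<mu> :: "'w \<Rightarrow> 'w \<Rightarrow> 'o \<Rightarrow> 'm"
    and \<iota> :: "'j \<Rightarrow> 'o \<Rightarrow> 'm"
  assumes P_functor: "\<lbrakk>x \<in> Ob J; y \<in> Ob J; f \<in> Hom J x y\<rbrakk> \<Longrightarrow> linear_functor (C x) (C y) (P f)"
    and compositor: "\<lbrakk>x \<in> Ob J; y \<in> Ob J; z \<in> Ob J; f \<in> Hom J x y; g \<in> Hom J y z\<rbrakk>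
      \<Longrightarrow> natural_iso (C x) (C z) (P g \<circ>\<^sub>F P f) (P (g \<cdot>\<^bsub>J\<^esub> f)) (\<mu> g f)"
    and unitor: "x \<in> Ob J \<Longrightarrow> natural_iso (C x) (C x) id_functor (P (Ident J x)) (\<iota> x)"
    and compositor_assoc: "\<lbrakk>w \<in> Ob J; x \<in> Ob J; y \<in> Ob J; z \<in> Ob J;
        f \<in> Hom J w x; g \<in> Hom J x y; h \<in> Hom J y z; X \<in> Ob (C w)\<rbrakk>
      \<Longrightarrow> \<mu> (h \<cdot>\<^bsub>J\<^esub> g) f X \<cdot>\<^bsub>C z\<^esub> \<mu> h g (on_ob (P f) X) =
          \<mu> h (g \<cdot>\<^bsub>J\<^esub> f) X \<cdot>\<^bsub>C z\<^esub> on_hom (P h) (\<mu> g f X)"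
    and compositor_ident_right: "\<lbrakk>x \<in> Ob J; y \<in> Ob J; f \<in> Hom J x y; X \<in> Ob (C x)\<rbrakk>
      \<Longrightarrow> \<mu> f (Ident J x) X \<cdot>\<^bsub>C y\<^esub> on_hom (P f) (\<iota> x X) = Ident (C y) (on_ob (P f) X)"
    and compositor_ident_left: "\<lbrakk>x \<in> Ob J; y \<in> Ob J; f \<in> Hom J x y; X \<in> Ob (C x)\<rbrakk>
      \<Longrightarrow> \<mu> (Ident J y) f X \<cdot>\<^bsub>C y\<^esub> \<iota> y (on_ob (P f) X) = Ident (C y) (on_ob (P f) X)"

abbreviation gen_class :: "cyc_gen \<Rightarrow> (nat \<times> cyc_gen list) set" where
  "gen_class g \<equiv> word_class (gen_src g) [g]"

text \<open>
  For a word \<open>w = [g\<^sub>1, \<dots>, g\<^sub>k]\<close> with source \<open>n\<close>, the isomorphism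
  \<open>P [g\<^sub>1] (\<dots> (P [g\<^sub>k] X)) \<rightarrow> P [w] X\<close> obtained by iterating the compositor.
\<close>
fun word_compositor ::
    "(nat \<Rightarrow> ('o, 'm, 'k) lin_cat) \<Rightarrow> ((nat \<times> cyc_gen list) set \<Rightarrow> ('o, 'm, 'o, 'm) functr) \<Rightarrow>
     ((nat \<times> cyc_gen list) set \<Rightarrow> (nat \<times> cyc_gen list) set \<Rightarrow> 'o \<Rightarrow> 'm) \<Rightarrow> (nat \<Rightarrow> 'o \<Rightarrow> 'm) \<Rightarrow>
     nat \<Rightarrow> cyc_gen list \<Rightarrow> 'o \<Rightarrow> 'm" where
  "word_compositor C P \<mu> \<iota> n [] X = \<iota> n X"
| "word_compositor C P \<mu> \<iota> n (g # w) X =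
     \<mu> (gen_class g) (word_class n w) X \<cdot>\<^bsub>C (gen_tgt g)\<^esub>
     on_hom (P (gen_class g)) (word_compositor C P \<mu> \<iota> n w X)"

text \<open>
  The last axiom says that the data extend to a pseudofunctor on the opposite cyclic category which
  sends the generators to \<open>d\<close>, \<open>s\<close>, \<open>t\<close>, the relations other than \<open>t\<^bsup>n+1\<^esup> = Id\<close> to the strict
  equalities of functors above, and the relation \<open>t\<^bsup>n+1\<^esup> = Id\<close> to \<open>\<theta>\<close>.
\<close>
locale cyclic_object_in_categories = simplicial_object_in_categories C d s
  for C :: "nat \<Rightarrow> ('o, 'm, 'k::{alg_closed_field, field_char_0}) lin_cat"
    and d :: "nat \<Rightarrow> nat \<Rightarrow> ('o, 'm, 'o, 'm) functr"
    and s :: "nat \<Rightarrow> nat \<Rightarrow> ('o, 'm, 'o, 'm) functr" +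
  fixes t :: "nat \<Rightarrow> ('o, 'm, 'o, 'm) functr"
    and \<theta> :: "nat \<Rightarrow> 'o \<Rightarrow> 'm"
  assumes t_functor: "linear_functor (C n) (C n) (t n)"
    and d_t: "\<lbrakk>1 \<le> i; i \<le> n\<rbrakk>
      \<Longrightarrow> functor_eq (C n) (d n i \<circ>\<^sub>F t n) (t (n - 1) \<circ>\<^sub>F d n (i - 1))"
    and d_zero_t: "1 \<le> n \<Longrightarrow> functor_eq (C n) (d n 0 \<circ>\<^sub>F t n) (d n n)"
    and s_t: "\<lbrakk>1 \<le> i; i \<le> n\<rbrakk>
      \<Longrightarrow> functor_eq (C n) (s n i \<circ>\<^sub>F t n) (t (n + 1) \<circ>\<^sub>F s n (i - 1))"
    and s_zero_t: "functor_eq (C n) (s n 0 \<circ>\<^sub>F t n) (t (n + 1) \<circ>\<^sub>F t (n + 1) \<circ>\<^sub>F s n n)"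
    and t_power: "natural_iso (C n) (C n) id_functor (functor_power (t n) (n + 1)) (\<theta> n)"
    and extends: "\<exists>P \<mu> \<iota>. pseudofunctor Lambda_op C P \<mu> \<iota> \<and>
      (\<forall>n i. 1 \<le> n \<and> i \<le> n \<longrightarrow> P (gen_class (Face n i)) = d n i) \<and>
      (\<forall>n i. i \<le> n \<longrightarrow> P (gen_class (Degen n i)) = s n i) \<and>
      (\<forall>n. P (gen_class (Cyc n)) = t n) \<and>
      (\<forall>n u v. cyc_rel n u v \<longrightarrow> (\<forall>X \<in> Ob (C n).
         word_compositor C P \<mu> \<iota> n u X = word_compositor C P \<mu> \<iota> n v X)) \<and>
      (\<forall>n. \<forall>X \<in> Ob (C n).
         word_compositor C P \<mu> \<iota> n (replicate (n + 1) (Cyc n)) X \<cdot>\<^bsub>C n\<^esub> \<theta> n X =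
         word_compositor C P \<mu> \<iota> n [] X)"

end

theory Submission
  imports Defs
begin

text \<open>
  A module over \<open>H\<^sup>n\<^sup>+\<^sup>1\<close> in \<open>\<M>\<close> is the same thing as an object \<open>N\<close> with a list
  \<open>[\<rho>\<^sub>0, \<dots>, \<rho>\<^sub>n]\<close> of actions of \<open>H\<close> such that, for \<open>i < j\<close>, the actions \<open>\<rho>\<^sub>i\<close> and \<open>\<rho>\<^sub>j\<close> commute up
  to the braiding; the action of \<open>H\<^sup>n\<^sup>+\<^sup>1\<close> is \<open>\<rho>\<^sub>0 (Id \<rhd> \<rho>\<^sub>1) (Id \<rhd> Id \<rhd> \<rho>\<^sub>2) \<dots>\<close>.  The two halves of this
  dictionary are \<open>comm_acts_act\<close> and \<open>act_power_obtains\<close>; they rest on the case of a tensor product of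
  two algebras, \<open>act_joint\<close> and \<open>act_split\<close>.  On lists the functors become elementary: an inner face
  replaces two neighbouring actions by the action of \<open>H\<close> through the comultiplication, a degeneracy
  inserts the trivial action given by the counit, and \<open>\<tau>\<^sub>n\<close> moves the last action to the front,
  precomposed with \<open>E\<close>.

  The simplicial and cyclic identities are then identities between lists.  Besides bookkeeping they
  use that merging is associative (\<open>merge_assoc\<close>), that the trivial action is neutral for it
  (\<open>merge_trivial\<close>), and that precomposition with \<open>E\<close> respects merging and fixes the trivial action
  (\<open>twist_merge\<close>, \<open>twist_trivial\<close>).  The last two facts are the axiom on \<open>E\<close> of a tensor product together
  with its consequence that \<open>E\<close> is trivial for the unit object; they give the one identity that is not
  formal, \<open>d\<^sub>0 \<tau>\<^sub>n \<tau>\<^sub>n = \<tau>\<^sub>n\<^sub>-\<^sub>1 d\<^sub>n\<^sub>-\<^sub>1\<close>.  The other axiom on \<open>E\<close> says that the twisted last action commutes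
  with the remaining ones when it is placed first (\<open>commuting_twist\<close>), so \<open>\<tau>\<^sub>n\<close> is well defined.

  Applying \<open>\<tau>\<^sub>n\<close> exactly \<open>n + 1\<close> times precomposes every action, hence the action of \<open>H\<^sup>n\<^sup>+\<^sup>1\<close>, with \<open>E\<close>.
  If \<open>\<M>\<close> is stable then \<open>E = \<sigma> (Id \<rhd> \<sigma>)\<^sup>-\<^sup>1\<close>, and therefore \<open>\<sigma>\<close> is an isomorphism from \<open>N\<close> with its
  given action to \<open>N\<close> with the new one (\<open>twist_power_hom\<close>).

  It remains to extend this to a pseudofunctor on the opposite cyclic category.  A word in the
  generators acts on the integers by a map that is equivariant for translations (the paracyclic
  category); all relations except \<open>\<tau>\<^sub>n\<^sup>n\<^sup>+\<^sup>1 = Id\<close> hold for these maps, and \<open>\<tau>\<^sub>n\<^sup>n\<^sup>+\<^sup>1\<close> becomes translation by a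
  period.  Hence two words with the same class differ by a well-defined number \<open>k\<close> of periods, and
  \<open>\<sigma>\<^sup>k\<close> is an isomorphism between the two functors that they define (\<open>word_eq_twist_pow\<close>).  With a chosen
  representative word for each class, the compositors are such powers of \<open>\<sigma>\<close>, and every coherence
  condition is an equality of exponents, which holds because \<open>k\<close> is additive (\<open>phase_append\<close>).
\<close>

section \<open>Arrows of a category\<close>

text \<open>
  Arrows that know their source and target; \<open>None\<close> is an absorbing error value.  With it composition
  is associative without side conditions, so that long composites can be rebracketed by rewriting.
\<close>
type_synonym ('o, 'm) arrow = "('o \<times> 'm \<times> 'o) option"

context category
begin

definition is_arrow :: "('o, 'm) arrow \<Rightarrow> bool" where
  "is_arrow p \<longleftrightarrow> (\<exists>X Y f. X \<in> Ob C \<and> Y \<in> Ob C \<and> f \<in> Hom C X Y \<and> p = Some (X, f, Y))"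

definition arrow :: "'o \<Rightarrow> 'm \<Rightarrow> 'o \<Rightarrow> ('o, 'm) arrow" where
  "arrow X f Y = Some (X, f, Y)"

definition src :: "('o, 'm) arrow \<Rightarrow> 'o" where
  "src p = fst (the p)"

definition mor :: "('o, 'm) arrow \<Rightarrow> 'm" where
  "mor p = fst (snd (the p))"

definition trg :: "('o, 'm) arrow \<Rightarrow> 'o" where
  "trg p = snd (snd (the p))"

definition acomp :: "('o, 'm) arrow \<Rightarrow> ('o, 'm) arrow \<Rightarrow> ('o, 'm) arrow"
    (infixr "\<star>" 70) where
  "q \<star> p = (if is_arrow p \<and> is_arrow q \<and> src q = trg p
     then arrow (src p) (mor q \<cdot> mor p) (trg q) else None)"

definition aid :: "'o \<Rightarrow> ('o, 'm) arrow" where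
  "aid X = arrow X (Ident C X) X"

lemma is_arrow_None [simp]: "\<not> is_arrow None"
  by (simp add: is_arrow_def)

lemma is_arrow_arrow [simp]:
  "is_arrow (arrow X f Y) \<longleftrightarrow> X \<in> Ob C \<and> Y \<in> Ob C \<and> f \<in> Hom C X Y"
  by (auto simp: is_arrow_def arrow_def)

lemma arrow_sel [simp]: "src (arrow X f Y) = X" "mor (arrow X f Y) = f" "trg (arrow X f Y) = Y"
  by (simp_all add: src_def mor_def trg_def arrow_def)

lemma is_arrowD:
  assumes "is_arrow p"
  shows "src p \<in> Ob C" "trg p \<in> Ob C" "mor p \<in> Hom C (src p) (trg p)"
  using assms by (auto simp: is_arrow_def src_def mor_def trg_def)

lemma arrow_eqI:
  "\<lbrakk>is_arrow p; is_arrow q; src p = src q; trg p = trg q; mor p = mor q\<rbrakk> \<Longrightarrow> p = q"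
  by (auto simp: is_arrow_def src_def mor_def trg_def)

lemma is_arrow_acomp [simp]:
  "is_arrow (q \<star> p) \<longleftrightarrow> is_arrow p \<and> is_arrow q \<and> src q = trg p"
  using comp_hom[of "src p" "trg p" "trg q" "mor p" "mor q"] is_arrowD[of p] is_arrowD[of q]
  by (auto simp: acomp_def)

lemma src_acomp [simp]: "\<lbrakk>is_arrow p; is_arrow q; src q = trg p\<rbrakk> \<Longrightarrow> src (q \<star> p) = src p"
  and trg_acomp [simp]: "\<lbrakk>is_arrow p; is_arrow q; src q = trg p\<rbrakk> \<Longrightarrow> trg (q \<star> p) = trg q"
  and mor_acomp: "\<lbrakk>is_arrow p; is_arrow q; src q = trg p\<rbrakk> \<Longrightarrow> mor (q \<star> p) = mor q \<cdot> mor p"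
  by (simp_all add: acomp_def)

text \<open>
  If one of the two bracketings is undefined then so is the other.
\<close>
lemma acomp_assoc [simp]: "(r \<star> q) \<star> p = r \<star> (q \<star> p)"
proof (cases "is_arrow p \<and> is_arrow q \<and> is_arrow r \<and> src q = trg p \<and> src r = trg q")
  case True
  then have "(mor r \<cdot> mor q) \<cdot> mor p = mor r \<cdot> (mor q \<cdot> mor p)"
    using comp_assoc[of "src p" "src q" "src r" "trg r" "mor p" "mor q" "mor r"]
      is_arrowD[of p] is_arrowD[of q] is_arrowD[of r] by simp
  with True show ?thesis
    by (intro arrow_eqI) (auto simp: mor_acomp)
next
  case False
  have None_iff: "v \<star> u = None \<longleftrightarrow> \<not> is_arrow (v \<star> u)" for u v
    unfolding is_arrow_acomp by (auto simp: acomp_def arrow_def)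
  from False have "\<not> is_arrow ((r \<star> q) \<star> p)" "\<not> is_arrow (r \<star> (q \<star> p))"
    by auto
  then show ?thesis
    using None_iff by metis
qed

lemma is_arrow_aid [simp]: "is_arrow (aid X) \<longleftrightarrow> X \<in> Ob C"
  using ident_hom by (auto simp: aid_def)

lemma aid_sel [simp]: "src (aid X) = X" "trg (aid X) = X" "mor (aid X) = Ident C X"
  by (simp_all add: aid_def)

lemma aid_left [simp]: "\<lbrakk>is_arrow p; trg p = Y\<rbrakk> \<Longrightarrow> aid Y \<star> p = p"
  using ident_left[of "src p" Y "mor p"] is_arrowD[of p] by (intro arrow_eqI) (auto simp: mor_acomp)

lemma aid_right [simp]: "\<lbrakk>is_arrow p; src p = X\<rbrakk> \<Longrightarrow> p \<star> aid X = p"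
  using ident_right[of X "trg p" "mor p"] is_arrowD[of p] by (intro arrow_eqI) (auto simp: mor_acomp)

text \<open>
  Associativity brackets composites to the right.  These two rules apply an equation between
  composites at the head of a longer one.
\<close>
lemma acomp_head: "q \<star> p = q' \<star> p' \<Longrightarrow> q \<star> (p \<star> r) = q' \<star> (p' \<star> r)"
  by (metis acomp_assoc)

lemma acomp_head1: "q \<star> p = s \<Longrightarrow> q \<star> (p \<star> r) = s \<star> r"
  by (metis acomp_assoc)

lemma inverse_pair_unique:
  assumes "X \<in> Ob C" "Y \<in> Ob C" "inverse_pair C X Y f g" "inverse_pair C X Y f h"
  shows "g = h"
proof -
  have "g = g \<cdot> (f \<cdot> h)"
    using assms ident_right[of Y X g] by (simp add: inverse_pair_def)
  also have "\<dots> = (g \<cdot> f) \<cdot> h"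
    using assms comp_assoc[of Y X Y X h f g] by (simp add: inverse_pair_def)
  also have "\<dots> = h"
    using assms ident_left[of Y X h] by (simp add: inverse_pair_def)
  finally show ?thesis .
qed

lemma inverse_pair_Inv:
  assumes "X \<in> Ob C" "Y \<in> Ob C" "is_iso C X Y f"
  shows "inverse_pair C X Y f (Inv C X Y f)"
proof -
  obtain g where "inverse_pair C X Y f g"
    using assms by (auto simp: is_iso_def)
  then show ?thesis
    unfolding Inv_def using inverse_pair_unique[OF assms(1,2)] theI[of "inverse_pair C X Y f" g]
    by blast
qed

lemma Inv_eqI:
  assumes "X \<in> Ob C" "Y \<in> Ob C" "inverse_pair C X Y f g"
  shows "Inv C X Y f = g"
  using inverse_pair_unique[OF assms(1,2) inverse_pair_Inv assms(3)] assms by (auto simp: is_iso_def)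

lemma inverse_pair_comp:
  assumes "X \<in> Ob C" "Y \<in> Ob C" "Z \<in> Ob C" "inverse_pair C X Y f f'" "inverse_pair C Y Z g g'"
  shows "inverse_pair C X Z (g \<cdot> f) (f' \<cdot> g')"
proof -
  have f: "f \<in> Hom C X Y" "f' \<in> Hom C Y X" "f' \<cdot> f = Ident C X" "f \<cdot> f' = Ident C Y"
    and g: "g \<in> Hom C Y Z" "g' \<in> Hom C Z Y" "g' \<cdot> g = Ident C Y" "g \<cdot> g' = Ident C Z"
    using assms by (auto simp: inverse_pair_def)
  have "(f' \<cdot> g') \<cdot> (g \<cdot> f) = f' \<cdot> ((g' \<cdot> g) \<cdot> f)"
    using assms(1-3) f g comp_hom[of X Y Z f g] comp_assoc[of X Z Y X "g \<cdot> f" g' f']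
      comp_assoc[of X Y Z Y f g g'] by simp
  also have "\<dots> = Ident C X"
    using assms(1-3) f g ident_left by simp
  finally have 1: "(f' \<cdot> g') \<cdot> (g \<cdot> f) = Ident C X" .
  have "(g \<cdot> f) \<cdot> (f' \<cdot> g') = g \<cdot> ((f \<cdot> f') \<cdot> g')"
    using assms(1-3) f g comp_hom[of Z Y X g' f'] comp_assoc[of Z X Y Z "f' \<cdot> g'" f g]
      comp_assoc[of Z Y X Y g' f' f] by simp
  also have "\<dots> = Ident C Z"
    using assms(1-3) f g ident_left by simp
  finally show ?thesis
    using 1 assms(1-3) f g comp_hom[of X Y Z f g] comp_hom[of Z Y X g' f']
    by (simp add: inverse_pair_def)
qed

lemma is_iso_comp:
  "\<lbrakk>X \<in> Ob C; Y \<in> Ob C; Z \<in> Ob C; is_iso C X Y f; is_iso C Y Z g\<rbrakk> \<Longrightarrow> is_iso C X Z (g \<cdot> f)"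
  unfolding is_iso_def using inverse_pair_comp by blast

lemma is_iso_Ident: "X \<in> Ob C \<Longrightarrow> is_iso C X X (Ident C X)"
  unfolding is_iso_def inverse_pair_def using ident_hom ident_left by blast

lemma is_iso_Inv: "\<lbrakk>X \<in> Ob C; Y \<in> Ob C; is_iso C X Y f\<rbrakk> \<Longrightarrow> is_iso C Y X (Inv C X Y f)"
  using inverse_pair_Inv unfolding is_iso_def inverse_pair_def by blast

end

section \<open>Actions of a monoidal category, written without brackets\<close>

context module_category
begin

notation acomp (infixr "\<star>" 70)

abbreviation tensor_B :: "'o \<Rightarrow> 'o \<Rightarrow> 'o" (infixr "\<boxtimes>" 80) where
  "X \<boxtimes> Y \<equiv> X \<otimes>\<^bsub>B\<^esub> Y"

abbreviation tensor_hom_B :: "'m \<Rightarrow> 'm \<Rightarrow> 'm" (infixr "\<boxdot>" 80) where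
  "f \<boxdot> g \<equiv> f \<odot>\<^bsub>B\<^esub> g"

text \<open>
  The functor \<open>X \<rhd> -\<close> on arrows of \<open>\<M>\<close>.
\<close>
definition whisk :: "'o \<Rightarrow> ('p, 'q) arrow \<Rightarrow> ('p, 'q) arrow"
    (infixr "|>" 80) where
  "X |> p = arrow (X \<rhd> src p) (Ident B X \<bullet> mor p) (X \<rhd> trg p)"

text \<open>
  A morphism of \<open>B\<close> as a natural transformation between action functors, at \<open>N\<close>.  An iterated action
  is always bracketed as \<open>X \<rhd> (Y \<rhd> \<dots>)\<close>; in this form the associativity constraints of \<open>B\<close> vanish.
\<close>
definition cell :: "'o \<Rightarrow> 'm \<Rightarrow> 'o \<Rightarrow> 'p \<Rightarrow> ('p, 'q) arrow" where
  "cell X f Y N = arrow (X \<rhd> N) (f \<bullet> Ident \<M> N) (Y \<rhd> N)"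

definition assr :: "'o \<Rightarrow> 'o \<Rightarrow> 'p \<Rightarrow> ('p, 'q) arrow" where
  "assr X Y N = arrow ((X \<boxtimes> Y) \<rhd> N) (MAssoc \<M> X Y N) (X \<rhd> (Y \<rhd> N))"

definition assl :: "'o \<Rightarrow> 'o \<Rightarrow> 'p \<Rightarrow> ('p, 'q) arrow" where
  "assl X Y N = arrow (X \<rhd> (Y \<rhd> N)) (InvMAssoc B \<M> X Y N) ((X \<boxtimes> Y) \<rhd> N)"

definition unt :: "'p \<Rightarrow> ('p, 'q) arrow" where
  "unt N = arrow (Unit B \<rhd> N) (MUnit \<M> N) N"

definition unt' :: "'p \<Rightarrow> ('p, 'q) arrow" where
  "unt' N = arrow N (Inv \<M> (Unit B \<rhd> N) N (MUnit \<M> N)) (Unit B \<rhd> N)"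

lemmas [simp] = act_ob B.tensor_ob B.unit_ob B.ident_hom ident_hom is_arrowD(1,2)

lemma whisk_arrow [simp]: "\<lbrakk>X \<in> Ob B; is_arrow p\<rbrakk> \<Longrightarrow> is_arrow (X |> p)"
  using act_hom is_arrowD by (simp add: whisk_def)

lemma whisk_sel [simp]: "src (X |> p) = X \<rhd> src p" "trg (X |> p) = X \<rhd> trg p"
  by (simp_all add: whisk_def)

lemma whisk_comp [simp]:
  assumes "X \<in> Ob B" "is_arrow p" "is_arrow q" "src q = trg p"
  shows "X |> (q \<star> p) = (X |> q) \<star> (X |> p)"
  using assms act_comp[of X X X "src p" "trg p" "trg q" "Ident B X" "Ident B X" "mor p" "mor q"]
    is_arrowD[of p] is_arrowD[of q] B.ident_left[of X X "Ident B X"]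
  by (intro arrow_eqI) (simp_all add: mor_acomp, simp add: whisk_def mor_acomp)

lemma whisk_aid [simp]: "\<lbrakk>X \<in> Ob B; N \<in> Ob \<M>\<rbrakk> \<Longrightarrow> X |> aid N = aid (X \<rhd> N)"
  using act_ident by (simp add: whisk_def aid_def)

lemma cell_arrow [simp]:
  "\<lbrakk>X \<in> Ob B; Y \<in> Ob B; f \<in> Hom B X Y; N \<in> Ob \<M>\<rbrakk> \<Longrightarrow> is_arrow (cell X f Y N)"
  using act_hom by (simp add: cell_def)

lemma cell_sel [simp]: "src (cell X f Y N) = X \<rhd> N" "trg (cell X f Y N) = Y \<rhd> N"
  by (simp_all add: cell_def)

lemma mor_simps:
  "mor (X |> p) = Ident B X \<bullet> mor p" "mor (cell X f Y N) = f \<bullet> Ident \<M> N"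
  "mor (assr X Y N) = MAssoc \<M> X Y N" "mor (unt N) = MUnit \<M> N"
  by (simp_all add: whisk_def cell_def assr_def unt_def)

lemma cell_Ident [simp]: "\<lbrakk>X \<in> Ob B; N \<in> Ob \<M>\<rbrakk> \<Longrightarrow> cell X (Ident B X) X N = aid (X \<rhd> N)"
  using act_ident by (simp add: cell_def aid_def)

lemma cell_comp:
  assumes "X \<in> Ob B" "Y \<in> Ob B" "Z \<in> Ob B" "f \<in> Hom B X Y" "g \<in> Hom B Y Z" "N \<in> Ob \<M>"
  shows "cell X (g \<cdot>\<^bsub>B\<^esub> f) Z N = cell Y g Z N \<star> cell X f Y N"
  using assms act_comp[of X Y Z N N N f g "Ident \<M> N" "Ident \<M> N"] B.comp_hom[of X Y Z f g]
    ident_left[of N N "Ident \<M> N"]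
  by (intro arrow_eqI) (simp_all add: mor_acomp mor_simps)

lemma cell_nat:
  assumes "X \<in> Ob B" "Y \<in> Ob B" "f \<in> Hom B X Y" "is_arrow p" "src p = M" "trg p = N"
  shows "cell X f Y N \<star> (X |> p) = (Y |> p) \<star> cell X f Y M"
proof -
  have m: "mor p \<in> Hom \<M> M N" "M \<in> Ob \<M>" "N \<in> Ob \<M>"
    using assms is_arrowD by auto
  have "(f \<bullet> Ident \<M> N) \<cdot> (Ident B X \<bullet> mor p) = f \<bullet> mor p"
    using act_comp[of X X Y M N N "Ident B X" f "mor p" "Ident \<M> N"] assms m
      B.ident_right[of X Y f] ident_left[of M N "mor p"] by simp
  moreover have "(Ident B Y \<bullet> mor p) \<cdot> (f \<bullet> Ident \<M> M) = f \<bullet> mor p"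
    using act_comp[of X Y Y M M N f "Ident B Y" "Ident \<M> M" "mor p"] assms m
      B.ident_left[of X Y f] ident_right[of M N "mor p"] by simp
  ultimately show ?thesis
    using assms m by (intro arrow_eqI) (simp_all add: mor_acomp mor_simps)
qed

lemma ass_iso:
  assumes "X \<in> Ob B" "Y \<in> Ob B" "N \<in> Ob \<M>"
  shows "inverse_pair \<M> ((X \<boxtimes> Y) \<rhd> N) (X \<rhd> (Y \<rhd> N)) (MAssoc \<M> X Y N) (InvMAssoc B \<M> X Y N)"
  using assms by (intro inverse_pair_Inv massoc_iso) auto

lemma assr_arrow [simp]: "\<lbrakk>X \<in> Ob B; Y \<in> Ob B; N \<in> Ob \<M>\<rbrakk> \<Longrightarrow> is_arrow (assr X Y N)"
  and assl_arrow [simp]: "\<lbrakk>X \<in> Ob B; Y \<in> Ob B; N \<in> Ob \<M>\<rbrakk> \<Longrightarrow> is_arrow (assl X Y N)"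
  using ass_iso[of X Y N] by (simp_all add: assr_def assl_def inverse_pair_def)

lemma ass_sel [simp]:
  "src (assr X Y N) = (X \<boxtimes> Y) \<rhd> N" "trg (assr X Y N) = X \<rhd> (Y \<rhd> N)"
  "src (assl X Y N) = X \<rhd> (Y \<rhd> N)" "trg (assl X Y N) = (X \<boxtimes> Y) \<rhd> N"
  by (simp_all add: assr_def assl_def)

lemma ass_cancel [simp]:
  assumes "X \<in> Ob B" "Y \<in> Ob B" "N \<in> Ob \<M>"
  shows "assr X Y N \<star> assl X Y N = aid (X \<rhd> (Y \<rhd> N))"
    and "assl X Y N \<star> assr X Y N = aid ((X \<boxtimes> Y) \<rhd> N)"
  using ass_iso[OF assms] assms
  by (simp_all add: assr_def assl_def aid_def inverse_pair_def acomp_def)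

lemma cancel_head:
  "\<lbrakk>q \<star> p = aid Y; is_arrow r; trg r = Y\<rbrakk> \<Longrightarrow> q \<star> (p \<star> r) = r"
  by (metis acomp_assoc aid_left)

lemma whisk_cancel:
  "\<lbrakk>q \<star> p = aid Y; is_arrow p; is_arrow q; src q = trg p; Y \<in> Ob \<M>; X \<in> Ob B\<rbrakk>
    \<Longrightarrow> (X |> q) \<star> (X |> p) = aid (X \<rhd> Y)"
  by (metis whisk_comp whisk_aid)

lemma ass_cancel_more [simp]:
  assumes "X \<in> Ob B" "Y \<in> Ob B" "N \<in> Ob \<M>"
  shows "\<lbrakk>is_arrow r; trg r = X \<rhd> (Y \<rhd> N)\<rbrakk> \<Longrightarrow> assr X Y N \<star> (assl X Y N \<star> r) = r"
    and "\<lbrakk>is_arrow r; trg r = (X \<boxtimes> Y) \<rhd> N\<rbrakk> \<Longrightarrow> assl X Y N \<star> (assr X Y N \<star> r) = r"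
    and "Z \<in> Ob B \<Longrightarrow> (Z |> assr X Y N) \<star> (Z |> assl X Y N) = aid (Z \<rhd> (X \<rhd> (Y \<rhd> N)))"
    and "Z \<in> Ob B \<Longrightarrow> (Z |> assl X Y N) \<star> (Z |> assr X Y N) = aid (Z \<rhd> ((X \<boxtimes> Y) \<rhd> N))"
    and "\<lbrakk>Z \<in> Ob B; is_arrow r; trg r = Z \<rhd> (X \<rhd> (Y \<rhd> N))\<rbrakk>
      \<Longrightarrow> (Z |> assr X Y N) \<star> ((Z |> assl X Y N) \<star> r) = r"
    and "\<lbrakk>Z \<in> Ob B; is_arrow r; trg r = Z \<rhd> ((X \<boxtimes> Y) \<rhd> N)\<rbrakk>
      \<Longrightarrow> (Z |> assl X Y N) \<star> ((Z |> assr X Y N) \<star> r) = r"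
  using assms by (simp_all add: cancel_head whisk_cancel)

lemma unt_iso:
  "N \<in> Ob \<M> \<Longrightarrow> inverse_pair \<M> (Unit B \<rhd> N) N (MUnit \<M> N) (Inv \<M> (Unit B \<rhd> N) N (MUnit \<M> N))"
  by (intro inverse_pair_Inv munit_iso) auto

lemma unt_arrow [simp]: "N \<in> Ob \<M> \<Longrightarrow> is_arrow (unt N)"
  and unt'_arrow [simp]: "N \<in> Ob \<M> \<Longrightarrow> is_arrow (unt' N)"
  using unt_iso[of N] by (simp_all add: unt_def unt'_def inverse_pair_def)

lemma unt_sel [simp]:
  "src (unt N) = Unit B \<rhd> N" "trg (unt N) = N" "src (unt' N) = N" "trg (unt' N) = Unit B \<rhd> N"
  by (simp_all add: unt_def unt'_def)

lemma unt_cancel [simp]: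
  assumes "N \<in> Ob \<M>"
  shows "unt N \<star> unt' N = aid N" "unt' N \<star> unt N = aid (Unit B \<rhd> N)"
  using unt_iso[OF assms] assms
  by (simp_all add: unt_def unt'_def aid_def inverse_pair_def acomp_def)

lemma unt_cancel_more [simp]:
  assumes "N \<in> Ob \<M>"
  shows "\<lbrakk>is_arrow r; trg r = N\<rbrakk> \<Longrightarrow> unt N \<star> (unt' N \<star> r) = r"
    and "\<lbrakk>is_arrow r; trg r = Unit B \<rhd> N\<rbrakk> \<Longrightarrow> unt' N \<star> (unt N \<star> r) = r"
    and "Z \<in> Ob B \<Longrightarrow> (Z |> unt N) \<star> (Z |> unt' N) = aid (Z \<rhd> N)"
    and "Z \<in> Ob B \<Longrightarrow> (Z |> unt' N) \<star> (Z |> unt N) = aid (Z \<rhd> (Unit B \<rhd> N))"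
    and "\<lbrakk>Z \<in> Ob B; is_arrow r; trg r = Z \<rhd> N\<rbrakk> \<Longrightarrow> (Z |> unt N) \<star> ((Z |> unt' N) \<star> r) = r"
    and "\<lbrakk>Z \<in> Ob B; is_arrow r; trg r = Z \<rhd> (Unit B \<rhd> N)\<rbrakk>
      \<Longrightarrow> (Z |> unt' N) \<star> ((Z |> unt N) \<star> r) = r"
  using assms by (simp_all add: cancel_head whisk_cancel)

lemma assr_whisk:
  assumes "X \<in> Ob B" "Y \<in> Ob B" "is_arrow p" "src p = M" "trg p = N"
  shows "assr X Y N \<star> ((X \<boxtimes> Y) |> p) = (X |> Y |> p) \<star> assr X Y M"
proof -
  have m: "mor p \<in> Hom \<M> M N" "M \<in> Ob \<M>" "N \<in> Ob \<M>"
    using assms is_arrowD by auto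
  show ?thesis
    using massoc_nat[of X X Y Y M N "Ident B X" "Ident B Y" "mor p"] assms m
    by (intro arrow_eqI)
      (simp_all add: mor_acomp mor_simps B.tensor_ident)
qed

lemma assr_cell:
  assumes "X \<in> Ob B" "Y \<in> Ob B" "X' \<in> Ob B" "Y' \<in> Ob B" "f \<in> Hom B X X'" "g \<in> Hom B Y Y'"
    "N \<in> Ob \<M>"
  shows "assr X' Y' N \<star> cell (X \<boxtimes> Y) (f \<boxdot> g) (X' \<boxtimes> Y') N =
    cell X f X' (Y' \<rhd> N) \<star> (X |> cell Y g Y' N) \<star> assr X Y N"
proof -
  have "f \<bullet> (g \<bullet> Ident \<M> N) = (f \<bullet> Ident \<M> (Y' \<rhd> N)) \<cdot> (Ident B X \<bullet> (g \<bullet> Ident \<M> N))"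
    using act_comp[of X X X' "Y \<rhd> N" "Y' \<rhd> N" "Y' \<rhd> N" "Ident B X" f "g \<bullet> Ident \<M> N"
        "Ident \<M> (Y' \<rhd> N)"] assms act_hom[of Y Y' N N g "Ident \<M> N"]
      B.ident_right[of X X' f] ident_left[of "Y \<rhd> N" "Y' \<rhd> N"] by simp
  then have "arrow (X \<rhd> Y \<rhd> N) (f \<bullet> (g \<bullet> Ident \<M> N)) (X' \<rhd> Y' \<rhd> N) =
      cell X f X' (Y' \<rhd> N) \<star> (X |> cell Y g Y' N)"
    using assms act_hom[of X X' "Y \<rhd> N" "Y' \<rhd> N" f "g \<bullet> Ident \<M> N"]
    by (intro arrow_eqI) (simp_all add: mor_acomp mor_simps act_hom)
  moreover have "assr X' Y' N \<star> cell (X \<boxtimes> Y) (f \<boxdot> g) (X' \<boxtimes> Y') N =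
      arrow (X \<rhd> Y \<rhd> N) (f \<bullet> (g \<bullet> Ident \<M> N)) (X' \<rhd> Y' \<rhd> N) \<star> assr X Y N"
    using massoc_nat[of X X' Y Y' N N f g "Ident \<M> N"] assms B.tensor_hom[of X Y X' Y' f g]
    by (intro arrow_eqI) (simp_all add: mor_acomp mor_simps act_hom)
  ultimately show ?thesis
    by simp
qed

lemma cell_tensor:
  assumes "X \<in> Ob B" "Y \<in> Ob B" "X' \<in> Ob B" "Y' \<in> Ob B" "f \<in> Hom B X X'" "g \<in> Hom B Y Y'"
    "N \<in> Ob \<M>"
  shows "cell (X \<boxtimes> Y) (f \<boxdot> g) (X' \<boxtimes> Y') N =
    assl X' Y' N \<star> cell X f X' (Y' \<rhd> N) \<star> (X |> cell Y g Y' N) \<star> assr X Y N"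
  using assms assr_cell[OF assms] B.tensor_hom[of X Y X' Y' f g]
  by (metis ass_cancel_more(2) cell_arrow cell_sel(2) B.tensor_ob)

lemma unt_nat:
  assumes "is_arrow p" "src p = M" "trg p = N"
  shows "unt N \<star> (Unit B |> p) = p \<star> unt M"
  using munit_nat[of M N "mor p"] is_arrowD[of p] assms
  by (intro arrow_eqI) (auto simp: mor_acomp mor_simps)

lemma assl_whisk:
  assumes "X \<in> Ob B" "Y \<in> Ob B" "is_arrow p" "src p = M" "trg p = N"
  shows "assl X Y N \<star> (X |> Y |> p) = ((X \<boxtimes> Y) |> p) \<star> assl X Y M"
proof -
  have "assl X Y N \<star> (X |> Y |> p) = assl X Y N \<star> ((X |> Y |> p) \<star> assr X Y M) \<star> assl X Y M"
    using assms by auto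
  also have "\<dots> = assl X Y N \<star> (assr X Y N \<star> ((X \<boxtimes> Y) |> p)) \<star> assl X Y M"
    using assr_whisk[OF assms] by simp
  also have "\<dots> = ((X \<boxtimes> Y) |> p) \<star> assl X Y M"
    using assms by auto
  finally show ?thesis .
qed

text \<open>
  The pentagon, read as: the associator acts as the identity after both bracketings of \<open>X\<close>, \<open>Y\<close>, \<open>Z\<close> are
  expanded to iterated actions.
\<close>
lemma cell_assoc:
  assumes "X \<in> Ob B" "Y \<in> Ob B" "Z \<in> Ob B" "N \<in> Ob \<M>"
  shows "cell ((X \<boxtimes> Y) \<boxtimes> Z) (Assoc B X Y Z) (X \<boxtimes> (Y \<boxtimes> Z)) N =
    assl X (Y \<boxtimes> Z) N \<star> (X |> assl Y Z N) \<star> assr X Y (Z \<rhd> N) \<star> assr (X \<boxtimes> Y) Z N"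
    (is "?c = ?r")
proof -
  have h: "Assoc B X Y Z \<in> Hom B ((X \<boxtimes> Y) \<boxtimes> Z) (X \<boxtimes> (Y \<boxtimes> Z))"
    using B.assoc_iso[of X Y Z] assms by (auto simp: is_iso_def inverse_pair_def)
  have "assr X Y (Z \<rhd> N) \<star> assr (X \<boxtimes> Y) Z N =
      (X |> assr Y Z N) \<star> assr X (Y \<boxtimes> Z) N \<star> ?c"
    using mpentagon[of X Y Z N] assms h
    by (intro arrow_eqI) (simp_all add: mor_acomp mor_simps)
  then show ?thesis
    using assms h by simp
qed

lemma cell_inverse:
  assumes "X \<in> Ob B" "Y \<in> Ob B" "inverse_pair B X Y f g" "N \<in> Ob \<M>"
  shows "cell Y g X N \<star> cell X f Y N = aid (X \<rhd> N)"
  using assms cell_comp[of X Y X f g N] by (simp add: inverse_pair_def)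

lemma cell_inv_assoc:
  assumes "X \<in> Ob B" "Y \<in> Ob B" "Z \<in> Ob B" "N \<in> Ob \<M>"
  shows "cell (X \<boxtimes> (Y \<boxtimes> Z)) (InvAssoc B X Y Z) ((X \<boxtimes> Y) \<boxtimes> Z) N =
    assl (X \<boxtimes> Y) Z N \<star> assl X Y (Z \<rhd> N) \<star> (X |> assr Y Z N) \<star> assr X (Y \<boxtimes> Z) N"
    (is "?c = ?r")
proof -
  have i: "inverse_pair B ((X \<boxtimes> Y) \<boxtimes> Z) (X \<boxtimes> (Y \<boxtimes> Z)) (Assoc B X Y Z) (InvAssoc B X Y Z)"
    using assms by (intro B.inverse_pair_Inv B.assoc_iso) auto
  then have h: "InvAssoc B X Y Z \<in> Hom B (X \<boxtimes> (Y \<boxtimes> Z)) ((X \<boxtimes> Y) \<boxtimes> Z)"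
    by (simp add: inverse_pair_def)
  have "?c = ?c \<star> cell ((X \<boxtimes> Y) \<boxtimes> Z) (Assoc B X Y Z) (X \<boxtimes> (Y \<boxtimes> Z)) N \<star> ?r"
    using assms h by (simp add: cell_assoc)
  also have "\<dots> = ?r"
    using assms cell_inverse[OF _ _ i, of N] by (intro cancel_head) auto
  finally show ?thesis .
qed

lemma cell_runit:
  assumes "X \<in> Ob B" "N \<in> Ob \<M>"
  shows "cell (X \<boxtimes> Unit B) (RUnit B X) X N = (X |> unt N) \<star> assr X (Unit B) N"
proof -
  have "RUnit B X \<in> Hom B (X \<boxtimes> Unit B) X"
    using B.runit_iso[of X] assms by (auto simp: is_iso_def inverse_pair_def)
  then show ?thesis
    using mtriangle[of X N] assms
    by (intro arrow_eqI) (simp_all add: mor_acomp mor_simps)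
qed

text \<open>
  Only the triangle for the right unit is an axiom.  The one for the left unit holds after whiskering
  with the unit object, by the pentagon and the triangle of the monoidal category, and whiskering with
  the unit object is faithful.
\<close>
lemma cell_lunit:
  assumes "X \<in> Ob B" "N \<in> Ob \<M>"
  shows "cell (Unit B \<boxtimes> X) (LUnit B X) X N = unt (X \<rhd> N) \<star> assr (Unit B) X N"
proof -
  let ?I = "Unit B"
  have h: "LUnit B X \<in> Hom B (?I \<boxtimes> X) X" "RUnit B ?I \<in> Hom B (?I \<boxtimes> ?I) ?I"
    "Assoc B ?I ?I X \<in> Hom B ((?I \<boxtimes> ?I) \<boxtimes> X) (?I \<boxtimes> (?I \<boxtimes> X))"
    using B.lunit_iso[of X] B.runit_iso[of ?I] B.assoc_iso[of ?I ?I X] assms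
    by (auto simp: is_iso_def inverse_pair_def)
  let ?c = "cell (?I \<boxtimes> X) (LUnit B X) X N" and ?r = "unt (X \<rhd> N) \<star> assr ?I X N"
  have "cell ((?I \<boxtimes> ?I) \<boxtimes> X) (RUnit B ?I \<boxdot> Ident B X) (?I \<boxtimes> X) N =
      cell (?I \<boxtimes> (?I \<boxtimes> X)) (Ident B ?I \<boxdot> LUnit B X) (?I \<boxtimes> X) N \<star>
      cell ((?I \<boxtimes> ?I) \<boxtimes> X) (Assoc B ?I ?I X) (?I \<boxtimes> (?I \<boxtimes> X)) N"
    using B.triangle[of ?I X] assms h
      cell_comp[of "(?I \<boxtimes> ?I) \<boxtimes> X" "?I \<boxtimes> (?I \<boxtimes> X)" "?I \<boxtimes> X"
        "Assoc B ?I ?I X" "Ident B ?I \<boxdot> LUnit B X" N] B.tensor_hom by simp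
  then have "assr ?I X N \<star> (assl ?I X N \<star> (?I |> unt (X \<rhd> N)) \<star> assr ?I ?I (X \<rhd> N) \<star> assr (?I \<boxtimes> ?I) X N) =
      assr ?I X N \<star> (assl ?I X N \<star> (?I |> ?c) \<star> (?I |> assl ?I X N) \<star> assr ?I ?I (X \<rhd> N) \<star> assr (?I \<boxtimes> ?I) X N)"
    using assms h by (simp add: cell_tensor cell_runit cell_assoc)
  then have "(?I |> unt (X \<rhd> N)) \<star> assr ?I ?I (X \<rhd> N) \<star> assr (?I \<boxtimes> ?I) X N =
      (?I |> ?c) \<star> (?I |> assl ?I X N) \<star> assr ?I ?I (X \<rhd> N) \<star> assr (?I \<boxtimes> ?I) X N" (is "?u = ?v")
    using assms h by simp
  then have "?u \<star> assl (?I \<boxtimes> ?I) X N \<star> assl ?I ?I (X \<rhd> N) = ?v \<star> assl (?I \<boxtimes> ?I) X N \<star> assl ?I ?I (X \<rhd> N)"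
    by simp
  then have "?I |> unt (X \<rhd> N) = (?I |> ?c) \<star> (?I |> assl ?I X N)"
    using assms h by simp
  then have "unt (X \<rhd> N) \<star> (?I |> unt (X \<rhd> N)) = unt (X \<rhd> N) \<star> (?I |> (?c \<star> assl ?I X N))"
    using assms h by simp
  then have "unt (X \<rhd> N) \<star> unt (?I \<rhd> (X \<rhd> N)) = (?c \<star> assl ?I X N) \<star> unt (?I \<rhd> (X \<rhd> N))"
    using assms h by (simp add: unt_nat acomp_head[OF unt_nat])
  then have "(unt (X \<rhd> N) \<star> unt (?I \<rhd> (X \<rhd> N))) \<star> unt' (?I \<rhd> (X \<rhd> N)) \<star> assr ?I X N =
      ((?c \<star> assl ?I X N) \<star> unt (?I \<rhd> (X \<rhd> N))) \<star> unt' (?I \<rhd> (X \<rhd> N)) \<star> assr ?I X N"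
    by simp
  then show ?thesis
    using assms h by simp
qed

end

section \<open>The braiding and the twist on iterated actions\<close>

locale braided_action = braided_module B \<M> E + B: braided_category B
  for B :: "('o, 'm, 'k::{alg_closed_field, field_char_0}) br_cat"
    and \<M> :: "('p, 'q, 'k, 'o, 'm) mod_cat" (structure)
    and E :: "'o \<Rightarrow> 'p \<Rightarrow> 'q"
begin

notation acomp (infixr "\<star>" 70)
notation whisk (infixr "|>" 80)
notation tensor_B (infixr "\<boxtimes>" 80)
notation tensor_hom_B (infixr "\<boxdot>" 80)

text \<open>
  The braiding \<open>X \<rhd> Y \<rhd> N \<rightarrow> Y \<rhd> X \<rhd> N\<close>.
\<close>
definition braid :: "'o \<Rightarrow> 'o \<Rightarrow> 'p \<Rightarrow> ('p, 'q) arrow" where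
  "braid X Y N = assr Y X N \<star> cell (X \<boxtimes> Y) (Braid B X Y) (Y \<boxtimes> X) N \<star> assl X Y N"

text \<open>
  Also an arrow \<open>X \<rhd> Y \<rhd> N \<rightarrow> Y \<rhd> X \<rhd> N\<close>; it is inverse to \<open>braid Y X N\<close>.
\<close>
definition inv_braid :: "'o \<Rightarrow> 'o \<Rightarrow> 'p \<Rightarrow> ('p, 'q) arrow" where
  "inv_braid X Y N = assr Y X N \<star> cell (X \<boxtimes> Y) (InvBraid B X Y) (Y \<boxtimes> X) N \<star> assl X Y N"

definition Ea :: "'o \<Rightarrow> 'p \<Rightarrow> ('p, 'q) arrow" where
  "Ea X N = arrow (X \<rhd> N) (E X N) (X \<rhd> N)"

lemma braid_inverse:
  "\<lbrakk>X \<in> Ob B; Y \<in> Ob B\<rbrakk>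
    \<Longrightarrow> inverse_pair B (X \<boxtimes> Y) (Y \<boxtimes> X) (Braid B X Y) (InvBraid B Y X)"
  by (intro B.inverse_pair_Inv B.braid_iso) auto

lemma braid_hom [simp]:
  "\<lbrakk>X \<in> Ob B; Y \<in> Ob B\<rbrakk> \<Longrightarrow> Braid B X Y \<in> Hom B (X \<boxtimes> Y) (Y \<boxtimes> X)"
  "\<lbrakk>X \<in> Ob B; Y \<in> Ob B\<rbrakk> \<Longrightarrow> InvBraid B X Y \<in> Hom B (X \<boxtimes> Y) (Y \<boxtimes> X)"
  using braid_inverse[of X Y] braid_inverse[of Y X] by (auto simp: inverse_pair_def)

lemma braid_arrow [simp]:
  "\<lbrakk>X \<in> Ob B; Y \<in> Ob B; N \<in> Ob \<M>\<rbrakk> \<Longrightarrow> is_arrow (braid X Y N)"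
  "\<lbrakk>X \<in> Ob B; Y \<in> Ob B; N \<in> Ob \<M>\<rbrakk> \<Longrightarrow> is_arrow (inv_braid X Y N)"
  by (simp_all add: braid_def inv_braid_def)

lemma braid_sel [simp]:
  assumes "X \<in> Ob B" "Y \<in> Ob B" "N \<in> Ob \<M>"
  shows "src (braid X Y N) = X \<rhd> Y \<rhd> N" "trg (braid X Y N) = Y \<rhd> X \<rhd> N"
    "src (inv_braid X Y N) = X \<rhd> Y \<rhd> N" "trg (inv_braid X Y N) = Y \<rhd> X \<rhd> N"
  using assms by (simp_all add: braid_def inv_braid_def)

lemma braid_cancel [simp]:
  assumes "X \<in> Ob B" "Y \<in> Ob B" "N \<in> Ob \<M>"
  shows "inv_braid X Y N \<star> braid Y X N = aid (Y \<rhd> X \<rhd> N)"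
    and "braid X Y N \<star> inv_braid Y X N = aid (Y \<rhd> X \<rhd> N)"
proof -
  have i: "inverse_pair B (Y \<boxtimes> X) (X \<boxtimes> Y) (InvBraid B Y X) (Braid B X Y)"
    using braid_inverse[of X Y] assms by (simp add: inverse_pair_def)
  show "inv_braid X Y N \<star> braid Y X N = aid (Y \<rhd> X \<rhd> N)"
    using assms cell_inverse[OF _ _ braid_inverse[of Y X], of N]
    by (simp add: braid_def inv_braid_def cancel_head)
  show "braid X Y N \<star> inv_braid Y X N = aid (Y \<rhd> X \<rhd> N)"
    using assms cell_inverse[OF _ _ i, of N]
    by (simp add: braid_def inv_braid_def cancel_head)
qed

lemma braid_cancel_more [simp]:
  assumes "X \<in> Ob B" "Y \<in> Ob B" "N \<in> Ob \<M>"
  shows "\<lbrakk>is_arrow r; trg r = Y \<rhd> X \<rhd> N\<rbrakk> \<Longrightarrow> inv_braid X Y N \<star> braid Y X N \<star> r = r"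
    and "\<lbrakk>is_arrow r; trg r = Y \<rhd> X \<rhd> N\<rbrakk> \<Longrightarrow> braid X Y N \<star> inv_braid Y X N \<star> r = r"
    and "Z \<in> Ob B \<Longrightarrow> (Z |> braid X Y N) \<star> (Z |> inv_braid Y X N) = aid (Z \<rhd> Y \<rhd> X \<rhd> N)"
    and "\<lbrakk>Z \<in> Ob B; is_arrow r; trg r = Z \<rhd> Y \<rhd> X \<rhd> N\<rbrakk>
      \<Longrightarrow> (Z |> braid X Y N) \<star> (Z |> inv_braid Y X N) \<star> r = r"
  using assms by (simp_all add: cancel_head whisk_cancel)

lemma braid_whisk:
  assumes "X \<in> Ob B" "Y \<in> Ob B" "is_arrow p" "src p = M" "trg p = N"
  shows "braid X Y N \<star> (X |> Y |> p) = (Y |> X |> p) \<star> braid X Y M"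
  using assms is_arrowD(1,2)[of p]
  by (simp add: braid_def assl_whisk acomp_head[OF cell_nat, of "X \<boxtimes> Y" "Y \<boxtimes> X" _ p M N]
      acomp_head[OF assr_whisk, of Y X p M N])

lemma assl_cell:
  assumes "X \<in> Ob B" "Y \<in> Ob B" "X' \<in> Ob B" "Y' \<in> Ob B" "f \<in> Hom B X X'" "g \<in> Hom B Y Y'"
    "N \<in> Ob \<M>"
  shows "assl X' Y' N \<star> cell X f X' (Y' \<rhd> N) \<star> (X |> cell Y g Y' N) =
    cell (X \<boxtimes> Y) (f \<boxdot> g) (X' \<boxtimes> Y') N \<star> assl X Y N"
  using assms by (simp add: cell_tensor)

lemma braid_cell:
  assumes "X \<in> Ob B" "Y \<in> Ob B" "X' \<in> Ob B" "Y' \<in> Ob B" "f \<in> Hom B X X'" "g \<in> Hom B Y Y'"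
    "N \<in> Ob \<M>"
  shows "braid X' Y' N \<star> cell X f X' (Y' \<rhd> N) \<star> (X |> cell Y g Y' N) =
    cell Y g Y' (X' \<rhd> N) \<star> (Y |> cell X f X' N) \<star> braid X Y N"
proof -
  have t: "f \<boxdot> g \<in> Hom B (X \<boxtimes> Y) (X' \<boxtimes> Y')" "g \<boxdot> f \<in> Hom B (Y \<boxtimes> X) (Y' \<boxtimes> X')"
    using assms B.tensor_hom by auto
  let ?b = "cell (X \<boxtimes> Y) (Braid B X Y) (Y \<boxtimes> X) N"
    and ?b' = "cell (X' \<boxtimes> Y') (Braid B X' Y') (Y' \<boxtimes> X') N"
    and ?fg = "cell (X \<boxtimes> Y) (f \<boxdot> g) (X' \<boxtimes> Y') N"
    and ?gf = "cell (Y \<boxtimes> X) (g \<boxdot> f) (Y' \<boxtimes> X') N"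
  have nat: "?b' \<star> ?fg = ?gf \<star> ?b"
    using cell_comp[of "X \<boxtimes> Y" "X' \<boxtimes> Y'" "Y' \<boxtimes> X'" "f \<boxdot> g" "Braid B X' Y'" N]
      cell_comp[of "X \<boxtimes> Y" "Y \<boxtimes> X" "Y' \<boxtimes> X'" "Braid B X Y" "g \<boxdot> f" N]
      B.braid_nat[of X Y X' Y' f g] assms t by simp
  have "braid X' Y' N \<star> cell X f X' (Y' \<rhd> N) \<star> (X |> cell Y g Y' N) =
      assr Y' X' N \<star> ?b' \<star> ?fg \<star> assl X Y N"
    using assms by (simp add: braid_def assl_cell)
  also have "\<dots> = (assr Y' X' N \<star> ?gf) \<star> ?b \<star> assl X Y N"
    by (simp add: acomp_head[OF nat])
  also have "\<dots> = cell Y g Y' (X' \<rhd> N) \<star> (Y |> cell X f X' N) \<star> braid X Y N"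
    using assms by (simp add: assr_cell braid_def)
  finally show ?thesis .
qed

lemma braid_cell_left:
  assumes "X \<in> Ob B" "Y \<in> Ob B" "X' \<in> Ob B" "f \<in> Hom B X X'" "N \<in> Ob \<M>"
  shows "braid X' Y N \<star> cell X f X' (Y \<rhd> N) = (Y |> cell X f X' N) \<star> braid X Y N"
  using assms braid_cell[of X Y X' Y f "Ident B Y" N] by simp

lemma braid_cell_right:
  assumes "X \<in> Ob B" "Y \<in> Ob B" "Y' \<in> Ob B" "g \<in> Hom B Y Y'" "N \<in> Ob \<M>"
  shows "braid X Y' N \<star> (X |> cell Y g Y' N) = cell Y g Y' (X \<rhd> N) \<star> braid X Y N"
  using assms braid_cell[of X Y X Y' "Ident B X" g N] by simp

lemma assoc_hom [simp]:
  assumes "X \<in> Ob B" "Y \<in> Ob B" "Z \<in> Ob B"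
  shows "Assoc B X Y Z \<in> Hom B ((X \<boxtimes> Y) \<boxtimes> Z) (X \<boxtimes> (Y \<boxtimes> Z))"
    and "InvAssoc B X Y Z \<in> Hom B (X \<boxtimes> (Y \<boxtimes> Z)) ((X \<boxtimes> Y) \<boxtimes> Z)"
  using B.inverse_pair_Inv[OF _ _ B.assoc_iso[OF assms]] assms by (auto simp: inverse_pair_def)

lemma unit_hom [simp]:
  assumes "X \<in> Ob B"
  shows "LUnit B X \<in> Hom B (Unit B \<boxtimes> X) X" "InvLUnit B X \<in> Hom B X (Unit B \<boxtimes> X)"
    "RUnit B X \<in> Hom B (X \<boxtimes> Unit B) X" "InvRUnit B X \<in> Hom B X (X \<boxtimes> Unit B)"
  using B.inverse_pair_Inv[OF _ _ B.lunit_iso[OF assms]]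
    B.inverse_pair_Inv[OF _ _ B.runit_iso[OF assms]] assms by (auto simp: inverse_pair_def)

text \<open>
  After conjugation with the associators of the action, each hexagon says that the braiding with a
  tensor product is done in two steps.
\<close>
lemma braid_hexagon_right:
  assumes "X \<in> Ob B" "Y \<in> Ob B" "Z \<in> Ob B" "N \<in> Ob \<M>"
  shows "assr Y Z (X \<rhd> N) \<star> braid X (Y \<boxtimes> Z) N =
    (Y |> braid X Z N) \<star> braid X Y (Z \<rhd> N) \<star> (X |> assr Y Z N)"
proof -
  let ?h = "cell (X \<boxtimes> (Y \<boxtimes> Z)) (Braid B X (Y \<boxtimes> Z)) ((Y \<boxtimes> Z) \<boxtimes> X) N"
  let ?S = "(X \<boxtimes> Y) \<boxtimes> Z"
  have t: "Ident B Y \<boxdot> Braid B X Z \<in> Hom B (Y \<boxtimes> (X \<boxtimes> Z)) (Y \<boxtimes> (Z \<boxtimes> X))"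
    "Braid B X Y \<boxdot> Ident B Z \<in> Hom B ?S ((Y \<boxtimes> X) \<boxtimes> Z)"
    using assms B.tensor_hom by auto
  have c: "Braid B X (Y \<boxtimes> Z) \<cdot>\<^bsub>B\<^esub> Assoc B X Y Z \<in> Hom B ?S ((Y \<boxtimes> Z) \<boxtimes> X)"
    "Assoc B Y X Z \<cdot>\<^bsub>B\<^esub> (Braid B X Y \<boxdot> Ident B Z) \<in> Hom B ?S (Y \<boxtimes> (X \<boxtimes> Z))"
    using assms t B.comp_hom[of ?S "X \<boxtimes> (Y \<boxtimes> Z)" "(Y \<boxtimes> Z) \<boxtimes> X"]
      B.comp_hom[of ?S "(Y \<boxtimes> X) \<boxtimes> Z" "Y \<boxtimes> (X \<boxtimes> Z)"] by simp_all
  have "cell ((Y \<boxtimes> Z) \<boxtimes> X) (Assoc B Y Z X) (Y \<boxtimes> (Z \<boxtimes> X)) N \<star> ?h \<star>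
      cell ?S (Assoc B X Y Z) (X \<boxtimes> (Y \<boxtimes> Z)) N =
    cell (Y \<boxtimes> (X \<boxtimes> Z)) (Ident B Y \<boxdot> Braid B X Z) (Y \<boxtimes> (Z \<boxtimes> X)) N \<star>
      cell ((Y \<boxtimes> X) \<boxtimes> Z) (Assoc B Y X Z) (Y \<boxtimes> (X \<boxtimes> Z)) N \<star>
      cell ?S (Braid B X Y \<boxdot> Ident B Z) ((Y \<boxtimes> X) \<boxtimes> Z) N"
    using arg_cong[OF B.hexagon_right[of X Y Z], of "\<lambda>f. cell ?S f (Y \<boxtimes> (Z \<boxtimes> X)) N"] assms t c
    by (simp add: cell_comp[of ?S "(Y \<boxtimes> Z) \<boxtimes> X" "Y \<boxtimes> (Z \<boxtimes> X)"]
      cell_comp[of ?S "X \<boxtimes> (Y \<boxtimes> Z)" "(Y \<boxtimes> Z) \<boxtimes> X"]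
      cell_comp[of ?S "Y \<boxtimes> (X \<boxtimes> Z)" "Y \<boxtimes> (Z \<boxtimes> X)"]
      cell_comp[of ?S "(Y \<boxtimes> X) \<boxtimes> Z" "Y \<boxtimes> (X \<boxtimes> Z)"])
  then have "(Y |> assr Z X N) \<star> (assr Y (Z \<boxtimes> X) N \<star>
      (cell ((Y \<boxtimes> Z) \<boxtimes> X) (Assoc B Y Z X) (Y \<boxtimes> (Z \<boxtimes> X)) N \<star> ?h \<star>
      cell ?S (Assoc B X Y Z) (X \<boxtimes> (Y \<boxtimes> Z)) N)) \<star> assl (X \<boxtimes> Y) Z N \<star> assl X Y (Z \<rhd> N) =
    (Y |> assr Z X N) \<star> (assr Y (Z \<boxtimes> X) N \<star>
    (cell (Y \<boxtimes> (X \<boxtimes> Z)) (Ident B Y \<boxdot> Braid B X Z) (Y \<boxtimes> (Z \<boxtimes> X)) N \<star>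
      cell ((Y \<boxtimes> X) \<boxtimes> Z) (Assoc B Y X Z) (Y \<boxtimes> (X \<boxtimes> Z)) N \<star>
      cell ?S (Braid B X Y \<boxdot> Ident B Z) ((Y \<boxtimes> X) \<boxtimes> Z) N)) \<star> assl (X \<boxtimes> Y) Z N \<star> assl X Y (Z \<rhd> N)"
    by simp
  then have "(assr Y Z (X \<rhd> N) \<star> braid X (Y \<boxtimes> Z) N) \<star> (X |> assl Y Z N) =
    (Y |> braid X Z N) \<star> braid X Y (Z \<rhd> N)"
    using assms t by (simp add: braid_def cell_assoc cell_tensor)
  then have "((assr Y Z (X \<rhd> N) \<star> braid X (Y \<boxtimes> Z) N) \<star> (X |> assl Y Z N)) \<star> (X |> assr Y Z N) =
    ((Y |> braid X Z N) \<star> braid X Y (Z \<rhd> N)) \<star> (X |> assr Y Z N)"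
    by simp
  then show ?thesis
    using assms by simp
qed

lemma braid_hexagon_left:
  assumes "X \<in> Ob B" "Y \<in> Ob B" "Z \<in> Ob B" "N \<in> Ob \<M>"
  shows "(Z |> assr X Y N) \<star> braid (X \<boxtimes> Y) Z N =
    braid X Z (Y \<rhd> N) \<star> (X |> braid Y Z N) \<star> assr X Y (Z \<rhd> N)"
proof -
  let ?h = "cell ((X \<boxtimes> Y) \<boxtimes> Z) (Braid B (X \<boxtimes> Y) Z) (Z \<boxtimes> (X \<boxtimes> Y)) N"
  let ?S = "X \<boxtimes> (Y \<boxtimes> Z)" and ?T = "(Z \<boxtimes> X) \<boxtimes> Y"
  have t: "Braid B X Z \<boxdot> Ident B Y \<in> Hom B ((X \<boxtimes> Z) \<boxtimes> Y) ?T"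
    "Ident B X \<boxdot> Braid B Y Z \<in> Hom B ?S (X \<boxtimes> (Z \<boxtimes> Y))"
    using assms B.tensor_hom by auto
  have c: "Braid B (X \<boxtimes> Y) Z \<cdot>\<^bsub>B\<^esub> InvAssoc B X Y Z \<in> Hom B ?S (Z \<boxtimes> (X \<boxtimes> Y))"
    "InvAssoc B X Z Y \<cdot>\<^bsub>B\<^esub> (Ident B X \<boxdot> Braid B Y Z) \<in> Hom B ?S ((X \<boxtimes> Z) \<boxtimes> Y)"
    using assms t B.comp_hom[of ?S "(X \<boxtimes> Y) \<boxtimes> Z" "Z \<boxtimes> (X \<boxtimes> Y)"]
      B.comp_hom[of ?S "X \<boxtimes> (Z \<boxtimes> Y)" "(X \<boxtimes> Z) \<boxtimes> Y"] by simp_all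
  have "cell (Z \<boxtimes> (X \<boxtimes> Y)) (InvAssoc B Z X Y) ?T N \<star> ?h \<star>
      cell ?S (InvAssoc B X Y Z) ((X \<boxtimes> Y) \<boxtimes> Z) N =
    cell ((X \<boxtimes> Z) \<boxtimes> Y) (Braid B X Z \<boxdot> Ident B Y) ?T N \<star>
      cell (X \<boxtimes> (Z \<boxtimes> Y)) (InvAssoc B X Z Y) ((X \<boxtimes> Z) \<boxtimes> Y) N \<star>
      cell ?S (Ident B X \<boxdot> Braid B Y Z) (X \<boxtimes> (Z \<boxtimes> Y)) N"
    using arg_cong[OF B.hexagon_left[of X Y Z], of "\<lambda>f. cell ?S f ?T N"] assms t c
    by (simp add: cell_comp[of ?S "Z \<boxtimes> (X \<boxtimes> Y)" ?T]
      cell_comp[of ?S "(X \<boxtimes> Y) \<boxtimes> Z" "Z \<boxtimes> (X \<boxtimes> Y)"]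
      cell_comp[of ?S "(X \<boxtimes> Z) \<boxtimes> Y" ?T]
      cell_comp[of ?S "X \<boxtimes> (Z \<boxtimes> Y)" "(X \<boxtimes> Z) \<boxtimes> Y"])
  then have "assr Z X (Y \<rhd> N) \<star> (assr (Z \<boxtimes> X) Y N \<star>
      (cell (Z \<boxtimes> (X \<boxtimes> Y)) (InvAssoc B Z X Y) ?T N \<star> ?h \<star>
      cell ?S (InvAssoc B X Y Z) ((X \<boxtimes> Y) \<boxtimes> Z) N)) \<star> assl X (Y \<boxtimes> Z) N \<star> (X |> assl Y Z N) =
    assr Z X (Y \<rhd> N) \<star> (assr (Z \<boxtimes> X) Y N \<star>
    (cell ((X \<boxtimes> Z) \<boxtimes> Y) (Braid B X Z \<boxdot> Ident B Y) ?T N \<star>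
      cell (X \<boxtimes> (Z \<boxtimes> Y)) (InvAssoc B X Z Y) ((X \<boxtimes> Z) \<boxtimes> Y) N \<star>
      cell ?S (Ident B X \<boxdot> Braid B Y Z) (X \<boxtimes> (Z \<boxtimes> Y)) N)) \<star> assl X (Y \<boxtimes> Z) N \<star> (X |> assl Y Z N)"
    by simp
  then have "((Z |> assr X Y N) \<star> braid (X \<boxtimes> Y) Z N) \<star> assl X Y (Z \<rhd> N) =
    braid X Z (Y \<rhd> N) \<star> (X |> braid Y Z N)"
    using assms t by (simp add: braid_def cell_inv_assoc cell_tensor)
  then have "(((Z |> assr X Y N) \<star> braid (X \<boxtimes> Y) Z N) \<star> assl X Y (Z \<rhd> N)) \<star> assr X Y (Z \<rhd> N) =
    (braid X Z (Y \<rhd> N) \<star> (X |> braid Y Z N)) \<star> assr X Y (Z \<rhd> N)"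
    by simp
  then show ?thesis
    using assms by simp
qed

lemma cancel_right:
  assumes "q \<star> p = q' \<star> p" "p \<star> r = aid Y" "is_arrow q" "is_arrow q'" "src q = Y" "src q' = Y"
  shows "q = q'"
  using assms by (metis acomp_assoc aid_right)

lemma cancel_left:
  assumes "p \<star> q = p \<star> q'" "r \<star> p = aid Y" "is_arrow q" "is_arrow q'" "trg q = Y" "trg q' = Y"
  shows "q = q'"
  using assms by (metis acomp_assoc aid_left)

lemma unt_cancel_whisk2:
  "\<lbrakk>X \<in> Ob B; Y \<in> Ob B; N \<in> Ob \<M>\<rbrakk> \<Longrightarrow> (X |> Y |> unt N) \<star> (X |> Y |> unt' N) = aid (X \<rhd> Y \<rhd> N)"
  by (intro whisk_cancel) auto

lemma unt_twice: "N \<in> Ob \<M> \<Longrightarrow> unt (Unit B \<rhd> N) = Unit B |> unt N"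
  by (rule cancel_left[of "unt N" _ _ "unt' N"]) (auto simp: unt_nat)

text \<open>
  The braiding with the unit object: applying the hexagon to \<open>I \<otimes> I \<cong> I\<close> shows that the braiding with
  \<open>I\<close>, up to unit constraints, is an idempotent, and it is invertible.
\<close>
lemma braid_unit_left:
  assumes "Z \<in> Ob B" "N \<in> Ob \<M>"
  shows "(Z |> unt N) \<star> braid (Unit B) Z N = unt (Z \<rhd> N)"
proof -
  let ?I = "Unit B"
  have 1: "unt (Z \<rhd> ?I \<rhd> N) = (Z |> unt (?I \<rhd> N)) \<star> braid ?I Z (?I \<rhd> N)"
  proof (rule cancel_right[of _ "?I |> braid ?I Z N" _ "?I |> inv_braid Z ?I N" "?I \<rhd> Z \<rhd> ?I \<rhd> N"])
    have "braid ?I Z N \<star> cell (?I \<boxtimes> ?I) (LUnit B ?I) ?I (Z \<rhd> N) =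
      (Z |> cell (?I \<boxtimes> ?I) (LUnit B ?I) ?I N) \<star> braid (?I \<boxtimes> ?I) Z N"
      using assms by (intro braid_cell_left) auto
    then have "(braid ?I Z N \<star> unt (?I \<rhd> Z \<rhd> N)) \<star> assr ?I ?I (Z \<rhd> N) =
      ((Z |> unt (?I \<rhd> N)) \<star> braid ?I Z (?I \<rhd> N) \<star> (?I |> braid ?I Z N)) \<star> assr ?I ?I (Z \<rhd> N)"
      using assms by (simp add: cell_lunit braid_hexagon_left)
    then have "braid ?I Z N \<star> unt (?I \<rhd> Z \<rhd> N) = (Z |> unt (?I \<rhd> N)) \<star> braid ?I Z (?I \<rhd> N) \<star> (?I |> braid ?I Z N)"
      by (rule cancel_right[of _ _ _ "assl ?I ?I (Z \<rhd> N)" "?I \<rhd> ?I \<rhd> Z \<rhd> N"]) (use assms in auto)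
    then show "unt (Z \<rhd> ?I \<rhd> N) \<star> (?I |> braid ?I Z N) =
        ((Z |> unt (?I \<rhd> N)) \<star> braid ?I Z (?I \<rhd> N)) \<star> (?I |> braid ?I Z N)"
      using assms by (simp add: unt_nat)
  qed (use assms in auto)
  show ?thesis
  proof (rule cancel_right[of _ "?I |> Z |> unt N" _ "?I |> Z |> unt' N" "?I \<rhd> Z \<rhd> N"])
    have "(Z |> unt N) \<star> braid ?I Z N \<star> (?I |> Z |> unt N) =
        (Z |> (unt N \<star> (?I |> unt N))) \<star> braid ?I Z (?I \<rhd> N)"
      using assms by (simp add: braid_whisk)
    also have "\<dots> = (Z |> unt N) \<star> unt (Z \<rhd> ?I \<rhd> N)"
      using assms 1 by (simp add: unt_twice)
    also have "\<dots> = unt (Z \<rhd> N) \<star> (?I |> Z |> unt N)"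
      using assms by (simp add: unt_nat)
    finally show "((Z |> unt N) \<star> braid ?I Z N) \<star> (?I |> Z |> unt N) = unt (Z \<rhd> N) \<star> (?I |> Z |> unt N)"
      by simp
  qed (use assms in \<open>simp_all add: unt_cancel_whisk2\<close>)
qed

lemma braid_unit_right:
  assumes "X \<in> Ob B" "N \<in> Ob \<M>"
  shows "unt (X \<rhd> N) \<star> braid X (Unit B) N = X |> unt N"
proof -
  let ?I = "Unit B"
  have 1: "X |> unt (?I \<rhd> N) = unt (X \<rhd> ?I \<rhd> N) \<star> braid X ?I (?I \<rhd> N)"
  proof (rule cancel_left[of "braid X ?I N" _ _ "inv_braid ?I X N" "X \<rhd> ?I \<rhd> N"])
    have "braid X ?I N \<star> (X |> cell (?I \<boxtimes> ?I) (LUnit B ?I) ?I N) =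
      cell (?I \<boxtimes> ?I) (LUnit B ?I) ?I (X \<rhd> N) \<star> braid X (?I \<boxtimes> ?I) N"
      using assms by (intro braid_cell_right) auto
    then have "(braid X ?I N \<star> (X |> unt (?I \<rhd> N))) \<star> (X |> assr ?I ?I N) =
      (unt (?I \<rhd> X \<rhd> N) \<star> (?I |> braid X ?I N) \<star> braid X ?I (?I \<rhd> N)) \<star> (X |> assr ?I ?I N)"
      using assms by (simp add: cell_lunit braid_hexagon_right)
    then have "braid X ?I N \<star> (X |> unt (?I \<rhd> N)) = unt (?I \<rhd> X \<rhd> N) \<star> (?I |> braid X ?I N) \<star> braid X ?I (?I \<rhd> N)"
      by (rule cancel_right[of _ _ _ "X |> assl ?I ?I N" "X \<rhd> ?I \<rhd> ?I \<rhd> N"]) (use assms in auto)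
    then show "braid X ?I N \<star> (X |> unt (?I \<rhd> N)) = braid X ?I N \<star> unt (X \<rhd> ?I \<rhd> N) \<star> braid X ?I (?I \<rhd> N)"
      using assms by (simp add: acomp_head[OF unt_nat])
  qed (use assms in auto)
  show ?thesis
  proof (rule cancel_right[of _ "X |> ?I |> unt N" _ "X |> ?I |> unt' N" "X \<rhd> ?I \<rhd> N"])
    have "unt (X \<rhd> N) \<star> braid X ?I N \<star> (X |> ?I |> unt N) = unt (X \<rhd> N) \<star> (?I |> X |> unt N) \<star> braid X ?I (?I \<rhd> N)"
      using assms by (simp add: braid_whisk)
    also have "\<dots> = (X |> unt N) \<star> (X |> unt (?I \<rhd> N))"
      using assms by (simp add: acomp_head[OF unt_nat] 1)
    also have "\<dots> = (X |> unt N) \<star> (X |> ?I |> unt N)"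
      using assms by (simp add: unt_twice)
    finally show "(unt (X \<rhd> N) \<star> braid X ?I N) \<star> (X |> ?I |> unt N) = (X |> unt N) \<star> (X |> ?I |> unt N)"
      by simp
  qed (use assms in \<open>simp_all add: unt_cancel_whisk2\<close>)
qed

lemma Ea_arrow [simp]: "\<lbrakk>X \<in> Ob B; N \<in> Ob \<M>\<rbrakk> \<Longrightarrow> is_arrow (Ea X N)"
  using E_iso[of X N] by (auto simp: Ea_def is_iso_def inverse_pair_def)

lemma Ea_sel [simp]: "src (Ea X N) = X \<rhd> N" "trg (Ea X N) = X \<rhd> N" "mor (Ea X N) = E X N"
  by (simp_all add: Ea_def)

lemma Ea_whisk:
  assumes "X \<in> Ob B" "is_arrow p" "src p = M" "trg p = N"
  shows "Ea X N \<star> (X |> p) = (X |> p) \<star> Ea X M"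
  using assms E_nat[of X X M N "Ident B X" "mor p"] is_arrowD[of p]
  by (intro arrow_eqI) (auto simp: mor_acomp mor_simps)

lemma Ea_cell:
  assumes "X \<in> Ob B" "Y \<in> Ob B" "f \<in> Hom B X Y" "N \<in> Ob \<M>"
  shows "Ea Y N \<star> cell X f Y N = cell X f Y N \<star> Ea X N"
  using assms E_nat[of X Y N N f "Ident \<M> N"]
  by (intro arrow_eqI) (auto simp: mor_acomp mor_simps)

lemma Ea_tensor:
  assumes "X \<in> Ob B" "Y \<in> Ob B" "N \<in> Ob \<M>"
  shows "assr Y X N \<star> Ea (Y \<boxtimes> X) N = Ea Y (X \<rhd> N) \<star> (Y |> Ea X N) \<star> assr Y X N"
proof -
  have "Ea (Y \<boxtimes> X) N = assl Y X N \<star> Ea Y (X \<rhd> N) \<star> (Y |> Ea X N) \<star> assr Y X N"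
    using assms E_tensor[of X Y N]
    by (intro arrow_eqI) (auto simp: mor_acomp mor_simps, simp add: assl_def)
  then show ?thesis
    using assms by simp
qed

text \<open>
  The formula for \<open>E\<close> on \<open>X \<rhd> N\<close>, with the inverse braidings moved to the other side.
\<close>
lemma Ea_braid:
  assumes "X \<in> Ob B" "Y \<in> Ob B" "N \<in> Ob \<M>"
  shows "braid Y X N \<star> Ea Y (X \<rhd> N) \<star> braid X Y N = X |> Ea Y N"
proof -
  have "Ea Y (X \<rhd> N) = inv_braid X Y N \<star> (X |> Ea Y N) \<star> inv_braid Y X N"
    using assms E_act[of X Y N]
    by (intro arrow_eqI) (auto simp: inv_braid_def mor_acomp mor_simps, simp add: assl_def)
  then show ?thesis
    using assms by simp
qed

text \<open>
  By naturality along \<open>I \<otimes> I \<cong> I\<close> and the axiom on tensor products, \<open>E\<close> at \<open>I\<close> is, up to unit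
  constraints, an idempotent, and it is invertible.
\<close>
lemma Ea_unit:
  assumes "N \<in> Ob \<M>"
  shows "Ea (Unit B) N = aid (Unit B \<rhd> N)"
proof -
  let ?I = "Unit B"
  have inv: "\<exists>r. r \<star> Ea ?I N = aid (?I \<rhd> N)"
  proof -
    obtain g where "inverse_pair \<M> (?I \<rhd> N) (?I \<rhd> N) (E ?I N) g"
      using E_iso[of ?I N] assms by (auto simp: is_iso_def)
    then have "arrow (?I \<rhd> N) g (?I \<rhd> N) \<star> Ea ?I N = aid (?I \<rhd> N)"
      using assms by (intro arrow_eqI) (auto simp: mor_acomp inverse_pair_def)
    then show ?thesis ..
  qed
  then obtain r where r: "r \<star> Ea ?I N = aid (?I \<rhd> N)"
    by blast
  have "Ea ?I N \<star> cell (?I \<boxtimes> ?I) (LUnit B ?I) ?I N = cell (?I \<boxtimes> ?I) (LUnit B ?I) ?I N \<star> Ea (?I \<boxtimes> ?I) N"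
    using assms by (intro Ea_cell) auto
  then have "(Ea ?I N \<star> unt (?I \<rhd> N)) \<star> assr ?I ?I N =
      (unt (?I \<rhd> N) \<star> Ea ?I (?I \<rhd> N) \<star> (?I |> Ea ?I N)) \<star> assr ?I ?I N"
    using assms by (simp add: cell_lunit Ea_tensor)
  then have "Ea ?I N \<star> unt (?I \<rhd> N) = unt (?I \<rhd> N) \<star> Ea ?I (?I \<rhd> N) \<star> (?I |> Ea ?I N)"
    by (rule cancel_right[of _ _ _ "assl ?I ?I N" "?I \<rhd> ?I \<rhd> N"]) (use assms in auto)
  also have "\<dots> = Ea ?I N \<star> unt (?I \<rhd> N) \<star> Ea ?I (?I \<rhd> N)"
    using assms by (simp add: Ea_whisk acomp_head[OF unt_nat])
  finally have "unt (?I \<rhd> N) = unt (?I \<rhd> N) \<star> Ea ?I (?I \<rhd> N)"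
    by (rule cancel_left[OF _ r]) (use assms in auto)
  then have "unt (?I \<rhd> N) \<star> aid (?I \<rhd> ?I \<rhd> N) = unt (?I \<rhd> N) \<star> Ea ?I (?I \<rhd> N)"
    using assms by simp
  then have 1: "aid (?I \<rhd> ?I \<rhd> N) = Ea ?I (?I \<rhd> N)"
    by (rule cancel_left[of "unt (?I \<rhd> N)" _ _ "unt' (?I \<rhd> N)"]) (use assms in auto)
  show ?thesis
    by (rule cancel_right[of _ "?I |> unt N" _ "?I |> unt' N" "?I \<rhd> N"]) (use assms in \<open>auto simp: Ea_whisk 1[symmetric]\<close>)
qed

end

section \<open>Joint and commuting actions\<close>

context braided_action
begin

text \<open>
  An arrow \<open>X \<rhd> N \<rightarrow> N\<close>, where \<open>X\<close> is any object.  The calculus of joint and commuting actions takes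
  place at this level; the axioms of an action enter with \<open>act\<close>.
\<close>
definition pact :: "'o \<Rightarrow> 'p \<Rightarrow> ('p, 'q) arrow \<Rightarrow> bool" where
  "pact X N p \<longleftrightarrow> X \<in> Ob B \<and> N \<in> Ob \<M> \<and> is_arrow p \<and> src p = X \<rhd> N \<and> trg p = N"

definition joint ::
    "'o \<Rightarrow> 'o \<Rightarrow> 'p \<Rightarrow> ('p, 'q) arrow \<Rightarrow> ('p, 'q) arrow \<Rightarrow> ('p, 'q) arrow" where
  "joint X Y N p q = p \<star> (X |> q) \<star> assr X Y N"

text \<open>
  This is the condition \<open>\<rho>\<^sub>A (Id \<otimes> \<rho>\<^sub>B) = \<rho>\<^sub>B (Id \<otimes> \<rho>\<^sub>A) \<tau>\<^sup>-\<^sup>1\<close> on modules over a twisted tensor product, with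
  the inverse braiding moved to the other side.  It is not symmetric in the two actions.
\<close>
definition commuting ::
    "'o \<Rightarrow> 'o \<Rightarrow> 'p \<Rightarrow> ('p, 'q) arrow \<Rightarrow> ('p, 'q) arrow \<Rightarrow> bool" where
  "commuting X Y N p q \<longleftrightarrow> q \<star> (Y |> p) = p \<star> (X |> q) \<star> braid Y X N"

lemma pactD:
  assumes "pact X N p"
  shows "is_arrow p" "src p = X \<rhd> N" "trg p = N" "X \<in> Ob B" "N \<in> Ob \<M>"
  using assms by (auto simp: pact_def)

lemma pact_joint [simp]: "\<lbrakk>pact X N p; pact Y N q\<rbrakk> \<Longrightarrow> pact (X \<boxtimes> Y) N (joint X Y N p q)"
  by (simp add: joint_def pact_def)

lemma pact_cell [simp]:
  "\<lbrakk>pact Y N p; X \<in> Ob B; f \<in> Hom B X Y\<rbrakk> \<Longrightarrow> pact X N (p \<star> cell X f Y N)"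
  by (simp add: pact_def)

lemma pact_Ea [simp]: "pact X N p \<Longrightarrow> pact X N (p \<star> Ea X N)"
  by (simp add: pact_def)

lemma pact_unt [simp]: "N \<in> Ob \<M> \<Longrightarrow> pact (Unit B) N (unt N)"
  by (simp add: pact_def)

lemma joint_cell:
  assumes "pact X' N p" "pact Y' N q" "X \<in> Ob B" "Y \<in> Ob B" "f \<in> Hom B X X'" "g \<in> Hom B Y Y'"
  shows "joint X' Y' N p q \<star> cell (X \<boxtimes> Y) (f \<boxdot> g) (X' \<boxtimes> Y') N =
    joint X Y N (p \<star> cell X f X' N) (q \<star> cell Y g Y' N)"
proof -
  note [simp] = pactD[OF assms(1)] pactD[OF assms(2)] assms(3-6)
  have "joint X' Y' N p q \<star> cell (X \<boxtimes> Y) (f \<boxdot> g) (X' \<boxtimes> Y') N =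
      p \<star> ((X' |> q) \<star> cell X f X' (Y' \<rhd> N)) \<star> (X |> cell Y g Y' N) \<star> assr X Y N"
    by (simp add: joint_def assr_cell)
  also have "\<dots> = p \<star> (cell X f X' N \<star> (X |> q)) \<star> (X |> cell Y g Y' N) \<star> assr X Y N"
    by (simp add: cell_nat)
  finally show ?thesis
    by (simp add: joint_def)
qed

lemma joint_assoc:
  assumes "pact X N p" "pact Y N q" "pact Z N r"
  shows "joint X (Y \<boxtimes> Z) N p (joint Y Z N q r) \<star>
      cell ((X \<boxtimes> Y) \<boxtimes> Z) (Assoc B X Y Z) (X \<boxtimes> (Y \<boxtimes> Z)) N =
    joint (X \<boxtimes> Y) Z N (joint X Y N p q) r"
proof -
  note [simp] = pactD[OF assms(1)] pactD[OF assms(2)] pactD[OF assms(3)]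
  have "joint (X \<boxtimes> Y) Z N (joint X Y N p q) r =
      p \<star> (X |> q) \<star> (assr X Y N \<star> ((X \<boxtimes> Y) |> r)) \<star> assr (X \<boxtimes> Y) Z N"
    by (simp add: joint_def)
  also have "\<dots> = p \<star> (X |> q) \<star> ((X |> Y |> r) \<star> assr X Y (Z \<rhd> N)) \<star> assr (X \<boxtimes> Y) Z N"
    by (simp add: assr_whisk)
  finally show ?thesis
    by (simp add: joint_def cell_assoc)
qed

lemma joint_inv_assoc:
  assumes "pact X N p" "pact Y N q" "pact Z N r"
  shows "joint (X \<boxtimes> Y) Z N (joint X Y N p q) r \<star>
      cell (X \<boxtimes> (Y \<boxtimes> Z)) (InvAssoc B X Y Z) ((X \<boxtimes> Y) \<boxtimes> Z) N =
    joint X (Y \<boxtimes> Z) N p (joint Y Z N q r)"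
proof -
  note [simp] = pactD[OF assms(1)] pactD[OF assms(2)] pactD[OF assms(3)]
  have i: "inverse_pair B (X \<boxtimes> (Y \<boxtimes> Z)) ((X \<boxtimes> Y) \<boxtimes> Z) (InvAssoc B X Y Z) (Assoc B X Y Z)"
    using B.inverse_pair_Inv[OF _ _ B.assoc_iso[of X Y Z]] by (simp add: inverse_pair_def)
  have p: "pact (X \<boxtimes> (Y \<boxtimes> Z)) N (joint X (Y \<boxtimes> Z) N p (joint Y Z N q r))"
    using assms by simp
  show ?thesis
    using cell_inverse[OF _ _ i, of N] pactD[OF p]
    unfolding joint_assoc[OF assms, symmetric] by simp
qed

lemma joint_unt_right: "pact X N p \<Longrightarrow> joint X (Unit B) N p (unt N) = p \<star> cell (X \<boxtimes> Unit B) (RUnit B X) X N"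
  using pactD[of X N p] by (simp add: joint_def cell_runit)

lemma joint_unt_left: "pact X N p \<Longrightarrow> joint (Unit B) X N (unt N) p = p \<star> cell (Unit B \<boxtimes> X) (LUnit B X) X N"
  using pactD[of X N p] by (simp add: joint_def cell_lunit acomp_head[OF unt_nat])

lemma joint_Ea:
  assumes "pact X N p" "pact Y N q"
  shows "joint X Y N p q \<star> Ea (X \<boxtimes> Y) N = joint X Y N (p \<star> Ea X N) (q \<star> Ea Y N)"
proof -
  note [simp] = pactD[OF assms(1)] pactD[OF assms(2)]
  have "joint X Y N p q \<star> Ea (X \<boxtimes> Y) N =
      p \<star> ((X |> q) \<star> Ea X (Y \<rhd> N)) \<star> (X |> Ea Y N) \<star> assr X Y N"
    by (simp add: joint_def Ea_tensor)
  also have "\<dots> = p \<star> (Ea X N \<star> (X |> q)) \<star> (X |> Ea Y N) \<star> assr X Y N"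
    by (simp add: Ea_whisk)
  finally show ?thesis
    by (simp add: joint_def)
qed

lemma commuting_joint_left:
  assumes "pact X N p" "pact Y N q" "pact Z N r" "commuting X Z N p r" "commuting Y Z N q r"
  shows "commuting (X \<boxtimes> Y) Z N (joint X Y N p q) r"
proof -
  note [simp] = pactD[OF assms(1)] pactD[OF assms(2)] pactD[OF assms(3)]
  have "r \<star> (Z |> joint X Y N p q) = (r \<star> (Z |> p)) \<star> (Z |> X |> q) \<star> (Z |> assr X Y N)"
    by (simp add: joint_def)
  also have "\<dots> = p \<star> (X |> r) \<star> (braid Z X N \<star> (Z |> X |> q)) \<star> (Z |> assr X Y N)"
    using assms(4) by (simp add: commuting_def)
  also have "\<dots> = p \<star> (X |> (r \<star> (Z |> q))) \<star> braid Z X (Y \<rhd> N) \<star> (Z |> assr X Y N)"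
    by (simp add: braid_whisk)
  also have "\<dots> = p \<star> (X |> q) \<star> (X |> Y |> r) \<star> ((X |> braid Z Y N) \<star> braid Z X (Y \<rhd> N) \<star> (Z |> assr X Y N))"
    using assms(5) by (simp add: commuting_def)
  also have "\<dots> = p \<star> (X |> q) \<star> ((X |> Y |> r) \<star> assr X Y (Z \<rhd> N)) \<star> braid Z (X \<boxtimes> Y) N"
    by (simp add: braid_hexagon_right)
  also have "\<dots> = p \<star> (X |> q) \<star> (assr X Y N \<star> ((X \<boxtimes> Y) |> r)) \<star> braid Z (X \<boxtimes> Y) N"
    by (simp add: assr_whisk)
  finally show ?thesis
    by (simp add: commuting_def joint_def)
qed

lemma commuting_joint_right:
  assumes "pact X N p" "pact Y N q" "pact Z N r" "commuting X Y N p q" "commuting X Z N p r"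
  shows "commuting X (Y \<boxtimes> Z) N p (joint Y Z N q r)"
proof -
  note [simp] = pactD[OF assms(1)] pactD[OF assms(2)] pactD[OF assms(3)]
  have "joint Y Z N q r \<star> ((Y \<boxtimes> Z) |> p) = q \<star> (Y |> r) \<star> (assr Y Z N \<star> ((Y \<boxtimes> Z) |> p))"
    by (simp add: joint_def)
  also have "\<dots> = q \<star> (Y |> (r \<star> (Z |> p))) \<star> assr Y Z (X \<rhd> N)"
    by (simp add: assr_whisk)
  also have "\<dots> = (q \<star> (Y |> p)) \<star> (Y |> X |> r) \<star> (Y |> braid Z X N) \<star> assr Y Z (X \<rhd> N)"
    using assms(5) by (simp add: commuting_def)
  also have "\<dots> = p \<star> (X |> q) \<star> (braid Y X N \<star> (Y |> X |> r)) \<star> (Y |> braid Z X N) \<star> assr Y Z (X \<rhd> N)"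
    using assms(4) by (simp add: commuting_def)
  also have "\<dots> = p \<star> (X |> q) \<star> (X |> Y |> r) \<star> (braid Y X (Z \<rhd> N) \<star> (Y |> braid Z X N) \<star> assr Y Z (X \<rhd> N))"
    by (simp add: braid_whisk)
  also have "\<dots> = p \<star> (X |> q) \<star> (X |> Y |> r) \<star> (X |> assr Y Z N) \<star> braid (Y \<boxtimes> Z) X N"
    by (simp add: braid_hexagon_left)
  finally show ?thesis
    by (simp add: commuting_def joint_def)
qed

lemma commuting_cell:
  assumes "pact X N p" "pact Y N q" "commuting X Y N p q" "X' \<in> Ob B" "Y' \<in> Ob B"
    "f \<in> Hom B X' X" "g \<in> Hom B Y' Y"
  shows "commuting X' Y' N (p \<star> cell X' f X N) (q \<star> cell Y' g Y N)"
proof -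
  note [simp] = pactD[OF assms(1)] pactD[OF assms(2)] assms(4-7)
  have "(q \<star> cell Y' g Y N) \<star> (Y' |> (p \<star> cell X' f X N)) =
      q \<star> (cell Y' g Y N \<star> (Y' |> p)) \<star> (Y' |> cell X' f X N)"
    by simp
  also have "\<dots> = (q \<star> (Y |> p)) \<star> cell Y' g Y (X \<rhd> N) \<star> (Y' |> cell X' f X N)"
    by (simp add: cell_nat)
  also have "\<dots> = p \<star> (X |> q) \<star> (braid Y X N \<star> cell Y' g Y (X \<rhd> N) \<star> (Y' |> cell X' f X N))"
    using assms(3) by (simp add: commuting_def)
  also have "\<dots> = p \<star> ((X |> q) \<star> cell X' f X (Y \<rhd> N)) \<star> (X' |> cell Y' g Y N) \<star> braid Y' X' N"
    by (simp add: braid_cell)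
  also have "\<dots> = p \<star> (cell X' f X N \<star> (X' |> q)) \<star> (X' |> cell Y' g Y N) \<star> braid Y' X' N"
    by (simp add: cell_nat)
  finally show ?thesis
    by (simp add: commuting_def)
qed

lemma commuting_unt_left: "pact Y N q \<Longrightarrow> commuting (Unit B) Y N (unt N) q"
  using pactD[of Y N q] by (simp add: commuting_def acomp_head[OF unt_nat] braid_unit_right)

lemma braid_unit_left':
  "\<lbrakk>Z \<in> Ob B; N \<in> Ob \<M>\<rbrakk> \<Longrightarrow> braid (Unit B) Z N = (Z |> unt' N) \<star> unt (Z \<rhd> N)"
  using braid_unit_left[of Z N] unt_cancel_more(6)[of N Z "braid (Unit B) Z N"] by simp

lemma commuting_unt_right: "pact X N p \<Longrightarrow> commuting X (Unit B) N p (unt N)"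
  using pactD[of X N p] by (simp add: commuting_def unt_nat braid_unit_left')

text \<open>
  Twisting the second of two commuting actions by \<open>E\<close> allows one to exchange them: moving \<open>E\<close> past the
  first action produces \<open>E\<close> on \<open>X \<rhd> N\<close>, which differs from \<open>Id \<rhd> E\<close> by the two braidings.
\<close>
lemma commuting_twist:
  assumes "pact X N p" "pact Y N q" "commuting X Y N p q"
  shows "commuting Y X N (q \<star> Ea Y N) p"
proof -
  note [simp] = pactD[OF assms(1)] pactD[OF assms(2)]
  have "(q \<star> Ea Y N) \<star> (Y |> p) \<star> braid X Y N = q \<star> (Ea Y N \<star> (Y |> p)) \<star> braid X Y N"
    by simp
  also have "\<dots> = (q \<star> (Y |> p)) \<star> Ea Y (X \<rhd> N) \<star> braid X Y N"
    by (simp add: Ea_whisk)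
  also have "\<dots> = p \<star> (X |> q) \<star> (braid Y X N \<star> Ea Y (X \<rhd> N) \<star> braid X Y N)"
    using assms(3) by (simp add: commuting_def)
  also have "\<dots> = p \<star> (X |> (q \<star> Ea Y N))"
    by (simp add: Ea_braid)
  finally show ?thesis
    by (simp add: commuting_def)
qed

definition algebraic :: "('o, 'm, 'z) algebra_scheme \<Rightarrow> bool" where
  "algebraic A \<longleftrightarrow> Carrier A \<in> Ob B \<and> Mult A \<in> Hom B (Carrier A \<boxtimes> Carrier A) (Carrier A) \<and>
     One A \<in> Hom B (Unit B) (Carrier A)"

text \<open>
  The multiplication and the unit of the monad \<open>A \<rhd> -\<close> on \<open>\<M>\<close>.  Its unit laws, as identities in \<open>\<M>\<close>,
  are what \<open>unital\<close> states.
\<close>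
definition mu :: "('o, 'm, 'z) algebra_scheme \<Rightarrow> 'p \<Rightarrow> ('p, 'q) arrow" where
  "mu A N = cell (Carrier A \<boxtimes> Carrier A) (Mult A) (Carrier A) N \<star> assl (Carrier A) (Carrier A) N"

definition eta :: "('o, 'm, 'z) algebra_scheme \<Rightarrow> 'p \<Rightarrow> ('p, 'q) arrow" where
  "eta A N = cell (Unit B) (One A) (Carrier A) N \<star> unt' N"

definition unital :: "('o, 'm, 'z) algebra_scheme \<Rightarrow> bool" where
  "unital A \<longleftrightarrow> algebraic A \<and> (\<forall>N \<in> Ob \<M>.
     mu A N \<star> eta A (Carrier A \<rhd> N) = aid (Carrier A \<rhd> N) \<and>
     mu A N \<star> (Carrier A |> eta A N) = aid (Carrier A \<rhd> N))"

definition act :: "('o, 'm, 'z) algebra_scheme \<Rightarrow> 'p \<Rightarrow> ('p, 'q) arrow \<Rightarrow> bool" where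
  "act A N p \<longleftrightarrow> pact (Carrier A) N p \<and>
     p \<star> cell (Carrier A \<boxtimes> Carrier A) (Mult A) (Carrier A) N =
       joint (Carrier A) (Carrier A) N p p \<and>
     p \<star> cell (Unit B) (One A) (Carrier A) N = unt N"

lemma act_pact: "act A N p \<Longrightarrow> pact (Carrier A) N p"
  by (simp add: act_def)

lemma algebraicD:
  assumes "algebraic A"
  shows "Carrier A \<in> Ob B" "Mult A \<in> Hom B (Carrier A \<boxtimes> Carrier A) (Carrier A)"
    "One A \<in> Hom B (Unit B) (Carrier A)"
  using assms by (auto simp: algebraic_def)

lemma mu_arrow [simp]:
  assumes "algebraic A" "N \<in> Ob \<M>"
  shows "is_arrow (mu A N)" "src (mu A N) = Carrier A \<rhd> Carrier A \<rhd> N" "trg (mu A N) = Carrier A \<rhd> N"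
  using algebraicD[OF assms(1)] assms(2) by (simp_all add: mu_def)

lemma eta_arrow [simp]:
  assumes "algebraic A" "N \<in> Ob \<M>"
  shows "is_arrow (eta A N)" "src (eta A N) = N" "trg (eta A N) = Carrier A \<rhd> N"
  using algebraicD[OF assms(1)] assms(2) by (simp_all add: eta_def)

text \<open>
  An action in the sense of \<open>B\<close> is an algebra for the monad.
\<close>
lemma act_iff:
  assumes "algebraic A" "pact (Carrier A) N p"
  shows "act A N p \<longleftrightarrow> p \<star> mu A N = p \<star> (Carrier A |> p) \<and> p \<star> eta A N = aid N"
proof -
  let ?A = "Carrier A"
  note [simp] = algebraicD[OF assms(1)] pactD[OF assms(2)]
  have "p \<star> cell (?A \<boxtimes> ?A) (Mult A) ?A N = joint ?A ?A N p p \<longleftrightarrow> p \<star> mu A N = p \<star> (?A |> p)"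
  proof
    assume "p \<star> cell (?A \<boxtimes> ?A) (Mult A) ?A N = joint ?A ?A N p p"
    then have "(p \<star> cell (?A \<boxtimes> ?A) (Mult A) ?A N) \<star> assl ?A ?A N = joint ?A ?A N p p \<star> assl ?A ?A N"
      by simp
    then show "p \<star> mu A N = p \<star> (?A |> p)"
      by (simp add: joint_def mu_def)
  next
    assume "p \<star> mu A N = p \<star> (?A |> p)"
    then have "(p \<star> mu A N) \<star> assr ?A ?A N = (p \<star> (?A |> p)) \<star> assr ?A ?A N"
      by simp
    then show "p \<star> cell (?A \<boxtimes> ?A) (Mult A) ?A N = joint ?A ?A N p p"
      by (simp add: joint_def mu_def)
  qed
  moreover have "p \<star> cell (Unit B) (One A) ?A N = unt N \<longleftrightarrow> p \<star> eta A N = aid N"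
  proof
    assume "p \<star> cell (Unit B) (One A) ?A N = unt N"
    then have "(p \<star> cell (Unit B) (One A) ?A N) \<star> unt' N = unt N \<star> unt' N"
      by simp
    then show "p \<star> eta A N = aid N"
      by (simp add: eta_def)
  next
    assume "p \<star> eta A N = aid N"
    then have "(p \<star> eta A N) \<star> unt N = aid N \<star> unt N"
      by simp
    then show "p \<star> cell (Unit B) (One A) ?A N = unt N"
      by (simp add: eta_def)
  qed
  ultimately show ?thesis
    using assms by (simp add: act_def)
qed

text \<open>
  Precomposition with \<open>E\<close> preserves actions because \<open>E\<close> is natural in the acting object, splits on
  tensor products, and is the identity on the unit object.
\<close>
lemma act_Ea:
  assumes "algebraic A" "act A N p"
  shows "act A N (p \<star> Ea (Carrier A) N)"
proof -
  let ?A = "Carrier A"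
  note [simp] = algebraicD[OF assms(1)] pactD[OF act_pact[OF assms(2)]]
  have "(p \<star> Ea ?A N) \<star> cell (?A \<boxtimes> ?A) (Mult A) ?A N =
      (p \<star> cell (?A \<boxtimes> ?A) (Mult A) ?A N) \<star> Ea (?A \<boxtimes> ?A) N"
    by (simp add: Ea_cell)
  also have "\<dots> = joint ?A ?A N (p \<star> Ea ?A N) (p \<star> Ea ?A N)"
    using assms(2) by (simp add: act_def joint_Ea del: acomp_assoc)
  finally have "(p \<star> Ea ?A N) \<star> cell (?A \<boxtimes> ?A) (Mult A) ?A N =
      joint ?A ?A N (p \<star> Ea ?A N) (p \<star> Ea ?A N)" .
  moreover have "(p \<star> Ea ?A N) \<star> cell (Unit B) (One A) ?A N =
      (p \<star> cell (Unit B) (One A) ?A N) \<star> Ea (Unit B) N"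
    by (simp add: Ea_cell)
  ultimately show ?thesis
    using assms(2) by (simp add: act_def joint_Ea Ea_unit)
qed

lemma act_restrict:
  assumes "algebraic A" "algebraic A'" "algebra_map B A A' f" "act A' N p"
  shows "act A N (p \<star> cell (Carrier A) f (Carrier A') N)"
proof -
  let ?A = "Carrier A" and ?A' = "Carrier A'"
  note [simp] = algebraicD[OF assms(1)] algebraicD[OF assms(2)]
  have p: "pact ?A' N p"
    using assms(4) by (rule act_pact)
  note [simp] = pactD[OF p]
  have f [simp]: "f \<in> Hom B ?A ?A'" and fm: "f \<cdot>\<^bsub>B\<^esub> Mult A = Mult A' \<cdot>\<^bsub>B\<^esub> (f \<boxdot> f)"
    and fo: "f \<cdot>\<^bsub>B\<^esub> One A = One A'"
    using assms(3) by (auto simp: algebra_map_def)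
  have ff [simp]: "f \<boxdot> f \<in> Hom B (?A \<boxtimes> ?A) (?A' \<boxtimes> ?A')"
    by (simp add: B.tensor_hom)
  have "p \<star> cell ?A f ?A' N \<star> cell (?A \<boxtimes> ?A) (Mult A) ?A N =
      joint ?A ?A N (p \<star> cell ?A f ?A' N) (p \<star> cell ?A f ?A' N)"
  proof -
    have "p \<star> cell ?A f ?A' N \<star> cell (?A \<boxtimes> ?A) (Mult A) ?A N =
        p \<star> cell (?A' \<boxtimes> ?A') (Mult A') ?A' N \<star> cell (?A \<boxtimes> ?A) (f \<boxdot> f) (?A' \<boxtimes> ?A') N"
      using fm by (simp add: cell_comp[symmetric])
    also have "\<dots> = joint ?A' ?A' N p p \<star> cell (?A \<boxtimes> ?A) (f \<boxdot> f) (?A' \<boxtimes> ?A') N"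
      using assms(4) by (simp add: act_def acomp_head1)
    finally show ?thesis
      using p by (simp add: joint_cell)
  qed
  moreover have "p \<star> cell ?A f ?A' N \<star> cell (Unit B) (One A) ?A N = unt N"
    using assms(4) fo by (simp add: cell_comp[symmetric] act_def)
  ultimately show ?thesis
    using p by (simp add: act_def)
qed

lemma eta_nat:
  assumes "algebraic A" "is_arrow p" "src p = M" "trg p = N"
  shows "eta A N \<star> p = (Carrier A |> p) \<star> eta A M"
proof -
  note [simp] = algebraicD[OF assms(1)] assms(2-4)
  have [simp]: "M \<in> Ob \<M>" "N \<in> Ob \<M>"
    using assms is_arrowD(1,2)[of p] by auto
  have "unt' N \<star> p = unt' N \<star> (p \<star> unt M) \<star> unt' M"
    by simp
  also have "\<dots> = unt' N \<star> (unt N \<star> (Unit B |> p)) \<star> unt' M"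
    by (simp add: unt_nat)
  finally have "unt' N \<star> p = (Unit B |> p) \<star> unt' M"
    by simp
  then have "eta A N \<star> p = (cell (Unit B) (One A) (Carrier A) N \<star> (Unit B |> p)) \<star> unt' M"
    by (simp add: eta_def)
  then show ?thesis
    by (simp add: eta_def cell_nat)
qed

lemma mu_nat:
  assumes "algebraic A" "is_arrow p" "src p = M" "trg p = N"
  shows "mu A N \<star> (Carrier A |> Carrier A |> p) = (Carrier A |> p) \<star> mu A M"
proof -
  let ?A = "Carrier A"
  note [simp] = algebraicD[OF assms(1)] assms(2-4)
  have [simp]: "M \<in> Ob \<M>" "N \<in> Ob \<M>"
    using assms is_arrowD(1,2)[of p] by auto
  have "mu A N \<star> (?A |> ?A |> p) =
      (cell (?A \<boxtimes> ?A) (Mult A) ?A N \<star> ((?A \<boxtimes> ?A) |> p)) \<star> assl ?A ?A M"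
    by (simp add: mu_def assl_whisk)
  then show ?thesis
    by (simp add: mu_def cell_nat)
qed

lemma braid_eta_left:
  assumes "algebraic A" "X \<in> Ob B" "N \<in> Ob \<M>"
  shows "braid (Carrier A) X N \<star> eta A (X \<rhd> N) = X |> eta A N"
proof -
  note [simp] = algebraicD[OF assms(1)] assms(2-3)
  have "braid (Carrier A) X N \<star> eta A (X \<rhd> N) =
      (braid (Carrier A) X N \<star> cell (Unit B) (One A) (Carrier A) (X \<rhd> N)) \<star> unt' (X \<rhd> N)"
    by (simp add: eta_def)
  then show ?thesis
    by (simp add: braid_cell_left braid_unit_left' eta_def)
qed

lemma braid_eta_right:
  assumes "algebraic A" "X \<in> Ob B" "N \<in> Ob \<M>"
  shows "braid X (Carrier A) N \<star> (X |> eta A N) = eta A (X \<rhd> N)"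
proof -
  note [simp] = algebraicD[OF assms(1)] assms(2-3)
  have u: "braid X (Unit B) N = unt' (X \<rhd> N) \<star> (X |> unt N)"
    using braid_unit_right[of X N] unt_cancel_more(2)[of "X \<rhd> N" "braid X (Unit B) N"] by simp
  have "braid X (Carrier A) N \<star> (X |> eta A N) =
      (braid X (Carrier A) N \<star> (X |> cell (Unit B) (One A) (Carrier A) N)) \<star> (X |> unt' N)"
    by (simp add: eta_def)
  then show ?thesis
    by (simp add: braid_cell_right u eta_def)
qed

text \<open>
  In terms of iterated actions all constraints in \<open>middle_braid\<close> cancel; what remains is the braiding
  of the two inner factors.
\<close>
lemma middle_braid_hom [simp]:
  assumes "X \<in> Ob B" "Y \<in> Ob B"
  shows "middle_braid B X Y \<in> Hom B ((X \<boxtimes> Y) \<boxtimes> (X \<boxtimes> Y)) ((X \<boxtimes> X) \<boxtimes> (Y \<boxtimes> Y))"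
    and cell_middle_braid: "N \<in> Ob \<M> \<Longrightarrow>
      cell ((X \<boxtimes> Y) \<boxtimes> (X \<boxtimes> Y)) (middle_braid B X Y) ((X \<boxtimes> X) \<boxtimes> (Y \<boxtimes> Y)) N =
      assl (X \<boxtimes> X) (Y \<boxtimes> Y) N \<star> assl X X ((Y \<boxtimes> Y) \<rhd> N) \<star> (X |> X |> assl Y Y N) \<star>
      (X |> braid Y X (Y \<rhd> N)) \<star> (X |> Y |> assr X Y N) \<star>
      assr X Y ((X \<boxtimes> Y) \<rhd> N) \<star> assr (X \<boxtimes> Y) (X \<boxtimes> Y) N"
proof -
  note [simp] = assms
  let ?S = "(X \<boxtimes> Y) \<boxtimes> (X \<boxtimes> Y)" and ?T = "(X \<boxtimes> X) \<boxtimes> (Y \<boxtimes> Y)"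
  let ?P1 = "X \<boxtimes> (Y \<boxtimes> (X \<boxtimes> Y))" and ?P2 = "X \<boxtimes> ((Y \<boxtimes> X) \<boxtimes> Y)"
    and ?P3 = "X \<boxtimes> ((X \<boxtimes> Y) \<boxtimes> Y)" and ?P4 = "X \<boxtimes> (X \<boxtimes> (Y \<boxtimes> Y))"
  let ?f2 = "Ident B X \<boxdot> InvAssoc B Y X Y"
    and ?f3 = "Ident B X \<boxdot> (Braid B Y X \<boxdot> Ident B Y)"
    and ?f4 = "Ident B X \<boxdot> Assoc B X Y Y"
  have b: "Braid B Y X \<boxdot> Ident B Y \<in> Hom B ((Y \<boxtimes> X) \<boxtimes> Y) ((X \<boxtimes> Y) \<boxtimes> Y)"
    by (intro B.tensor_hom) auto
  have f2: "?f2 \<in> Hom B ?P1 ?P2" and f3: "?f3 \<in> Hom B ?P2 ?P3" and f4: "?f4 \<in> Hom B ?P3 ?P4"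
    by (intro B.tensor_hom b; simp)+
  have g2: "?f2 \<cdot>\<^bsub>B\<^esub> Assoc B X Y (X \<boxtimes> Y) \<in> Hom B ?S ?P2"
    by (rule B.comp_hom[OF _ _ _ _ f2]) simp_all
  have g3: "?f3 \<cdot>\<^bsub>B\<^esub> ?f2 \<cdot>\<^bsub>B\<^esub> Assoc B X Y (X \<boxtimes> Y) \<in> Hom B ?S ?P3"
    by (rule B.comp_hom[OF _ _ _ g2 f3]) simp_all
  have g4: "?f4 \<cdot>\<^bsub>B\<^esub> ?f3 \<cdot>\<^bsub>B\<^esub> ?f2 \<cdot>\<^bsub>B\<^esub> Assoc B X Y (X \<boxtimes> Y) \<in> Hom B ?S ?P4"
    by (rule B.comp_hom[OF _ _ _ g3 f4]) simp_all
  show "middle_braid B X Y \<in> Hom B ?S ?T"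
    unfolding middle_braid_def by (rule B.comp_hom[OF _ _ _ g4]) simp_all
  assume [simp]: "N \<in> Ob \<M>"
  have "cell ?S (middle_braid B X Y) ?T N =
      cell ?P4 (InvAssoc B X X (Y \<boxtimes> Y)) ?T N \<star> cell ?P3 ?f4 ?P4 N \<star> cell ?P2 ?f3 ?P3 N \<star>
      cell ?P1 ?f2 ?P2 N \<star> cell ?S (Assoc B X Y (X \<boxtimes> Y)) ?P1 N"
    unfolding middle_braid_def using f2 f3 f4 g2 g3 g4
    by (simp add: cell_comp[of ?S ?P4 ?T] cell_comp[of ?S ?P3 ?P4] cell_comp[of ?S ?P2 ?P3]
      cell_comp[of ?S ?P1 ?P2])
  then show "cell ?S (middle_braid B X Y) ?T N =
      assl (X \<boxtimes> X) (Y \<boxtimes> Y) N \<star> assl X X ((Y \<boxtimes> Y) \<rhd> N) \<star> (X |> X |> assl Y Y N) \<star>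
      (X |> braid Y X (Y \<rhd> N)) \<star> (X |> Y |> assr X Y N) \<star>
      assr X Y ((X \<boxtimes> Y) \<rhd> N) \<star> assr (X \<boxtimes> Y) (X \<boxtimes> Y) N"
    using b by (simp add: cell_inv_assoc cell_assoc cell_tensor braid_def)
qed

lemma tensor_algebra_sel [simp]:
  "Carrier (tensor_algebra B A A') = Carrier A \<boxtimes> Carrier A'"
  "Mult (tensor_algebra B A A') = (Mult A \<boxdot> Mult A') \<cdot>\<^bsub>B\<^esub> middle_braid B (Carrier A) (Carrier A')"
  "One (tensor_algebra B A A') = (One A \<boxdot> One A') \<cdot>\<^bsub>B\<^esub> InvLUnit B (Unit B)"
  by (simp_all add: tensor_algebra_def)

lemma algebraic_tensor [simp]:
  assumes "algebraic A" "algebraic A'"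
  shows "algebraic (tensor_algebra B A A')"
proof -
  let ?A = "Carrier A" and ?A' = "Carrier A'"
  note [simp] = algebraicD[OF assms(1)] algebraicD[OF assms(2)]
  have "Mult (tensor_algebra B A A') \<in> Hom B ((?A \<boxtimes> ?A') \<boxtimes> (?A \<boxtimes> ?A')) (?A \<boxtimes> ?A')"
    unfolding tensor_algebra_sel
    by (rule B.comp_hom[of _ "(?A \<boxtimes> ?A) \<boxtimes> (?A' \<boxtimes> ?A')"]) (simp_all add: B.tensor_hom)
  moreover have "One (tensor_algebra B A A') \<in> Hom B (Unit B) (?A \<boxtimes> ?A')"
    unfolding tensor_algebra_sel
    by (rule B.comp_hom[of _ "Unit B \<boxtimes> Unit B"]) (simp_all add: B.tensor_hom)
  ultimately show ?thesis
    by (simp add: algebraic_def)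
qed

lemma cell_inv_lunit:
  assumes "X \<in> Ob B" "N \<in> Ob \<M>"
  shows "cell X (InvLUnit B X) (Unit B \<boxtimes> X) N = assl (Unit B) X N \<star> unt' (X \<rhd> N)"
proof (rule cancel_right[of _ "cell (Unit B \<boxtimes> X) (LUnit B X) X N" _
      "cell X (InvLUnit B X) (Unit B \<boxtimes> X) N" "X \<rhd> N"])
  have i: "inverse_pair B (Unit B \<boxtimes> X) X (LUnit B X) (InvLUnit B X)"
    using assms by (intro B.inverse_pair_Inv B.lunit_iso) auto
  then have i': "inverse_pair B X (Unit B \<boxtimes> X) (InvLUnit B X) (LUnit B X)"
    by (simp add: inverse_pair_def)
  show "cell X (InvLUnit B X) (Unit B \<boxtimes> X) N \<star> cell (Unit B \<boxtimes> X) (LUnit B X) X N =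
      (assl (Unit B) X N \<star> unt' (X \<rhd> N)) \<star> cell (Unit B \<boxtimes> X) (LUnit B X) X N"
    using assms cell_inverse[OF _ _ i, of N] by (simp add: cell_lunit)
  show "cell (Unit B \<boxtimes> X) (LUnit B X) X N \<star> cell X (InvLUnit B X) (Unit B \<boxtimes> X) N = aid (X \<rhd> N)"
    using assms cell_inverse[OF _ _ i', of N] by simp
qed (use assms in auto)

lemma cell_inv_runit:
  assumes "X \<in> Ob B" "N \<in> Ob \<M>"
  shows "cell X (InvRUnit B X) (X \<boxtimes> Unit B) N = assl X (Unit B) N \<star> (X |> unt' N)"
proof (rule cancel_right[of _ "cell (X \<boxtimes> Unit B) (RUnit B X) X N" _
      "cell X (InvRUnit B X) (X \<boxtimes> Unit B) N" "X \<rhd> N"])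
  have i: "inverse_pair B (X \<boxtimes> Unit B) X (RUnit B X) (InvRUnit B X)"
    using assms by (intro B.inverse_pair_Inv B.runit_iso) auto
  then have i': "inverse_pair B X (X \<boxtimes> Unit B) (InvRUnit B X) (RUnit B X)"
    by (simp add: inverse_pair_def)
  show "cell X (InvRUnit B X) (X \<boxtimes> Unit B) N \<star> cell (X \<boxtimes> Unit B) (RUnit B X) X N =
      (assl X (Unit B) N \<star> (X |> unt' N)) \<star> cell (X \<boxtimes> Unit B) (RUnit B X) X N"
    using assms cell_inverse[OF _ _ i, of N] by (simp add: cell_runit)
  show "cell (X \<boxtimes> Unit B) (RUnit B X) X N \<star> cell X (InvRUnit B X) (X \<boxtimes> Unit B) N = aid (X \<rhd> N)"
    using assms cell_inverse[OF _ _ i', of N] by simp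
qed (use assms in auto)

text \<open>
  Up to the constraint \<open>(A \<otimes> A') \<rhd> N \<cong> A \<rhd> A' \<rhd> N\<close>, the monad of the tensor product is the composite of the
  two monads, with the braiding as distributive law.
\<close>
lemma mu_tensor:
  assumes "algebraic A" "algebraic A'" "N \<in> Ob \<M>"
  shows "assr (Carrier A) (Carrier A') N \<star> mu (tensor_algebra B A A') N =
    mu A (Carrier A' \<rhd> N) \<star> (Carrier A |> Carrier A |> mu A' N) \<star>
    (Carrier A |> braid (Carrier A') (Carrier A) (Carrier A' \<rhd> N)) \<star>
    assr (Carrier A) (Carrier A') (Carrier A \<rhd> Carrier A' \<rhd> N) \<star>
    ((Carrier A \<boxtimes> Carrier A') |> assr (Carrier A) (Carrier A') N)"
proof -
  let ?A = "Carrier A" and ?A' = "Carrier A'"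
  note [simp] = algebraicD[OF assms(1)] algebraicD[OF assms(2)] assms(3)
  let ?K = "?A \<boxtimes> ?A'" and ?Q = "(?A \<boxtimes> ?A) \<boxtimes> (?A' \<boxtimes> ?A')"
  have [simp]: "Mult A \<boxdot> Mult A' \<in> Hom B ?Q ?K"
    by (simp add: B.tensor_hom)
  have "assr ?A ?A' N \<star> mu (tensor_algebra B A A') N =
      cell (?A \<boxtimes> ?A) (Mult A) ?A (?A' \<rhd> N) \<star>
      (((?A \<boxtimes> ?A) |> cell (?A' \<boxtimes> ?A') (Mult A') ?A' N) \<star> assl ?A ?A ((?A' \<boxtimes> ?A') \<rhd> N)) \<star>
      (?A |> ?A |> assl ?A' ?A' N) \<star> (?A |> braid ?A' ?A (?A' \<rhd> N)) \<star>
      ((?A |> ?A' |> assr ?A ?A' N) \<star> assr ?A ?A' (?K \<rhd> N))"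
    by (simp add: mu_def cell_comp[of _ ?Q] cell_middle_braid
      cell_tensor)
  also have "\<dots> = cell (?A \<boxtimes> ?A) (Mult A) ?A (?A' \<rhd> N) \<star>
      (assl ?A ?A (?A' \<rhd> N) \<star> (?A |> ?A |> cell (?A' \<boxtimes> ?A') (Mult A') ?A' N)) \<star>
      (?A |> ?A |> assl ?A' ?A' N) \<star> (?A |> braid ?A' ?A (?A' \<rhd> N)) \<star>
      (assr ?A ?A' (?A \<rhd> ?A' \<rhd> N) \<star> (?K |> assr ?A ?A' N))"
    by (simp add: assl_whisk assr_whisk)
  finally show ?thesis
    by (simp add: mu_def)
qed

lemma eta_tensor:
  assumes "algebraic A" "algebraic A'" "N \<in> Ob \<M>"
  shows "assr (Carrier A) (Carrier A') N \<star> eta (tensor_algebra B A A') N =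
    eta A (Carrier A' \<rhd> N) \<star> eta A' N"
proof -
  let ?A = "Carrier A" and ?A' = "Carrier A'" and ?I = "Unit B"
  note [simp] = algebraicD[OF assms(1)] algebraicD[OF assms(2)] assms(3)
  have [simp]: "One A \<boxdot> One A' \<in> Hom B (?I \<boxtimes> ?I) (?A \<boxtimes> ?A')"
    by (simp add: B.tensor_hom)
  have "assr ?A ?A' N \<star> eta (tensor_algebra B A A') N =
      cell ?I (One A) ?A (?A' \<rhd> N) \<star> ((?I |> cell ?I (One A') ?A' N) \<star> unt' (?I \<rhd> N)) \<star> unt' N"
    by (simp add: eta_def cell_comp[of _ "?I \<boxtimes> ?I"] cell_inv_lunit cell_tensor)
  also have "(?I |> cell ?I (One A') ?A' N) \<star> unt' (?I \<rhd> N) = unt' (?A' \<rhd> N) \<star> cell ?I (One A') ?A' N"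
  proof (rule cancel_left[of "unt (?A' \<rhd> N)" _ _ "unt' (?A' \<rhd> N)"])
    show "unt (?A' \<rhd> N) \<star> (?I |> cell ?I (One A') ?A' N) \<star> unt' (?I \<rhd> N) =
      unt (?A' \<rhd> N) \<star> unt' (?A' \<rhd> N) \<star> cell ?I (One A') ?A' N"
      by (simp add: acomp_head[OF unt_nat])
  qed auto
  finally show ?thesis
    by (simp add: eta_def)
qed

end

section \<open>Modules over a tensor product of algebras\<close>

context braided_action
begin

text \<open>
  Two commuting actions assemble to an action of the tensor product, as algebras do over a
  composite monad.
\<close>
lemma act_joint:
  assumes "algebraic A" "algebraic A'" "act A N p" "act A' N q"
    "commuting (Carrier A) (Carrier A') N p q"
  shows "act (tensor_algebra B A A') N (joint (Carrier A) (Carrier A') N p q)"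
proof -
  let ?A = "Carrier A" and ?A' = "Carrier A'" and ?K = "Carrier A \<boxtimes> Carrier A'"
  have p: "pact ?A N p" and q: "pact ?A' N q"
    using assms by (auto intro: act_pact)
  note [simp] = algebraicD[OF assms(1)] algebraicD[OF assms(2)] pactD[OF p] pactD[OF q] assms(1,2)
  have pm: "p \<star> mu A N = p \<star> (?A |> p)" and pe: "p \<star> eta A N = aid N"
    and qm: "q \<star> mu A' N = q \<star> (?A' |> q)" and qe: "q \<star> eta A' N = aid N"
    using assms p q by (auto simp: act_iff)
  have c: "p \<star> (?A |> q) \<star> braid ?A' ?A N = q \<star> (?A' |> p)"
    using assms(5) by (simp add: commuting_def)
  have "joint ?A ?A' N p q \<star> mu (tensor_algebra B A A') N =
      p \<star> ((?A |> q) \<star> mu A (?A' \<rhd> N)) \<star> (?A |> ?A |> mu A' N) \<star> (?A |> braid ?A' ?A (?A' \<rhd> N)) \<star>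
      assr ?A ?A' (?A \<rhd> ?A' \<rhd> N) \<star> (?K |> assr ?A ?A' N)"
    by (simp add: joint_def mu_tensor)
  also have "\<dots> = (p \<star> mu A N) \<star> (?A |> ?A |> (q \<star> mu A' N)) \<star> (?A |> braid ?A' ?A (?A' \<rhd> N)) \<star>
      assr ?A ?A' (?A \<rhd> ?A' \<rhd> N) \<star> (?K |> assr ?A ?A' N)"
    by (simp add: mu_nat[symmetric])
  also have "\<dots> = p \<star> (?A |> (p \<star> (?A |> q) \<star> ((?A |> ?A' |> q) \<star> braid ?A' ?A (?A' \<rhd> N)))) \<star>
      assr ?A ?A' (?A \<rhd> ?A' \<rhd> N) \<star> (?K |> assr ?A ?A' N)"
    unfolding pm qm by simp
  also have "\<dots> = p \<star> (?A |> ((p \<star> (?A |> q) \<star> braid ?A' ?A N) \<star> (?A' |> ?A |> q))) \<star>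
      assr ?A ?A' (?A \<rhd> ?A' \<rhd> N) \<star> (?K |> assr ?A ?A' N)"
    by (simp add: braid_whisk)
  also have "\<dots> = p \<star> (?A |> q) \<star> ((?A |> ?A' |> (p \<star> (?A |> q))) \<star> assr ?A ?A' (?A \<rhd> ?A' \<rhd> N)) \<star>
      (?K |> assr ?A ?A' N)"
    unfolding c by simp
  also have "\<dots> = p \<star> (?A |> q) \<star> (assr ?A ?A' N \<star> (?K |> (p \<star> (?A |> q)))) \<star>
      (?K |> assr ?A ?A' N)"
    by (subst assr_whisk[symmetric]) auto
  finally have 1: "joint ?A ?A' N p q \<star> mu (tensor_algebra B A A') N =
      joint ?A ?A' N p q \<star> (?K |> joint ?A ?A' N p q)"
    by (simp add: joint_def)
  have "joint ?A ?A' N p q \<star> eta (tensor_algebra B A A') N =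
      p \<star> ((?A |> q) \<star> eta A (?A' \<rhd> N)) \<star> eta A' N"
    by (simp add: joint_def eta_tensor)
  also have "\<dots> = (p \<star> eta A N) \<star> (q \<star> eta A' N)"
    by (simp add: eta_nat)
  also have "\<dots> = aid N"
    unfolding pe qe by simp
  finally show ?thesis
    using 1 p q by (simp add: act_iff)
qed

lemma eta_pull:
  assumes "algebraic A" "is_arrow p" "src p = M"
  shows "(Carrier A |> p) \<star> eta A M = eta A (trg p) \<star> p"
    and "(Carrier A |> p) \<star> eta A M \<star> r = eta A (trg p) \<star> p \<star> r"
  using eta_nat[OF assms refl] by (simp_all add: acomp_head[OF eta_nat[OF assms refl]])

definition incl_left :: "('o, 'm, 'y) algebra_scheme \<Rightarrow> ('o, 'm, 'z) algebra_scheme \<Rightarrow> 'm" where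
  "incl_left A A' = (Ident B (Carrier A) \<boxdot> One A') \<cdot>\<^bsub>B\<^esub> InvRUnit B (Carrier A)"

definition incl_right :: "('o, 'm, 'y) algebra_scheme \<Rightarrow> ('o, 'm, 'z) algebra_scheme \<Rightarrow> 'm" where
  "incl_right A A' = (One A \<boxdot> Ident B (Carrier A')) \<cdot>\<^bsub>B\<^esub> InvLUnit B (Carrier A')"

lemma incl_hom [simp]:
  assumes "algebraic A" "algebraic A'"
  shows "incl_left A A' \<in> Hom B (Carrier A) (Carrier A \<boxtimes> Carrier A')"
    and "incl_right A A' \<in> Hom B (Carrier A') (Carrier A \<boxtimes> Carrier A')"
proof -
  note [simp] = algebraicD[OF assms(1)] algebraicD[OF assms(2)]
  show "incl_left A A' \<in> Hom B (Carrier A) (Carrier A \<boxtimes> Carrier A')"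
    unfolding incl_left_def
    by (rule B.comp_hom[of _ "Carrier A \<boxtimes> Unit B"]) (simp_all add: B.tensor_hom)
  show "incl_right A A' \<in> Hom B (Carrier A') (Carrier A \<boxtimes> Carrier A')"
    unfolding incl_right_def
    by (rule B.comp_hom[of _ "Unit B \<boxtimes> Carrier A'"]) (simp_all add: B.tensor_hom)
qed

lemma cell_incl:
  assumes "algebraic A" "algebraic A'" "N \<in> Ob \<M>"
  shows "assr (Carrier A) (Carrier A') N \<star>
      cell (Carrier A) (incl_left A A') (Carrier A \<boxtimes> Carrier A') N = Carrier A |> eta A' N"
    and "assr (Carrier A) (Carrier A') N \<star>
      cell (Carrier A') (incl_right A A') (Carrier A \<boxtimes> Carrier A') N = eta A (Carrier A' \<rhd> N)"
proof -
  let ?A = "Carrier A" and ?A' = "Carrier A'"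
  note [simp] = algebraicD[OF assms(1)] algebraicD[OF assms(2)] assms(3)
  have [simp]: "Ident B ?A \<boxdot> One A' \<in> Hom B (?A \<boxtimes> Unit B) (?A \<boxtimes> ?A')"
    "One A \<boxdot> Ident B ?A' \<in> Hom B (Unit B \<boxtimes> ?A') (?A \<boxtimes> ?A')"
    by (simp_all add: B.tensor_hom)
  show "assr ?A ?A' N \<star> cell ?A (incl_left A A') (?A \<boxtimes> ?A') N = ?A |> eta A' N"
    by (simp add: incl_left_def cell_comp[of _ "?A \<boxtimes> Unit B"] cell_inv_runit cell_tensor eta_def)
  show "assr ?A ?A' N \<star> cell ?A' (incl_right A A') (?A \<boxtimes> ?A') N = eta A (?A' \<rhd> N)"
    by (simp add: incl_right_def cell_comp[of _ "Unit B \<boxtimes> ?A'"] cell_inv_lunit cell_tensor eta_def)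
qed

text \<open>
  Conversely an action of the tensor product is recovered from its restrictions to the factors.  All
  four claims come from the multiplicativity of the action by inserting units: in \<open>A \<rhd> A' \<rhd> A \<rhd> A' \<rhd> N\<close>
  two of the four factors are filled by units, and the braiding with a unit is trivial.
\<close>
lemma act_split:
  fixes A :: "('o, 'm, 'y) algebra_scheme" and A' :: "('o, 'm, 'z) algebra_scheme"
  assumes "unital A" "unital A'" "act (tensor_algebra B A A') N r"
  defines "p \<equiv> r \<star> cell (Carrier A) (incl_left A A') (Carrier A \<boxtimes> Carrier A') N"
    and "q \<equiv> r \<star> cell (Carrier A') (incl_right A A') (Carrier A \<boxtimes> Carrier A') N"
  shows "act A N p" "act A' N q" "commuting (Carrier A) (Carrier A') N p q"
    "joint (Carrier A) (Carrier A') N p q = r"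
proof -
  let ?A = "Carrier A" and ?A' = "Carrier A'" and ?K = "Carrier A \<boxtimes> Carrier A'"
  have [simp]: "algebraic A" "algebraic A'"
    using assms by (auto simp: unital_def)
  note [simp] = algebraicD[OF \<open>algebraic A\<close>] algebraicD[OF \<open>algebraic A'\<close>]
  have r: "pact ?K N r"
    using act_pact[OF assms(3)] by simp
  note [simp] = pactD[OF r]
  have u: "mu A M \<star> eta A (?A \<rhd> M) = aid (?A \<rhd> M)" "mu A M \<star> (?A |> eta A M) = aid (?A \<rhd> M)"
    "mu A' M \<star> eta A' (?A' \<rhd> M) = aid (?A' \<rhd> M)" "mu A' M \<star> (?A' |> eta A' M) = aid (?A' \<rhd> M)"
    if "M \<in> Ob \<M>" for M
    using assms(1,2) that by (auto simp: unital_def)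
  define h where "h = r \<star> assl ?A ?A' N"
  have h [simp]: "is_arrow h" "src h = ?A \<rhd> ?A' \<rhd> N" "trg h = N"
    by (simp_all add: h_def)
  have rh: "r = h \<star> assr ?A ?A' N"
    by (simp add: h_def)
  have p: "p = h \<star> (?A |> eta A' N)" and q: "q = h \<star> eta A (?A' \<rhd> N)"
    by (simp_all add: p_def q_def rh cell_incl)
  have pact: "pact ?A N p" "pact ?A' N q"
    by (simp_all add: p q pact_def)
  \<comment> \<open>the action law of the tensor product on \<open>A \<rhd> A' \<rhd> N\<close>, from which everything below is derived\<close>
  have m: "h \<star> (?A |> ?A' |> h) = h \<star> mu A (?A' \<rhd> N) \<star> (?A |> ?A |> mu A' N) \<star> (?A |> braid ?A' ?A (?A' \<rhd> N))"
  proof (rule cancel_right[of _ "assr ?A ?A' (?A \<rhd> ?A' \<rhd> N) \<star> (?K |> assr ?A ?A' N)" _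
        "(?K |> assl ?A ?A' N) \<star> assl ?A ?A' (?A \<rhd> ?A' \<rhd> N)" "?A \<rhd> ?A' \<rhd> ?A \<rhd> ?A' \<rhd> N"])
    have "h \<star> ((?A |> ?A' |> h) \<star> assr ?A ?A' (?A \<rhd> ?A' \<rhd> N)) \<star> (?K |> assr ?A ?A' N) = r \<star> (?K |> r)"
      by (subst assr_whisk[symmetric]) (auto simp: rh)
    also have "\<dots> = r \<star> mu (tensor_algebra B A A') N"
      using assms(3) r act_iff[of "tensor_algebra B A A'" N r] by simp
    finally show "(h \<star> (?A |> ?A' |> h)) \<star> assr ?A ?A' (?A \<rhd> ?A' \<rhd> N) \<star> (?K |> assr ?A ?A' N) =
        (h \<star> mu A (?A' \<rhd> N) \<star> (?A |> ?A |> mu A' N) \<star> (?A |> braid ?A' ?A (?A' \<rhd> N))) \<star>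
        assr ?A ?A' (?A \<rhd> ?A' \<rhd> N) \<star> (?K |> assr ?A ?A' N)"
      by (simp add: rh mu_tensor)
  qed auto
  have e: "h \<star> eta A (?A' \<rhd> N) \<star> eta A' N = aid N"
    using assms(3) r act_iff[of "tensor_algebra B A A'" N r] by (simp add: rh eta_tensor)
  have "p \<star> (?A |> p) = h \<star> (?A |> (eta A' N \<star> h)) \<star> (?A |> ?A |> eta A' N)"
    by (simp add: p)
  also have "\<dots> = (h \<star> (?A |> ?A' |> h)) \<star> (?A |> eta A' (?A \<rhd> ?A' \<rhd> N)) \<star> (?A |> ?A |> eta A' N)"
    by (simp add: eta_nat)
  also have "\<dots> = h \<star> mu A (?A' \<rhd> N) \<star> (?A |> ?A |> mu A' N) \<star>
      (?A |> (braid ?A' ?A (?A' \<rhd> N) \<star> eta A' (?A \<rhd> ?A' \<rhd> N))) \<star> (?A |> ?A |> eta A' N)"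
    unfolding m by simp
  also have "\<dots> = h \<star> mu A (?A' \<rhd> N) \<star> (?A |> ?A |> (mu A' N \<star> eta A' (?A' \<rhd> N))) \<star> (?A |> ?A |> eta A' N)"
    by (simp add: braid_eta_left)
  also have "\<dots> = h \<star> (mu A (?A' \<rhd> N) \<star> (?A |> ?A |> eta A' N))"
    by (simp add: u)
  also have "\<dots> = p \<star> mu A N"
    by (simp add: mu_nat p)
  finally have "p \<star> mu A N = p \<star> (?A |> p)"
    by simp
  moreover have "p \<star> eta A N = h \<star> (eta A (?A' \<rhd> N) \<star> eta A' N)"
    by (simp add: p eta_nat)
  ultimately show "act A N p"
    using pact e by (simp add: act_iff)
  have "q \<star> (?A' |> q) = h \<star> (eta A (?A' \<rhd> N) \<star> (?A' |> h)) \<star> (?A' |> eta A (?A' \<rhd> N))"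
    by (simp add: q)
  also have "\<dots> = (h \<star> (?A |> ?A' |> h)) \<star> eta A (?A' \<rhd> ?A \<rhd> ?A' \<rhd> N) \<star> (?A' |> eta A (?A' \<rhd> N))"
    by (simp add: eta_nat)
  also have "\<dots> = h \<star> mu A (?A' \<rhd> N) \<star> (?A |> ?A |> mu A' N) \<star>
      ((?A |> braid ?A' ?A (?A' \<rhd> N)) \<star> eta A (?A' \<rhd> ?A \<rhd> ?A' \<rhd> N)) \<star> (?A' |> eta A (?A' \<rhd> N))"
    unfolding m by simp
  also have "\<dots> = h \<star> mu A (?A' \<rhd> N) \<star> ((?A |> ?A |> mu A' N) \<star> eta A (?A \<rhd> ?A' \<rhd> ?A' \<rhd> N)) \<star>
      (braid ?A' ?A (?A' \<rhd> N) \<star> (?A' |> eta A (?A' \<rhd> N)))"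
    by (simp add: eta_pull)
  also have "\<dots> = h \<star> (mu A (?A' \<rhd> N) \<star> eta A (?A \<rhd> ?A' \<rhd> N)) \<star> (?A |> mu A' N) \<star> eta A (?A' \<rhd> ?A' \<rhd> N)"
    by (simp add: braid_eta_right eta_pull)
  also have "\<dots> = h \<star> ((?A |> mu A' N) \<star> eta A (?A' \<rhd> ?A' \<rhd> N))"
    by (simp add: u)
  also have "\<dots> = q \<star> mu A' N"
    by (simp add: q eta_nat)
  finally have "q \<star> mu A' N = q \<star> (?A' |> q)"
    by simp
  then show "act A' N q"
    using pact e by (simp add: act_iff q)
  have pq: "p \<star> (?A |> q) = h"
  proof -
    have "p \<star> (?A |> q) = h \<star> (?A |> (eta A' N \<star> h)) \<star> (?A |> eta A (?A' \<rhd> N))"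
      by (simp add: p q)
    also have "\<dots> = (h \<star> (?A |> ?A' |> h)) \<star> (?A |> eta A' (?A \<rhd> ?A' \<rhd> N)) \<star> (?A |> eta A (?A' \<rhd> N))"
      by (simp add: eta_nat)
    also have "\<dots> = h \<star> mu A (?A' \<rhd> N) \<star> (?A |> ?A |> mu A' N) \<star>
        (?A |> (braid ?A' ?A (?A' \<rhd> N) \<star> eta A' (?A \<rhd> ?A' \<rhd> N))) \<star> (?A |> eta A (?A' \<rhd> N))"
      unfolding m by simp
    also have "\<dots> = h \<star> mu A (?A' \<rhd> N) \<star> (?A |> ?A |> (mu A' N \<star> eta A' (?A' \<rhd> N))) \<star> (?A |> eta A (?A' \<rhd> N))"
      by (simp add: braid_eta_left)
    also have "\<dots> = h"
      by (simp add: u)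
    finally show ?thesis .
  qed
  have "q \<star> (?A' |> p) = h \<star> (eta A (?A' \<rhd> N) \<star> (?A' |> h)) \<star> (?A' |> ?A |> eta A' N)"
    by (simp add: p q)
  also have "\<dots> = (h \<star> (?A |> ?A' |> h)) \<star> eta A (?A' \<rhd> ?A \<rhd> ?A' \<rhd> N) \<star> (?A' |> ?A |> eta A' N)"
    by (simp add: eta_nat)
  also have "\<dots> = h \<star> mu A (?A' \<rhd> N) \<star> (?A |> ?A |> mu A' N) \<star>
      ((?A |> braid ?A' ?A (?A' \<rhd> N)) \<star> eta A (?A' \<rhd> ?A \<rhd> ?A' \<rhd> N)) \<star> (?A' |> ?A |> eta A' N)"
    unfolding m by simp
  also have "\<dots> = h \<star> mu A (?A' \<rhd> N) \<star> ((?A |> ?A |> mu A' N) \<star> eta A (?A \<rhd> ?A' \<rhd> ?A' \<rhd> N)) \<star>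
      (braid ?A' ?A (?A' \<rhd> N) \<star> (?A' |> ?A |> eta A' N))"
    by (simp add: eta_pull)
  also have "\<dots> = h \<star> (mu A (?A' \<rhd> N) \<star> eta A (?A \<rhd> ?A' \<rhd> N)) \<star>
      (?A |> (mu A' N \<star> (?A' |> eta A' N))) \<star> braid ?A' ?A N"
    by (simp add: braid_whisk eta_pull)
  also have "\<dots> = h \<star> braid ?A' ?A N"
    by (simp add: u)
  finally show "commuting ?A ?A' N p q"
    by (simp add: commuting_def pq[symmetric])
  show "joint ?A ?A' N p q = r"
    by (simp add: joint_def rh pq[symmetric])
qed

text \<open>
  The tensor powers are unital by induction, so that \<open>act_split\<close> applies to \<open>H\<^sup>n\<^sup>+\<^sup>1 = H\<^sup>n \<otimes> H\<close>.
\<close>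
lemma unital_tensor:
  assumes "unital A" "unital A'"
  shows "unital (tensor_algebra B A A')"
proof -
  let ?A = "Carrier A" and ?A' = "Carrier A'" and ?K = "Carrier A \<boxtimes> Carrier A'"
    and ?T = "tensor_algebra B A A'"
  have [simp]: "algebraic A" "algebraic A'"
    using assms by (auto simp: unital_def)
  note [simp] = algebraicD[OF \<open>algebraic A\<close>] algebraicD[OF \<open>algebraic A'\<close>]
  have u: "mu A M \<star> eta A (?A \<rhd> M) = aid (?A \<rhd> M)" "mu A M \<star> (?A |> eta A M) = aid (?A \<rhd> M)"
    "mu A' M \<star> eta A' (?A' \<rhd> M) = aid (?A' \<rhd> M)" "mu A' M \<star> (?A' |> eta A' M) = aid (?A' \<rhd> M)"
    if "M \<in> Ob \<M>" for M
    using assms(1,2) that by (auto simp: unital_def)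
  have "mu ?T N \<star> eta ?T (?K \<rhd> N) = aid (?K \<rhd> N) \<and> mu ?T N \<star> (?K |> eta ?T N) = aid (?K \<rhd> N)"
    if [simp]: "N \<in> Ob \<M>" for N
  proof
    let ?R = "mu A (?A' \<rhd> N) \<star> (?A |> ?A |> mu A' N) \<star> (?A |> braid ?A' ?A (?A' \<rhd> N))"
    have "assr ?A ?A' N \<star> mu ?T N \<star> eta ?T (?K \<rhd> N) =
        ?R \<star> assr ?A ?A' (?A \<rhd> ?A' \<rhd> N) \<star> ((?K |> assr ?A ?A' N) \<star> eta ?T (?K \<rhd> N))"
      using acomp_head1[OF mu_tensor[of A A' N]] by simp
    also have "\<dots> = ?R \<star> (assr ?A ?A' (?A \<rhd> ?A' \<rhd> N) \<star> eta ?T (?A \<rhd> ?A' \<rhd> N)) \<star> assr ?A ?A' N"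
      using eta_nat[of ?T "assr ?A ?A' N" "?K \<rhd> N" "?A \<rhd> ?A' \<rhd> N"] by simp
    also have "\<dots> = mu A (?A' \<rhd> N) \<star> (?A |> ?A |> mu A' N) \<star>
        ((?A |> braid ?A' ?A (?A' \<rhd> N)) \<star> eta A (?A' \<rhd> ?A \<rhd> ?A' \<rhd> N)) \<star> eta A' (?A \<rhd> ?A' \<rhd> N) \<star> assr ?A ?A' N"
      by (simp add: eta_tensor)
    also have "\<dots> = mu A (?A' \<rhd> N) \<star> ((?A |> ?A |> mu A' N) \<star> eta A (?A \<rhd> ?A' \<rhd> ?A' \<rhd> N)) \<star>
        (braid ?A' ?A (?A' \<rhd> N) \<star> eta A' (?A \<rhd> ?A' \<rhd> N)) \<star> assr ?A ?A' N"
      by (simp add: eta_pull)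
    also have "\<dots> = (mu A (?A' \<rhd> N) \<star> eta A (?A \<rhd> ?A' \<rhd> N)) \<star>
        (?A |> (mu A' N \<star> eta A' (?A' \<rhd> N))) \<star> assr ?A ?A' N"
      by (simp add: braid_eta_left eta_pull)
    also have "\<dots> = assr ?A ?A' N \<star> aid (?K \<rhd> N)"
      by (simp add: u)
    finally show "mu ?T N \<star> eta ?T (?K \<rhd> N) = aid (?K \<rhd> N)"
      by (rule cancel_left[of "assr ?A ?A' N" _ _ "assl ?A ?A' N" "?K \<rhd> N"]) auto
    have "assr ?A ?A' N \<star> mu ?T N \<star> (?K |> eta ?T N) =
        ?R \<star> assr ?A ?A' (?A \<rhd> ?A' \<rhd> N) \<star> (?K |> (assr ?A ?A' N \<star> eta ?T N))"
      using acomp_head1[OF mu_tensor[of A A' N]] by simp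
    also have "\<dots> = ?R \<star> assr ?A ?A' (?A \<rhd> ?A' \<rhd> N) \<star> (?K |> (eta A (?A' \<rhd> N) \<star> eta A' N))"
      by (subst eta_tensor) simp_all
    also have "\<dots> = mu A (?A' \<rhd> N) \<star> (?A |> ?A |> mu A' N) \<star>
        (?A |> (braid ?A' ?A (?A' \<rhd> N) \<star> (?A' |> eta A (?A' \<rhd> N)))) \<star> (?A |> ?A' |> eta A' N) \<star> assr ?A ?A' N"
      using assr_whisk[of ?A ?A' "eta A (?A' \<rhd> N) \<star> eta A' N" N "?A \<rhd> ?A' \<rhd> N"] by simp
    also have "\<dots> = mu A (?A' \<rhd> N) \<star>
        (?A |> ((?A |> mu A' N) \<star> eta A (?A' \<rhd> ?A' \<rhd> N))) \<star> (?A |> ?A' |> eta A' N) \<star> assr ?A ?A' N"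
      by (simp add: braid_eta_right)
    also have "\<dots> = mu A (?A' \<rhd> N) \<star>
        (?A |> (eta A (?A' \<rhd> N) \<star> mu A' N)) \<star> (?A |> ?A' |> eta A' N) \<star> assr ?A ?A' N"
      by (subst eta_pull(1)) simp_all
    also have "\<dots> = (mu A (?A' \<rhd> N) \<star> (?A |> eta A (?A' \<rhd> N))) \<star>
        (?A |> (mu A' N \<star> (?A' |> eta A' N))) \<star> assr ?A ?A' N"
      by simp
    also have "\<dots> = assr ?A ?A' N \<star> aid (?K \<rhd> N)"
      by (simp add: u)
    finally show "mu ?T N \<star> (?K |> eta ?T N) = aid (?K \<rhd> N)"
      by (rule cancel_left[of "assr ?A ?A' N" _ _ "assl ?A ?A' N" "?K \<rhd> N"]) auto
  qed
  then show ?thesis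
    by (simp add: unital_def)
qed

end

section \<open>Modules over tensor powers as lists of actions\<close>

locale hopf_action = braided_action B \<M> E + H: hopf_algebra B H
  for B :: "('o, 'm, 'k::{alg_closed_field, field_char_0}) br_cat"
    and \<M> :: "('p, 'q, 'k, 'o, 'm) mod_cat" (structure)
    and E :: "'o \<Rightarrow> 'p \<Rightarrow> 'q"
    and H :: "('o, 'm) hopf"
begin

notation acomp (infixr "\<star>" 70)
notation whisk (infixr "|>" 80)
notation tensor_B (infixr "\<boxtimes>" 80)
notation tensor_hom_B (infixr "\<boxdot>" 80)

abbreviation "CH \<equiv> Carrier H"
abbreviation "pow n \<equiv> algebra_power B H n"
abbreviation "P n \<equiv> power_ob B H n"

lemma algebraic_H [simp]: "algebraic H"
  using H.carrier_ob H.mult_hom H.one_hom by (simp add: algebraic_def)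

lemmas H_simps [simp] = algebraicD[OF algebraic_H]

lemma comult_hom [simp]: "Comult H \<in> Hom B CH (CH \<boxtimes> CH)"
  and counit_hom [simp]: "Counit H \<in> Hom B CH (Unit B)"
  using H.comult_map H.counit_map by (simp_all add: algebra_map_def unit_algebra_def)

lemma unital_H: "unital H"
proof -
  have 1: "One H \<boxdot> Ident B CH \<in> Hom B (Unit B \<boxtimes> CH) (CH \<boxtimes> CH)"
    "Ident B CH \<boxdot> One H \<in> Hom B (CH \<boxtimes> Unit B) (CH \<boxtimes> CH)"
    by (simp_all add: B.tensor_hom)
  have "mu H N \<star> eta H (CH \<rhd> N) = aid (CH \<rhd> N) \<and> mu H N \<star> (CH |> eta H N) = aid (CH \<rhd> N)"
    if [simp]: "N \<in> Ob \<M>" for N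
  proof
    have "cell (CH \<boxtimes> CH) (Mult H) CH N \<star>
        cell (Unit B \<boxtimes> CH) (One H \<boxdot> Ident B CH) (CH \<boxtimes> CH) N = cell (Unit B \<boxtimes> CH) (LUnit B CH) CH N"
      using 1 H.one_left by (simp add: cell_comp[symmetric])
    then have "(mu H N \<star> cell (Unit B) (One H) CH (CH \<rhd> N) \<star> assr (Unit B) CH N) \<star> assl (Unit B) CH N \<star> unt' (CH \<rhd> N) =
        (unt (CH \<rhd> N) \<star> assr (Unit B) CH N) \<star> assl (Unit B) CH N \<star> unt' (CH \<rhd> N)"
      by (simp add: cell_tensor cell_lunit mu_def)
    then show "mu H N \<star> eta H (CH \<rhd> N) = aid (CH \<rhd> N)"
      by (simp add: eta_def)
    have "cell (CH \<boxtimes> CH) (Mult H) CH N \<star>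
        cell (CH \<boxtimes> Unit B) (Ident B CH \<boxdot> One H) (CH \<boxtimes> CH) N = cell (CH \<boxtimes> Unit B) (RUnit B CH) CH N"
      using 1 H.one_right by (simp add: cell_comp[symmetric])
    then have "(mu H N \<star> (CH |> cell (Unit B) (One H) CH N) \<star> assr CH (Unit B) N) \<star> assl CH (Unit B) N \<star> (CH |> unt' N) =
        ((CH |> unt N) \<star> assr CH (Unit B) N) \<star> assl CH (Unit B) N \<star> (CH |> unt' N)"
      by (simp add: cell_tensor cell_runit mu_def)
    then show "mu H N \<star> (CH |> eta H N) = aid (CH \<rhd> N)"
      by (simp add: eta_def)
  qed
  then show ?thesis
    by (simp add: unital_def)
qed

lemma truncate_sel [simp]:
  "Carrier (algebra.truncate H) = CH" "Mult (algebra.truncate H) = Mult H"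
  "One (algebra.truncate H) = One H"
  by (simp_all add: algebra.truncate_def)

lemma unital_truncate: "unital (algebra.truncate H)"
  using unital_H by (simp add: unital_def algebraic_def mu_def eta_def)

lemma act_truncate [simp]: "act (algebra.truncate H) N p = act H N p"
  by (simp add: act_def)

lemma unit_algebra_sel [simp]:
  "Carrier (unit_algebra B) = Unit B" "Mult (unit_algebra B) = LUnit B (Unit B)"
  "One (unit_algebra B) = Ident B (Unit B)"
  by (simp_all add: unit_algebra_def)

lemma algebraic_unit [simp]: "algebraic (unit_algebra B)"
  by (simp add: algebraic_def)

lemma act_unit: "N \<in> Ob \<M> \<Longrightarrow> act (unit_algebra B) N (unt N)"
  by (simp add: act_def joint_unt_left)

lemma unital_power: "unital (pow (Suc n))"
  by (induction n) (simp_all add: unital_truncate unital_tensor unital_H)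

lemma algebraic_power [simp]: "algebraic (pow n)"
  using unital_power by (cases n) (auto simp: unital_def)

lemmas power_simps [simp] = algebraicD[OF algebraic_power]

text \<open>
  The action of \<open>H\<^sup>n\<close> given by a list of \<open>n\<close> actions of \<open>H\<close>.  The powers are bracketed to the left, hence
  the recursion on the reversed list.  The empty list gives the action of the unit object.
\<close>
fun joint_rev :: "'p \<Rightarrow> ('p, 'q) arrow list \<Rightarrow> ('p, 'q) arrow" where
  "joint_rev N [] = unt N"
| "joint_rev N [x] = x"
| "joint_rev N (y # x # xs) = joint (P (Suc (length xs))) CH N (joint_rev N (x # xs)) y"

definition joint_list :: "'p \<Rightarrow> ('p, 'q) arrow list \<Rightarrow> ('p, 'q) arrow" where
  "joint_list N xs = joint_rev N (rev xs)"

lemma joint_list_Nil [simp]: "joint_list N [] = unt N"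
  and joint_list_single [simp]: "joint_list N [x] = x"
  by (simp_all add: joint_list_def)

lemma joint_list_snoc: "xs \<noteq> [] \<Longrightarrow> joint_list N (xs @ [y]) = joint (P (length xs)) CH N (joint_list N xs) y"
  by (cases xs rule: rev_cases) (simp_all add: joint_list_def)

lemma pow_snoc: "xs \<noteq> [] \<Longrightarrow> pow (length (xs @ [y])) = tensor_algebra B (pow (length xs)) H"
  by (cases xs) simp_all

lemma joint_list_pact: "\<lbrakk>N \<in> Ob \<M>; \<forall>x \<in> set xs. pact CH N x\<rbrakk> \<Longrightarrow> pact (P (length xs)) N (joint_list N xs)"
proof (cases "xs = []")
  case False
  then show "\<forall>x \<in> set xs. pact CH N x \<Longrightarrow> ?thesis"
  proof (induction xs rule: rev_nonempty_induct)
    case (snoc x xs)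
    then show ?case
      using pow_snoc[OF snoc.hyps, of x] by (simp add: joint_list_snoc)
  qed simp
qed simp

lemma joint_list_commuting:
  "\<lbrakk>N \<in> Ob \<M>; \<forall>x \<in> set xs. pact CH N x; pact CH N y; \<forall>x \<in> set xs. commuting CH CH N x y\<rbrakk>
    \<Longrightarrow> commuting (P (length xs)) CH N (joint_list N xs) y"
proof (cases "xs = []")
  case True
  then show "pact CH N y \<Longrightarrow> ?thesis"
    by (simp add: commuting_unt_left)
next
  case False
  then show "\<lbrakk>N \<in> Ob \<M>; \<forall>x \<in> set xs. pact CH N x; pact CH N y; \<forall>x \<in> set xs. commuting CH CH N x y\<rbrakk> \<Longrightarrow> ?thesis"
  proof (induction xs rule: rev_nonempty_induct)
    case (snoc x xs)
    then show ?case
      using pow_snoc[OF snoc.hyps, of x] joint_list_pact[of N xs]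
      by (simp add: joint_list_snoc commuting_joint_left)
  qed simp
qed

text \<open>
  The lists of actions that correspond to modules over tensor powers of \<open>H\<close>.
\<close>
definition comm_acts :: "'p \<Rightarrow> ('p, 'q) arrow list \<Rightarrow> bool" where
  "comm_acts N xs \<longleftrightarrow> N \<in> Ob \<M> \<and> (\<forall>x \<in> set xs. act H N x) \<and> sorted_wrt (commuting CH CH N) xs"

lemma comm_acts_pact: "comm_acts N xs \<Longrightarrow> N \<in> Ob \<M> \<and> (\<forall>x \<in> set xs. pact CH N x)"
  by (auto simp: comm_acts_def act_pact)

lemma comm_acts_act: "comm_acts N xs \<Longrightarrow> act (pow (length xs)) N (joint_list N xs)"
proof (cases "xs = []")
  case True
  then show "comm_acts N xs \<Longrightarrow> ?thesis"
    by (simp add: comm_acts_def act_unit)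
next
  case False
  then show "comm_acts N xs \<Longrightarrow> ?thesis"
  proof (induction xs rule: rev_nonempty_induct)
    case (single x)
    then show ?case
      by (simp add: comm_acts_def)
  next
    case (snoc x xs)
    then have "comm_acts N xs" "act H N x" "\<forall>y \<in> set xs. commuting CH CH N y x"
      by (auto simp: comm_acts_def sorted_wrt_append)
    moreover have "commuting (P (length xs)) CH N (joint_list N xs) x"
      using calculation comm_acts_pact[of N xs] by (intro joint_list_commuting) (auto intro: act_pact)
    ultimately show ?case
      using pow_snoc[OF snoc.hyps, of x] snoc by (simp add: joint_list_snoc act_joint)
  qed
qed

text \<open>
  Inserting the unit of one factor recovers the action of the other.
\<close>
lemma joint_incl:
  assumes "algebraic A" "algebraic A'" "act A N p" "act A' N q"
  shows "joint (Carrier A) (Carrier A') N p q \<star>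
      cell (Carrier A) (incl_left A A') (Carrier A \<boxtimes> Carrier A') N = p"
    and "joint (Carrier A) (Carrier A') N p q \<star>
      cell (Carrier A') (incl_right A A') (Carrier A \<boxtimes> Carrier A') N = q"
proof -
  let ?A = "Carrier A" and ?A' = "Carrier A'"
  have p: "pact ?A N p" and q: "pact ?A' N q"
    using assms by (auto intro: act_pact)
  note [simp] = assms(1,2) pactD[OF p] pactD[OF q]
  have e: "p \<star> eta A N = aid N" "q \<star> eta A' N = aid N"
    using assms p q by (auto simp: act_iff)
  have "p \<star> (?A |> (q \<star> eta A' N)) = p"
    by (simp only: e) simp
  then show "joint ?A ?A' N p q \<star> cell ?A (incl_left A A') (?A \<boxtimes> ?A') N = p"
    by (simp add: joint_def cell_incl)
  have "(p \<star> eta A N) \<star> q = q"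
    by (simp only: e) simp
  then show "joint ?A ?A' N p q \<star> cell ?A' (incl_right A A') (?A \<boxtimes> ?A') N = q"
    by (simp add: joint_def cell_incl eta_pull)
qed

lemma commuting_joint_list:
  assumes "xs \<noteq> []" "comm_acts N xs" "pact CH N y" "commuting (P (length xs)) CH N (joint_list N xs) y"
  shows "\<forall>x \<in> set xs. commuting CH CH N x y"
  using assms
proof (induction xs rule: rev_nonempty_induct)
  case (snoc x xs)
  let ?n = "length xs"
  have g: "comm_acts N xs" and x: "act H N x"
    using snoc.prems by (auto simp: comm_acts_def sorted_wrt_append)
  have xs: "act (pow ?n) N (joint_list N xs)"
    using g by (rule comm_acts_act)
  have pj: "pact (P ?n \<boxtimes> CH) N (joint (P ?n) CH N (joint_list N xs) x)"
    using xs x by (auto intro!: pact_joint dest: act_pact)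
  have c: "commuting (P ?n \<boxtimes> CH) CH N (joint (P ?n) CH N (joint_list N xs) x) y"
    using snoc.prems pow_snoc[OF snoc.hyps, of x] by (simp add: joint_list_snoc snoc.hyps)
  note ji = joint_incl[OF algebraic_power algebraic_H xs x]
  have id: "y \<star> cell CH (Ident B CH) CH N = y"
    using pactD[OF snoc.prems(2)] by simp
  have "commuting (P ?n) CH N (joint_list N xs) y"
    using commuting_cell[OF pj snoc.prems(2) c, of "P ?n" CH "incl_left (pow ?n) H" "Ident B CH"]
    by (simp add: ji id)
  moreover have "commuting CH CH N x y"
    using commuting_cell[OF pj snoc.prems(2) c, of CH CH "incl_right (pow ?n) H" "Ident B CH"]
    by (simp add: ji id)
  ultimately show ?case
    using snoc.IH[OF g snoc.prems(2)] by simp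
qed simp

text \<open>
  Split off the last factor \<open>H\<close> of \<open>H\<^sup>n\<^sup>+\<^sup>1\<close> and induct; the last action commutes with the joint action of
  the others, hence with each of them by \<open>commuting_joint_list\<close>.
\<close>
lemma act_power_obtains:
  assumes "act (pow (Suc n)) N r"
  shows "\<exists>xs. length xs = Suc n \<and> comm_acts N xs \<and> joint_list N xs = r"
  using assms
proof (induction n arbitrary: r)
  case 0
  then show ?case
    using act_pact[OF 0] pactD by (intro exI[of _ "[r]"]) (auto simp: comm_acts_def)
next
  case (Suc n)
  let ?A = "pow (Suc n)"
  from Suc.prems have r: "act (tensor_algebra B ?A H) N r"
    by simp
  note sp = act_split[OF unital_power unital_H r]
  obtain xs where xs: "length xs = Suc n" "comm_acts N xs"
      "joint_list N xs = r \<star> cell (Carrier ?A) (incl_left ?A H) (Carrier ?A \<boxtimes> CH) N"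
    using Suc.IH[OF sp(1)] by blast
  define y where "y = r \<star> cell CH (incl_right ?A H) (Carrier ?A \<boxtimes> CH) N"
  have ne: "xs \<noteq> []"
    using xs(1) by auto
  have y: "act H N y"
    using sp(2) by (simp add: y_def)
  have "\<forall>x \<in> set xs. commuting CH CH N x y"
    using sp(3) xs act_pact[OF y] by (intro commuting_joint_list[OF ne xs(2)]) (simp_all add: y_def)
  then have "comm_acts N (xs @ [y])"
    using xs(2) y by (auto simp: comm_acts_def sorted_wrt_append)
  moreover have "joint_list N (xs @ [y]) = r"
    using sp(4) xs ne by (simp add: joint_list_snoc y_def)
  ultimately show ?case
    using xs(1) by (intro exI[of _ "xs @ [y]"]) simp
qed

lemma tensor_iso:
  assumes "X \<in> Ob B" "X' \<in> Ob B" "Y \<in> Ob B" "is_iso B X X' f"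
  shows "is_iso B (X \<boxtimes> Y) (X' \<boxtimes> Y) (f \<boxdot> Ident B Y)"
proof -
  obtain g where g: "f \<in> Hom B X X'" "g \<in> Hom B X' X" "g \<cdot>\<^bsub>B\<^esub> f = Ident B X" "f \<cdot>\<^bsub>B\<^esub> g = Ident B X'"
    using assms(4) by (auto simp: is_iso_def inverse_pair_def)
  have "inverse_pair B (X \<boxtimes> Y) (X' \<boxtimes> Y) (f \<boxdot> Ident B Y) (g \<boxdot> Ident B Y)"
    using assms g B.tensor_comp[of X Y X' Y X Y f g "Ident B Y" "Ident B Y"]
      B.tensor_comp[of X' Y X Y X' Y g f "Ident B Y" "Ident B Y"] B.ident_left[of Y Y "Ident B Y"]
    by (simp add: inverse_pair_def B.tensor_hom B.tensor_ident)
  then show ?thesis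
    by (auto simp: is_iso_def)
qed

lemma power_join_iso: "is_iso B (P a \<boxtimes> P b) (P (a + b)) (power_join B H a b)"
proof (cases a)
  case 0
  then show ?thesis
    by (simp add: B.lunit_iso)
next
  case (Suc c)
  have one: "is_iso B (P (Suc c) \<boxtimes> P (Suc b)) (P (Suc c + Suc b)) (power_join B H (Suc c) (Suc b))" for b
  proof (induction b)
    case 0
    have "P (Suc (Suc c)) \<in> Ob B"
      by (rule power_simps(1))
    then show ?case
      using B.is_iso_Ident[of "P (Suc (Suc c))"] by simp
  next
    case (Suc b)
    let ?A = "P (Suc c)" and ?C = "P (Suc b)"
    have "is_iso B (?A \<boxtimes> (?C \<boxtimes> CH)) ((?A \<boxtimes> ?C) \<boxtimes> CH) (InvAssoc B ?A ?C CH)"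
      by (intro B.is_iso_Inv B.assoc_iso) (simp_all del: algebra_power.simps)
    moreover have "is_iso B ((?A \<boxtimes> ?C) \<boxtimes> CH) (P (Suc c + Suc b) \<boxtimes> CH)
        (power_join B H (Suc c) (Suc b) \<boxdot> Ident B CH)"
      using Suc by (intro tensor_iso) (simp_all del: algebra_power.simps)
    ultimately have "is_iso B (?A \<boxtimes> (?C \<boxtimes> CH)) (P (Suc c + Suc b) \<boxtimes> CH)
        ((power_join B H (Suc c) (Suc b) \<boxdot> Ident B CH) \<cdot>\<^bsub>B\<^esub> InvAssoc B ?A ?C CH)"
      by (intro B.is_iso_comp[of _ "(?A \<boxtimes> ?C) \<boxtimes> CH"]) (simp_all del: algebra_power.simps)
    then show ?case
      by simp
  qed
  show ?thesis
  proof (cases b)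
    case 0
    then show ?thesis
      using Suc B.runit_iso[of "P (Suc c)"] by (simp del: algebra_power.simps add: algebra_power.simps(1))
  next
    case (Suc d)
    then show ?thesis
      using one[of d] \<open>a = Suc c\<close> by (simp del: algebra_power.simps)
  qed
qed

lemma power_join_inverse:
  "inverse_pair B (P a \<boxtimes> P b) (P (a + b)) (power_join B H a b) (power_split B H a b)"
  unfolding power_split_def by (intro B.inverse_pair_Inv power_join_iso) simp_all

lemma power_join_hom [simp]: "power_join B H a b \<in> Hom B (P a \<boxtimes> P b) (P (a + b))"
  and power_split_hom [simp]: "power_split B H a b \<in> Hom B (P (a + b)) (P a \<boxtimes> P b)"
  using power_join_inverse[of a b] by (simp_all add: inverse_pair_def)

text \<open>
  Concatenation of lists corresponds to the canonical isomorphism \<open>H\<^sup>a \<otimes> H\<^sup>b \<cong> H\<^sup>a\<^sup>+\<^sup>b\<close>.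
\<close>
lemma joint_list_power_join:
  assumes "N \<in> Ob \<M>" "\<forall>x \<in> set xs. pact CH N x" "\<forall>y \<in> set ys. pact CH N y"
  shows "joint_list N (xs @ ys) \<star> cell (P (length xs) \<boxtimes> P (length ys)) (power_join B H (length xs) (length ys))
      (P (length xs + length ys)) N = joint (P (length xs)) (P (length ys)) N (joint_list N xs) (joint_list N ys)"
proof (cases "xs = []")
  case True
  then show ?thesis
    using assms joint_list_pact[of N ys] by (simp add: joint_unt_left)
next
  case xs: False
  then obtain a where a: "length xs = Suc a"
    by (cases xs) auto
  have px: "pact (P (Suc a)) N (joint_list N xs)"
    using joint_list_pact[of N xs] assms a by simp
  show ?thesis
  proof (cases "ys = []")
    case True
    then show ?thesis
      using px a by (simp add: joint_unt_right del: algebra_power.simps add: algebra_power.simps(1))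
  next
    case False
    then show ?thesis
      using assms(3)
    proof (induction ys rule: rev_nonempty_induct)
      case (single y)
      have "pact (P (Suc (Suc a))) N (joint_list N (xs @ [y]))"
        using joint_list_pact[of N "xs @ [y]"] assms single a by simp
      then have "joint_list N (xs @ [y]) \<star> cell (P (Suc (Suc a))) (Ident B (P (Suc (Suc a)))) (P (Suc (Suc a))) N =
          joint_list N (xs @ [y])"
        by (simp add: pactD)
      then show ?case
        using a xs by (simp add: joint_list_snoc)
    next
      case (snoc y ys)
      obtain b where b: "length ys = Suc b"
        using snoc.hyps by (cases ys) auto
      let ?A = "P (Suc a)" and ?C = "P (Suc b)" and ?D = "P (Suc a + Suc b)"
      let ?j = "power_join B H (Suc a) (Suc b)"
      have py: "pact ?C N (joint_list N ys)" "pact CH N y"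
        using joint_list_pact[of N ys] assms(1) snoc.prems b by auto
      have pxy: "pact ?D N (joint_list N (xs @ ys))"
        using joint_list_pact[of N "xs @ ys"] assms(1,2) snoc.prems a b by auto
      have jh: "?j \<in> Hom B (?A \<boxtimes> ?C) ?D"
        by (rule power_join_hom)
      have t: "?j \<boxdot> Ident B CH \<in> Hom B ((?A \<boxtimes> ?C) \<boxtimes> CH) (?D \<boxtimes> CH)"
        using jh by (intro B.tensor_hom) (simp_all del: algebra_power.simps power_join.simps)
      have IH: "joint_list N (xs @ ys) \<star> cell (?A \<boxtimes> ?C) ?j ?D N = joint ?A ?C N (joint_list N xs) (joint_list N ys)"
        using snoc.IH snoc.prems a b by simp
      have id: "y \<star> cell CH (Ident B CH) CH N = y"
        using pactD[OF py(2)] by simp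
      have "joint_list N (xs @ ys @ [y]) \<star> cell (?A \<boxtimes> (?C \<boxtimes> CH))
          ((?j \<boxdot> Ident B CH) \<cdot>\<^bsub>B\<^esub> InvAssoc B ?A ?C CH) (?D \<boxtimes> CH) N =
        (joint ?D CH N (joint_list N (xs @ ys)) y \<star> cell ((?A \<boxtimes> ?C) \<boxtimes> CH) (?j \<boxdot> Ident B CH) (?D \<boxtimes> CH) N) \<star>
          cell (?A \<boxtimes> (?C \<boxtimes> CH)) (InvAssoc B ?A ?C CH) ((?A \<boxtimes> ?C) \<boxtimes> CH) N"
        using t xs assms(1) a b joint_list_snoc[of "xs @ ys" N y]
        by (simp del: algebra_power.simps power_join.simps add: cell_comp[of _ "(?A \<boxtimes> ?C) \<boxtimes> CH"])
      also have "\<dots> = joint (?A \<boxtimes> ?C) CH N (joint ?A ?C N (joint_list N xs) (joint_list N ys)) y \<star>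
          cell (?A \<boxtimes> (?C \<boxtimes> CH)) (InvAssoc B ?A ?C CH) ((?A \<boxtimes> ?C) \<boxtimes> CH) N"
        using jh by (subst joint_cell[OF pxy py(2)]) (simp_all del: algebra_power.simps power_join.simps add: IH[simplified] id)
      also have "\<dots> = joint ?A (?C \<boxtimes> CH) N (joint_list N xs) (joint ?C CH N (joint_list N ys) y)"
        by (rule joint_inv_assoc[OF px py])
      finally show ?case
        using snoc.hyps a b by (simp add: joint_list_snoc)
    qed
  qed
qed

lemma joint_list_power_split:
  assumes "N \<in> Ob \<M>" "\<forall>x \<in> set xs. pact CH N x" "\<forall>y \<in> set ys. pact CH N y"
  shows "joint (P (length xs)) (P (length ys)) N (joint_list N xs) (joint_list N ys) \<star> cell (P (length xs + length ys))
      (power_split B H (length xs) (length ys)) (P (length xs) \<boxtimes> P (length ys)) N = joint_list N (xs @ ys)"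
proof -
  let ?a = "length xs" and ?b = "length ys"
  have i: "inverse_pair B (P (?a + ?b)) (P ?a \<boxtimes> P ?b) (power_split B H ?a ?b) (power_join B H ?a ?b)"
    using power_join_inverse[of ?a ?b] by (simp add: inverse_pair_def)
  have p: "pact (P (?a + ?b)) N (joint_list N (xs @ ys))"
    using joint_list_pact[of N "xs @ ys"] assms by auto
  show ?thesis
    unfolding joint_list_power_join[OF assms, symmetric]
    using cell_inverse[OF _ _ i, of N] assms(1) pactD[OF p] by simp
qed

text \<open>
  A morphism \<open>f : H\<^sup>p \<rightarrow> H\<^sup>q\<close> applied in the middle replaces a segment \<open>zs'\<close> of the list by any segment \<open>zs\<close>
  whose joint action is that of \<open>zs'\<close> restricted along \<open>f\<close>.
\<close>
lemma pad_hom: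
  assumes "f \<in> Hom B (P p) (P q)"
  shows "pad B H a p q f b \<in> Hom B (P (a + p + b)) (P (a + q + b))"
    and joint_list_pad: "\<lbrakk>N \<in> Ob \<M>; \<forall>x \<in> set xs \<union> set zs \<union> set zs' \<union> set ys. pact CH N x; length xs = a;
        length zs = p; length zs' = q; length ys = b; joint_list N zs' \<star> cell (P p) f (P q) N = joint_list N zs\<rbrakk>
      \<Longrightarrow> joint_list N (xs @ zs' @ ys) \<star> cell (P (a + p + b)) (pad B H a p q f b) (P (a + q + b)) N =
        joint_list N (xs @ zs @ ys)"
proof -
  let ?b = "P b" and ?a = "P a"
  let ?f1 = "power_split B H (a + p) b" and ?X1 = "P (a + p) \<boxtimes> ?b"
  let ?f2 = "power_split B H a p \<boxdot> Ident B ?b" and ?X2 = "(?a \<boxtimes> P p) \<boxtimes> ?b"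
  let ?f3 = "(Ident B ?a \<boxdot> f) \<boxdot> Ident B ?b" and ?X3 = "(?a \<boxtimes> P q) \<boxtimes> ?b"
  let ?f4 = "power_join B H a q \<boxdot> Ident B ?b" and ?X4 = "P (a + q) \<boxtimes> ?b"
  let ?f5 = "power_join B H (a + q) b" and ?S = "P (a + p + b)" and ?T = "P (a + q + b)"
  have f3': "Ident B ?a \<boxdot> f \<in> Hom B (?a \<boxtimes> P p) (?a \<boxtimes> P q)"
    using assms by (intro B.tensor_hom) simp_all
  have f1: "?f1 \<in> Hom B ?S ?X1" and f2: "?f2 \<in> Hom B ?X1 ?X2" and f3: "?f3 \<in> Hom B ?X2 ?X3"
    and f4: "?f4 \<in> Hom B ?X3 ?X4" and f5: "?f5 \<in> Hom B ?X4 ?T"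
    using f3' by (simp_all add: B.tensor_hom)
  have g2: "?f2 \<cdot>\<^bsub>B\<^esub> ?f1 \<in> Hom B ?S ?X2"
    by (rule B.comp_hom[OF _ _ _ f1 f2]) simp_all
  have g3: "?f3 \<cdot>\<^bsub>B\<^esub> ?f2 \<cdot>\<^bsub>B\<^esub> ?f1 \<in> Hom B ?S ?X3"
    by (rule B.comp_hom[OF _ _ _ g2 f3]) simp_all
  have g4: "?f4 \<cdot>\<^bsub>B\<^esub> ?f3 \<cdot>\<^bsub>B\<^esub> ?f2 \<cdot>\<^bsub>B\<^esub> ?f1 \<in> Hom B ?S ?X4"
    by (rule B.comp_hom[OF _ _ _ g3 f4]) simp_all
  show "pad B H a p q f b \<in> Hom B ?S ?T"
    unfolding pad_def by (rule B.comp_hom[OF _ _ _ g4 f5]) simp_all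
  assume N: "N \<in> Ob \<M>" and x: "\<forall>x \<in> set xs \<union> set zs \<union> set zs' \<union> set ys. pact CH N x"
    and l: "length xs = a" "length zs = p" "length zs' = q" "length ys = b"
    and z: "joint_list N zs' \<star> cell (P p) f (P q) N = joint_list N zs"
  have pa: "pact ?a N (joint_list N xs)" "pact (P p) N (joint_list N zs)" "pact (P q) N (joint_list N zs')" "pact ?b N (joint_list N ys)"
    "pact (P (a + q)) N (joint_list N (xs @ zs'))" "pact (P (a + p)) N (joint_list N (xs @ zs))"
    using x l joint_list_pact[OF N, of xs] joint_list_pact[OF N, of zs] joint_list_pact[OF N, of zs'] joint_list_pact[OF N, of ys]
      joint_list_pact[OF N, of "xs @ zs'"] joint_list_pact[OF N, of "xs @ zs"] by auto
  have id: "joint_list N ys \<star> cell ?b (Ident B ?b) ?b N = joint_list N ys" "joint_list N xs \<star> cell ?a (Ident B ?a) ?a N = joint_list N xs"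
    using pactD[OF pa(4)] pactD[OF pa(1)] by simp_all
  have 5: "joint_list N (xs @ zs' @ ys) \<star> cell ?X4 ?f5 ?T N = joint (P (a + q)) ?b N (joint_list N (xs @ zs')) (joint_list N ys)"
    using joint_list_power_join[OF N, of "xs @ zs'" ys] x l by auto
  have 4: "joint (P (a + q)) ?b N (joint_list N (xs @ zs')) (joint_list N ys) \<star> cell ?X3 ?f4 ?X4 N =
      joint (?a \<boxtimes> P q) ?b N (joint ?a (P q) N (joint_list N xs) (joint_list N zs')) (joint_list N ys)"
    using joint_list_power_join[OF N, of xs zs'] x l by (subst joint_cell[OF pa(5,4)]) (auto simp: id)
  have 3: "joint (?a \<boxtimes> P q) ?b N (joint ?a (P q) N (joint_list N xs) (joint_list N zs')) (joint_list N ys) \<star> cell ?X2 ?f3 ?X3 N =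
      joint (?a \<boxtimes> P p) ?b N (joint ?a (P p) N (joint_list N xs) (joint_list N zs)) (joint_list N ys)"
    using f3' assms pa joint_cell[OF pa(1,3), of ?a "P p" "Ident B ?a" f]
    by (subst joint_cell[OF pact_joint[OF pa(1,3)] pa(4)]) (auto simp: id z)
  have 2: "joint (?a \<boxtimes> P p) ?b N (joint ?a (P p) N (joint_list N xs) (joint_list N zs)) (joint_list N ys) \<star> cell ?X1 ?f2 ?X2 N =
      joint (P (a + p)) ?b N (joint_list N (xs @ zs)) (joint_list N ys)"
    using joint_list_power_split[OF N, of xs zs] x l by (subst joint_cell[OF pact_joint[OF pa(1,2)] pa(4)]) (auto simp: id)
  have 1: "joint (P (a + p)) ?b N (joint_list N (xs @ zs)) (joint_list N ys) \<star> cell ?S ?f1 ?X1 N = joint_list N (xs @ zs @ ys)"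
    using joint_list_power_split[OF N, of "xs @ zs" ys] x l by auto
  have "cell ?S (pad B H a p q f b) ?T N =
      cell ?X4 ?f5 ?T N \<star> cell ?X3 ?f4 ?X4 N \<star> cell ?X2 ?f3 ?X3 N \<star> cell ?X1 ?f2 ?X2 N \<star> cell ?S ?f1 ?X1 N"
    unfolding pad_def using f1 f2 f3 f4 f5 g2 g3 g4 N
    by (simp add: cell_comp[of ?S ?X4 ?T] cell_comp[of ?S ?X3 ?X4] cell_comp[of ?S ?X2 ?X3]
      cell_comp[of ?S ?X1 ?X2])
  then show "joint_list N (xs @ zs' @ ys) \<star> cell ?S (pad B H a p q f b) ?T N = joint_list N (xs @ zs @ ys)"
    by (simp only: 1 2 3 4 5 acomp_head1[OF 2] acomp_head1[OF 3] acomp_head1[OF 4] acomp_head1[OF 5])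
qed

lemma joint_list_Ea:
  assumes "N \<in> Ob \<M>" "xs \<noteq> []" "\<forall>x \<in> set xs. pact CH N x"
  shows "joint_list N xs \<star> Ea (P (length xs)) N = joint_list N (map (\<lambda>x. x \<star> Ea CH N) xs)"
  using assms(2,3)
proof (induction xs rule: rev_nonempty_induct)
  case (snoc x xs)
  then have "pact (P (length xs)) N (joint_list N xs)" "pact CH N x"
    using joint_list_pact[OF assms(1)] by auto
  then show ?case
    using snoc pow_snoc[OF snoc.hyps, of x] by (simp add: joint_list_snoc joint_Ea)
qed simp

text \<open>
  The operations on actions behind the three kinds of generators: the diagonal action of two
  commuting actions, the action through the counit, and the twist by \<open>E\<close>.
\<close>
definition merge :: "'p \<Rightarrow> ('p, 'q) arrow \<Rightarrow> ('p, 'q) arrow \<Rightarrow> ('p, 'q) arrow" where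
  "merge N x y = joint CH CH N x y \<star> cell CH (Comult H) (CH \<boxtimes> CH) N"

definition trivial :: "'p \<Rightarrow> ('p, 'q) arrow" where
  "trivial N = unt N \<star> cell CH (Counit H) (Unit B) N"

definition twist :: "'p \<Rightarrow> ('p, 'q) arrow \<Rightarrow> ('p, 'q) arrow" where
  "twist N x = x \<star> Ea CH N"

lemma pact_merge [simp]: "\<lbrakk>pact CH N x; pact CH N y\<rbrakk> \<Longrightarrow> pact CH N (merge N x y)"
  by (simp add: merge_def)

lemma pact_trivial [simp]: "N \<in> Ob \<M> \<Longrightarrow> pact CH N (trivial N)"
  by (simp add: trivial_def)

lemma pact_twist [simp]: "pact CH N x \<Longrightarrow> pact CH N (twist N x)"
  by (simp add: twist_def)

lemma act_merge:
  "\<lbrakk>act H N x; act H N y; commuting CH CH N x y\<rbrakk> \<Longrightarrow> act H N (merge N x y)"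
  using act_restrict[OF algebraic_H _ H.comult_map act_joint[of H H N x y]] by (simp add: merge_def)

lemma act_trivial: "N \<in> Ob \<M> \<Longrightarrow> act H N (trivial N)"
  using act_restrict[OF algebraic_H _ H.counit_map act_unit, of N] by (simp add: trivial_def)

lemma act_twist: "act H N x \<Longrightarrow> act H N (twist N x)"
  by (simp add: twist_def act_Ea)

lemma cell_Ident_right: "pact X N p \<Longrightarrow> p \<star> cell X (Ident B X) X N = p"
  by (simp add: pactD)

lemma commuting_merge_left:
  "\<lbrakk>pact CH N x; pact CH N y; pact CH N z; commuting CH CH N x z; commuting CH CH N y z\<rbrakk>
    \<Longrightarrow> commuting CH CH N (merge N x y) z"
  using commuting_cell[OF pact_joint[of CH N x CH y] _ commuting_joint_left[of CH N x CH y CH z],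
      of CH CH "Comult H" "Ident B CH"]
  by (simp add: merge_def cell_Ident_right)

lemma commuting_merge_right:
  "\<lbrakk>pact CH N x; pact CH N y; pact CH N z; commuting CH CH N z x; commuting CH CH N z y\<rbrakk>
    \<Longrightarrow> commuting CH CH N z (merge N x y)"
  using commuting_cell[OF _ pact_joint[of CH N x CH y] commuting_joint_right[of CH N z CH x CH y],
      of CH CH "Ident B CH" "Comult H"]
  by (simp add: merge_def cell_Ident_right)

lemma commuting_trivial_left: "pact CH N z \<Longrightarrow> commuting CH CH N (trivial N) z"
  using commuting_cell[OF _ _ commuting_unt_left, of N CH z CH CH "Counit H" "Ident B CH"]
  by (simp add: trivial_def cell_Ident_right pactD)

lemma commuting_trivial_right: "pact CH N z \<Longrightarrow> commuting CH CH N z (trivial N)"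
  using commuting_cell[OF _ _ commuting_unt_right, of CH N z CH CH "Ident B CH" "Counit H"]
  by (simp add: trivial_def cell_Ident_right pactD)

lemma commuting_twist_last:
  "\<lbrakk>pact CH N x; pact CH N y; commuting CH CH N x y\<rbrakk> \<Longrightarrow> commuting CH CH N (twist N y) x"
  by (simp add: twist_def commuting_twist)

text \<open>
  Coassociativity of \<open>H\<close>, as joint actions are associative.
\<close>
lemma merge_assoc:
  assumes "pact CH N x" "pact CH N y" "pact CH N z"
  shows "merge N (merge N x y) z = merge N x (merge N y z)"
proof -
  let ?D = "Comult H" and ?HH = "CH \<boxtimes> CH"
  note [simp] = pactD[OF assms(1)] pactD[OF assms(3)]
  have t: "?D \<boxdot> Ident B CH \<in> Hom B ?HH (?HH \<boxtimes> CH)" "Ident B CH \<boxdot> ?D \<in> Hom B ?HH (CH \<boxtimes> ?HH)"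
    by (simp_all add: B.tensor_hom)
  have t2: "(?D \<boxdot> Ident B CH) \<cdot>\<^bsub>B\<^esub> ?D \<in> Hom B CH (?HH \<boxtimes> CH)"
    by (rule B.comp_hom[OF _ _ _ _ t(1)]) simp_all
  have pj: "pact ?HH N (joint CH CH N x y)" "pact ?HH N (joint CH CH N y z)"
    using assms by simp_all
  have co: "cell (?HH \<boxtimes> CH) (Assoc B CH CH CH) (CH \<boxtimes> ?HH) N \<star>
      cell ?HH (?D \<boxdot> Ident B CH) (?HH \<boxtimes> CH) N \<star> cell CH ?D ?HH N =
      cell ?HH (Ident B CH \<boxdot> ?D) (CH \<boxtimes> ?HH) N \<star> cell CH ?D ?HH N"
    using H.coassoc t t2 by (simp add: cell_comp[symmetric])
  have "merge N (merge N x y) z = joint ?HH CH N (joint CH CH N x y) z \<star>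
      cell ?HH (?D \<boxdot> Ident B CH) (?HH \<boxtimes> CH) N \<star> cell CH ?D ?HH N"
    by (simp add: merge_def acomp_head1[OF joint_cell[OF pj(1) assms(3), of CH CH ?D "Ident B CH"]] cell_Ident_right[OF assms(3)])
  also have "\<dots> = joint CH ?HH N x (joint CH CH N y z) \<star>
      cell ?HH (Ident B CH \<boxdot> ?D) (CH \<boxtimes> ?HH) N \<star> cell CH ?D ?HH N"
    unfolding joint_assoc[OF assms, symmetric] by (simp add: co)
  also have "\<dots> = merge N x (merge N y z)"
    by (simp add: merge_def acomp_head1[OF joint_cell[OF assms(1) pj(2), of CH CH "Ident B CH" ?D]] cell_Ident_right[OF assms(1)])
  finally show ?thesis .
qed

lemma merge_trivial:
  assumes "pact CH N x"
  shows "merge N (trivial N) x = x" "merge N x (trivial N) = x"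
proof -
  let ?D = "Comult H" and ?HH = "CH \<boxtimes> CH" and ?e = "Counit H"
  note [simp] = pactD[OF assms]
  have t: "?e \<boxdot> Ident B CH \<in> Hom B ?HH (Unit B \<boxtimes> CH)" "Ident B CH \<boxdot> ?e \<in> Hom B ?HH (CH \<boxtimes> Unit B)"
    by (simp_all add: B.tensor_hom)
  have t2: "(?e \<boxdot> Ident B CH) \<cdot>\<^bsub>B\<^esub> ?D \<in> Hom B CH (Unit B \<boxtimes> CH)"
    "(Ident B CH \<boxdot> ?e) \<cdot>\<^bsub>B\<^esub> ?D \<in> Hom B CH (CH \<boxtimes> Unit B)"
    by (rule B.comp_hom[OF _ _ _ _ t(1)], simp_all) (rule B.comp_hom[OF _ _ _ _ t(2)], simp_all)
  have l: "cell (Unit B \<boxtimes> CH) (LUnit B CH) CH N \<star> cell ?HH (?e \<boxdot> Ident B CH) (Unit B \<boxtimes> CH) N \<star>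
      cell CH ?D ?HH N = aid (CH \<rhd> N)"
    using H.counit_left t t2 by (simp add: cell_comp[symmetric])
  have r: "cell (CH \<boxtimes> Unit B) (RUnit B CH) CH N \<star> cell ?HH (Ident B CH \<boxdot> ?e) (CH \<boxtimes> Unit B) N \<star>
      cell CH ?D ?HH N = aid (CH \<rhd> N)"
    using H.counit_right t t2 by (simp add: cell_comp[symmetric])
  have "merge N (trivial N) x = joint (Unit B) CH N (unt N) x \<star>
      cell ?HH (?e \<boxdot> Ident B CH) (Unit B \<boxtimes> CH) N \<star> cell CH ?D ?HH N"
    by (simp add: merge_def trivial_def acomp_head1[OF joint_cell[OF pact_unt assms, of CH CH ?e "Ident B CH"]] cell_Ident_right[OF assms])
  then show "merge N (trivial N) x = x"
    by (simp add: joint_unt_left[OF assms] l)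
  have "merge N x (trivial N) = joint CH (Unit B) N x (unt N) \<star>
      cell ?HH (Ident B CH \<boxdot> ?e) (CH \<boxtimes> Unit B) N \<star> cell CH ?D ?HH N"
    by (simp add: merge_def trivial_def acomp_head1[OF joint_cell[OF assms pact_unt, of CH CH "Ident B CH" ?e]] cell_Ident_right[OF assms])
  then show "merge N x (trivial N) = x"
    by (simp add: joint_unt_right[OF assms] r)
qed

text \<open>
  \<open>E\<close> is natural along the comultiplication and splits on \<open>H \<otimes> H\<close>.
\<close>
lemma twist_merge:
  assumes "pact CH N x" "pact CH N y"
  shows "merge N (twist N x) (twist N y) = twist N (merge N x y)"
proof -
  note [simp] = pactD[OF assms(1)]
  have "twist N (merge N x y) = (joint CH CH N x y \<star> Ea (CH \<boxtimes> CH) N) \<star> cell CH (Comult H) (CH \<boxtimes> CH) N"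
    by (simp add: twist_def merge_def Ea_cell)
  then show ?thesis
    by (simp only: joint_Ea[OF assms] twist_def merge_def)
qed

lemma twist_trivial: "N \<in> Ob \<M> \<Longrightarrow> twist N (trivial N) = trivial N"
  by (simp add: twist_def trivial_def Ea_cell[symmetric] Ea_unit)

end

section \<open>The face, degeneracy and cyclic functors on lists of actions\<close>

context braided_action
begin

lemma is_module_iff_act:
  assumes "algebraic A" "pact (Carrier A) N p"
  shows "is_module B \<M> A (N, mor p) \<longleftrightarrow> act A N p"
proof -
  let ?A = "Carrier A"
  note [simp] = algebraicD[OF assms(1)] pactD[OF assms(2)]
  have m: "mor p \<in> Hom \<M> (?A \<rhd> N) N"
    using is_arrowD(3)[of p] by simp
  have "p \<star> cell (?A \<boxtimes> ?A) (Mult A) ?A N = joint ?A ?A N p p \<longleftrightarrow>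
      mor (p \<star> cell (?A \<boxtimes> ?A) (Mult A) ?A N) = mor (joint ?A ?A N p p)"
    by (auto intro!: arrow_eqI simp: joint_def)
  moreover have "p \<star> cell (Unit B) (One A) ?A N = unt N \<longleftrightarrow>
      mor (p \<star> cell (Unit B) (One A) ?A N) = mor (unt N)"
    by (auto intro!: arrow_eqI)
  ultimately show ?thesis
    using assms(2) m by (simp add: is_module_def act_def joint_def mor_acomp mor_simps)
qed

lemma is_module_obtains:
  assumes "algebraic A" "is_module B \<M> A X"
  shows "\<exists>N p. X = (N, mor p) \<and> act A N p"
proof -
  obtain N \<rho> where X: "X = (N, \<rho>)"
    by fastforce
  let ?p = "arrow (Carrier A \<rhd> N) \<rho> N"
  have "pact (Carrier A) N ?p"
    using assms X algebraicD[OF assms(1)] by (auto simp: is_module_def pact_def)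
  then have "act A N ?p"
    using is_module_iff_act[OF assms(1), of N ?p] assms(2) X by simp
  then show ?thesis
    using X by (intro exI[of _ N] exI[of _ ?p]) simp
qed

lemma Mod_sel [simp]:
  "Ob (Mod B \<M> A) = {X. is_module B \<M> A X}"
  "Ident (Mod B \<M> A) X = Ident \<M> (fst X)"
  "Compose (Mod B \<M> A) = Compose \<M>"
  "Add (Mod B \<M> A) = Add \<M>"
  "Scale (Mod B \<M> A) = Scale \<M>"
  "Zero (Mod B \<M> A) X Y = Zero \<M> (fst X) (fst Y)"
  by (simp_all add: Mod_def case_prod_beta)

lemma Mod_Hom:
  "u \<in> Hom (Mod B \<M> A) X Y \<longleftrightarrow> u \<in> Hom \<M> (fst X) (fst Y) \<and>
    u \<cdot> snd X = snd Y \<cdot> (Ident B (Carrier A) \<bullet> u)"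
  by (simp add: Mod_def case_prod_beta)

text \<open>
  A zero morphism has the form \<open>f + (-1) f\<close>, so bilinear operations preserve it.
\<close>
lemma comp_zero:
  assumes "X \<in> Ob \<M>" "Y \<in> Ob \<M>" "Z \<in> Ob \<M>"
  shows "f \<in> Hom \<M> X Y \<Longrightarrow> Zero \<M> Y Z \<cdot> f = Zero \<M> X Z"
    and "f \<in> Hom \<M> Y Z \<Longrightarrow> f \<cdot> Zero \<M> X Y = Zero \<M> X Z"
proof -
  have z: "Zero \<M> Y Z \<in> Hom \<M> Y Z" "Zero \<M> X Y \<in> Hom \<M> X Y"
    using assms zero_hom by auto
  assume f: "f \<in> Hom \<M> X Y"
  have "Zero \<M> Y Z \<cdot> f = Add \<M> (Zero \<M> Y Z) (Scale \<M> (-1) (Zero \<M> Y Z)) \<cdot> f"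
    using add_minus[of Y Z "Zero \<M> Y Z"] assms z by simp
  also have "\<dots> = Add \<M> (Zero \<M> Y Z \<cdot> f) (Scale \<M> (-1) (Zero \<M> Y Z \<cdot> f))"
    using assms z f scale_hom[of Y Z "Zero \<M> Y Z" "-1"]
    by (simp add: comp_add_left[of X Y Z] comp_scale_left[of X Y Z])
  also have "\<dots> = Zero \<M> X Z"
    using assms z f comp_hom[of X Y Z f "Zero \<M> Y Z"] by (intro add_minus) auto
  finally show "Zero \<M> Y Z \<cdot> f = Zero \<M> X Z" .
next
  have z: "Zero \<M> Y Z \<in> Hom \<M> Y Z" "Zero \<M> X Y \<in> Hom \<M> X Y"
    using assms zero_hom by auto
  assume f: "f \<in> Hom \<M> Y Z"
  have "f \<cdot> Zero \<M> X Y = f \<cdot> Add \<M> (Zero \<M> X Y) (Scale \<M> (-1) (Zero \<M> X Y))"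
    using add_minus[of X Y "Zero \<M> X Y"] assms z by simp
  also have "\<dots> = Add \<M> (f \<cdot> Zero \<M> X Y) (Scale \<M> (-1) (f \<cdot> Zero \<M> X Y))"
    using assms z f scale_hom[of X Y "Zero \<M> X Y" "-1"]
    by (simp add: comp_add_right[of X Y Z] comp_scale_right[of X Y Z])
  also have "\<dots> = Zero \<M> X Z"
    using assms z f comp_hom[of X Y Z "Zero \<M> X Y" f] by (intro add_minus) auto
  finally show "f \<cdot> Zero \<M> X Y = Zero \<M> X Z" .
qed

lemma act_zero:
  assumes "X \<in> Ob B" "M \<in> Ob \<M>" "N \<in> Ob \<M>"
  shows "Ident B X \<bullet> Zero \<M> M N = Zero \<M> (X \<rhd> M) (X \<rhd> N)"
proof -
  have z: "Zero \<M> M N \<in> Hom \<M> M N"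
    using assms zero_hom by auto
  have "Ident B X \<bullet> Zero \<M> M N = Ident B X \<bullet> Add \<M> (Zero \<M> M N) (Scale \<M> (-1) (Zero \<M> M N))"
    using add_minus[of M N "Zero \<M> M N"] assms z by simp
  also have "\<dots> = Add \<M> (Ident B X \<bullet> Zero \<M> M N) (Scale \<M> (-1) (Ident B X \<bullet> Zero \<M> M N))"
    using assms z scale_hom[of M N "Zero \<M> M N" "-1"]
    by (simp add: act_add_right[of X X M N] act_scale_right[of X X M N])
  also have "\<dots> = Zero \<M> (X \<rhd> M) (X \<rhd> N)"
    using assms z act_hom[of X X M N "Ident B X" "Zero \<M> M N"] by (intro add_minus) auto
  finally show ?thesis .
qed

lemma linear_category_Mod:
  assumes A: "Carrier A \<in> Ob B"
  shows "linear_category (Mod B \<M> A)"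
proof -
  let ?A = "Carrier A"
  have ob: "fst X \<in> Ob \<M>" "snd X \<in> Hom \<M> (?A \<rhd> fst X) (fst X)" if "is_module B \<M> A X" for X
    using that by (auto simp: is_module_def case_prod_beta)
  have iu: "Ident B ?A \<bullet> u \<in> Hom \<M> (?A \<rhd> M) (?A \<rhd> N)"
    if "M \<in> Ob \<M>" "N \<in> Ob \<M>" "u \<in> Hom \<M> M N" for M N u
    using act_hom[of ?A ?A M N "Ident B ?A" u] that A by simp
  show ?thesis
  proof (unfold_locales, unfold Mod_sel mem_Collect_eq Mod_Hom, goal_cases)
    case (1 X)
    then show ?case
      using ob[of X] A act_ident[of ?A "fst X"] ident_left[of "?A \<rhd> fst X" "fst X" "snd X"]
        ident_right[of "?A \<rhd> fst X" "fst X" "snd X"] by simp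
  next
    case (2 X Y Z f g)
    note o = ob[OF 2(1)] ob[OF 2(2)] ob[OF 2(3)]
    have "(g \<cdot> f) \<cdot> snd X = (snd Z \<cdot> (Ident B ?A \<bullet> g)) \<cdot> (Ident B ?A \<bullet> f)"
      using 2 o A iu comp_assoc[of "?A \<rhd> fst X" "fst X" "fst Y" "fst Z" "snd X" f g]
        comp_assoc[of "?A \<rhd> fst X" "?A \<rhd> fst Y" "fst Y" "fst Z" "Ident B ?A \<bullet> f" "snd Y" g] by simp
    also have "\<dots> = snd Z \<cdot> (Ident B ?A \<bullet> (g \<cdot> f))"
      using 2 o A iu act_comp[of ?A ?A ?A "fst X" "fst Y" "fst Z" "Ident B ?A" "Ident B ?A" f g]
        comp_assoc[of "?A \<rhd> fst X" "?A \<rhd> fst Y" "?A \<rhd> fst Z" "fst Z" "Ident B ?A \<bullet> f" "Ident B ?A \<bullet> g" "snd Z"]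
        B.ident_left[of ?A ?A "Ident B ?A"] by simp
    finally show ?case
      using 2 o comp_hom[of "fst X" "fst Y" "fst Z" f g] by simp
  next
    case (3 X Y f)
    then show ?case
      using ob[OF 3(1)] ob[OF 3(2)] ident_left by blast
  next
    case (4 X Y f)
    then show ?case
      using ob[OF 4(1)] ob[OF 4(2)] ident_right by blast
  next
    case (5 W X Y Z f g h)
    then show ?case
      using ob[OF 5(1)] ob[OF 5(2)] ob[OF 5(3)] ob[OF 5(4)] comp_assoc by blast
  next
    case (6 X Y)
    then show ?case
      using ob[OF 6(1)] ob[OF 6(2)] A zero_hom by (simp add: act_zero comp_zero[of "?A \<rhd> fst X"])
  next
    case (7 X Y f g)
    then show ?case
      using ob[OF 7(1)] ob[OF 7(2)] A iu
      by (simp add: add_hom act_add_right[of ?A ?A "fst X" "fst Y"]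
        comp_add_left[of "?A \<rhd> fst X" "fst X" "fst Y"]
        comp_add_right[of "?A \<rhd> fst X" "?A \<rhd> fst Y" "fst Y"])
  next
    case (8 X Y f a)
    then show ?case
      using ob[OF 8(1)] ob[OF 8(2)] A iu
      by (simp add: scale_hom act_scale_right[of ?A ?A "fst X" "fst Y"]
        comp_scale_left[of "?A \<rhd> fst X" "fst X" "fst Y"]
        comp_scale_right[of "?A \<rhd> fst X" "?A \<rhd> fst Y" "fst Y"])
  next
    case (9 X Y f g h)
    then show ?case using ob[OF 9(1)] ob[OF 9(2)] add_assoc by blast
  next
    case (10 X Y f g)
    then show ?case using ob[OF 10(1)] ob[OF 10(2)] add_comm by blast
  next
    case (11 X Y f)
    then show ?case using ob[OF 11(1)] ob[OF 11(2)] add_zero by blast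
  next
    case (12 X Y f)
    then show ?case using ob[OF 12(1)] ob[OF 12(2)] add_minus by blast
  next
    case (13 X Y f)
    then show ?case using ob[OF 13(1)] ob[OF 13(2)] scale_one by blast
  next
    case (14 X Y f a b)
    then show ?case using ob[OF 14(1)] ob[OF 14(2)] scale_mult by blast
  next
    case (15 X Y f a b)
    then show ?case using ob[OF 15(1)] ob[OF 15(2)] scale_add_left by blast
  next
    case (16 X Y f g a)
    then show ?case using ob[OF 16(1)] ob[OF 16(2)] scale_add_right by blast
  next
    case (17 X Y Z f g g')
    then show ?case using ob[OF 17(1)] ob[OF 17(2)] ob[OF 17(3)] comp_add_left by blast
  next
    case (18 X Y Z f f' g)
    then show ?case using ob[OF 18(1)] ob[OF 18(2)] ob[OF 18(3)] comp_add_right by blast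
  next
    case (19 X Y Z f g a)
    then show ?case using ob[OF 19(1)] ob[OF 19(2)] ob[OF 19(3)] comp_scale_left by blast
  next
    case (20 X Y Z f g a)
    then show ?case using ob[OF 20(1)] ob[OF 20(2)] ob[OF 20(3)] comp_scale_right by blast
  qed
qed

text \<open>
  All functors in question keep the underlying object and are the identity on morphisms, so only
  objects and homs have to be checked.
\<close>
lemma linear_functor_Mod:
  assumes "Carrier A \<in> Ob B" "Carrier A' \<in> Ob B" "on_hom F = (\<lambda>u. u)"
    and "\<And>X. is_module B \<M> A X \<Longrightarrow> is_module B \<M> A' (on_ob F X) \<and> fst (on_ob F X) = fst X"
    and "\<And>X Y u. \<lbrakk>is_module B \<M> A X; is_module B \<M> A Y; u \<in> Hom (Mod B \<M> A) X Y\<rbrakk>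
      \<Longrightarrow> u \<in> Hom (Mod B \<M> A') (on_ob F X) (on_ob F Y)"
  shows "linear_functor (Mod B \<M> A) (Mod B \<M> A') F"
proof -
  interpret C: linear_category "Mod B \<M> A"
    using assms(1) by (rule linear_category_Mod)
  interpret D: linear_category "Mod B \<M> A'"
    using assms(2) by (rule linear_category_Mod)
  show ?thesis
    by unfold_locales (use assms(3-5) in auto)
qed

definition intertwines :: "'o \<Rightarrow> ('p, 'q) arrow \<Rightarrow> ('p, 'q) arrow \<Rightarrow> ('p, 'q) arrow \<Rightarrow> bool" where
  "intertwines X u p p' \<longleftrightarrow> u \<star> p = p' \<star> (X |> u)"

lemma Mod_Hom_iff_intertwines:
  assumes "pact (Carrier A) N p" "pact (Carrier A) N' p'"
  shows "u \<in> Hom (Mod B \<M> A) (N, mor p) (N', mor p') \<longleftrightarrow>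
    u \<in> Hom \<M> N N' \<and> intertwines (Carrier A) (arrow N u N') p p'"
proof -
  note [simp] = pactD[OF assms(1)] pactD[OF assms(2)]
  have "intertwines (Carrier A) (arrow N u N') p p' \<longleftrightarrow>
      mor (arrow N u N' \<star> p) = mor (p' \<star> (Carrier A |> arrow N u N'))" if "u \<in> Hom \<M> N N'"
    unfolding intertwines_def using that by (auto intro!: arrow_eqI)
  then show ?thesis
    by (auto simp: Mod_Hom mor_acomp mor_simps)
qed

lemma intertwines_cell:
  assumes "pact Y N p" "pact Y N' p'" "intertwines Y u p p'" "is_arrow u" "src u = N" "trg u = N'"
    "X \<in> Ob B" "f \<in> Hom B X Y"
  shows "intertwines X u (p \<star> cell X f Y N) (p' \<star> cell X f Y N')"
proof -
  note [simp] = pactD[OF assms(1)] pactD[OF assms(2)] assms(4-8)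
  have "u \<star> p \<star> cell X f Y N = p' \<star> (Y |> u) \<star> cell X f Y N"
    using acomp_head[OF assms(3)[unfolded intertwines_def]] .
  then show ?thesis
    by (simp add: intertwines_def cell_nat)
qed

lemma intertwines_Ea:
  assumes "pact X N p" "pact X N' p'" "intertwines X u p p'" "is_arrow u" "src u = N" "trg u = N'"
  shows "intertwines X u (p \<star> Ea X N) (p' \<star> Ea X N')"
proof -
  note [simp] = pactD[OF assms(1)] pactD[OF assms(2)] assms(4-6)
  have "u \<star> p \<star> Ea X N = p' \<star> (X |> u) \<star> Ea X N"
    using acomp_head[OF assms(3)[unfolded intertwines_def]] .
  then show ?thesis
    by (simp add: intertwines_def Ea_whisk)
qed

lemma intertwines_joint:
  assumes "pact X N p" "pact X N' p'" "pact Y N q" "pact Y N' q'" "intertwines X u p p'" "intertwines Y u q q'"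
    "is_arrow u" "src u = N" "trg u = N'"
  shows "intertwines (X \<boxtimes> Y) u (joint X Y N p q) (joint X Y N' p' q')"
proof -
  note [simp] = pactD[OF assms(1)] pactD[OF assms(2)] pactD[OF assms(3)] pactD[OF assms(4)] assms(7-9)
  have "u \<star> joint X Y N p q = p' \<star> (X |> (u \<star> q)) \<star> assr X Y N"
    by (simp add: joint_def acomp_head[OF assms(5)[unfolded intertwines_def]])
  also have "\<dots> = p' \<star> (X |> q') \<star> (X |> Y |> u) \<star> assr X Y N"
    unfolding assms(6)[unfolded intertwines_def] by simp
  finally show ?thesis
    by (simp add: intertwines_def joint_def assr_whisk)
qed

lemma on_ob_restrict:
  assumes "pact Y N p" "X \<in> Ob B" "f \<in> Hom B X Y"
  shows "on_ob (restrict_functor \<M> f) (N, mor p) = (N, mor (p \<star> cell X f Y N))"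
  using pactD[OF assms(1)] assms(2,3) by (simp add: restrict_functor_def mor_acomp mor_simps)

lemma mor_joint:
  "\<lbrakk>pact X N p; pact Y N q\<rbrakk> \<Longrightarrow> mor (joint X Y N p q) = mor p \<cdot> (Ident B X \<bullet> mor q) \<cdot> MAssoc \<M> X Y N"
  using pactD[of X N p] pactD[of Y N q] by (simp add: joint_def mor_acomp mor_simps)

lemma on_ob_swap:
  fixes A :: "('o, 'm, 'y) algebra_scheme" and A' :: "('o, 'm, 'z) algebra_scheme"
  assumes "algebraic A" "algebraic A'" "pact (Carrier A \<boxtimes> Carrier A') N p"
  defines "l \<equiv> p \<star> cell (Carrier A) (incl_left A A') (Carrier A \<boxtimes> Carrier A') N"
    and "r \<equiv> p \<star> cell (Carrier A') (incl_right A A') (Carrier A \<boxtimes> Carrier A') N"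
  shows "on_ob (swap_functor B \<M> E A A') (N, mor p) =
    (N, mor (joint (Carrier A') (Carrier A) N (r \<star> Ea (Carrier A') N) l))"
proof -
  note [simp] = pactD[OF assms(3)] algebraicD[OF assms(1)] algebraicD[OF assms(2)] assms(1,2)
  have pl: "pact (Carrier A) N l" and pr: "pact (Carrier A') N r"
    using assms(3) by (simp_all add: l_def r_def)
  have "left_action B \<M> A A' N (mor p) = mor l"
    by (simp add: left_action_def l_def mor_acomp mor_simps incl_left_def[symmetric])
  moreover have "right_action B \<M> A A' N (mor p) = mor r"
    by (simp add: right_action_def r_def mor_acomp mor_simps incl_right_def[symmetric])
  moreover have "mor r \<cdot> E (Carrier A') N = mor (r \<star> Ea (Carrier A') N)"
    using pactD[OF pr] by (simp add: mor_acomp)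
  moreover have "pact (Carrier A') N (r \<star> Ea (Carrier A') N)"
    using pr by simp
  ultimately show ?thesis
    using pl by (simp add: swap_functor_def joint_action_def mor_joint)
qed

end

context hopf_action
begin

abbreviation "C n \<equiv> cyc_cat B \<M> H n"

definition obj :: "'p \<Rightarrow> ('p, 'q) arrow list \<Rightarrow> 'p \<times> 'q" where
  "obj N xs = (N, mor (joint_list N xs))"

lemma C_Mod: "C n = Mod B \<M> (pow (Suc n))"
  by (simp add: cyc_cat_def)

lemma obj_in_C: "\<lbrakk>comm_acts N xs; length xs = Suc n\<rbrakk> \<Longrightarrow> is_module B \<M> (pow (Suc n)) (obj N xs)"
  using comm_acts_act[of N xs] is_module_iff_act[OF algebraic_power, of "Suc n" N "joint_list N xs"]
  by (simp add: obj_def act_pact del: algebra_power.simps)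

lemma C_obtains:
  assumes "is_module B \<M> (pow (Suc n)) X"
  obtains N xs where "comm_acts N xs" "length xs = Suc n" "X = obj N xs"
  using is_module_obtains[OF algebraic_power assms] act_power_obtains[of n] unfolding obj_def by blast

fun merge_at :: "'p \<Rightarrow> nat \<Rightarrow> ('p, 'q) arrow list \<Rightarrow> ('p, 'q) arrow list" where
  "merge_at N 0 (x # y # zs) = merge N x y # zs"
| "merge_at N (Suc i) (x # zs) = x # merge_at N i zs"
| "merge_at N _ zs = zs"

fun insert_at :: "nat \<Rightarrow> 'a \<Rightarrow> 'a list \<Rightarrow> 'a list" where
  "insert_at 0 e zs = e # zs"
| "insert_at (Suc i) e (x # zs) = x # insert_at i e zs"
| "insert_at (Suc i) e [] = [e]"

definition rotate_twist :: "'p \<Rightarrow> ('p, 'q) arrow list \<Rightarrow> ('p, 'q) arrow list" where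
  "rotate_twist N xs = twist N (last xs) # butlast xs"

lemma rotate_twist_snoc [simp]: "rotate_twist N (xs @ [y]) = twist N y # xs"
  by (simp add: rotate_twist_def)

lemma length_rotate_twist [simp]: "xs \<noteq> [] \<Longrightarrow> length (rotate_twist N xs) = length xs"
  by (cases xs rule: rev_cases) simp_all

lemma merge_at_append: "merge_at N (length xs) (xs @ x # y # ys) = xs @ merge N x y # ys"
  by (induction xs) simp_all

lemma insert_at_append: "insert_at (length xs) e (xs @ ys) = xs @ e # ys"
  by (induction xs) simp_all

lemma split_at_pair:
  "Suc i < length xs \<Longrightarrow> \<exists>us x y vs. xs = us @ x # y # vs \<and> length us = i"
  by (metis (no_types, lifting) Cons_nth_drop_Suc Suc_lessD append_take_drop_id length_take
      min.absorb4)

lemma split_at: "i \<le> length xs \<Longrightarrow> \<exists>us vs. xs = us @ vs \<and> length us = i"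
  by (metis append_take_drop_id length_take min.absorb2)

lemma length_merge_at [simp]: "Suc i < length xs \<Longrightarrow> length (merge_at N i xs) = length xs - 1"
  using split_at_pair[of i xs] by (auto simp: merge_at_append)

lemma length_insert_at [simp]: "length (insert_at i e xs) = Suc (length xs)"
  by (induction i e xs rule: insert_at.induct) simp_all

lemma comm_acts_merge_at: "\<lbrakk>comm_acts N xs; Suc i < length xs\<rbrakk> \<Longrightarrow> comm_acts N (merge_at N i xs)"
  using split_at_pair[of i xs]
  by (auto simp: merge_at_append comm_acts_def sorted_wrt_append act_merge act_pact
      commuting_merge_left commuting_merge_right)

lemma comm_acts_insert_at: "\<lbrakk>comm_acts N xs; i \<le> length xs\<rbrakk> \<Longrightarrow> comm_acts N (insert_at i (trivial N) xs)"
  using split_at[of i xs]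
  by (auto simp: insert_at_append comm_acts_def sorted_wrt_append act_trivial act_pact
      commuting_trivial_left commuting_trivial_right)

lemma comm_acts_rot: "\<lbrakk>comm_acts N xs; xs \<noteq> []\<rbrakk> \<Longrightarrow> comm_acts N (rotate_twist N xs)"
  by (cases xs rule: rev_cases)
    (auto simp: comm_acts_def sorted_wrt_append act_twist act_pact commuting_twist_last)

lemma P_2: "P 2 = CH \<boxtimes> CH"
  by (simp add: numeral_2_eq_2)

lemma comult_pad: "Comult H \<in> Hom B (P 1) (P 2)"
  by (simp add: P_2)

lemma counit_pad: "Counit H \<in> Hom B (P 1) (P 0)"
  by simp

lemma inner_face_obj:
  assumes "comm_acts N xs" "length xs = Suc n" "i < n"
  shows "on_ob (inner_face B \<M> H n i) (obj N xs) = obj N (merge_at N i xs)"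
proof -
  obtain us x y vs where xs: "xs = us @ x # y # vs" "length us = i"
    using split_at_pair[of i xs] assms by auto
  have v: "length vs = n - 1 - i"
    using xs assms by simp
  have N: "N \<in> Ob \<M>" and p: "\<forall>z \<in> set xs. pact CH N z"
    using comm_acts_pact[OF assms(1)] by auto
  have e: "i + 1 + (n - 1 - i) = n" "i + 2 + (n - 1 - i) = Suc n"
    using assms by auto
  have "joint_list N [x, y] \<star> cell (P 1) (Comult H) (P 2) N = joint_list N [merge N x y]"
    using joint_list_snoc[of "[x]" N y] by (simp add: merge_def P_2)
  then have "joint_list N (us @ [x, y] @ vs) \<star> cell (P n) (pad B H i 1 2 (Comult H) (n - 1 - i)) (P (Suc n)) N =
      joint_list N (us @ [merge N x y] @ vs)"
    using joint_list_pad[OF comult_pad N, where xs = us and zs = "[merge N x y]" and zs' = "[x, y]" and ys = vs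
        and a = i and b = "n - 1 - i"] xs v p
    unfolding e by auto
  moreover have "on_ob (inner_face B \<M> H n i) (obj N xs) =
      (N, mor (joint_list N xs \<star> cell (P n) (pad B H i 1 2 (Comult H) (n - 1 - i)) (P (Suc n)) N))"
    unfolding inner_face_def obj_def
    using pad_hom[OF comult_pad, where a = i and b = "n - 1 - i"] joint_list_pact[OF N p] assms(2) unfolding e
    by (intro on_ob_restrict) (simp_all del: algebra_power.simps)
  ultimately show ?thesis
    using merge_at_append[where N = N and xs = us and x = x and y = y and ys = vs] xs by (simp add: obj_def)
qed

lemma degeneracy_obj:
  assumes "comm_acts N xs" "length xs = Suc n" "- 1 \<le> i" "i \<le> int n"
  shows "on_ob (degeneracy_functor B \<M> H n i) (obj N xs) = obj N (insert_at (nat (i + 1)) (trivial N) xs)"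
proof -
  let ?a = "nat (i + 1)" and ?b = "nat (int n - i)"
  have "?a \<le> length xs"
    using assms by linarith
  then obtain us vs where xs: "xs = us @ vs" "length us = ?a"
    using split_at by blast
  have v: "length vs = ?b"
    using xs assms by (simp add: nat_eq_iff)
  have N: "N \<in> Ob \<M>" and p: "\<forall>z \<in> set xs. pact CH N z"
    using comm_acts_pact[OF assms(1)] by auto
  have e: "?a + 1 + ?b = Suc (Suc n)" "?a + 0 + ?b = Suc n"
    using assms by auto
  have "joint_list N [] \<star> cell (P 1) (Counit H) (P 0) N = joint_list N [trivial N]"
    by (simp add: trivial_def)
  then have "joint_list N (us @ [] @ vs) \<star> cell (P (Suc (Suc n))) (pad B H ?a 1 0 (Counit H) ?b) (P (Suc n)) N =
      joint_list N (us @ [trivial N] @ vs)"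
    using joint_list_pad[OF counit_pad N, where xs = us and zs = "[trivial N]" and zs' = "[]" and ys = vs
        and a = ?a and b = ?b] xs v p N
    unfolding e by auto
  moreover have "on_ob (degeneracy_functor B \<M> H n i) (obj N xs) =
      (N, mor (joint_list N xs \<star> cell (P (Suc (Suc n))) (pad B H ?a 1 0 (Counit H) ?b) (P (Suc n)) N))"
    unfolding degeneracy_functor_def obj_def
    using pad_hom[OF counit_pad, where a = ?a and b = ?b] joint_list_pact[OF N p] assms(2) unfolding e
    by (intro on_ob_restrict) (simp_all del: algebra_power.simps)
  ultimately show ?thesis
    using insert_at_append[of us "trivial N" vs] xs by (simp add: obj_def)
qed

text \<open>
  The intermediate steps of \<open>\<tau>\<^sub>n\<close> for an arbitrary arrow \<open>p\<close>.  In this generality morphisms of modules can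
  be followed through the construction.
\<close>
definition unjoin :: "nat \<Rightarrow> 'p \<Rightarrow> ('p, 'q) arrow \<Rightarrow> ('p, 'q) arrow" where
  "unjoin n N p = p \<star> cell (P n \<boxtimes> CH) (power_join B H n 1) (P (Suc n)) N"

definition last_action :: "nat \<Rightarrow> 'p \<Rightarrow> ('p, 'q) arrow \<Rightarrow> ('p, 'q) arrow" where
  "last_action n N p = unjoin n N p \<star> cell CH (incl_right (pow n) H) (P n \<boxtimes> CH) N"

definition front_action :: "nat \<Rightarrow> 'p \<Rightarrow> ('p, 'q) arrow \<Rightarrow> ('p, 'q) arrow" where
  "front_action n N p = unjoin n N p \<star> cell (P n) (incl_left (pow n) H) (P n \<boxtimes> CH) N"

definition cyc_joint :: "nat \<Rightarrow> 'p \<Rightarrow> ('p, 'q) arrow \<Rightarrow> ('p, 'q) arrow" where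
  "cyc_joint n N p = joint CH (P n) N (last_action n N p \<star> Ea CH N) (front_action n N p)"

definition cyc_arrow :: "nat \<Rightarrow> 'p \<Rightarrow> ('p, 'q) arrow \<Rightarrow> ('p, 'q) arrow" where
  "cyc_arrow n N p = cyc_joint n N p \<star> cell (P (Suc n)) (power_split B H 1 n) (CH \<boxtimes> P n) N"

lemma P_tensor: "P n \<boxtimes> CH \<in> Ob B" "P (Suc n) \<in> Ob B"
  by (simp, rule power_simps(1))

lemma power_join_1: "power_join B H n 1 \<in> Hom B (P n \<boxtimes> CH) (P (Suc n))"
  using power_join_hom[of n 1] by (simp del: algebra_power.simps(3))

lemma power_split_1: "power_split B H 1 n \<in> Hom B (P (Suc n)) (CH \<boxtimes> P n)"
  using power_split_hom[of 1 n] by (simp del: algebra_power.simps(3))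

lemma cyc_arrow_pact:
  assumes "pact (P (Suc n)) N p"
  shows "pact (P n \<boxtimes> CH) N (unjoin n N p)" (is ?r)
    and "pact CH N (last_action n N p)" (is ?q)
    and "pact (P n) N (front_action n N p)" (is ?l)
    and "pact (CH \<boxtimes> P n) N (cyc_joint n N p)" (is ?j)
    and "pact (P (Suc n)) N (cyc_arrow n N p)"
proof -
  show r: ?r
    unfolding unjoin_def by (rule pact_cell[OF assms P_tensor(1) power_join_1])
  show q: ?q
    unfolding last_action_def by (rule pact_cell[OF r]) simp_all
  show l: ?l
    unfolding front_action_def by (rule pact_cell[OF r]) simp_all
  show j: ?j
    unfolding cyc_joint_def by (rule pact_joint[OF pact_Ea[OF q] l])
  show "pact (P (Suc n)) N (cyc_arrow n N p)"
    unfolding cyc_arrow_def by (rule pact_cell[OF j P_tensor(2) power_split_1])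
qed

lemma on_ob_cyc:
  assumes "pact (P (Suc n)) N p"
  shows "on_ob (cyc_functor B \<M> E H n) (N, mor p) = (N, mor (cyc_arrow n N p))"
proof -
  have "on_ob (restrict_functor \<M> (power_join B H n 1)) (N, mor p) = (N, mor (unjoin n N p))"
    unfolding unjoin_def by (rule on_ob_restrict[OF assms P_tensor(1) power_join_1])
  moreover have "on_ob (swap_functor B \<M> E (pow n) H) (N, mor (unjoin n N p)) = (N, mor (cyc_joint n N p))"
    unfolding cyc_joint_def last_action_def front_action_def
    by (rule on_ob_swap[OF algebraic_power algebraic_H cyc_arrow_pact(1)[OF assms]])
  moreover have "on_ob (restrict_functor \<M> (power_split B H 1 n)) (N, mor (cyc_joint n N p)) =
      (N, mor (cyc_arrow n N p))"
    unfolding cyc_arrow_def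
    by (rule on_ob_restrict[OF cyc_arrow_pact(4)[OF assms] P_tensor(2) power_split_1])
  ultimately show ?thesis
    by (simp add: cyc_functor_def comp_functor_def)
qed

lemma cyc_arrow_intertwines:
  assumes "pact (P (Suc n)) N p" "pact (P (Suc n)) N' p'" "intertwines (P (Suc n)) u p p'"
    "is_arrow u" "src u = N" "trg u = N'"
  shows "intertwines (P (Suc n)) u (cyc_arrow n N p) (cyc_arrow n N' p')"
proof -
  note pa = cyc_arrow_pact[OF assms(1)] and pa' = cyc_arrow_pact[OF assms(2)]
  have r: "intertwines (P n \<boxtimes> CH) u (unjoin n N p) (unjoin n N' p')"
    unfolding unjoin_def by (rule intertwines_cell[OF assms P_tensor(1) power_join_1])
  have q: "intertwines CH u (last_action n N p) (last_action n N' p')"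
    unfolding last_action_def by (rule intertwines_cell[OF pa(1) pa'(1) r assms(4-6)]) simp_all
  have l: "intertwines (P n) u (front_action n N p) (front_action n N' p')"
    unfolding front_action_def by (rule intertwines_cell[OF pa(1) pa'(1) r assms(4-6)]) simp_all
  have j: "intertwines (CH \<boxtimes> P n) u (cyc_joint n N p) (cyc_joint n N' p')"
    unfolding cyc_joint_def
    by (rule intertwines_joint[OF pact_Ea[OF pa(2)] pact_Ea[OF pa'(2)] pa(3) pa'(3)
          intertwines_Ea[OF pa(2) pa'(2) q assms(4-6)] l assms(4-6)])
  show ?thesis
    unfolding cyc_arrow_def
    by (rule intertwines_cell[OF pa(4) pa'(4) j assms(4-6) P_tensor(2) power_split_1])
qed

text \<open>
  The identification of \<open>H\<^sup>n\<^sup>+\<^sup>1\<close> with \<open>H\<^sup>n \<otimes> H\<close> and with \<open>H \<otimes> H\<^sup>n\<close> corresponds to viewing the list as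
  \<open>xs @ [y]\<close> and as \<open>y # xs\<close>.
\<close>
lemma cyc_obj:
  assumes "comm_acts N xs" "length xs = Suc n"
  shows "on_ob (cyc_functor B \<M> E H n) (obj N xs) = obj N (rotate_twist N xs)"
proof -
  obtain ys y where xs: "xs = ys @ [y]" "length ys = n"
    using assms(2) by (cases xs rule: rev_cases) auto
  have N: "N \<in> Ob \<M>" and p: "\<forall>z \<in> set ys. pact CH N z" "pact CH N y"
    using comm_acts_pact[OF assms(1)] xs by auto
  have g: "comm_acts N ys" "act H N y"
    using assms(1) xs by (auto simp: comm_acts_def sorted_wrt_append)
  have "joint_list N xs \<star> cell (P n \<boxtimes> CH) (power_join B H n 1) (P (Suc n)) N = joint (P n) CH N (joint_list N ys) y"
    using joint_list_power_join[OF N, of ys "[y]"] p xs by (simp del: algebra_power.simps(3))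
  moreover have "joint CH (P n) N (y \<star> Ea CH N) (joint_list N ys) \<star>
      cell (P (Suc n)) (power_split B H 1 n) (CH \<boxtimes> P n) N = joint_list N (twist N y # ys)"
    using joint_list_power_split[OF N, of "[twist N y]" ys] p xs by (simp add: twist_def del: algebra_power.simps(3))
  ultimately have "cyc_arrow n N (joint_list N xs) = joint_list N (rotate_twist N xs)"
    using joint_incl[OF algebraic_power algebraic_H comm_acts_act[OF g(1)] g(2)] xs
    by (simp add: cyc_arrow_def cyc_joint_def last_action_def front_action_def unjoin_def del: acomp_assoc)
  moreover have "pact (P (Suc n)) N (joint_list N xs)"
    using joint_list_pact[OF N, of xs] p xs by auto
  ultimately show ?thesis
    using on_ob_cyc by (simp add: obj_def)
qed

lemma obj_fst [simp]: "fst (obj N xs) = N"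
  by (simp add: obj_def)

lemma linear_functor_restrict:
  assumes "f \<in> Hom B (P (Suc m)) (P (Suc n))"
    and "\<And>N xs. \<lbrakk>comm_acts N xs; length xs = Suc n\<rbrakk> \<Longrightarrow>
      \<exists>ys. comm_acts N ys \<and> length ys = Suc m \<and> on_ob (restrict_functor \<M> f) (obj N xs) = obj N ys"
  shows "linear_functor (C n) (C m) (restrict_functor \<M> f)"
  unfolding C_Mod
proof (rule linear_functor_Mod)
  show "Carrier (pow (Suc n)) \<in> Ob B" "Carrier (pow (Suc m)) \<in> Ob B"
    by (rule power_simps(1))+
  show "on_hom (restrict_functor \<M> f) = (\<lambda>u. u)"
    by (simp add: restrict_functor_def)
next
  fix X assume "is_module B \<M> (pow (Suc n)) X"
  then obtain N xs where X: "comm_acts N xs" "length xs = Suc n" "X = obj N xs"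
    by (rule C_obtains)
  then obtain ys where "comm_acts N ys" "length ys = Suc m" "on_ob (restrict_functor \<M> f) X = obj N ys"
    using assms(2) by blast
  then show "is_module B \<M> (pow (Suc m)) (on_ob (restrict_functor \<M> f) X) \<and>
      fst (on_ob (restrict_functor \<M> f) X) = fst X"
    using obj_in_C[of N ys m] X by simp
next
  fix X Y u
  assume X: "is_module B \<M> (pow (Suc n)) X" and Y: "is_module B \<M> (pow (Suc n)) Y"
    and u: "u \<in> Hom (Mod B \<M> (pow (Suc n))) X Y"
  obtain N p where p: "X = (N, mor p)" "pact (P (Suc n)) N p"
    using is_module_obtains[OF algebraic_power X] act_pact by blast
  obtain N' p' where p': "Y = (N', mor p')" "pact (P (Suc n)) N' p'"
    using is_module_obtains[OF algebraic_power Y] act_pact by blast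
  let ?u = "arrow N u N'"
  have c: "u \<in> Hom \<M> N N'" "intertwines (P (Suc n)) ?u p p'"
    using u Mod_Hom_iff_intertwines[OF p(2) p'(2)] p(1) p'(1) by auto
  have m: "P (Suc m) \<in> Ob B"
    by (rule power_simps(1))
  have "intertwines (P (Suc m)) ?u (p \<star> cell (P (Suc m)) f (P (Suc n)) N) (p' \<star> cell (P (Suc m)) f (P (Suc n)) N')"
    using c pactD[OF p(2)] pactD[OF p'(2)] by (intro intertwines_cell[OF p(2) p'(2) c(2) _ _ _ m assms(1)]) simp_all
  then show "u \<in> Hom (Mod B \<M> (pow (Suc m))) (on_ob (restrict_functor \<M> f) X) (on_ob (restrict_functor \<M> f) Y)"
    using on_ob_restrict[OF p(2) m assms(1)] on_ob_restrict[OF p'(2) m assms(1)] p(1) p'(1) c(1)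
      Mod_Hom_iff_intertwines[OF pact_cell[OF p(2) m assms(1)] pact_cell[OF p'(2) m assms(1)], of u] by simp
qed

lemma linear_functor_inner_face:
  assumes "i < n"
  shows "linear_functor (C n) (C (n - 1)) (inner_face B \<M> H n i)"
  unfolding inner_face_def
proof (rule linear_functor_restrict)
  have "i + 1 + (n - 1 - i) = Suc (n - 1)" "i + 2 + (n - 1 - i) = Suc n"
    using assms by auto
  then show "pad B H i 1 2 (Comult H) (n - 1 - i) \<in> Hom B (P (Suc (n - 1))) (P (Suc n))"
    using pad_hom[OF comult_pad, where a = i and b = "n - 1 - i"] by metis
  fix N xs assume "comm_acts N xs" "length xs = Suc n"
  then show "\<exists>ys. comm_acts N ys \<and> length ys = Suc (n - 1) \<and>
      on_ob (restrict_functor \<M> (pad B H i 1 2 (Comult H) (n - 1 - i))) (obj N xs) = obj N ys"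
    using inner_face_obj[of N xs n i] assms
    by (intro exI[of _ "merge_at N i xs"]) (simp add: comm_acts_merge_at inner_face_def)
qed

lemma linear_functor_degeneracy:
  assumes "- 1 \<le> i" "i \<le> int n"
  shows "linear_functor (C n) (C (n + 1)) (degeneracy_functor B \<M> H n i)"
  unfolding degeneracy_functor_def
proof (rule linear_functor_restrict)
  have "nat (i + 1) + 1 + nat (int n - i) = Suc (n + 1)" "nat (i + 1) + 0 + nat (int n - i) = Suc n"
    using assms by auto
  then show "pad B H (nat (i + 1)) 1 0 (Counit H) (nat (int n - i)) \<in> Hom B (P (Suc (n + 1))) (P (Suc n))"
    using pad_hom[OF counit_pad, where a = "nat (i + 1)" and b = "nat (int n - i)"] by metis
  fix N xs assume "comm_acts N xs" "length xs = Suc n"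
  then show "\<exists>ys. comm_acts N ys \<and> length ys = Suc (n + 1) \<and>
      on_ob (restrict_functor \<M> (pad B H (nat (i + 1)) 1 0 (Counit H) (nat (int n - i)))) (obj N xs) = obj N ys"
    using degeneracy_obj[of N xs n i] assms
    by (intro exI[of _ "insert_at (nat (i + 1)) (trivial N) xs"]) (auto simp add: comm_acts_insert_at degeneracy_functor_def)
qed

lemma on_hom_cyc: "on_hom (cyc_functor B \<M> E H n) = (\<lambda>u. u)"
  by (simp add: cyc_functor_def comp_functor_def restrict_functor_def swap_functor_def comp_def)

lemma linear_functor_cyc: "linear_functor (C n) (C n) (cyc_functor B \<M> E H n)"
  unfolding C_Mod
proof (rule linear_functor_Mod)
  show "Carrier (pow (Suc n)) \<in> Ob B" "Carrier (pow (Suc n)) \<in> Ob B"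
    by (rule power_simps(1))+
  show "on_hom (cyc_functor B \<M> E H n) = (\<lambda>u. u)"
    by (rule on_hom_cyc)
next
  fix X assume "is_module B \<M> (pow (Suc n)) X"
  then obtain N xs where X: "comm_acts N xs" "length xs = Suc n" "X = obj N xs"
    by (rule C_obtains)
  moreover have "comm_acts N (rotate_twist N xs)" "length (rotate_twist N xs) = Suc n"
    using X comm_acts_rot[of N xs] by (cases xs; simp)+
  ultimately show "is_module B \<M> (pow (Suc n)) (on_ob (cyc_functor B \<M> E H n) X) \<and>
      fst (on_ob (cyc_functor B \<M> E H n) X) = fst X"
    using obj_in_C[of N "rotate_twist N xs" n] by (simp add: cyc_obj)
next
  fix X Y u
  assume X: "is_module B \<M> (pow (Suc n)) X" and Y: "is_module B \<M> (pow (Suc n)) Y"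
    and u: "u \<in> Hom (Mod B \<M> (pow (Suc n))) X Y"
  obtain N p where p: "X = (N, mor p)" "pact (P (Suc n)) N p"
    using is_module_obtains[OF algebraic_power X] act_pact by blast
  obtain N' p' where p': "Y = (N', mor p')" "pact (P (Suc n)) N' p'"
    using is_module_obtains[OF algebraic_power Y] act_pact by blast
  let ?u = "arrow N u N'"
  have c: "u \<in> Hom \<M> N N'" "intertwines (P (Suc n)) ?u p p'"
    using u Mod_Hom_iff_intertwines[OF p(2) p'(2)] p(1) p'(1) by auto
  have "intertwines (P (Suc n)) ?u (cyc_arrow n N p) (cyc_arrow n N' p')"
    using c pactD[OF p(2)] pactD[OF p'(2)] by (intro cyc_arrow_intertwines p p') simp_all
  then show "u \<in> Hom (Mod B \<M> (pow (Suc n))) (on_ob (cyc_functor B \<M> E H n) X) (on_ob (cyc_functor B \<M> E H n) Y)"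
    using on_ob_cyc[OF p(2)] on_ob_cyc[OF p'(2)] p(1) p'(1) c(1)
      Mod_Hom_iff_intertwines[OF cyc_arrow_pact(5)[OF p(2)] cyc_arrow_pact(5)[OF p'(2)], of u] by simp
qed

end

section \<open>The simplicial and cyclic relations\<close>

lemma comp_functor_sel [simp]:
  "on_ob (G \<circ>\<^sub>F F) X = on_ob G (on_ob F X)" "on_hom (G \<circ>\<^sub>F F) u = on_hom G (on_hom F u)"
  by (simp_all add: comp_functor_def)

lemma id_functor_sel [simp]: "on_ob id_functor X = X" "on_hom id_functor u = u"
  by (simp_all add: id_functor_def)

lemma linear_functor_id: "linear_category A \<Longrightarrow> linear_functor A A id_functor"
  by (simp add: linear_functor_def linear_functor_axioms_def id_functor_def)

lemma linear_functor_comp: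
  assumes "linear_functor A1 A2 F" "linear_functor A2 A3 G"
  shows "linear_functor A1 A3 (G \<circ>\<^sub>F F)"
proof -
  interpret F: linear_functor A1 A2 F by fact
  interpret G: linear_functor A2 A3 G by fact
  show ?thesis
    by unfold_locales
      (simp_all add: F.on_ob G.on_ob F.on_hom G.on_hom[OF F.on_ob F.on_ob F.on_hom] F.map_ident
        G.map_ident[OF F.on_ob] F.map_comp F.map_add F.map_scale
        G.map_comp[OF F.on_ob F.on_ob F.on_ob F.on_hom F.on_hom]
        G.map_add[OF F.on_ob F.on_ob F.on_hom F.on_hom] G.map_scale[OF F.on_ob F.on_ob F.on_hom])
qed

context hopf_action
begin

definition pact_list :: "'p \<Rightarrow> ('p, 'q) arrow list \<Rightarrow> bool" where
  "pact_list N xs \<longleftrightarrow> N \<in> Ob \<M> \<and> (\<forall>x \<in> set xs. pact CH N x)"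

lemma pact_list_simps [simp]:
  "pact_list N [] \<longleftrightarrow> N \<in> Ob \<M>"
  "pact_list N (x # xs) \<longleftrightarrow> pact CH N x \<and> pact_list N xs"
  "pact_list N (xs @ ys) \<longleftrightarrow> pact_list N xs \<and> pact_list N ys"
  by (auto simp: pact_list_def)

lemma merge_at_merge_at:
  "\<lbrakk>i < j; Suc j < length xs; pact_list N xs\<rbrakk> \<Longrightarrow> merge_at N i (merge_at N j xs) = merge_at N (j - 1) (merge_at N i xs)"
proof (induction i arbitrary: j xs)
  case 0
  then obtain x y zs where xs: "xs = x # y # zs"
    by (metis Suc_less_eq2 Suc_length_conv not_less_eq not_less_zero length_Cons list.exhaust list.size(3))
  obtain k where j: "j = Suc k"
    using 0 by (cases j) auto
  show ?case
  proof (cases k)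
    case 0
    then obtain z zs' where "zs = z # zs'"
      using \<open>Suc j < length xs\<close> xs j by (cases zs) auto
    then show ?thesis
      using 0 xs j \<open>pact_list N xs\<close> by (simp add: merge_assoc)
  next
    case (Suc l)
    then show ?thesis
      using xs j by simp
  qed
next
  case (Suc i)
  then obtain k x zs where "j = Suc k" "xs = x # zs"
    by (cases j; cases xs) auto
  moreover from this obtain k' where "k = Suc k'"
    using Suc by (cases k) auto
  ultimately show ?case
    using Suc.IH[of k zs] Suc.prems by auto
qed

lemma insert_at_insert_at: "\<lbrakk>i < j; j \<le> Suc (length xs)\<rbrakk> \<Longrightarrow> insert_at j e (insert_at i e xs) = insert_at i e (insert_at (j - 1) e xs)"
proof (induction i arbitrary: j xs)
  case 0
  then show ?case
    by (cases j) simp_all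
next
  case (Suc i)
  then obtain k x zs where "j = Suc k" "xs = x # zs"
    by (cases j; cases xs) auto
  moreover from this obtain k' where "k = Suc k'"
    using Suc by (cases k) auto
  ultimately show ?case
    using Suc.IH[of k zs] Suc.prems by auto
qed

lemma merge_at_insert_at_less: "\<lbrakk>i < j; j < length xs\<rbrakk> \<Longrightarrow> merge_at N i (insert_at (Suc j) e xs) = insert_at j e (merge_at N i xs)"
proof (induction i arbitrary: j xs)
  case 0
  then obtain k x y zs where "j = Suc k" "xs = x # y # zs"
    by (cases j; cases xs; cases "tl xs") auto
  then show ?case
    by simp
next
  case (Suc i)
  then obtain k x zs where "j = Suc k" "xs = x # zs"
    by (cases j; cases xs) auto
  then show ?case
    using Suc by simp
qed

lemma merge_at_insert_at_eq: "\<lbrakk>i < length xs; pact_list N xs\<rbrakk> \<Longrightarrow> merge_at N i (insert_at (Suc i) (trivial N) xs) = xs"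
proof (induction i arbitrary: xs)
  case 0
  then show ?case
    by (cases xs) (simp_all add: merge_trivial)
next
  case (Suc i)
  then show ?case
    by (cases xs) simp_all
qed

lemma merge_at_insert_at_Suc: "\<lbrakk>i < length xs; pact_list N xs\<rbrakk> \<Longrightarrow> merge_at N i (insert_at i (trivial N) xs) = xs"
proof (induction i arbitrary: xs)
  case 0
  then show ?case
    by (cases xs) (simp_all add: merge_trivial)
next
  case (Suc i)
  then show ?case
    by (cases xs) simp_all
qed

lemma merge_at_insert_at_greater:
  "\<lbrakk>j < i; i < length xs\<rbrakk> \<Longrightarrow> merge_at N i (insert_at j e xs) = insert_at j e (merge_at N (i - 1) xs)"
proof (induction j arbitrary: i xs)
  case 0
  then show ?case
    by (cases i) simp_all
next
  case (Suc j)
  then obtain k x zs where k: "i = Suc k" "xs = x # zs"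
    by (cases i; cases xs) auto
  moreover from this obtain k' where "k = Suc k'"
    using Suc by (cases k) auto
  ultimately show ?case
    using Suc.IH[of k zs] Suc.prems by simp
qed

lemma merge_at_snoc: "Suc i < length xs \<Longrightarrow> merge_at N i (xs @ [y]) = merge_at N i xs @ [y]"
  using split_at_pair[of i xs] merge_at_append by fastforce

lemma insert_at_snoc: "i \<le> length xs \<Longrightarrow> insert_at i e (xs @ [y]) = insert_at i e xs @ [y]"
  by (induction i e xs rule: insert_at.induct) simp_all

lemma merge_at_rot: "\<lbrakk>Suc (Suc i) < length xs\<rbrakk> \<Longrightarrow> rotate_twist N (merge_at N i xs) = merge_at N (Suc i) (rotate_twist N xs)"
  by (cases xs rule: rev_cases) (simp_all add: merge_at_snoc)

text \<open>
  The identity \<open>\<tau>\<^sub>n\<^sub>-\<^sub>1 d\<^sub>n\<^sub>-\<^sub>1 = d\<^sub>0 \<tau>\<^sub>n \<tau>\<^sub>n\<close>: merging the last two actions and moving the result to the front is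
  the same as moving both and merging there.
\<close>
lemma merge_at_rot_rot:
  assumes "pact_list N xs" "length xs = Suc (Suc n)"
  shows "rotate_twist N (merge_at N n xs) = merge_at N 0 (rotate_twist N (rotate_twist N xs))"
proof -
  obtain us x y where xs: "xs = us @ [x] @ [y]" "length us = n"
    using assms(2) by (cases xs rule: rev_cases; cases "butlast xs" rule: rev_cases) auto
  have "rotate_twist N (us @ [x] @ [y]) = (twist N y # us) @ [x]"
    using rotate_twist_snoc[of N "us @ [x]" y] by simp
  then show ?thesis
    using xs assms(1) merge_at_append[of N us x y "[]"] rotate_twist_snoc[of N "twist N y # us" x]
    by (simp add: twist_merge del: rotate_twist_snoc) (simp add: rotate_twist_snoc)
qed

lemma insert_at_rot: "i < length xs \<Longrightarrow> insert_at (Suc i) e (rotate_twist N xs) = rotate_twist N (insert_at i e xs)"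
  by (cases xs rule: rev_cases) (simp_all add: insert_at_snoc)

lemma insert_at_length: "insert_at (length xs) e xs = xs @ [e]"
  using insert_at_append[of xs e "[]"] by simp

lemma insert_at_rot_rot:
  assumes "N \<in> Ob \<M>" "xs \<noteq> []"
  shows "insert_at 1 (trivial N) (rotate_twist N xs) = rotate_twist N (rotate_twist N (insert_at (length xs) (trivial N) xs))"
proof -
  obtain us y where xs: "xs = us @ [y]"
    using assms(2) by (cases xs rule: rev_cases) auto
  show ?thesis
    unfolding insert_at_length rotate_twist_snoc
    using xs assms(1) rotate_twist_snoc[of N "trivial N # us" y] by (simp add: twist_trivial)
qed

lemma rotate_twist_power:
  "(rotate_twist N ^^ length ys) (us @ ys) = map (twist N) ys @ us"
proof (induction ys arbitrary: us rule: rev_induct)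
  case (snoc y ys)
  have "(rotate_twist N ^^ length (ys @ [y])) (us @ ys @ [y]) = (rotate_twist N ^^ length ys) (rotate_twist N ((us @ ys) @ [y]))"
    by (simp add: funpow_swap1)
  also have "\<dots> = (rotate_twist N ^^ length ys) ((twist N y # us) @ ys)"
    by (simp only: rotate_twist_snoc) simp
  finally show ?case
    using snoc.IH[of "twist N y # us"] by simp
qed simp

text \<open>
  The last face is by definition the face \<open>d\<^sub>0\<close> after \<open>\<tau>\<^sub>n\<close>.
\<close>
definition face_list :: "'p \<Rightarrow> nat \<Rightarrow> nat \<Rightarrow> ('p, 'q) arrow list \<Rightarrow> ('p, 'q) arrow list" where
  "face_list N n i xs = (if i < n then merge_at N i xs else merge_at N 0 (rotate_twist N xs))"

definition degen_list :: "'p \<Rightarrow> nat \<Rightarrow> ('p, 'q) arrow list \<Rightarrow> ('p, 'q) arrow list" where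
  "degen_list N i xs = insert_at (Suc i) (trivial N) xs"

lemma comm_acts_pacts: "comm_acts N xs \<Longrightarrow> pact_list N xs"
  using comm_acts_pact by (auto simp: pact_list_def)

lemma length_face_list [simp]: "\<lbrakk>length xs = Suc n; 1 \<le> n\<rbrakk> \<Longrightarrow> length (face_list N n i xs) = n"
  by (cases "xs = []") (auto simp: face_list_def)

lemma comm_acts_face_list [simp]: "\<lbrakk>comm_acts N xs; length xs = Suc n; 1 \<le> n\<rbrakk> \<Longrightarrow> comm_acts N (face_list N n i xs)"
  by (cases "xs = []") (auto simp: face_list_def comm_acts_merge_at comm_acts_rot)

lemma length_degen_list [simp]: "length (degen_list N i xs) = Suc (length xs)"
  by (simp add: degen_list_def)

lemma comm_acts_degen_list [simp]: "\<lbrakk>comm_acts N xs; length xs = Suc n; i \<le> n\<rbrakk> \<Longrightarrow> comm_acts N (degen_list N i xs)"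
  by (simp add: degen_list_def comm_acts_insert_at)

lemma length_rot_Suc [simp]: "length xs = Suc n \<Longrightarrow> length (rotate_twist N xs) = Suc n"
  by (cases "xs = []") auto

lemma comm_acts_rot_Suc [simp]: "\<lbrakk>comm_acts N xs; length xs = Suc n\<rbrakk> \<Longrightarrow> comm_acts N (rotate_twist N xs)"
  by (cases "xs = []") (auto simp: comm_acts_rot)

text \<open>
  For inner faces this is associativity of \<open>merge\<close>.  If the outer face \<open>d\<^sub>n\<close> is involved, \<open>\<tau>\<^sub>n\<close> is moved
  to the right; only the case of \<open>d\<^sub>n\<^sub>-\<^sub>1 d\<^sub>n\<close> needs \<open>merge_at_rot_rot\<close>.
\<close>
lemma face_list_face_list:
  assumes "comm_acts N xs" "length xs = Suc n" "2 \<le> n" "i < j" "j \<le> n"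
  shows "face_list N (n - 1) i (face_list N n j xs) = face_list N (n - 1) (j - 1) (face_list N n i xs)"
proof -
  note p = comm_acts_pacts[OF assms(1)] comm_acts_pacts[OF comm_acts_rot_Suc[OF assms(1,2)]]
  consider "j < n" | "j = n" "i < n - 1" | "j = n" "i = n - 1"
    using assms by linarith
  then show ?thesis
  proof cases
    case 1
    then show ?thesis
      using assms p merge_at_merge_at[of i j xs N] by (auto simp: face_list_def)
  next
    case 2
    then have "merge_at N 0 (merge_at N (Suc i) (rotate_twist N xs)) = merge_at N i (merge_at N 0 (rotate_twist N xs))"
      using merge_at_merge_at[of 0 "Suc i" "rotate_twist N xs" N] p assms by simp
    then show ?thesis
      using assms 2 merge_at_rot[of i xs N] by (auto simp: face_list_def)
  next
    case 3
    have "rotate_twist N (merge_at N 0 (rotate_twist N xs)) = merge_at N 1 (rotate_twist N (rotate_twist N xs))"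
      using merge_at_rot[of 0 "rotate_twist N xs" N] assms by simp
    moreover have "merge_at N 0 (merge_at N 1 (rotate_twist N (rotate_twist N xs))) = merge_at N 0 (merge_at N 0 (rotate_twist N (rotate_twist N xs)))"
      using merge_at_merge_at[of 0 1 "rotate_twist N (rotate_twist N xs)" N] assms
        comm_acts_pacts[OF comm_acts_rot_Suc[OF comm_acts_rot_Suc[OF assms(1,2)]]] by simp
    moreover have "rotate_twist N (merge_at N (n - 1) xs) = merge_at N 0 (rotate_twist N (rotate_twist N xs))"
      using merge_at_rot_rot[OF p(1), of "n - 1"] assms by simp
    ultimately show ?thesis
      using assms 3 by (auto simp: face_list_def)
  qed
qed

lemma degen_list_degen_list: "\<lbrakk>length xs = Suc n; j < i; i \<le> n + 1\<rbrakk> \<Longrightarrow> degen_list N i (degen_list N j xs) = degen_list N j (degen_list N (i - 1) xs)"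
  using insert_at_insert_at[of "Suc j" "Suc i" xs] by (simp add: degen_list_def)

lemma face_list_degen_list_less:
  "\<lbrakk>length xs = Suc n; i < j; j \<le> n\<rbrakk> \<Longrightarrow> face_list N (n + 1) i (degen_list N j xs) = degen_list N (j - 1) (face_list N n i xs)"
  by (simp add: face_list_def degen_list_def merge_at_insert_at_less)

lemma face_list_degen_list_eq:
  assumes "comm_acts N xs" "length xs = Suc n" "j \<le> n" "i = j \<or> i = j + 1"
  shows "face_list N (n + 1) i (degen_list N j xs) = xs"
proof -
  note p = comm_acts_pacts[OF assms(1)]
  consider "i = j" | "i = j + 1" "j < n" | "i = n + 1" "j = n"
    using assms by linarith
  then show ?thesis
  proof cases
    case 3
    have N: "N \<in> Ob \<M>"
      using assms(1) by (simp add: comm_acts_def)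
    have "rotate_twist N (xs @ [trivial N]) = trivial N # xs"
      using N by (simp add: twist_trivial)
    then show ?thesis
      using 3 assms(2) insert_at_length[of xs "trivial N"] p
      by (cases xs) (simp_all add: face_list_def degen_list_def merge_trivial)
  qed (use assms p in \<open>auto simp: face_list_def degen_list_def merge_at_insert_at_eq merge_at_insert_at_Suc\<close>)
qed

lemma face_list_degen_list_greater:
  assumes "length xs = Suc n" "j + 1 < i" "i \<le> n + 1"
  shows "face_list N (n + 1) i (degen_list N j xs) = degen_list N j (face_list N n (i - 1) xs)"
proof (cases "i = n + 1")
  case True
  then have "rotate_twist N (insert_at (Suc j) (trivial N) xs) = insert_at (Suc (Suc j)) (trivial N) (rotate_twist N xs)"
    using assms by (simp add: insert_at_rot)
  then show ?thesis
    using True assms by (simp add: face_list_def degen_list_def merge_at_insert_at_less)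
next
  case False
  then show ?thesis
    using assms by (auto simp: face_list_def degen_list_def merge_at_insert_at_greater)
qed

lemma face_list_rot:
  assumes "comm_acts N xs" "length xs = Suc n" "1 \<le> i" "i \<le> n"
  shows "face_list N n i (rotate_twist N xs) = rotate_twist N (face_list N n (i - 1) xs)"
proof (cases "i = n")
  case True
  then show ?thesis
    using assms merge_at_rot_rot[OF comm_acts_pacts[OF assms(1)], of "n - 1"] by (simp add: face_list_def)
next
  case False
  then have "i - 1 < n" "i < n"
    using assms by auto
  then show ?thesis
    using assms merge_at_rot[of "i - 1" xs N] by (simp add: face_list_def)
qed

lemma face_list_zero_rot: "1 \<le> n \<Longrightarrow> face_list N n 0 (rotate_twist N xs) = face_list N n n xs"
  by (simp add: face_list_def)

lemma degen_list_rot: "\<lbrakk>length xs = Suc n; 1 \<le> i; i \<le> n\<rbrakk> \<Longrightarrow> degen_list N i (rotate_twist N xs) = rotate_twist N (degen_list N (i - 1) xs)"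
  by (simp add: degen_list_def insert_at_rot)

lemma degen_list_zero_rot:
  "\<lbrakk>comm_acts N xs; length xs = Suc n\<rbrakk> \<Longrightarrow> degen_list N 0 (rotate_twist N xs) = rotate_twist N (rotate_twist N (degen_list N n xs))"
  using insert_at_rot_rot[of N xs] by (cases "xs = []") (auto simp: degen_list_def comm_acts_def)

abbreviation "d \<equiv> face_functor B \<M> E H"
definition s :: "nat \<Rightarrow> nat \<Rightarrow> ('p \<times> 'q, 'q, 'p \<times> 'q, 'q) functr" where
  "s n i = degeneracy_functor B \<M> H n (int i)"
abbreviation "t \<equiv> cyc_functor B \<M> E H"

lemma d_obj [simp]:
  "\<lbrakk>comm_acts N xs; length xs = Suc n; 1 \<le> n; i \<le> n\<rbrakk> \<Longrightarrow> on_ob (d n i) (obj N xs) = obj N (face_list N n i xs)"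
  by (simp add: face_functor_def face_list_def inner_face_obj comp_functor_def cyc_obj)

lemma s_obj [simp]:
  "\<lbrakk>comm_acts N xs; length xs = Suc n; i \<le> n\<rbrakk> \<Longrightarrow> on_ob (s n i) (obj N xs) = obj N (degen_list N i xs)"
  by (simp add: s_def degeneracy_obj degen_list_def nat_add_distrib)

lemma t_obj [simp]:
  "\<lbrakk>comm_acts N xs; length xs = Suc n\<rbrakk> \<Longrightarrow> on_ob (t n) (obj N xs) = obj N (rotate_twist N xs)"
  by (rule cyc_obj)

lemma on_hom_d [simp]: "on_hom (d n i) = (\<lambda>u. u)"
  by (simp add: face_functor_def inner_face_def restrict_functor_def comp_functor_def on_hom_cyc comp_def)

lemma on_hom_s [simp]: "on_hom (s n i) = (\<lambda>u. u)"
  by (simp add: s_def degeneracy_functor_def restrict_functor_def)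

lemmas on_hom_t [simp] = on_hom_cyc

lemma functor_eqI:
  assumes "\<And>u. on_hom F u = on_hom G u"
    and "\<And>N xs. \<lbrakk>comm_acts N xs; length xs = Suc n\<rbrakk> \<Longrightarrow> on_ob F (obj N xs) = on_ob G (obj N xs)"
  shows "functor_eq (C n) F G"
  unfolding functor_eq_def C_Mod using assms C_obtains[of n] by (metis (no_types, lifting) Mod_sel(1) mem_Collect_eq)

lemma linear_functor_d: "\<lbrakk>1 \<le> n; i \<le> n\<rbrakk> \<Longrightarrow> linear_functor (C n) (C (n - 1)) (d n i)"
  using linear_functor_inner_face[of i n] linear_functor_inner_face[of 0 n]
  by (auto simp: face_functor_def intro: linear_functor_comp linear_functor_cyc)

lemma simplicial: "simplicial_object_in_categories C d s"
proof (rule simplicial_object_in_categories.intro)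
  show "linear_category (C n)" for n
    unfolding C_Mod by (rule linear_category_Mod) (rule power_simps(1))
  show "linear_functor (C n) (C (n - 1)) (d n i)" if "1 \<le> n" "i \<le> n" for n i
    using that by (rule linear_functor_d)
  show "linear_functor (C n) (C (n + 1)) (s n i)" if "i \<le> n" for n i
    unfolding s_def using that by (intro linear_functor_degeneracy) auto
  show "functor_eq (C n) (d (n - 1) i \<circ>\<^sub>F d n j) (d (n - 1) (j - 1) \<circ>\<^sub>F d n i)"
    if "2 \<le> n" "i < j" "j \<le> n" for n i j
    using that face_list_face_list[of _ _ n i j] by (intro functor_eqI) simp_all
  show "functor_eq (C n) (s (n + 1) i \<circ>\<^sub>F s n j) (s (n + 1) j \<circ>\<^sub>F s n (i - 1))"
    if "j < i" "i \<le> n + 1" for n i j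
    using that degen_list_degen_list[of _ n j i] by (intro functor_eqI) simp_all
  show "functor_eq (C n) (d (n + 1) i \<circ>\<^sub>F s n j) (s (n - 1) (j - 1) \<circ>\<^sub>F d n i)"
    if "i < j" "j \<le> n" for n i j
    using that face_list_degen_list_less[of _ n i j] by (intro functor_eqI) simp_all
  show "functor_eq (C n) (d (n + 1) i \<circ>\<^sub>F s n j) id_functor" if "j \<le> n" "i = j \<or> i = j + 1" for n i j
    using that face_list_degen_list_eq[of _ _ n j i] by (intro functor_eqI) auto
  show "functor_eq (C n) (d (n + 1) i \<circ>\<^sub>F s n j) (s (n - 1) j \<circ>\<^sub>F d n (i - 1))"
    if "j + 1 < i" "i \<le> n + 1" for n i j
    using that face_list_degen_list_greater[of _ n j i] by (intro functor_eqI) simp_all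
qed

lemma cyclic_relations:
  shows d_t: "\<lbrakk>1 \<le> i; i \<le> n\<rbrakk> \<Longrightarrow> functor_eq (C n) (d n i \<circ>\<^sub>F t n) (t (n - 1) \<circ>\<^sub>F d n (i - 1))"
    and d_zero_t: "1 \<le> n \<Longrightarrow> functor_eq (C n) (d n 0 \<circ>\<^sub>F t n) (d n n)"
    and s_t: "\<lbrakk>1 \<le> i; i \<le> n\<rbrakk> \<Longrightarrow> functor_eq (C n) (s n i \<circ>\<^sub>F t n) (t (n + 1) \<circ>\<^sub>F s n (i - 1))"
    and s_zero_t: "functor_eq (C n) (s n 0 \<circ>\<^sub>F t n) (t (n + 1) \<circ>\<^sub>F t (n + 1) \<circ>\<^sub>F s n n)"
  using face_list_rot[of _ _ n i] face_list_zero_rot[of n] degen_list_rot[of _ n i] degen_list_zero_rot[of _ _ n]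
  by (intro functor_eqI; simp)+

end

section \<open>Extension to the cyclic category\<close>

text \<open>
  The generators act on the integers by the maps of the paracyclic category, contravariantly: on each
  period a face skips \<open>i\<close>, a degeneracy repeats \<open>i\<close>, and \<open>\<tau>\<^sub>n\<close> is translation by \<open>-1\<close>.  An object \<open>n\<close> stands
  for the integers with period \<open>n + 1\<close>.
\<close>
fun gen_map :: "cyc_gen \<Rightarrow> int \<Rightarrow> int" where
  "gen_map (Face n i) x = (let q = x div int n; r = x mod int n
     in q * (int n + 1) + (if r < int i then r else r + 1))"
| "gen_map (Degen n i) x = (let q = x div (int n + 2); r = x mod (int n + 2)
     in q * (int n + 1) + (if r \<le> int i then r else r - 1))"
| "gen_map (Cyc n) x = x - 1"

fun word_map :: "cyc_gen list \<Rightarrow> int \<Rightarrow> int" where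
  "word_map [] x = x"
| "word_map (g # w) x = word_map w (gen_map g x)"

lemma word_map_append [simp]: "word_map (u @ v) x = word_map v (word_map u x)"
  by (induction u arbitrary: x) simp_all

lemma word_path_append [simp]:
  "word_path n (u @ v) l \<longleftrightarrow> (\<exists>m. word_path n v m \<and> word_path m u l)"
  by (induction u arbitrary: l) auto

lemma word_path_unique: "\<lbrakk>word_path n u m; word_path n u l\<rbrakk> \<Longrightarrow> m = l"
  by (cases u) auto

lemma gen_map_periodic:
  "gen_valid g \<Longrightarrow> gen_map g (x + k * (int (gen_tgt g) + 1)) = gen_map g x + k * (int (gen_src g) + 1)"
proof (cases g)
  case (Face n i)
  assume "gen_valid g"
  then have n: "int n \<noteq> 0" "int (gen_tgt g) + 1 = int n"
    using Face by auto
  have "(x + k * int n) div int n = x div int n + k" "(x + k * int n) mod int n = x mod int n"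
    using n by simp_all
  then show ?thesis
    unfolding n(2) unfolding Face gen_map.simps Let_def gen_src.simps by (simp add: distrib_right)
next
  case (Degen n i)
  have n: "int n + 2 \<noteq> 0" "int (gen_tgt g) + 1 = int n + 2"
    using Degen by auto
  have "(x + k * (int n + 2)) div (int n + 2) = x div (int n + 2) + k"
    "(x + k * (int n + 2)) mod (int n + 2) = x mod (int n + 2)"
    using n by simp_all
  then show ?thesis
    unfolding n(2) unfolding Degen gen_map.simps Let_def gen_src.simps by (simp add: distrib_right)
qed simp

lemma word_map_periodic:
  "word_path n w m \<Longrightarrow> word_map w (x + k * (int m + 1)) = word_map w x + k * (int n + 1)"
proof (induction w arbitrary: m x)
  case (Cons g w)
  then show ?case
    using gen_map_periodic[of g x k] by auto
qed simp

text \<open>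
  An equivariant map is determined by its values on one period.
\<close>
lemma word_map_eqI:
  assumes "word_path n u m" "word_path n v m"
    "\<And>r. \<lbrakk>0 \<le> r; r \<le> int m\<rbrakk> \<Longrightarrow> word_map u r = word_map v r"
  shows "word_map u = word_map v"
proof
  fix x
  let ?p = "int m + 1"
  have "x = x mod ?p + (x div ?p) * ?p"
    by (rule mod_div_mult_eq[symmetric])
  moreover have "word_map u (x mod ?p) = word_map v (x mod ?p)"
    using pos_mod_bound[of ?p x] by (intro assms(3)) auto
  ultimately show "word_map u x = word_map v x"
    using word_map_periodic[OF assms(1), of "x mod ?p" "x div ?p"]
      word_map_periodic[OF assms(2), of "x mod ?p" "x div ?p"] by metis
qed

lemma face_map: "\<lbrakk>0 \<le> r; r < int n\<rbrakk> \<Longrightarrow> gen_map (Face n i) r = (if r < int i then r else r + 1)"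
  by simp

lemma degen_map: "\<lbrakk>0 \<le> r; r < int n + 2\<rbrakk> \<Longrightarrow> gen_map (Degen n i) r = (if r \<le> int i then r else r - 1)"
  by simp

text \<open>
  Values just below zero, which appear in the relations with \<open>\<tau>\<^sub>n\<close>.
\<close>
lemma face_map_neg:
  assumes "1 \<le> n"
  shows "gen_map (Face n i) (- 1) = (if int n - 1 < int i then - 2 else - 1)"
  using assms by (simp add: div_eq_minus1 zmod_minus1)

lemma degen_map_neg:
  assumes "k = 1 \<or> k = 2"
  shows "gen_map (Degen n i) (- k) = (if int n + 2 - k \<le> int i then 1 - k else - k)"
proof -
  have "(- k) div (int n + 2) = -1"
    by (rule int_div_pos_eq[of _ _ _ "int n + 2 - k"]) (use assms in auto)
  moreover have "(- k) mod (int n + 2) = int n + 2 - k"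
    by (rule int_mod_pos_eq[of _ _ "-1"]) (use assms in auto)
  ultimately show ?thesis
    by simp
qed

lemma degen_map_neg1: "gen_map (Degen n i) (- 1) = (if int n + 1 \<le> int i then 0 else - 1)"
  and degen_map_neg2: "gen_map (Degen n i) (- 2) = (if n \<le> i then - 1 else - 2)"
  using degen_map_neg[of 1 n i] degen_map_neg[of 2 n i] by (simp_all del: gen_map.simps)

lemma cyc_rel_path: "cyc_rel n u v \<Longrightarrow> \<exists>m. word_path n u m \<and> word_path n v m"
  by (induction rule: cyc_rel.induct) auto

lemma cyc_rel_map:
  assumes "cyc_rel n u v"
  shows "word_map u = word_map v"
proof -
  obtain m where m: "word_path n u m" "word_path n v m"
    using cyc_rel_path[OF assms] by blast
  show ?thesis
  proof (rule word_map_eqI[OF m])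
    fix r :: int
    assume r: "0 \<le> r" "r \<le> int m"
    show "word_map u r = word_map v r"
      using assms m r
    proof cases
      case (1 i j)
      then show ?thesis using m r
        by (auto simp: face_map of_nat_diff simp del: gen_map.simps)
    next
      case (2 j i)
      then show ?thesis using m r
        by (auto simp: degen_map of_nat_diff simp del: gen_map.simps)
    next
      case (3 i j)
      then show ?thesis using m r
        by (auto simp: degen_map face_map of_nat_diff simp del: gen_map.simps)
    next
      case (4 j i)
      then show ?thesis using m r
        by (auto simp: degen_map face_map of_nat_diff simp del: gen_map.simps)
    next
      case (5 j i)
      then show ?thesis using m r
        by (auto simp: degen_map face_map of_nat_diff simp del: gen_map.simps)
    next
      case (6 i)
      then show ?thesis using m r
        by (cases "r = 0") (auto simp: face_map face_map_neg of_nat_diff simp del: gen_map.simps(1,2))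
    next
      case 7
      then show ?thesis using m r
        by (auto simp: face_map of_nat_diff simp del: gen_map.simps(1,2))
    next
      case (8 i)
      then show ?thesis using m r
        by (cases "r = 0") (auto simp: degen_map degen_map_neg1 of_nat_diff simp del: gen_map.simps(1,2))
    next
      case 9
      then show ?thesis using m r
        by (cases "r = 0"; cases "r = 1")
          (auto simp: degen_map degen_map_neg1 degen_map_neg2 of_nat_diff
            simp del: gen_map.simps(1,2))
    qed
  qed
qed

lemma cyc_power_map: "word_map (replicate k (Cyc n)) x = x - int k"
  by (induction k arbitrary: x) simp_all

lemma cyc_power_path: "word_path n (replicate k (Cyc n)) n"
  by (induction k) simp_all

lemma word_eq_path: "word_eq n u v \<Longrightarrow> \<exists>m. word_path n u m \<and> word_path n v m"
proof (induction rule: word_eq.induct)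
  case (word_eq_rel n u v)
  then show ?case
    by (rule cyc_rel_path)
next
  case (word_eq_cyc n)
  show ?case
    using cyc_power_path[of n "n + 1"] by (intro exI[of _ n]) simp
next
  case (word_eq_trans n u v w)
  then show ?case
    using word_path_unique by metis
next
  case (word_eq_cong n u v k x m w l)
  then show ?case
    using word_path_unique by (metis word_path_append)
qed auto

lemma word_eq_shift:
  "word_eq n u v \<Longrightarrow> \<exists>k. \<forall>x. word_map u x = word_map v x + k * (int n + 1)"
proof (induction rule: word_eq.induct)
  case (word_eq_rel n u v)
  then show ?case
    using cyc_rel_map by (intro exI[of _ 0]) simp
next
  case (word_eq_cyc n)
  show ?case
    by (intro exI[of _ "-1"]) (simp only: cyc_power_map, simp)
next
  case (word_eq_refl n u m)
  show ?case
    by (intro exI[of _ 0]) simp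
next
  case (word_eq_sym n u v)
  then obtain k where "\<forall>x. word_map u x = word_map v x + k * (int n + 1)"
    by blast
  then show ?case
    by (intro exI[of _ "-k"]) simp
next
  case (word_eq_trans n u v w)
  then obtain k l where "\<forall>x. word_map u x = word_map v x + k * (int n + 1)"
    "\<forall>x. word_map v x = word_map w x + l * (int n + 1)"
    by blast
  then show ?case
    by (intro exI[of _ "k + l"]) (simp add: algebra_simps)
next
  case (word_eq_cong n u v k x m w l)
  then obtain a where "\<forall>y. word_map u y = word_map v y + a * (int n + 1)"
    by blast
  then show ?case
    using word_map_periodic[OF word_eq_cong(2)] by (intro exI[of _ a]) simp
qed

text \<open>
  Distinct generators stay distinct in the cyclic category, since their maps differ by more than a
  translation.  Thus a functor can be prescribed on the class of each generator.
\<close>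
lemma gen_eq_if_word_eq:
  assumes "gen_valid g" "gen_valid g'" "gen_src g' = gen_src g" "word_eq (gen_src g) [g] [g']"
  shows "g = g'"
proof -
  let ?n = "gen_src g"
  have t: "gen_tgt g = gen_tgt g'"
    using word_eq_path[OF assms(4)] by auto
  obtain k where k: "gen_map g x = gen_map g' x + k * (int ?n + 1)" for x
    using word_eq_shift[OF assms(4)] by auto
  show ?thesis
  proof (cases g)
    case (Face n i)
    then obtain j where g': "g' = Face n j" and n: "1 \<le> n" "i \<le> n" "j \<le> n"
      using assms t by (cases g') auto
    have r: "(if r < int i then r else r + 1) = (if r < int j then r else r + 1) + k * (int n + 1)"
      if "0 \<le> r" "r < int n" for r
      using k[of r] face_map[OF that] Face g' by simp
    \<comment> \<open>at \<open>0\<close> the two maps differ by at most one, but a period has length at least two\<close>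
    have "k = 0"
    proof (rule ccontr)
      assume "k \<noteq> 0"
      then have "\<bar>k * (int n + 1)\<bar> \<ge> 2"
        using n(1) mult_mono[of 1 "\<bar>k\<bar>" 2 "int n + 1"] by (simp add: abs_mult)
      then show False
        using r[of 0] n(1) by (auto split: if_splits)
    qed
    then have "i = j"
      using r[of "int (min i j)"] n by (cases "i < j"; cases "j < i") (auto simp: min_def split: if_splits)
    then show ?thesis
      using Face g' by simp
  next
    case (Degen n i)
    then obtain j where g': "g' = Degen n j" and n: "i \<le> n" "j \<le> n"
      using assms t by (cases g') auto
    have r: "(if r \<le> int i then r else r - 1) = (if r \<le> int j then r else r - 1) + k * (int n + 1)"
      if "0 \<le> r" "r < int n + 2" for r
      using k[of r] degen_map[OF that] Degen g' by simp
    have "k = 0"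
      using r[of 0] by simp
    then have "i = j"
      using r[of "int (min i j) + 1"] n by (cases "i < j"; cases "j < i") (auto simp: min_def split: if_splits)
    then show ?thesis
      using Degen g' by simp
  next
    case (Cyc n)
    then show ?thesis
      using assms t by (cases g') auto
  qed
qed

lemma word_eq_cong_left: "\<lbrakk>word_eq n u v; word_path n u m; word_path m w l\<rbrakk> \<Longrightarrow> word_eq n (w @ u) (w @ v)"
  using word_eq_cong[of n u v n "[]" m w l] by simp

lemma word_eq_cong_right: "\<lbrakk>word_eq n u v; word_path k x n; word_path n u m\<rbrakk> \<Longrightarrow> word_eq k (u @ x) (v @ x)"
  using word_eq_cong[of n u v k x m "[]" m] by simp

lemma word_class_iff: "(n', v) \<in> word_class n u \<longleftrightarrow> n' = n \<and> word_eq n u v"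
  by (auto simp: word_class_def)

lemma word_class_eqI: "word_eq n u v \<Longrightarrow> word_class n u = word_class n v"
  by (auto simp: word_class_def intro: word_eq_trans word_eq_sym)

lemma word_class_eqD:
  assumes "word_class n u = word_class n' v" "word_path n u m"
  shows "n' = n" "word_eq n u v"
proof -
  have "(n, u) \<in> word_class n' v"
    using assms word_eq_refl word_class_iff by metis
  then show "n' = n" "word_eq n u v"
    by (auto simp: word_class_iff intro: word_eq_sym)
qed

lemma Lambda_op_sel [simp]:
  "Ob Lambda_op = UNIV"
  "Hom Lambda_op n m = {word_class n u | u. word_path n u m}"
  "Ident Lambda_op n = word_class n []"
  by (simp_all add: Lambda_op_def)

lemma Lambda_op_comp [simp]:
  assumes "word_path n v m" "word_path m u l"
  shows "word_class m u \<cdot>\<^bsub>Lambda_op\<^esub> word_class n v = word_class n (u @ v)"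
proof -
  have eq: "word_class n (u' @ v') = word_class n (u @ v)" if "word_eq m u u'" "word_eq n v v'" for u' v'
  proof -
    have "word_path n v' m"
      using word_eq_path[OF that(2)] assms(1) word_path_unique by metis
    then have "word_eq n (u @ v) (u' @ v')"
      using word_eq_cong_left[OF that(2) assms] word_eq_cong_right[OF that(1) _ assms(2)] word_eq_trans by blast
    then show ?thesis
      by (simp add: word_class_eqI)
  qed
  have "{word_class k (u' @ v') | m' u' k v'. (m', u') \<in> word_class m u \<and> (k, v') \<in> word_class n v} =
      {word_class n (u @ v)}"
    using eq assms word_eq_refl unfolding word_class_iff by blast
  then show ?thesis
    by (simp add: Lambda_op_def)
qed

lemma category_Lambda_op: "category Lambda_op"
proof
  fix n
  show "Ident Lambda_op n \<in> Hom Lambda_op n n"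
    by auto
next
  fix x y z f g
  assume "f \<in> Hom Lambda_op x y" "g \<in> Hom Lambda_op y z"
  then obtain u v where u: "f = word_class x u" "word_path x u y" and v: "g = word_class y v" "word_path y v z"
    by auto
  then show "g \<cdot>\<^bsub>Lambda_op\<^esub> f \<in> Hom Lambda_op x z"
    by (auto intro!: exI[of _ "v @ u"])
next
  fix x y f
  assume "f \<in> Hom Lambda_op x y"
  then obtain u where u: "f = word_class x u" "word_path x u y"
    by auto
  then show "Ident Lambda_op y \<cdot>\<^bsub>Lambda_op\<^esub> f = f" "f \<cdot>\<^bsub>Lambda_op\<^esub> Ident Lambda_op x = f"
    using Lambda_op_comp[of x u y "[]" y] Lambda_op_comp[of x "[]" x u y] by auto
next
  fix w x y z f g h
  assume "f \<in> Hom Lambda_op w x" "g \<in> Hom Lambda_op x y" "h \<in> Hom Lambda_op y z"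
  then obtain u v r where u: "f = word_class w u" "word_path w u x" and v: "g = word_class x v" "word_path x v y"
    and r: "h = word_class y r" "word_path y r z"
    by auto
  have "word_class x (r @ v) \<cdot>\<^bsub>Lambda_op\<^esub> word_class w u = word_class w ((r @ v) @ u)"
    by (rule Lambda_op_comp[of w u x "r @ v" z]) (use u v r in auto)
  moreover have "word_class y r \<cdot>\<^bsub>Lambda_op\<^esub> word_class w (v @ u) = word_class w (r @ (v @ u))"
    by (rule Lambda_op_comp[of w "v @ u" y r z]) (use u v r in auto)
  ultimately show "(h \<cdot>\<^bsub>Lambda_op\<^esub> g) \<cdot>\<^bsub>Lambda_op\<^esub> f = h \<cdot>\<^bsub>Lambda_op\<^esub> g \<cdot>\<^bsub>Lambda_op\<^esub> f"
    using u v r by simp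
qed

text \<open>
  A representative word for each class; the class of a generator is represented by that generator.
  For \<open>n = 0\<close> the class of \<open>\<tau>\<^sub>0\<close> is the identity, which is then represented by \<open>[Cyc 0]\<close> and not by the
  empty word.
\<close>
definition class_rep :: "(nat \<times> cyc_gen list) set \<Rightarrow> cyc_gen list" where
  "class_rep c = (if \<exists>g. gen_valid g \<and> c = gen_class g then [SOME g. gen_valid g \<and> c = gen_class g]
     else snd (SOME p. p \<in> c))"

definition class_src :: "(nat \<times> cyc_gen list) set \<Rightarrow> nat" where
  "class_src c = fst (SOME p. p \<in> c)"

text \<open>
  The number of periods by which the map of a word exceeds that of the chosen representative.
\<close>
definition phase :: "nat \<Rightarrow> cyc_gen list \<Rightarrow> int" where
  "phase n u = (word_map u 0 - word_map (class_rep (word_class n u)) 0) div (int n + 1)"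

lemma class_rep_eq:
  assumes "word_path n u m"
  shows "word_eq n u (class_rep (word_class n u))" "class_src (word_class n u) = n"
proof -
  let ?c = "word_class n u"
  have in_c: "(n, u) \<in> ?c"
    using assms by (simp add: word_class_iff word_eq_refl)
  then have "(SOME p. p \<in> ?c) \<in> ?c"
    by (rule someI)
  then have some: "fst (SOME p. p \<in> ?c) = n" "word_eq n u (snd (SOME p. p \<in> ?c))"
    by (metis prod.collapse word_class_iff)+
  then show "class_src ?c = n"
    by (simp add: class_src_def)
  show "word_eq n u (class_rep ?c)"
  proof (cases "\<exists>g. gen_valid g \<and> ?c = gen_class g")
    case True
    define g where "g = (SOME g. gen_valid g \<and> ?c = gen_class g)"
    have "gen_valid g \<and> ?c = gen_class g"
      unfolding g_def using True by (rule someI_ex)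
    then have "word_eq n u [g]"
      using word_class_eqD(2)[OF _ assms] by blast
    then show ?thesis
      using True by (simp add: class_rep_def g_def)
  next
    case False
    then show ?thesis
      using some unfolding class_rep_def if_not_P[OF False] by simp
  qed
qed

lemma class_rep_path: "word_path n u m \<Longrightarrow> word_path n (class_rep (word_class n u)) m"
  using word_eq_path[OF class_rep_eq(1)] word_path_unique by metis

lemma word_class_rep: "word_path n u m \<Longrightarrow> word_class n (class_rep (word_class n u)) = word_class n u"
  using word_class_eqI[OF class_rep_eq(1)] by simp

lemma class_rep_gen:
  assumes "gen_valid g"
  shows "class_rep (gen_class g) = [g]"
proof -
  have "(SOME g'. gen_valid g' \<and> gen_class g = gen_class g') = g"
  proof (rule some_equality)
    fix g' assume g': "gen_valid g' \<and> gen_class g = gen_class g'"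
    have "word_path (gen_src g) [g] (gen_tgt g)"
      using assms by simp
    then have "gen_src g' = gen_src g" "word_eq (gen_src g) [g] [g']"
      using word_class_eqD[OF conjunct2[OF g']] by blast+
    then show "g' = g"
      using gen_eq_if_word_eq[OF assms conjunct1[OF g']] by blast
  qed (use assms in simp)
  then show ?thesis
    using assms by (auto simp: class_rep_def)
qed

lemma phase_shift:
  assumes "word_path n u m"
  shows "word_map u x = word_map (class_rep (word_class n u)) x + phase n u * (int n + 1)"
proof -
  obtain k where k: "\<forall>x. word_map u x = word_map (class_rep (word_class n u)) x + k * (int n + 1)"
    using word_eq_shift[OF class_rep_eq(1)[OF assms]] by blast
  then have "phase n u = k"
    by (simp add: phase_def)
  then show ?thesis
    using k by simp
qed

lemma phase_eq:
  assumes "word_eq n u v" "word_map u 0 = word_map v 0 + k * (int n + 1)"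
  shows "phase n u = phase n v + k"
proof -
  let ?r = "word_map (class_rep (word_class n v)) 0"
  have "phase n u = ((word_map v 0 - ?r) + k * (int n + 1)) div (int n + 1)"
    unfolding phase_def word_class_eqI[OF assms(1)] assms(2) by (rule arg_cong2[of _ _ _ _ "(div)"]) simp_all
  also have "\<dots> = phase n v + k"
    unfolding phase_def by (subst div_mult_self1) simp_all
  finally show ?thesis .
qed

lemma phase_rep: "word_path n u m \<Longrightarrow> phase n (class_rep (word_class n u)) = 0"
  using phase_shift[of n "class_rep (word_class n u)" m 0] class_rep_path[of n u m] word_class_rep[of n u m]
  by simp

lemma phase_append:
  assumes "word_path n v m" "word_path m u l"
  shows "phase n (u @ v) = phase n (class_rep (word_class m u) @ v) + phase m u"
    and "phase n (u @ v) = phase n (u @ class_rep (word_class n v)) + phase n v"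
proof -
  show "phase n (u @ v) = phase n (class_rep (word_class m u) @ v) + phase m u"
  proof (rule phase_eq)
    show "word_eq n (u @ v) (class_rep (word_class m u) @ v)"
      using word_eq_cong_right[OF class_rep_eq(1)[OF assms(2)] assms] .
    show "word_map (u @ v) 0 = word_map (class_rep (word_class m u) @ v) 0 + phase m u * (int n + 1)"
      using phase_shift[OF assms(2), of 0] word_map_periodic[OF assms(1)] by simp
  qed
  show "phase n (u @ v) = phase n (u @ class_rep (word_class n v)) + phase n v"
  proof (rule phase_eq)
    show "word_eq n (u @ v) (u @ class_rep (word_class n v))"
      using word_eq_cong_left[OF class_rep_eq(1)[OF assms(1)] assms] .
    show "word_map (u @ v) 0 = word_map (u @ class_rep (word_class n v)) 0 + phase n v * (int n + 1)"
      using phase_shift[OF assms(1)] by simp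
  qed
qed


locale natural_automorphism = category M
  for M :: "('p, 'm, 'y) cat_scheme" (structure) +
  fixes \<sigma> :: "'p \<Rightarrow> 'm"
  assumes twist_natural: "natural_iso M M id_functor id_functor \<sigma>"
begin

abbreviation "\<sigma>' N \<equiv> Inv M N N (\<sigma> N)"

lemma twist_inverse: "N \<in> Ob M \<Longrightarrow> inverse_pair M N N (\<sigma> N) (\<sigma>' N)"
  using twist_natural by (intro inverse_pair_Inv) (auto simp: natural_iso_def id_functor_def)

lemma twist_hom [simp]: "N \<in> Ob M \<Longrightarrow> \<sigma> N \<in> Hom M N N" "N \<in> Ob M \<Longrightarrow> \<sigma>' N \<in> Hom M N N"
  and twist_cancel [simp]: "N \<in> Ob M \<Longrightarrow> \<sigma> N \<cdot> \<sigma>' N = Ident M N" "N \<in> Ob M \<Longrightarrow> \<sigma>' N \<cdot> \<sigma> N = Ident M N"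
  using twist_inverse[of N] by (auto simp: inverse_pair_def)

lemma twist_nat: "\<lbrakk>X \<in> Ob M; Y \<in> Ob M; f \<in> Hom M X Y\<rbrakk> \<Longrightarrow> \<sigma> Y \<cdot> f = f \<cdot> \<sigma> X"
  using twist_natural by (auto simp: natural_iso_def id_functor_def)

definition twist_pow :: "int \<Rightarrow> 'p \<Rightarrow> 'm" where
  "twist_pow k N = (if 0 \<le> k then ((\<cdot>) (\<sigma> N) ^^ nat k) (Ident M N) else ((\<cdot>) (\<sigma>' N) ^^ nat (- k)) (Ident M N))"

lemma twist_pow_0 [simp]: "twist_pow 0 N = Ident M N"
  by (simp add: twist_pow_def)

lemma twist_pow_hom [simp]: "N \<in> Ob M \<Longrightarrow> twist_pow k N \<in> Hom M N N"
proof -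
  assume N: "N \<in> Ob M"
  have "((\<cdot>) g ^^ j) (Ident M N) \<in> Hom M N N" if "g \<in> Hom M N N" for g j
    using that N ident_hom comp_hom by (induction j) auto
  then show ?thesis
    using N by (simp add: twist_pow_def)
qed

lemma twist_pow_Suc: "N \<in> Ob M \<Longrightarrow> twist_pow (k + 1) N = \<sigma> N \<cdot> twist_pow k N"
proof -
  assume N: "N \<in> Ob M"
  show ?thesis
  proof (cases "0 \<le> k")
    case True
    then show ?thesis
      by (simp add: twist_pow_def nat_add_distrib)
  next
    case False
    then obtain j where j: "k = - int (Suc j)"
      using negD by force
    have "twist_pow k N = \<sigma>' N \<cdot> twist_pow (k + 1) N"
      using j by (auto simp: twist_pow_def nat_add_distrib)
    then have "\<sigma> N \<cdot> twist_pow k N = (\<sigma> N \<cdot> \<sigma>' N) \<cdot> twist_pow (k + 1) N"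
      using N comp_assoc[of N N N N "twist_pow (k + 1) N" "\<sigma>' N" "\<sigma> N"] by simp
    then show ?thesis
      using N ident_left[of N N "twist_pow (k + 1) N"] by simp
  qed
qed

lemma twist_pow_1: "N \<in> Ob M \<Longrightarrow> twist_pow 1 N = \<sigma> N"
  using twist_pow_Suc[of N 0] ident_right[of N N "\<sigma> N"] by simp

lemma twist_pow_pred: "N \<in> Ob M \<Longrightarrow> twist_pow (k - 1) N = \<sigma>' N \<cdot> twist_pow k N"
  using twist_pow_Suc[of N "k - 1"] comp_assoc[of N N N N "twist_pow (k - 1) N" "\<sigma> N" "\<sigma>' N"]
    ident_left[of N N "twist_pow (k - 1) N"] by simp

lemma twist_pow_add: "N \<in> Ob M \<Longrightarrow> twist_pow (a + b) N = twist_pow a N \<cdot> twist_pow b N"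
proof (induction a rule: int_induct[of _ 0])
  case base
  then show ?case
    using ident_left[of N N "twist_pow b N"] by simp
next
  case (step1 i)
  then show ?case
    using twist_pow_Suc[of N "i + b"] twist_pow_Suc[of N i] comp_assoc[of N N N N "twist_pow b N" "twist_pow i N" "\<sigma> N"]
    by (simp add: algebra_simps)
next
  case (step2 i)
  then show ?case
    using twist_pow_pred[of N "i + b"] twist_pow_pred[of N i] comp_assoc[of N N N N "twist_pow b N" "twist_pow i N" "\<sigma>' N"]
    by (simp add: algebra_simps)
qed

lemma twist_pow_inverse: "N \<in> Ob M \<Longrightarrow> inverse_pair M N N (twist_pow k N) (twist_pow (- k) N)"
  using twist_pow_add[of N k "- k"] twist_pow_add[of N "- k" k] by (simp add: inverse_pair_def)

lemma twist_pow_nat: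
  assumes "X \<in> Ob M" "Y \<in> Ob M" "f \<in> Hom M X Y"
  shows "twist_pow k Y \<cdot> f = f \<cdot> twist_pow k X"
proof (induction k rule: int_induct[of _ 0])
  case base
  then show ?case
    using assms ident_left[of X Y f] ident_right[of X Y f] by simp
next
  case (step1 i)
  have "twist_pow (i + 1) Y \<cdot> f = \<sigma> Y \<cdot> (f \<cdot> twist_pow i X)"
    using assms step1 comp_assoc[of X Y Y Y f "twist_pow i Y" "\<sigma> Y"] by (simp add: twist_pow_Suc)
  also have "\<dots> = (f \<cdot> \<sigma> X) \<cdot> twist_pow i X"
    using assms comp_assoc[of X X Y Y "twist_pow i X" f "\<sigma> Y"] by (simp add: twist_nat)
  also have "\<dots> = f \<cdot> twist_pow (i + 1) X"
    using assms comp_assoc[of X X X Y "twist_pow i X" "\<sigma> X" f] by (simp add: twist_pow_Suc)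
  finally show ?case .
next
  case (step2 i)
  have nat': "\<sigma>' Y \<cdot> f = f \<cdot> \<sigma>' X"
  proof -
    have "\<sigma>' Y \<cdot> f = \<sigma>' Y \<cdot> ((f \<cdot> \<sigma> X) \<cdot> \<sigma>' X)"
      using assms comp_assoc[of X X X Y "\<sigma>' X" "\<sigma> X" f] ident_right[of X Y f] by simp
    also have "\<dots> = \<sigma>' Y \<cdot> (\<sigma> Y \<cdot> (f \<cdot> \<sigma>' X))"
      using assms twist_nat[of X Y f] comp_assoc[of X X Y Y "\<sigma>' X" f "\<sigma> Y"] by simp
    also have "\<dots> = f \<cdot> \<sigma>' X"
      using assms comp_hom[of X X Y "\<sigma>' X" f] comp_assoc[of X Y Y Y "f \<cdot> \<sigma>' X" "\<sigma> Y" "\<sigma>' Y"]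
        ident_left[of X Y "f \<cdot> \<sigma>' X"] by simp
    finally show ?thesis .
  qed
  have "twist_pow (i - 1) Y \<cdot> f = \<sigma>' Y \<cdot> (f \<cdot> twist_pow i X)"
    using assms step2 comp_assoc[of X Y Y Y f "twist_pow i Y" "\<sigma>' Y"] by (simp add: twist_pow_pred)
  also have "\<dots> = (f \<cdot> \<sigma>' X) \<cdot> twist_pow i X"
    using assms nat' comp_assoc[of X X Y Y "twist_pow i X" f "\<sigma>' Y"] by simp
  also have "\<dots> = f \<cdot> twist_pow (i - 1) X"
    using assms comp_assoc[of X X X Y "twist_pow i X" "\<sigma>' X" f] by (simp add: twist_pow_pred)
  finally show ?case .
qed

end

text \<open>
  The situation of modules in abstract form: the categories lie over a fixed category \<open>M\<close> by a functor
  \<open>U\<close> that is the inclusion on homs, all functors lie over \<open>M\<close>, the cyclic relations other than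
  \<open>t\<^sup>n\<^sup>+\<^sup>1 = Id\<close> hold strictly, and a natural automorphism \<open>\<sigma>\<close> of the identity of \<open>M\<close> lifts to \<open>Id \<cong> t\<^sup>n\<^sup>+\<^sup>1\<close>.
\<close>
locale concrete_paracyclic_object = natural_automorphism M \<sigma> + simplicial_object_in_categories C d s
  for M :: "('p, 'm, 'y) cat_scheme" (structure)
    and \<sigma> :: "'p \<Rightarrow> 'm"
    and C :: "nat \<Rightarrow> ('o, 'm, 'k::{alg_closed_field, field_char_0}) lin_cat"
    and d :: "nat \<Rightarrow> nat \<Rightarrow> ('o, 'm, 'o, 'm) functr"
    and s :: "nat \<Rightarrow> nat \<Rightarrow> ('o, 'm, 'o, 'm) functr" +
  fixes t :: "nat \<Rightarrow> ('o, 'm, 'o, 'm) functr"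
    and U :: "'o \<Rightarrow> 'p"
  assumes U_ob: "X \<in> Ob (C n) \<Longrightarrow> U X \<in> Ob M"
    and C_hom: "\<lbrakk>X \<in> Ob (C n); Y \<in> Ob (C n); f \<in> Hom (C n) X Y\<rbrakk> \<Longrightarrow> f \<in> Hom M (U X) (U Y)"
    and C_comp: "Compose (C n) = Compose M"
    and C_ident: "X \<in> Ob (C n) \<Longrightarrow> Ident (C n) X = Ident M (U X)"
    and C_inverse: "\<lbrakk>X \<in> Ob (C n); Y \<in> Ob (C n); f \<in> Hom (C n) X Y; inverse_pair M (U X) (U Y) f g\<rbrakk>
      \<Longrightarrow> g \<in> Hom (C n) Y X"
    and t_linear: "linear_functor (C n) (C n) (t n)"
    and U_d: "\<lbrakk>1 \<le> n; i \<le> n; X \<in> Ob (C n)\<rbrakk> \<Longrightarrow> U (on_ob (d n i) X) = U X"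
    and U_s: "\<lbrakk>i \<le> n; X \<in> Ob (C n)\<rbrakk> \<Longrightarrow> U (on_ob (s n i) X) = U X"
    and U_t: "X \<in> Ob (C n) \<Longrightarrow> U (on_ob (t n) X) = U X"
    and d_hom: "on_hom (d n i) u = u"
    and s_hom: "on_hom (s n i) u = u"
    and t_hom: "on_hom (t n) u = u"
    and d_t: "\<lbrakk>1 \<le> i; i \<le> n\<rbrakk> \<Longrightarrow> functor_eq (C n) (d n i \<circ>\<^sub>F t n) (t (n - 1) \<circ>\<^sub>F d n (i - 1))"
    and d_zero_t: "1 \<le> n \<Longrightarrow> functor_eq (C n) (d n 0 \<circ>\<^sub>F t n) (d n n)"
    and s_t: "\<lbrakk>1 \<le> i; i \<le> n\<rbrakk> \<Longrightarrow> functor_eq (C n) (s n i \<circ>\<^sub>F t n) (t (n + 1) \<circ>\<^sub>F s n (i - 1))"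
    and s_zero_t: "functor_eq (C n) (s n 0 \<circ>\<^sub>F t n) (t (n + 1) \<circ>\<^sub>F t (n + 1) \<circ>\<^sub>F s n n)"
    and twist_C: "X \<in> Ob (C n) \<Longrightarrow> \<sigma> (U X) \<in> Hom (C n) X (on_ob (functor_power (t n) (n + 1)) X)"
begin

fun gen_fun :: "cyc_gen \<Rightarrow> ('o, 'm, 'o, 'm) functr" where
  "gen_fun (Face n i) = d n i"
| "gen_fun (Degen n i) = s n i"
| "gen_fun (Cyc n) = t n"

fun word_fun :: "cyc_gen list \<Rightarrow> ('o, 'm, 'o, 'm) functr" where
  "word_fun [] = id_functor"
| "word_fun (g # w) = gen_fun g \<circ>\<^sub>F word_fun w"

lemma gen_fun_linear: "gen_valid g \<Longrightarrow> linear_functor (C (gen_src g)) (C (gen_tgt g)) (gen_fun g)"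
  using d_functor s_functor t_linear by (cases g) auto

lemma word_fun_linear: "word_path n w m \<Longrightarrow> linear_functor (C n) (C m) (word_fun w)"
proof (induction w arbitrary: m)
  case Nil
  then show ?case
    using linear_functor_id[OF linear] by simp
next
  case (Cons g w)
  then show ?case
    using linear_functor_comp[OF Cons.IH gen_fun_linear[of g]] by simp
qed

lemma word_fun_ob: "\<lbrakk>word_path n w m; X \<in> Ob (C n)\<rbrakk> \<Longrightarrow> on_ob (word_fun w) X \<in> Ob (C m)"
  by (rule linear_functor.on_ob[OF word_fun_linear])

lemma word_fun_hom [simp]: "on_hom (word_fun w) u = u"
proof (induction w)
  case (Cons g w)
  then show ?case
    by (cases g) (simp_all add: d_hom s_hom t_hom)
qed simp

lemma word_fun_map:
  "\<lbrakk>word_path n w m; X \<in> Ob (C n); Y \<in> Ob (C n); u \<in> Hom (C n) X Y\<rbrakk>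
    \<Longrightarrow> u \<in> Hom (C m) (on_ob (word_fun w) X) (on_ob (word_fun w) Y)"
  using linear_functor.on_hom[OF word_fun_linear[of n w m], of X Y u] by simp

lemma U_word_fun [simp]: "\<lbrakk>word_path n w m; X \<in> Ob (C n)\<rbrakk> \<Longrightarrow> U (on_ob (word_fun w) X) = U X"
proof (induction w arbitrary: m)
  case (Cons g w)
  then have ob: "on_ob (word_fun w) X \<in> Ob (C (gen_src g))" and U: "U (on_ob (word_fun w) X) = U X"
    using word_fun_ob by auto
  then show ?case
    using Cons.prems by (cases g) (auto simp: U_d U_s U_t)
qed simp

lemma word_fun_append [simp]: "on_ob (word_fun (u @ v)) X = on_ob (word_fun u) (on_ob (word_fun v) X)"
  by (induction u) simp_all

lemma word_fun_single: "word_fun [g] = gen_fun g"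
  by (simp add: comp_functor_def id_functor_def comp_def)

lemma cyc_rel_fun:
  assumes "cyc_rel n u v" "X \<in> Ob (C n)"
  shows "on_ob (word_fun u) X = on_ob (word_fun v) X"
proof -
  have "functor_eq (C n) (word_fun u) (word_fun v)"
    using assms(1) d_d s_s d_s_less d_s_eq d_s_greater d_t d_zero_t s_t s_zero_t
    by cases (auto simp: functor_eq_def d_hom s_hom t_hom)
  then show ?thesis
    using assms(2) by (simp add: functor_eq_def)
qed

lemma word_fun_power: "on_ob (word_fun (replicate k (Cyc n))) X = on_ob (functor_power (t n) k) X"
  by (induction k) simp_all

text \<open>
  Equal words in the cyclic category give isomorphic functors, by the power of \<open>\<sigma>\<close> that counts the
  periods between their maps.  The sign comes from \<open>t\<^sup>n\<^sup>+\<^sup>1\<close>: its map is translation by \<open>-(n + 1)\<close>, and the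
  isomorphism to the identity is the inverse of \<open>\<sigma>\<close>.
\<close>
lemma word_eq_twist_pow:
  "word_eq n u v \<Longrightarrow> \<exists>m k. word_path n u m \<and> word_path n v m \<and>
    (\<forall>x. word_map u x = word_map v x + k * (int n + 1)) \<and>
    (\<forall>X \<in> Ob (C n). twist_pow k (U X) \<in> Hom (C m) (on_ob (word_fun u) X) (on_ob (word_fun v) X))"
proof (induction rule: word_eq.induct)
  case (word_eq_rel n u v)
  obtain m where m: "word_path n u m" "word_path n v m"
    using cyc_rel_path[OF word_eq_rel] by blast
  interpret Cm: linear_category "C m" by (rule linear)
  have "twist_pow 0 (U X) \<in> Hom (C m) (on_ob (word_fun u) X) (on_ob (word_fun v) X)" if X: "X \<in> Ob (C n)" for X
  proof -
    have ob: "on_ob (word_fun v) X \<in> Ob (C m)"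
      using m X word_fun_ob by blast
    show ?thesis
      using Cm.ident_hom[OF ob] C_ident[OF ob] cyc_rel_fun[OF word_eq_rel X] m X by simp
  qed
  then show ?case
    using m cyc_rel_map[OF word_eq_rel] by (intro exI[of _ m] exI[of _ 0]) simp
next
  case (word_eq_cyc n)
  have p: "word_path n (replicate (n + 1) (Cyc n)) n"
    by (rule cyc_power_path)
  have "twist_pow (-1) (U X) \<in> Hom (C n) (on_ob (word_fun (replicate (n + 1) (Cyc n))) X) X" if X: "X \<in> Ob (C n)" for X
  proof -
    have ob: "on_ob (word_fun (replicate (n + 1) (Cyc n))) X \<in> Ob (C n)"
      by (rule word_fun_ob[OF p X])
    have "twist_pow 1 (U X) \<in> Hom (C n) X (on_ob (word_fun (replicate (n + 1) (Cyc n))) X)"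
      unfolding word_fun_power using twist_C[OF X] twist_pow_1[OF U_ob[OF X]] by simp
    then show ?thesis
      using C_inverse[OF X ob] twist_pow_inverse[OF U_ob[OF X], of 1] U_word_fun[OF p X] by simp
  qed
  then show ?case
    using p cyc_power_map[of "n + 1" n]
    by (intro exI[of _ n] exI[of _ "-1"] conjI) (simp_all del: replicate_Suc word_fun.simps add: word_fun.simps(1))
next
  case (word_eq_refl n u m)
  interpret Cm: linear_category "C m" by (rule linear)
  have "twist_pow 0 (U X) \<in> Hom (C m) (on_ob (word_fun u) X) (on_ob (word_fun u) X)" if X: "X \<in> Ob (C n)" for X
    using Cm.ident_hom[OF word_fun_ob[OF word_eq_refl X]] C_ident[OF word_fun_ob[OF word_eq_refl X]]
      word_eq_refl X by simp
  then show ?case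
    using word_eq_refl by (intro exI[of _ m] exI[of _ 0]) simp
next
  case (word_eq_sym n u v)
  then obtain m k where m: "word_path n u m" "word_path n v m"
    "\<forall>x. word_map u x = word_map v x + k * (int n + 1)"
    and h: "\<forall>X \<in> Ob (C n). twist_pow k (U X) \<in> Hom (C m) (on_ob (word_fun u) X) (on_ob (word_fun v) X)"
    by blast
  have "twist_pow (-k) (U X) \<in> Hom (C m) (on_ob (word_fun v) X) (on_ob (word_fun u) X)" if X: "X \<in> Ob (C n)" for X
    using C_inverse[OF word_fun_ob[OF m(1) X] word_fun_ob[OF m(2) X], of "twist_pow k (U X)" "twist_pow (-k) (U X)"] h X
      twist_pow_inverse[OF U_ob[OF X], of k] U_word_fun[OF m(1) X] U_word_fun[OF m(2) X] by simp
  then show ?case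
    using m by (intro exI[of _ m] exI[of _ "-k"]) simp
next
  case (word_eq_trans n u v w)
  then obtain m k where m: "word_path n u m" "word_path n v m"
    "\<forall>x. word_map u x = word_map v x + k * (int n + 1)"
    and h: "\<forall>X \<in> Ob (C n). twist_pow k (U X) \<in> Hom (C m) (on_ob (word_fun u) X) (on_ob (word_fun v) X)"
    by blast
  obtain m' l where m': "word_path n v m'" "word_path n w m'"
    "\<forall>x. word_map v x = word_map w x + l * (int n + 1)"
    and h': "\<forall>X \<in> Ob (C n). twist_pow l (U X) \<in> Hom (C m') (on_ob (word_fun v) X) (on_ob (word_fun w) X)"
    using word_eq_trans by blast
  have e: "m' = m"
    using word_path_unique m m' by blast
  interpret Cm: linear_category "C m" by (rule linear)
  have "twist_pow (k + l) (U X) \<in> Hom (C m) (on_ob (word_fun u) X) (on_ob (word_fun w) X)" if X: "X \<in> Ob (C n)" for X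
    using Cm.comp_hom[OF word_fun_ob[OF m(1) X] word_fun_ob[OF m(2) X] word_fun_ob[OF m'(2)[unfolded e] X]]
      h h' X twist_pow_add[OF U_ob[OF X], of l k] e by (simp add: C_comp add.commute)
  then show ?case
    using m m' e by (intro exI[of _ m] exI[of _ "k + l"]) (simp add: algebra_simps)
next
  case (word_eq_cong n u v k x m w l)
  then obtain m' a where m': "word_path n u m'" "word_path n v m'"
    "\<forall>y. word_map u y = word_map v y + a * (int n + 1)"
    and h: "\<forall>X \<in> Ob (C n). twist_pow a (U X) \<in> Hom (C m') (on_ob (word_fun u) X) (on_ob (word_fun v) X)"
    by blast
  have e: "m' = m"
    using word_path_unique m' word_eq_cong by blast
  have "twist_pow a (U X) \<in> Hom (C l) (on_ob (word_fun (w @ u @ x)) X) (on_ob (word_fun (w @ v @ x)) X)"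
    if X: "X \<in> Ob (C k)" for X
  proof -
    have Y: "on_ob (word_fun x) X \<in> Ob (C n)"
      by (rule word_fun_ob[OF word_eq_cong(2) X])
    show ?thesis
      using word_fun_map[OF word_eq_cong(4) word_fun_ob[OF m'(1)[unfolded e] Y] word_fun_ob[OF m'(2)[unfolded e] Y]]
        h Y U_word_fun[OF word_eq_cong(2) X] e by auto
  qed
  then show ?case
    using m' e word_eq_cong word_map_periodic[OF word_eq_cong(2)]
    by (intro exI[of _ l] exI[of _ a]) auto
qed

definition functor_of :: "(nat \<times> cyc_gen list) set \<Rightarrow> ('o, 'm, 'o, 'm) functr" where
  "functor_of c = word_fun (class_rep c)"

text \<open>
  The exponent compares the concatenation of the two representatives with the representative of the
  composite.
\<close>
definition compositor_of :: "(nat \<times> cyc_gen list) set \<Rightarrow> (nat \<times> cyc_gen list) set \<Rightarrow> 'o \<Rightarrow> 'm" where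
  "compositor_of c c' X = twist_pow (phase (class_src c') (class_rep c @ class_rep c')) (U X)"

definition unitor_of :: "nat \<Rightarrow> 'o \<Rightarrow> 'm" where
  "unitor_of n X = twist_pow (phase n []) (U X)"

lemma twist_pow_phase:
  assumes "word_path n u m" "X \<in> Ob (C n)"
  shows "twist_pow (phase n u) (U X) \<in> Hom (C m) (on_ob (word_fun u) X) (on_ob (functor_of (word_class n u)) X)"
proof -
  obtain m' k where k: "word_path n u m'" "\<forall>x. word_map u x = word_map (class_rep (word_class n u)) x + k * (int n + 1)"
    "\<forall>X \<in> Ob (C n). twist_pow k (U X) \<in> Hom (C m') (on_ob (word_fun u) X) (on_ob (functor_of (word_class n u)) X)"
    using word_eq_twist_pow[OF class_rep_eq(1)[OF assms(1)]] unfolding functor_of_def by blast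
  have "m' = m"
    using k(1) assms(1) word_path_unique by blast
  moreover have "phase n u = k"
    using phase_shift[OF assms(1), of 0] k(2) by simp
  ultimately show ?thesis
    using k(3) assms(2) by simp
qed

lemma functor_of_ob:
  "\<lbrakk>word_path n u m; X \<in> Ob (C n)\<rbrakk> \<Longrightarrow> on_ob (functor_of (word_class n u)) X \<in> Ob (C m)"
  "\<lbrakk>word_path n u m; X \<in> Ob (C n)\<rbrakk> \<Longrightarrow> U (on_ob (functor_of (word_class n u)) X) = U X"
  unfolding functor_of_def by (rule word_fun_ob[OF class_rep_path], assumption+) (rule U_word_fun[OF class_rep_path])

lemma twist_pow_iso:
  assumes "X \<in> Ob (C n)" "Y \<in> Ob (C n)" "U X = U Y" "twist_pow k (U X) \<in> Hom (C n) X Y"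
  shows "is_iso (C n) X Y (twist_pow k (U X))"
proof -
  have "twist_pow (- k) (U X) \<in> Hom (C n) Y X"
    using C_inverse[OF assms(1,2,4)] twist_pow_inverse[OF U_ob[OF assms(1)], of k] assms(3) by simp
  then have "inverse_pair (C n) X Y (twist_pow k (U X)) (twist_pow (- k) (U X))"
    using assms twist_pow_inverse[OF U_ob[OF assms(1)], of k] by (simp add: inverse_pair_def C_comp C_ident)
  then show ?thesis
    by (auto simp: is_iso_def)
qed

lemma compositor_word:
  assumes "word_path x u y" "word_path y v z"
  shows "compositor_of (word_class y v) (word_class x u) X =
    twist_pow (phase x (class_rep (word_class y v) @ class_rep (word_class x u))) (U X)"
  using class_rep_eq(2)[OF assms(1)] by (simp add: compositor_of_def)

text \<open>
  Every structure isomorphism is a power of \<open>\<sigma>\<close>, and powers of \<open>\<sigma>\<close> commute with all functors and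
  morphisms.  The coherence conditions therefore compare exponents, and both sides count the periods
  between the long word and the representative of its class.
\<close>
lemma pseudofunctor_functor_of: "pseudofunctor Lambda_op C functor_of compositor_of unitor_of"
proof (intro pseudofunctor.intro pseudofunctor_axioms.intro)
  show "category Lambda_op"
    by (rule category_Lambda_op)
next
  fix x y f
  assume "f \<in> Hom Lambda_op x y"
  then show "linear_functor (C x) (C y) (functor_of f)"
    using class_rep_path word_fun_linear by (auto simp: functor_of_def)
next
  fix x y z f g
  assume "f \<in> Hom Lambda_op x y" "g \<in> Hom Lambda_op y z"
  then obtain u v where u: "f = word_class x u" "word_path x u y" and v: "g = word_class y v" "word_path y v z"
    by auto
  let ?u = "class_rep f" and ?v = "class_rep g"
  have pu: "word_path x ?u y" and pv: "word_path y ?v z" and puv: "word_path x (?v @ ?u) z"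
    using class_rep_path u v by auto
  have fg: "g \<cdot>\<^bsub>Lambda_op\<^esub> f = word_class x (?v @ ?u)"
    using Lambda_op_comp[OF pu pv] u v word_class_rep by simp
  show "natural_iso (C x) (C z) (functor_of g \<circ>\<^sub>F functor_of f) (functor_of (g \<cdot>\<^bsub>Lambda_op\<^esub> f)) (compositor_of g f)"
    unfolding natural_iso_def
  proof (intro conjI ballI)
    fix X assume X: "X \<in> Ob (C x)"
    have h: "twist_pow (phase x (?v @ ?u)) (U X) \<in> Hom (C z) (on_ob (word_fun (?v @ ?u)) X) (on_ob (functor_of (g \<cdot>\<^bsub>Lambda_op\<^esub> f)) X)"
      using twist_pow_phase[OF puv X] fg by simp
    have "U (on_ob (word_fun (?v @ ?u)) X) = U X" "U (on_ob (functor_of (g \<cdot>\<^bsub>Lambda_op\<^esub> f)) X) = U X"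
      using U_word_fun[OF puv X] functor_of_ob(2)[OF puv X] fg by simp_all
    then have "is_iso (C z) (on_ob (word_fun (?v @ ?u)) X) (on_ob (functor_of (g \<cdot>\<^bsub>Lambda_op\<^esub> f)) X)
        (twist_pow (phase x (?v @ ?u)) (U X))"
      using twist_pow_iso[OF word_fun_ob[OF puv X] functor_of_ob(1)[OF puv X]] h fg by metis
    then show "is_iso (C z) (on_ob (functor_of g \<circ>\<^sub>F functor_of f) X) (on_ob (functor_of (g \<cdot>\<^bsub>Lambda_op\<^esub> f)) X)
        (compositor_of g f X)"
      using compositor_word[OF u(2) v(2)] u v by (simp add: functor_of_def)
  next
    fix X Y h assume X: "X \<in> Ob (C x)" and Y: "Y \<in> Ob (C x)" and h: "h \<in> Hom (C x) X Y"
    show "compositor_of g f Y \<cdot>\<^bsub>C z\<^esub> on_hom (functor_of g \<circ>\<^sub>F functor_of f) h =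
        on_hom (functor_of (g \<cdot>\<^bsub>Lambda_op\<^esub> f)) h \<cdot>\<^bsub>C z\<^esub> compositor_of g f X"
      using twist_pow_nat[OF U_ob[OF X] U_ob[OF Y] C_hom[OF X Y h]] compositor_word[OF u(2) v(2)] u v
      by (simp add: functor_of_def C_comp)
  qed
next
  fix x
  have p: "word_path x [] x"
    by simp
  show "natural_iso (C x) (C x) id_functor (functor_of (Ident Lambda_op x)) (unitor_of x)"
    unfolding natural_iso_def
  proof (intro conjI ballI)
    fix X assume X: "X \<in> Ob (C x)"
    show "is_iso (C x) (on_ob id_functor X) (on_ob (functor_of (Ident Lambda_op x)) X) (unitor_of x X)"
      using twist_pow_iso[OF X functor_of_ob(1)[OF p X]] twist_pow_phase[OF p X] functor_of_ob(2)[OF p X]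
      by (simp add: unitor_of_def)
  next
    fix X Y h assume X: "X \<in> Ob (C x)" and Y: "Y \<in> Ob (C x)" and h: "h \<in> Hom (C x) X Y"
    show "unitor_of x Y \<cdot>\<^bsub>C x\<^esub> on_hom id_functor h = on_hom (functor_of (Ident Lambda_op x)) h \<cdot>\<^bsub>C x\<^esub> unitor_of x X"
      using twist_pow_nat[OF U_ob[OF X] U_ob[OF Y] C_hom[OF X Y h]]
      by (simp add: functor_of_def C_comp unitor_of_def)
  qed
next
  fix w x y z f g h X
  assume "f \<in> Hom Lambda_op w x" "g \<in> Hom Lambda_op x y" "h \<in> Hom Lambda_op y z" and X: "X \<in> Ob (C w)"
  then obtain u v r where u: "f = word_class w u" "word_path w u x" and v: "g = word_class x v" "word_path x v y"
    and r: "h = word_class y r" "word_path y r z"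
    by auto
  let ?u = "class_rep f" and ?v = "class_rep g" and ?r = "class_rep h"
  have pu: "word_path w ?u x" and pv: "word_path x ?v y" and pr: "word_path y ?r z"
    and puv: "word_path w (?v @ ?u) y" and pvr: "word_path x (?r @ ?v) z"
    using class_rep_path u v r by auto
  have gf: "g \<cdot>\<^bsub>Lambda_op\<^esub> f = word_class w (?v @ ?u)" and hg: "h \<cdot>\<^bsub>Lambda_op\<^esub> g = word_class x (?r @ ?v)"
    using Lambda_op_comp[OF pu pv] Lambda_op_comp[OF pv pr] u v r word_class_rep by simp_all
  have c: "class_src f = w" "class_src g = x" "class_src (g \<cdot>\<^bsub>Lambda_op\<^esub> f) = w"
    using class_rep_eq(2) u v puv gf by metis+
  have Uf: "U (on_ob (functor_of f) X) = U X"
    using functor_of_ob(2)[OF u(2) X] u(1) by simp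
  have "phase w (class_rep (h \<cdot>\<^bsub>Lambda_op\<^esub> g) @ ?u) + phase x (?r @ ?v) =
      phase w (?r @ class_rep (g \<cdot>\<^bsub>Lambda_op\<^esub> f)) + phase w (?v @ ?u)"
    using phase_append(1)[OF pu pvr] phase_append(2)[OF puv pr] gf hg by simp
  then show "compositor_of (h \<cdot>\<^bsub>Lambda_op\<^esub> g) f X \<cdot>\<^bsub>C z\<^esub> compositor_of h g (on_ob (functor_of f) X) =
      compositor_of h (g \<cdot>\<^bsub>Lambda_op\<^esub> f) X \<cdot>\<^bsub>C z\<^esub> on_hom (functor_of h) (compositor_of g f X)"
    unfolding compositor_of_def c Uf C_comp using U_ob[OF X]
    by (simp add: functor_of_def twist_pow_add[symmetric])
next
  fix x y f X
  assume "f \<in> Hom Lambda_op x y" and X: "X \<in> Ob (C x)"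
  then obtain u where u: "f = word_class x u" "word_path x u y"
    by auto
  let ?u = "class_rep f"
  have pu: "word_path x ?u y" and c: "class_src f = x" and ph: "phase x ?u = 0"
    using class_rep_path class_rep_eq(2) phase_rep u by auto
  have ci: "class_src (Ident Lambda_op x) = x"
    using class_rep_eq(2)[of x "[]" x] by simp
  have ob: "on_ob (functor_of f) X \<in> Ob (C y)" "U (on_ob (functor_of f) X) = U X"
    using functor_of_ob[OF u(2) X] u(1) by simp_all
  have "phase x (?u @ class_rep (Ident Lambda_op x)) + phase x [] = 0"
    using phase_append(2)[of x "[]" x ?u y] pu ph by simp
  then show "compositor_of f (Ident Lambda_op x) X \<cdot>\<^bsub>C y\<^esub> on_hom (functor_of f) (unitor_of x X) =
      Ident (C y) (on_ob (functor_of f) X)"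
    using twist_pow_add[OF U_ob[OF X], symmetric] ob ci C_ident[OF ob(1)]
    by (simp add: compositor_of_def unitor_of_def C_comp functor_of_def)
  have "phase x (class_rep (Ident Lambda_op y) @ ?u) + phase y [] = 0"
    using phase_append(1)[of x ?u y "[]" y] pu ph by simp
  then show "compositor_of (Ident Lambda_op y) f X \<cdot>\<^bsub>C y\<^esub> unitor_of y (on_ob (functor_of f) X) =
      Ident (C y) (on_ob (functor_of f) X)"
    using twist_pow_add[OF U_ob[OF X], symmetric] ob c C_ident[OF ob(1)]
    by (simp add: compositor_of_def unitor_of_def C_comp)
qed

lemma functor_of_gen: "gen_valid g \<Longrightarrow> functor_of (gen_class g) = gen_fun g"
  by (simp only: functor_of_def class_rep_gen word_fun_single)

text \<open>
  Iterating the compositor along a word accumulates the whole phase of the word.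
\<close>
lemma word_compositor_twist_pow:
  assumes "word_path n u m" "X \<in> Ob (C n)"
  shows "word_compositor C functor_of compositor_of unitor_of n u X = twist_pow (phase n u) (U X)"
  using assms(1)
proof (induction u arbitrary: m)
  case Nil
  then show ?case
    by (simp add: unitor_of_def)
next
  case (Cons g w)
  then have g: "gen_valid g" "word_path n w (gen_src g)" "word_path (gen_src g) [g] m"
    by auto
  have "phase n (g # w) = phase n ([g] @ class_rep (word_class n w)) + phase n w"
    using phase_append(2)[OF g(2,3)] by simp
  moreover have "compositor_of (gen_class g) (word_class n w) X = twist_pow (phase n ([g] @ class_rep (word_class n w))) (U X)"
    using class_rep_eq(2)[OF g(2)] class_rep_gen[OF g(1)] by (simp add: compositor_of_def)
  ultimately show ?case
    using Cons.IH[OF g(2)] twist_pow_add[OF U_ob[OF assms(2)]] by (simp add: functor_of_def C_comp)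
qed

lemma twist_natural_iso: "natural_iso (C n) (C n) id_functor (functor_power (t n) (n + 1)) (\<lambda>X. \<sigma> (U X))"
  unfolding natural_iso_def
proof (intro conjI ballI)
  have p: "word_path n (replicate (n + 1) (Cyc n)) n"
    by (rule cyc_power_path)
  have hom: "on_hom (functor_power (t n) k) h = h" for k h
    by (induction k) (simp_all add: t_hom)
  {
    fix X assume X: "X \<in> Ob (C n)"
    have "twist_pow 1 (U X) \<in> Hom (C n) X (on_ob (functor_power (t n) (n + 1)) X)"
      using twist_C[OF X] twist_pow_1[OF U_ob[OF X]] by simp
    then have "is_iso (C n) X (on_ob (functor_power (t n) (n + 1)) X) (twist_pow 1 (U X))"
      using word_fun_ob[OF p X] U_word_fun[OF p X] by (intro twist_pow_iso X) (simp_all only: word_fun_power)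
    then show "is_iso (C n) (on_ob id_functor X) (on_ob (functor_power (t n) (n + 1)) X) (\<sigma> (U X))"
      using twist_pow_1[OF U_ob[OF X]] by simp
  next
    fix X Y h assume X: "X \<in> Ob (C n)" and Y: "Y \<in> Ob (C n)" and h: "h \<in> Hom (C n) X Y"
    show "\<sigma> (U Y) \<cdot>\<^bsub>C n\<^esub> on_hom id_functor h = on_hom (functor_power (t n) (n + 1)) h \<cdot>\<^bsub>C n\<^esub> \<sigma> (U X)"
      unfolding hom using twist_nat[OF U_ob[OF X] U_ob[OF Y] C_hom[OF X Y h]] by (simp add: C_comp)
  }
qed

theorem cyclic_object: "cyclic_object_in_categories C d s t (\<lambda>n X. \<sigma> (U X))"
proof (intro cyclic_object_in_categories.intro cyclic_object_in_categories_axioms.intro)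
  show "simplicial_object_in_categories C d s"
    by (rule simplicial_object_in_categories_axioms)
  show "\<exists>P \<mu> \<iota>. pseudofunctor Lambda_op C P \<mu> \<iota> \<and>
      (\<forall>n i. 1 \<le> n \<and> i \<le> n \<longrightarrow> P (gen_class (Face n i)) = d n i) \<and>
      (\<forall>n i. i \<le> n \<longrightarrow> P (gen_class (Degen n i)) = s n i) \<and>
      (\<forall>n. P (gen_class (Cyc n)) = t n) \<and>
      (\<forall>n u v. cyc_rel n u v \<longrightarrow> (\<forall>X \<in> Ob (C n).
         word_compositor C P \<mu> \<iota> n u X = word_compositor C P \<mu> \<iota> n v X)) \<and>
      (\<forall>n. \<forall>X \<in> Ob (C n).
         word_compositor C P \<mu> \<iota> n (replicate (n + 1) (Cyc n)) X \<cdot>\<^bsub>C n\<^esub> \<sigma> (U X) =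
         word_compositor C P \<mu> \<iota> n [] X)"
  proof (intro exI[of _ functor_of] exI[of _ compositor_of] exI[of _ unitor_of] conjI allI impI ballI)
    show "pseudofunctor Lambda_op C functor_of compositor_of unitor_of"
      by (rule pseudofunctor_functor_of)
    show "functor_of (gen_class (Face n i)) = d n i" if "1 \<le> n \<and> i \<le> n" for n i
      using functor_of_gen[of "Face n i"] that by simp
    show "functor_of (gen_class (Degen n i)) = s n i" if "i \<le> n" for n i
      using functor_of_gen[of "Degen n i"] that by simp
    show "functor_of (gen_class (Cyc n)) = t n" for n
      using functor_of_gen[of "Cyc n"] by simp
    show "word_compositor C functor_of compositor_of unitor_of n u X =
        word_compositor C functor_of compositor_of unitor_of n v X" if r: "cyc_rel n u v" and X: "X \<in> Ob (C n)" for n u v X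
    proof -
      obtain m where m: "word_path n u m" "word_path n v m"
        using cyc_rel_path[OF r] by blast
      have "phase n u = phase n v"
        using phase_eq[OF word_eq_rel[OF r], of 0] cyc_rel_map[OF r] by simp
      then show ?thesis
        using word_compositor_twist_pow[OF m(1) X] word_compositor_twist_pow[OF m(2) X] by simp
    qed
    show "word_compositor C functor_of compositor_of unitor_of n (replicate (n + 1) (Cyc n)) X \<cdot>\<^bsub>C n\<^esub> \<sigma> (U X) =
        word_compositor C functor_of compositor_of unitor_of n [] X" if X: "X \<in> Ob (C n)" for n X
    proof -
      have p: "word_path n (replicate (n + 1) (Cyc n)) n" "word_path n [] n"
        using cyc_power_path by auto
      have "phase n (replicate (n + 1) (Cyc n)) = phase n [] + (-1)"
        by (rule phase_eq[OF word_eq_cyc]) (simp only: cyc_power_map, simp)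
      then show ?thesis
        unfolding word_compositor_twist_pow[OF p(1) X] word_compositor_twist_pow[OF p(2) X]
        using twist_pow_add[OF U_ob[OF X], of "phase n [] + (-1)" 1] twist_pow_1[OF U_ob[OF X]] by (simp add: C_comp)
    qed
  qed
qed (use t_linear d_t d_zero_t s_t s_zero_t twist_natural_iso in auto)

end

section \<open>The cyclic object of a stable braided module\<close>

locale stable_hopf_action = hopf_action B \<M> E H + stable_braided_module B \<M> E \<sigma>
  for B :: "('o, 'm, 'k::{alg_closed_field, field_char_0}) br_cat"
    and \<M> :: "('p, 'q, 'k, 'o, 'm) mod_cat" (structure)
    and E :: "'o \<Rightarrow> 'p \<Rightarrow> 'q"
    and H :: "('o, 'm) hopf"
    and \<sigma> :: "'p \<Rightarrow> 'q"
begin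

notation acomp (infixr "\<star>" 70)
notation whisk (infixr "|>" 80)

sublocale natural_automorphism \<M> \<sigma>
  by unfold_locales (rule twist_natural)

definition twist_arrow :: "'p \<Rightarrow> ('p, 'q) arrow" where
  "twist_arrow N = arrow N (\<sigma> N) N"

lemma twist_arrow_arrow [simp]: "N \<in> Ob \<M> \<Longrightarrow> is_arrow (twist_arrow N)" "src (twist_arrow N) = N" "trg (twist_arrow N) = N"
  by (simp_all add: twist_arrow_def)

lemma twist_arrow_nat: "\<lbrakk>is_arrow p; src p = M; trg p = N\<rbrakk> \<Longrightarrow> twist_arrow N \<star> p = p \<star> twist_arrow M"
  using twist_nat[of M N "mor p"] is_arrowD[of p]
  by (intro arrow_eqI) (auto simp: twist_arrow_def mor_acomp)

text \<open>
  Stability, with the inverse of \<open>Id \<rhd> \<sigma>\<close> moved to the other side.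
\<close>
lemma Ea_twist_arrow:
  assumes "X \<in> Ob B" "N \<in> Ob \<M>"
  shows "Ea X N \<star> (X |> twist_arrow N) = twist_arrow (X \<rhd> N)"
proof -
  let ?s = "Ident B X \<bullet> \<sigma> N" and ?s' = "Ident B X \<bullet> \<sigma>' N" and ?XN = "X \<rhd> N"
  have s: "?s \<in> Hom \<M> ?XN ?XN" "?s' \<in> Hom \<M> ?XN ?XN"
    using assms by (auto intro!: act_hom)
  have "inverse_pair \<M> ?XN ?XN ?s ?s'"
    using assms s act_comp[of X X X N N N "Ident B X" "Ident B X" "\<sigma> N" "\<sigma>' N"]
      act_comp[of X X X N N N "Ident B X" "Ident B X" "\<sigma>' N" "\<sigma> N"] B.ident_left[of X X "Ident B X"]
    by (simp add: inverse_pair_def act_ident)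
  then have i: "Inv \<M> ?XN ?XN ?s = ?s'" "?s' \<cdot> ?s = Ident \<M> ?XN"
    using assms Inv_eqI by (auto simp: inverse_pair_def)
  have "E X N \<cdot> ?s = \<sigma> ?XN \<cdot> (?s' \<cdot> ?s)"
    using E_twist[OF assms] assms s comp_assoc[of ?XN ?XN ?XN ?XN ?s ?s' "\<sigma> ?XN"] i(1) by simp
  then have "E X N \<cdot> ?s = \<sigma> ?XN"
    using assms i(2) ident_right[of ?XN ?XN "\<sigma> ?XN"] by simp
  then show ?thesis
    using assms by (intro arrow_eqI) (simp_all add: mor_acomp mor_simps, simp_all add: twist_arrow_def)
qed

lemma power_t_obj:
  "\<lbrakk>comm_acts N xs; length xs = Suc n\<rbrakk>
    \<Longrightarrow> comm_acts N ((rotate_twist N ^^ k) xs) \<and> length ((rotate_twist N ^^ k) xs) = Suc n \<and>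
      on_ob (functor_power (t n) k) (obj N xs) = obj N ((rotate_twist N ^^ k) xs)"
  by (induction k) auto

lemma power_t_full:
  assumes "comm_acts N xs" "length xs = Suc n"
  shows "on_ob (functor_power (t n) (n + 1)) (obj N xs) = obj N (map (twist N) xs)"
  using power_t_obj[OF assms, of "n + 1"] rotate_twist_power[where N = N and ys = xs and us = "[]"] assms(2) by simp

text \<open>
  After \<open>n + 1\<close> rotations every action is twisted, so the action of \<open>H\<^sup>n\<^sup>+\<^sup>1\<close> is precomposed with \<open>E\<close>, and
  stability turns \<open>E (Id \<rhd> \<sigma>)\<close> into \<open>\<sigma>\<close>, which is natural.
\<close>
lemma twist_power_hom:
  assumes "X \<in> Ob (C n)"
  shows "\<sigma> (fst X) \<in> Hom (C n) X (on_ob (functor_power (t n) (n + 1)) X)"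
proof -
  have "is_module B \<M> (pow (Suc n)) X"
    using assms by (simp add: C_Mod del: algebra_power.simps)
  then obtain N xs where g: "comm_acts N xs" "length xs = Suc n" and X: "X = obj N xs"
    by (rule C_obtains)
  have N: "N \<in> Ob \<M>" and p: "\<forall>x \<in> set xs. pact CH N x"
    using comm_acts_pact[OF g(1)] by auto
  have ne: "xs \<noteq> []"
    using g(2) by auto
  have pJ: "pact (P (Suc n)) N (joint_list N xs)"
    using joint_list_pact[OF N p] g(2) by simp
  note pJ' = pactD[OF pJ]
  have "joint_list N (map (twist N) xs) = joint_list N xs \<star> Ea (P (Suc n)) N"
    using joint_list_Ea[OF N ne p] g(2) by (simp add: twist_def[abs_def])
  then have Jt: "joint_list N (map (twist N) xs) = joint_list N xs \<star> Ea (P (Suc n)) N" .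
  have pE: "pact (P (Suc n)) N (joint_list N xs \<star> Ea (P (Suc n)) N)"
    using pJ by (rule pact_Ea)
  have "twist_arrow N \<star> joint_list N xs = (joint_list N xs \<star> Ea (P (Suc n)) N) \<star> (P (Suc n) |> twist_arrow N)"
    using twist_arrow_nat[OF pJ'(1-3)] Ea_twist_arrow[OF pJ'(4) N] by simp
  then have "\<sigma> N \<in> Hom (Mod B \<M> (pow (Suc n))) (N, mor (joint_list N xs)) (N, mor (joint_list N xs \<star> Ea (P (Suc n)) N))"
    using Mod_Hom_iff_intertwines[OF pJ pE, of "\<sigma> N"] N by (simp add: intertwines_def twist_arrow_def)
  then show ?thesis
    unfolding X power_t_full[OF g] unfolding obj_def Jt C_Mod by simp
qed

lemma Mod_Hom_inverse:
  assumes "X \<in> Ob (C n)" "Y \<in> Ob (C n)" "f \<in> Hom (C n) X Y" "inverse_pair \<M> (fst X) (fst Y) f g"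
  shows "g \<in> Hom (C n) Y X"
proof -
  let ?A = "P (Suc n)"
  have "is_module B \<M> (pow (Suc n)) X" "is_module B \<M> (pow (Suc n)) Y"
    using assms(1,2) by (simp_all add: C_Mod del: algebra_power.simps)
  then obtain N p N' p' where X: "X = (N, mor p)" and p: "pact ?A N p"
    and Y: "Y = (N', mor p')" and p': "pact ?A N' p'"
    using is_module_obtains[OF algebraic_power] act_pact by metis
  note [simp] = pactD[OF p] pactD[OF p']
  let ?u = "arrow N f N'" and ?v = "arrow N' g N"
  have f: "f \<in> Hom \<M> N N'" and c: "?u \<star> p = p' \<star> (?A |> ?u)"
    using assms(3) Mod_Hom_iff_intertwines[OF p p'] X Y by (auto simp: C_Mod intertwines_def simp del: algebra_power.simps)
  have g: "g \<in> Hom \<M> N' N" and gf: "g \<cdot> f = Ident \<M> N" "f \<cdot> g = Ident \<M> N'"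
    using assms(4) X Y by (auto simp: inverse_pair_def)
  note [simp] = f g
  have vu: "?v \<star> ?u = aid N" and uv: "?u \<star> ?v = aid N'"
    using f g gf by (auto intro!: arrow_eqI simp: mor_acomp)
  have "?v \<star> p' = ?v \<star> p' \<star> (?A |> (?u \<star> ?v))"
    unfolding uv by simp
  also have "\<dots> = ?v \<star> (p' \<star> (?A |> ?u)) \<star> (?A |> ?v)"
    by simp
  also have "\<dots> = (?v \<star> ?u) \<star> p \<star> (?A |> ?v)"
    unfolding c[symmetric] by simp
  also have "\<dots> = p \<star> (?A |> ?v)"
    unfolding vu by simp
  finally show ?thesis
    using Mod_Hom_iff_intertwines[OF p' p] g X Y by (simp add: C_Mod intertwines_def del: algebra_power.simps)
qed

lemma cyclic: "cyclic_object_in_categories C d s t (\<lambda>n X. \<sigma> (fst X))"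
proof -
  have ob: "X \<in> Ob (C n) \<Longrightarrow> \<exists>N xs. comm_acts N xs \<and> length xs = Suc n \<and> X = obj N xs" for X n
    unfolding C_Mod Mod_sel(1) mem_Collect_eq by (rule C_obtains) blast+
  interpret concrete_paracyclic_object \<M> \<sigma> C d s t fst
  proof (intro concrete_paracyclic_object.intro concrete_paracyclic_object_axioms.intro)
    show "natural_automorphism \<M> \<sigma>"
      by (rule natural_automorphism_axioms)
    show "simplicial_object_in_categories C d s"
      by (rule simplicial)
    show "fst X \<in> Ob \<M>" if "X \<in> Ob (C n)" for n X
      using ob[OF that] by (auto simp: comm_acts_def)
    show "f \<in> Hom \<M> (fst X) (fst Y)" if "f \<in> Hom (C n) X Y" for n X Y f
      using that by (simp add: C_Mod Mod_Hom del: algebra_power.simps)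
    show "Compose (C n) = Compose \<M>" for n
      by (simp add: C_Mod del: algebra_power.simps)
    show "Ident (C n) X = Ident \<M> (fst X)" for n X
      by (simp add: C_Mod del: algebra_power.simps)
    show "linear_functor (C n) (C n) (t n)" for n
      by (rule linear_functor_cyc)
    show "fst (on_ob (d n i) X) = fst X" if "1 \<le> n" "i \<le> n" "X \<in> Ob (C n)" for n i X
      using ob[OF that(3)] that by auto
    show "fst (on_ob (s n i) X) = fst X" if "i \<le> n" "X \<in> Ob (C n)" for n i X
      using ob[OF that(2)] that by auto
    show "fst (on_ob (t n) X) = fst X" if "X \<in> Ob (C n)" for n X
      using ob[OF that] by auto
  qed (use Mod_Hom_inverse cyclic_relations twist_power_hom in auto)
  show ?thesis
    by (rule cyclic_object)
qed

end

theorem proposition4p10: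
  fixes B :: "('o, 'm, 'k::{alg_closed_field, field_char_0}) br_cat"
    and H :: "('o, 'm) hopf"
    and \<M> :: "('p, 'q, 'k, 'o, 'm) mod_cat"
    and E :: "'o \<Rightarrow> 'p \<Rightarrow> 'q"
    and \<sigma> :: "'p \<Rightarrow> 'q"
  assumes "rigid_braided_category B"
    and "hopf_algebra B H"
  shows
    "(stable_braided_module B \<M> E \<sigma> \<longrightarrow>
        cyclic_object_in_categories
          (cyc_cat B \<M> H)
          (face_functor B \<M> E H)
          (\<lambda>n i. degeneracy_functor B \<M> H n (int i))
          (cyc_functor B \<M> E H)
          (\<lambda>n (N, \<rho>). \<sigma> N) \<and>
        (\<forall>n. linear_functor (cyc_cat B \<M> H n) (cyc_cat B \<M> H (n + 1))
          (degeneracy_functor B \<M> H n (- 1)))) \<and>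
     (braided_module B \<M> E \<longrightarrow>
        simplicial_object_in_categories
          (cyc_cat B \<M> H)
          (face_functor B \<M> E H)
          (\<lambda>n i. degeneracy_functor B \<M> H n (int i)) \<and>
        (\<forall>n. linear_functor (cyc_cat B \<M> H n) (cyc_cat B \<M> H (n + 1))
          (degeneracy_functor B \<M> H n (- 1))))"
proof -
  interpret R: rigid_braided_category B by fact
  have hopf: "hopf_action B \<M> E H" if "braided_module B \<M> E"
    using that assms(2) R.braided_category_axioms by (intro hopf_action.intro braided_action.intro)
  have simp: "simplicial_object_in_categories (cyc_cat B \<M> H) (face_functor B \<M> E H)
      (\<lambda>n i. degeneracy_functor B \<M> H n (int i))"
    and deg: "\<forall>n. linear_functor (cyc_cat B \<M> H n) (cyc_cat B \<M> H (n + 1)) (degeneracy_functor B \<M> H n (- 1))"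
    if "braided_module B \<M> E"
  proof -
    interpret hopf_action B \<M> E H by (rule hopf[OF that])
    show "simplicial_object_in_categories (cyc_cat B \<M> H) (face_functor B \<M> E H)
        (\<lambda>n i. degeneracy_functor B \<M> H n (int i))"
      using simplicial by (simp add: s_def[abs_def])
    show "\<forall>n. linear_functor (cyc_cat B \<M> H n) (cyc_cat B \<M> H (n + 1)) (degeneracy_functor B \<M> H n (- 1))"
      by (intro allI linear_functor_degeneracy) auto
  qed
  have cyc: "cyclic_object_in_categories (cyc_cat B \<M> H) (face_functor B \<M> E H)
      (\<lambda>n i. degeneracy_functor B \<M> H n (int i)) (cyc_functor B \<M> E H) (\<lambda>n (N, \<rho>). \<sigma> N)"
    if "stable_braided_module B \<M> E \<sigma>"
  proof -
    interpret S: stable_braided_module B \<M> E \<sigma> by fact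
    interpret stable_hopf_action B \<M> E H \<sigma>
      by (intro stable_hopf_action.intro hopf S.braided_module_axioms that)
    show ?thesis
      using cyclic by (simp add: s_def[abs_def] case_prod_beta')
  qed
  show ?thesis
    using simp deg cyc stable_braided_module.axioms(1) by blast
qed

end
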